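(* (1) Let $H$ be a braided coalgebra and $V$ a braided right $H$-comodule with coaction $\rho_R:V\to V\otimes H$ (and braiding $\Psi_{HV}:H\otimes V\to V\otimes H$). Let $U\subset H'$ be a non-degenerate (unital) subalgebra with respect to the product $\underline m$ (unit $\varepsilon$) such that $\Psi_{UU}$ and $\Psi_{UV}^\circ$ are bijective. Then $V$ becomes a braided left $U$-module with respect to the braidings $\Psi_{UU}$, $\Psi_{UV}^\circ$ and the left action $\nu_L:U\otimes V\to V$, $\nu_L(f\otimes v):=(f\otimes\mathrm{id}_V)\big(\Psi_{HV}^{-1}(\rho_R(v))\big)$. If $H$ is a braided bialgebra, $V$ is a braided right $H$-comodule algebra, and $U$ is a standard left dual of $H$, then $\nu_L$ turns $V$ into a braided left $U$-module algebra. (2) Let $H$ be a braided coalgebra and $V$ a braided left $H$-comodule with coaction $\rho_L:V\to H\otimes V$ (and braiding $\Psi_{VH}:V\otimes H\to H\otimes V$). Let $U\subset H'$ be a non-degenerate (unital) subalgebra with respect to $\underline m$ such that $\Psi_{UU}$ and $\Psi_{VU}^\circ$ are bijective. Then $V$ becomes a braided right $U$-module with respect to the braidings $\Psi_{UU}$, $\Psi_{VU}^\circ$ and the right action $\nu_R:V\otimes U\to V$, $\nu_R(v\otimes f):=(\mathrm{id}_V\otimes f)\big(\Psi_{VH}^{-1}(\rho_L(v))\big)$. If $H$ is a braided bialgebra, $V$ is a braided left $H$-comodule algebra, and $U$ is a standard right dual of $H$, then $\nu_R$ turns $V$ into a braided right $U$-module algebra.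
   Context: All vector spaces are over a fixed field $\mathbb K$, $\otimes$ is the algebraic tensor product, $X'$ is the full linear dual of $X$, and composition of maps is written by juxtaposition. A braiding on $V$ is a bijective linear map $\Psi_{VV}:V\otimes V\to V\otimes V$ with $(\Psi_{VV}\otimes\mathrm{id})(\mathrm{id}\otimes\Psi_{VV})(\Psi_{VV}\otimes\mathrm{id})=(\mathrm{id}\otimes\Psi_{VV})(\Psi_{VV}\otimes\mathrm{id})(\mathrm{id}\otimes\Psi_{VV})$; $V$ is then a braided vector space. Let $\Psi_{VW}:V\otimes W\to W\otimes V$ be bijective and linear. If $V$ is braided, $W$ is a left $V$-braided vector space if $(\Psi_{VW}\otimes\mathrm{id})(\mathrm{id}\otimes\Psi_{VW})(\Psi_{VV}\otimes\mathrm{id})=(\mathrm{id}\otimes\Psi_{VV})(\Psi_{VW}\otimes\mathrm{id})(\mathrm{id}\otimes\Psi_{VW})$. If $W$ is braided, $V$ is a right $W$-braided vector space if $(\mathrm{id}\otimes\Psi_{VW})(\Psi_{VW}\otimes\mathrm{id})(\mathrm{id}\otimes\Psi_{WW})=(\Psi_{WW}\otimes\mathrm{id})(\mathrm{id}\otimes\Psi_{VW})(\Psi_{VW}\otimes\mathrm{id})$. Compatibility of $\Psi=\Psi_{VW}$: with the multiplication of an algebra $V$: $\Psi(m_V\otimes\mathrm{id})=(\mathrm{id}\otimes m_V)(\Psi\otimes\mathrm{id})(\mathrm{id}\otimes\Psi)$ and $\Psi(1\otimes w)=w\otimes1$ if $1\in V$; with the multiplication of an algebra $W$: $\Psi(\mathrm{id}\otimes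 m_W)=(m_W\otimes\mathrm{id})(\mathrm{id}\otimes\Psi)(\Psi\otimes\mathrm{id})$ and $\Psi(v\otimes1)=1\otimes v$ if $1\in W$; with the comultiplication of a coalgebra $V$: $(\mathrm{id}\otimes\Delta)\Psi=(\Psi\otimes\mathrm{id})(\mathrm{id}\otimes\Psi)(\Delta\otimes\mathrm{id})$ and $(\mathrm{id}\otimes\varepsilon)\Psi=\varepsilon\otimes\mathrm{id}$; with the comultiplication of a coalgebra $W$: $(\Delta\otimes\mathrm{id})\Psi=(\mathrm{id}\otimes\Psi)(\Psi\otimes\mathrm{id})(\mathrm{id}\otimes\Delta)$ and $(\varepsilon\otimes\mathrm{id})\Psi=\mathrm{id}\otimes\varepsilon$. A braided (co)algebra is a (co)algebra with a braiding satisfying both compatibility conditions with its (co)multiplication. A braided bialgebra is a unital algebra $(H,m)$ with a coalgebra structure $(\Delta,\varepsilon)$ and a braiding $\Psi_{HH}$ making it a braided algebra and a braided coalgebra, such that $\Delta m=(m\otimes m)(\mathrm{id}\otimes\Psi_{HH}\otimes\mathrm{id})(\Delta\otimes\Delta)$, $\Delta(1)=1\otimes1$, and $\varepsilon$ is a unital algebra homomorphism. Braided modules over a braided (unital) algebra $(A,m)$: a braided left $A$-module is a left $A$-braided vector space $W$ with $\Psi_{AW}$ compatible with $m$ and a map $\nu_L:A\otimes W\to W$ with $\nu_L(\mathrm{id}\otimes\nu_L)=\nu_L(m\otimes\mathrm{id})$, $\nu_L(1\otimes w)=w$ (if $1\in A$), $\Psi_{AW}(\mathrm{id}\otimes\nu_L)=(\nu_L\otimes\mathrm{id})(\mathrm{id}\otimes\Psi_{AW})(\Psi_{AA}\otimes\mathrm{id})$.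 A braided right $A$-module is a right $A$-braided vector space $V$ with $\Psi_{VA}$ compatible with $m$ and $\nu_R:V\otimes A\to V$ with $\nu_R(\nu_R\otimes\mathrm{id})=\nu_R(\mathrm{id}\otimes m)$, $\nu_R(v\otimes1)=v$ (if $1\in A$), $\Psi_{VA}(\nu_R\otimes\mathrm{id})=(\mathrm{id}\otimes\nu_R)(\Psi_{VA}\otimes\mathrm{id})(\mathrm{id}\otimes\Psi_{AA})$. Braided comodules over a braided coalgebra $H$: a braided right $H$-comodule is a left $H$-braided vector space $V$ with $\Psi_{HV}$ compatible with the comultiplication of $H$ and $\rho_R:V\to V\otimes H$ with $(\rho_R\otimes\mathrm{id})\rho_R=(\mathrm{id}\otimes\Delta)\rho_R$, $(\mathrm{id}\otimes\varepsilon)\rho_R=\mathrm{id}$, $(\rho_R\otimes\mathrm{id})\Psi_{HV}=(\mathrm{id}\otimes\Psi_{HH})(\Psi_{HV}\otimes\mathrm{id})(\mathrm{id}\otimes\rho_R)$. A braided left $H$-comodule is a right $H$-braided vector space $V$ with $\Psi_{VH}$ compatible with the comultiplication of $H$ and $\rho_L:V\to H\otimes V$ with $(\mathrm{id}\otimes\rho_L)\rho_L=(\Delta\otimes\mathrm{id})\rho_L$, $(\varepsilon\otimes\mathrm{id})\rho_L=\mathrm{id}$, $(\mathrm{id}\otimes\rho_L)\Psi_{VH}=(\Psi_{HH}\otimes\mathrm{id})(\mathrm{id}\otimes\Psi_{VH})(\rho_L\otimes\mathrm{id})$. (Co)module algebras: let $H$ be a braided bialgebra and $B$ a braided algebra.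 Suppose $B$ is left $H$-braided with $\Psi_{HB}$ compatible with the multiplications of $H$ and $B$ and the comultiplication of $H$. $B$ is a braided left $H$-module algebra if it is a braided left $H$-module with $\nu_L(\mathrm{id}\otimes m_B)=m_B(\nu_L\otimes\nu_L)(\mathrm{id}\otimes\Psi_{HB}\otimes\mathrm{id})(\Delta\otimes\mathrm{id}\otimes\mathrm{id})$ and, if $1\in B$, $\nu_L(h\otimes1)=\varepsilon(h)1$; a braided right $H$-comodule algebra if it is a braided right $H$-comodule with $\rho_Rm_B=(m_B\otimes m_H)(\mathrm{id}\otimes\Psi_{HB}\otimes\mathrm{id})(\rho_R\otimes\rho_R)$ and, if $1\in B$, $\rho_R(1)=1\otimes1$. Mirror versions: $B$ is right $H$-braided with $\Psi_{BH}$ satisfying the same compatibilities; braided right $H$-module algebra: $\nu_R(m_B\otimes\mathrm{id})=m_B(\nu_R\otimes\nu_R)(\mathrm{id}\otimes\Psi_{BH}\otimes\mathrm{id})(\mathrm{id}\otimes\mathrm{id}\otimes\Delta)$, $\nu_R(1\otimes h)=\varepsilon(h)1$; braided left $H$-comodule algebra: $\rho_Lm_B=(m_H\otimes m_B)(\mathrm{id}\otimes\Psi_{BH}\otimes\mathrm{id})(\rho_L\otimes\rho_L)$, $\rho_L(1)=1\otimes1$. Duality notation: $\langle f,a\rangle=\langle a,f\rangle=f(a)$. $U\subset H'$ is non-degenerate if it separates the points of $H$. $\langle\langle\xi\otimes\eta,x\otimes y\rangle\rangle:=\langle\xi,y\rangle\langle\eta,x\rangle$. Tensor products are embedded into duals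 by $(\xi\otimes\eta)(x\otimes y)=\langle\xi,x\rangle\langle\eta,y\rangle$. For $f,g\in U$, $a,b\in H$, $v\in V$, $e\in V'$ define $\Psi_{UU}(f\otimes g)(b\otimes a):=\langle\langle f\otimes g,\Psi_{HH}(a\otimes b)\rangle\rangle$ (values in $(H\otimes H)'\supset U\otimes U$); if $V$ is left $H$-braided, $\Psi_{UV}^\circ(f\otimes v)(e\otimes a):=\langle\langle e\otimes f,\Psi_{HV}^{-1}(v\otimes a)\rangle\rangle$ (values in $(V'\otimes H)'\supset V\otimes U$); if $V$ is right $H$-braided, $\Psi_{VU}^\circ(v\otimes f)(a\otimes e):=\langle\langle f\otimes e,\Psi_{VH}^{-1}(a\otimes v)\rangle\rangle$ (values in $(H\otimes V')'\supset U\otimes V$); $\Psi_{UH}^\circ(g\otimes a)(f\otimes b):=\langle\langle f\otimes g,\Psi_{HH}^{-1}(a\otimes b)\rangle\rangle$, $f\in H'$ (values in $(H'\otimes H)'\supset H\otimes U$); $\Psi_{HU}^\circ(b\otimes f)(a\otimes g):=\langle\langle f\otimes g,\Psi_{HH}^{-1}(a\otimes b)\rangle\rangle$, $g\in H'$ (values in $(H\otimes H')'\supset U\otimes H$). Such a map $\Psi_{XY}$ is called bijective if it is a bijection $X\otimes Y\to Y\otimes X$. Product and coproduct on duals: $\underline m(f\otimes g)(a):=\langle\langle f\otimes g,\Psi_{HH}^{-1}(\Delta(a))\rangle\rangle$ on $H'$, with unit $\varepsilon$; $\underline\Delta(f)$ is determined by $\langle\langle\underline\Delta(f),a\otimes b\rangle\rangle=f(m\Psi_{HH}(a\otimes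 b))$. A standard left (resp. right) dual of a braided bialgebra $H$ is a non-degenerate subspace $U\subset H'$ containing $\varepsilon$, closed under $\underline m$, with $\underline\Delta(U)\subset U\otimes U$, and such that $\Psi_{UU}$ and $\Psi_{UH}^\circ$ (resp. $\Psi_{UU}$ and $\Psi_{HU}^\circ$) are bijective; $U$ is then regarded as braided bialgebra with product $\underline m$, unit $\varepsilon$, coproduct $\underline\Delta$, counit $f\mapsto f(1)$ and braiding $\Psi_{UU}$. *)

theory Defs
  imports Complex_Main "HOL-Library.Function_Algebras"
begin

text \<open>
  A vector space over the field given by the type \<open>'k\<close> is a linear subspace \<open>car V\<close> of an
  ambient type that is a vector space under \<open>scl V\<close>. The carrier is needed because subspaces of
  duals occur as vector spaces in their own right.
\<close>

record ('k, 'a) vs =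
  car :: "'a set"
  scl :: "'k \<Rightarrow> 'a \<Rightarrow> 'a"

definition vspace :: "('k::field, 'a::ab_group_add) vs \<Rightarrow> bool" where
  "vspace V \<longleftrightarrow> vector_space (scl V) \<and> module.subspace (scl V) (car V)"

definition ground :: "('k::field, 'k) vs" where
  "ground = \<lparr>car = UNIV, scl = (*)\<rparr>"

definition linear_map ::
  "('k::field, 'a::ab_group_add) vs \<Rightarrow> ('k, 'b::ab_group_add) vs \<Rightarrow> ('a \<Rightarrow> 'b) \<Rightarrow> bool" where
  "linear_map V W f \<longleftrightarrow>
     (\<forall>x\<in>car V. f x \<in> car W) \<and>
     (\<forall>x\<in>car V. \<forall>y\<in>car V. f (x + y) = f x + f y) \<and>
     (\<forall>c. \<forall>x\<in>car V. f (scl V c x) = scl W c (f x))"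

definition bilinear_map ::
  "('k::field, 'a::ab_group_add) vs \<Rightarrow> ('k, 'b::ab_group_add) vs \<Rightarrow> ('k, 'c::ab_group_add) vs
    \<Rightarrow> ('a \<Rightarrow> 'b \<Rightarrow> 'c) \<Rightarrow> bool" where
  "bilinear_map V W X b \<longleftrightarrow>
     (\<forall>x\<in>car V. linear_map W X (b x)) \<and> (\<forall>y\<in>car W. linear_map V X (\<lambda>x. b x y))"

text \<open>
  Functionals on \<open>V\<close> are normalised to be \<open>0\<close> outside the carrier, so that equality of functionals
  is equality on \<open>car V\<close>.
\<close>

definition functional :: "('k::field, 'a::ab_group_add) vs \<Rightarrow> ('a \<Rightarrow> 'k) \<Rightarrow> 'a \<Rightarrow> 'k" where
  "functional V f = (\<lambda>x. if x \<in> car V then f x else 0)"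

definition dual :: "('k::field, 'a::ab_group_add) vs \<Rightarrow> ('k, 'a \<Rightarrow> 'k) vs" where
  "dual V = \<lparr>car = {f. linear_map V ground f \<and> (\<forall>x. x \<notin> car V \<longrightarrow> f x = 0)},
             scl = (\<lambda>c f x. c * f x)\<rparr>"

text \<open>
  The tensor product of \<open>V\<close> and \<open>W\<close> is realised as the span of the evaluation functionals
  \<open>\<beta> \<mapsto> \<beta> v w\<close> in the dual of the space of bilinear forms on \<open>V \<times> W\<close>. Over a field this is
  the algebraic tensor product; lemmas \<open>tlift_linear\<close>, \<open>tlift_pure\<close> and \<open>tensor_ext\<close>
  below are its universal property. After these lemmas, only the universal property is used:
  every map out of a tensor product is introduced by \<open>tlift\<close>.
\<close>

typedef ('k, 'a, 'b) tens = "UNIV :: (('a \<Rightarrow> 'b \<Rightarrow> 'k) \<Rightarrow> 'k) set"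
  morphisms eval Tens ..

lemma eval_Tens [simp]: "eval (Tens f) = f"
  by (simp add: Tens_inverse)

lemma tens_eqI: "(\<And>\<beta>. eval s \<beta> = eval t \<beta>) \<Longrightarrow> s = t"
  by (metis eval_inject ext)

instantiation tens :: (ab_group_add, type, type) ab_group_add
begin

definition "0 = Tens (\<lambda>\<beta>. 0)"
definition "s + t = Tens (\<lambda>\<beta>. eval s \<beta> + eval t \<beta>)"
definition "s - t = Tens (\<lambda>\<beta>. eval s \<beta> - eval t \<beta>)"
definition "- t = Tens (\<lambda>\<beta>. - eval t \<beta>)"

instance
  by standard
    (auto intro!: tens_eqI simp: zero_tens_def plus_tens_def minus_tens_def uminus_tens_def algebra_simps)

end

definition tscale :: "'k::field \<Rightarrow> ('k, 'a, 'b) tens \<Rightarrow> ('k, 'a, 'b) tens" where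
  "tscale c t = Tens (\<lambda>\<beta>. c * eval t \<beta>)"

lemma eval_simps:
  "eval 0 \<beta> = 0" "eval (s + t) \<beta> = eval s \<beta> + eval t \<beta>" "eval (tscale c t) \<beta> = c * eval t \<beta>"
  by (simp_all add: zero_tens_def plus_tens_def tscale_def)

definition pure ::
  "('k::field, 'a::ab_group_add) vs \<Rightarrow> ('k, 'b::ab_group_add) vs \<Rightarrow> 'a \<Rightarrow> 'b \<Rightarrow> ('k, 'a, 'b) tens" where
  "pure V W v w = Tens (\<lambda>\<beta>. if bilinear_map V W ground \<beta> then \<beta> v w else 0)"

definition tensor ::
  "('k::field, 'a::ab_group_add) vs \<Rightarrow> ('k, 'b::ab_group_add) vs \<Rightarrow> ('k, ('k, 'a, 'b) tens) vs"
    (infixr \<open>\<otimes>\<close> 75) where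
  "V \<otimes> W = \<lparr>car = module.span tscale {pure V W v w | v w. v \<in> car V \<and> w \<in> car W},
            scl = tscale\<rparr>"

definition tlift ::
  "('k::field, 'a::ab_group_add) vs \<Rightarrow> ('k, 'b::ab_group_add) vs \<Rightarrow> ('k, 'c::ab_group_add) vs
    \<Rightarrow> ('a \<Rightarrow> 'b \<Rightarrow> 'c) \<Rightarrow> ('k, 'a, 'b) tens \<Rightarrow> 'c" where
  "tlift V W X b = (SOME L. linear_map (V \<otimes> W) X L \<and>
     (\<forall>v\<in>car V. \<forall>w\<in>car W. L (pure V W v w) = b v w))"

lemma vector_space_pointwise: "vector_space (\<lambda>(c::'k::field) (f::'a \<Rightarrow> 'k) x. c * f x)"
  by standard (auto simp: fun_eq_iff algebra_simps)

lemma vector_space_tscale: "vector_space (tscale :: 'k::field \<Rightarrow> ('k, 'a, 'b) tens \<Rightarrow> _)"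
  by standard (auto intro!: tens_eqI simp: eval_simps algebra_simps)

lemma vspace_ground: "vspace (ground :: ('k::field, 'k) vs)"
proof -
  have v: "vector_space ((*) :: 'k \<Rightarrow> 'k \<Rightarrow> 'k)"
    by standard (auto simp: algebra_simps)
  interpret vector_space "(*) :: 'k \<Rightarrow> 'k \<Rightarrow> 'k" by (rule v)
  show ?thesis
    using v by (auto simp: vspace_def ground_def)
qed

lemma vspace_dual: "vspace (dual V)" if "vspace V" for V :: "('k::field, 'a::ab_group_add) vs"
proof -
  interpret vector_space "\<lambda>(c::'k) (f::'a \<Rightarrow> 'k) x. c * f x"
    by (rule vector_space_pointwise)
  have "subspace {f. linear_map V ground f \<and> (\<forall>x. x \<notin> car V \<longrightarrow> f x = 0)}"
    by (auto simp: subspace_def linear_map_def ground_def algebra_simps)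
  then show ?thesis
    using vector_space_axioms by (simp add: vspace_def dual_def)
qed

lemma vspace_tensor: "vspace (V \<otimes> W)"
  for V :: "('k::field, 'a::ab_group_add) vs" and W :: "('k, 'b::ab_group_add) vs"
proof -
  interpret vector_space "tscale :: 'k \<Rightarrow> ('k, 'a, 'b) tens \<Rightarrow> _"
    by (rule vector_space_tscale)
  show ?thesis
    unfolding vspace_def tensor_def
    using vector_space_axioms subspace_span by simp
qed

lemma vspaceD:
  assumes "vspace V"
  shows "0 \<in> car V" "x \<in> car V \<Longrightarrow> y \<in> car V \<Longrightarrow> x + y \<in> car V"
    "x \<in> car V \<Longrightarrow> scl V c x \<in> car V" "scl V 1 x = x"
    "scl V c (x + y) = scl V c x + scl V c y"
    "scl V (c + d) x = scl V c x + scl V d x"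
    "scl V c (scl V d x) = scl V (c * d) x"
    "scl V c 0 = 0"
proof -
  interpret vector_space "scl V" using assms by (simp add: vspace_def)
  have s: "subspace (car V)" using assms by (simp add: vspace_def)
  show "0 \<in> car V" "x \<in> car V \<Longrightarrow> y \<in> car V \<Longrightarrow> x + y \<in> car V"
    "x \<in> car V \<Longrightarrow> scl V c x \<in> car V" "scl V 1 x = x"
    "scl V c (x + y) = scl V c x + scl V c y"
    "scl V (c + d) x = scl V c x + scl V d x"
    "scl V c (scl V d x) = scl V (c * d) x"
    "scl V c 0 = 0"
    using s by (auto intro: subspace_0 subspace_add subspace_scale simp: scale_right_distrib scale_left_distrib)
qed

lemma dual_separates:
  fixes V :: "('k::field, 'a::ab_group_add) vs"
  assumes V: "vspace V" and x: "x \<in> car V" and z: "\<And>f. f \<in> car (dual V) \<Longrightarrow> f x = 0"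
  shows "x = 0"
proof (rule ccontr)
  assume "x \<noteq> 0"
  interpret V: vector_space "scl V" using V by (simp add: vspace_def)
  interpret K: vector_space "(*) :: 'k \<Rightarrow> 'k \<Rightarrow> 'k"
    by standard (auto simp: algebra_simps)
  interpret vp: vector_space_pair "scl V" "(*) :: 'k \<Rightarrow> 'k \<Rightarrow> 'k" ..
  have "V.independent {x}"
    using \<open>x \<noteq> 0\<close> by simp
  then obtain g where g: "Vector_Spaces.linear (scl V) (*) g" "\<forall>y\<in>{x}. g y = 1"
    using vp.linear_independent_extend[of "{x}" "\<lambda>_. 1"] by blast
  interpret g: Vector_Spaces.linear "scl V" "(*)" g by (rule g)
  have "functional V g \<in> car (dual V)"
    using vspaceD[OF V]
    by (auto simp: dual_def functional_def linear_map_def ground_def g.add g.scale)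
  then have "functional V g x = 0" by (rule z)
  then show False using g(2) x by (simp add: functional_def)
qed

lemma pure_in_tensor: "v \<in> car V \<Longrightarrow> w \<in> car W \<Longrightarrow> pure V W v w \<in> car (V \<otimes> W)"
  for V :: "('k::field, 'a::ab_group_add) vs" and W :: "('k, 'b::ab_group_add) vs"
proof -
  interpret vector_space "tscale :: 'k \<Rightarrow> ('k, 'a, 'b) tens \<Rightarrow> _"
    by (rule vector_space_tscale)
  show "v \<in> car V \<Longrightarrow> w \<in> car W \<Longrightarrow> pure V W v w \<in> car (V \<otimes> W)"
    by (auto simp: tensor_def intro!: span_base)
qed

lemma pure_bilinear: "bilinear_map V W (V \<otimes> W) (pure V W)"
  unfolding bilinear_map_def[of V W "V \<otimes> W"] linear_map_def
  using pure_in_tensor[of _ V _ W]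
  by (auto intro!: tens_eqI
      simp: tensor_def pure_def eval_simps bilinear_map_def linear_map_def ground_def)

lemma tensor_induct [consumes 1, case_names zero add]:
  fixes V :: "('k::field, 'a::ab_group_add) vs" and W :: "('k, 'b::ab_group_add) vs"
  assumes "t \<in> car (V \<otimes> W)" "P 0"
    "\<And>c v w s. v \<in> car V \<Longrightarrow> w \<in> car W \<Longrightarrow> s \<in> car (V \<otimes> W) \<Longrightarrow> P s
       \<Longrightarrow> P (scl (V \<otimes> W) c (pure V W v w) + s)"
  shows "P t"
proof -
  interpret vector_space "tscale :: 'k \<Rightarrow> ('k, 'a, 'b) tens \<Rightarrow> _"
    by (rule vector_space_tscale)
  let ?S = "{pure V W v w | v w. v \<in> car V \<and> w \<in> car W}"
  have "t \<in> span ?S" using assms(1) by (simp add: tensor_def)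
  then have "t \<in> span ?S \<and> P t"
  proof (induct rule: span_induct_alt)
    case base
    then show ?case using assms(2) span_zero[of ?S] by simp
  next
    case (step c x y)
    then obtain v w where vw: "x = pure V W v w" "v \<in> car V" "w \<in> car W" by auto
    have "P (scl (V \<otimes> W) c x + y)"
      unfolding vw(1) using vw step by (intro assms(3)) (auto simp: tensor_def)
    moreover have "tscale c x + y \<in> span ?S"
      using step by (intro span_add span_scale) (auto intro: span_base)
    ultimately show ?case by (simp add: tensor_def)
  qed
  then show ?thesis ..
qed

lemma linear_map_0: "L 0 = 0" if "linear_map V X L" "vspace V"
proof -
  have "L (0 + 0) = L 0 + L 0"
    using that(1) vspaceD(1)[OF that(2)] unfolding linear_map_def by blast
  then show ?thesis by simp
qed

lemma tensor_ext:
  assumes "linear_map (V \<otimes> W) X L" "linear_map (V \<otimes> W) X M"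
    and "\<And>v w. v \<in> car V \<Longrightarrow> w \<in> car W \<Longrightarrow> L (pure V W v w) = M (pure V W v w)"
    and "t \<in> car (V \<otimes> W)"
  shows "L t = M t"
  using assms(4)
proof (induct rule: tensor_induct)
  case zero
  show ?case
    using linear_map_0[OF assms(1) vspace_tensor] linear_map_0[OF assms(2) vspace_tensor] by metis
next
  case (add c v w s)
  have p: "pure V W v w \<in> car (V \<otimes> W)"
    using add pure_in_tensor by blast
  have q: "scl (V \<otimes> W) c (pure V W v w) \<in> car (V \<otimes> W)"
    by (rule vspaceD(3)[OF vspace_tensor p])
  have "N (scl (V \<otimes> W) c (pure V W v w) + s) = scl X c (N (pure V W v w)) + N s"
    if "linear_map (V \<otimes> W) X N" for N
    using that p q \<open>s \<in> car (V \<otimes> W)\<close> by (simp add: linear_map_def)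
  from this[OF assms(1)] this[OF assms(2)] show ?case
    using assms(3)[of v w] add by simp
qed

lemma tlift_exists:
  fixes V :: "('k::field, 'a::ab_group_add) vs" and W :: "('k, 'b::ab_group_add) vs"
    and X :: "('k, 'c::ab_group_add) vs"
  assumes X: "vspace X" and b: "bilinear_map V W X b"
  shows "\<exists>L. linear_map (V \<otimes> W) X L \<and> (\<forall>v\<in>car V. \<forall>w\<in>car W. L (pure V W v w) = b v w)"
proof -
  define R where "R t x \<longleftrightarrow> x \<in> car X \<and> (\<forall>\<phi>\<in>car (dual X). \<phi> x = eval t (\<lambda>v w. \<phi> (b v w)))" for t x
  have lin: "x \<in> car X \<Longrightarrow> y \<in> car X \<Longrightarrow> \<phi> (x + y) = \<phi> x + \<phi> y"
      "x \<in> car X \<Longrightarrow> \<phi> (scl X c x) = c * \<phi> x"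
    if "\<phi> \<in> car (dual X)" for \<phi> c x y
    using that by (auto simp: dual_def linear_map_def ground_def)
  have bil: "bilinear_map V W ground (\<lambda>v w. \<phi> (b v w))" if "\<phi> \<in> car (dual X)" for \<phi>
    using b lin[OF that] by (auto simp: bilinear_map_def linear_map_def ground_def)
  have R0: "R 0 0"
    using linear_map_0[OF _ X] vspaceD(1)[OF X] by (auto simp: R_def dual_def eval_simps)
  have Rp: "R (pure V W v w) (b v w)" if "v \<in> car V" "w \<in> car W" for v w
    using that b bil by (auto simp: R_def pure_def bilinear_map_def linear_map_def)
  have Ra: "R (t + s) (x + y)" if "R t x" "R s y" for t s x y
    using that vspaceD(2)[OF X] lin(1) by (simp add: R_def eval_simps)
  have Rs: "R (scl (V \<otimes> W) c t) (scl X c x)" if "R t x" for c t x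
    using that vspaceD(3)[OF X] lin(2) by (simp add: R_def tensor_def eval_simps)
  have ex: "\<exists>x. R t x" if "t \<in> car (V \<otimes> W)" for t
    using that
  proof (induct rule: tensor_induct)
    case zero
    show ?case using R0 by blast
  next
    case (add c v w s)
    then obtain x where "R s x" by blast
    then have "R (scl (V \<otimes> W) c (pure V W v w) + s) (scl X c (b v w) + x)"
      using Ra Rs Rp add by simp
    then show ?case by blast
  qed
  have un: "x = y" if "R t x" "R t y" for t x y
  proof -
    have m: "x \<in> car X" "scl X (-1) y \<in> car X" and xy: "y \<in> car X"
      using that vspaceD(3)[OF X] by (auto simp: R_def)
    have "\<phi> (x + scl X (-1) y) = 0" if p: "\<phi> \<in> car (dual X)" for \<phi>
    proof -
      have "\<phi> (x + scl X (-1) y) = \<phi> x - \<phi> y"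
        using lin(1)[OF p m] lin(2)[OF p xy, of "-1"] by simp
      moreover have "\<phi> x = \<phi> y"
        using \<open>R t x\<close> \<open>R t y\<close> p unfolding R_def by metis
      ultimately show ?thesis by simp
    qed
    then have "x + scl X (-1) y = 0"
      by (rule dual_separates[OF X vspaceD(2)[OF X m]])
    moreover have "scl X (-1) y + y = 0"
      using vspaceD(6)[OF X, of "-1" 1 y] vspaceD(4)[OF X, of y] vspaceD(6)[OF X, of 0 0 y] by simp
    ultimately show ?thesis
      using add.assoc[of x "scl X (-1) y" y] by simp
  qed
  define L where "L t = (SOME x. R t x)" for t
  have RL: "R t (L t)" if "t \<in> car (V \<otimes> W)" for t
    unfolding L_def using ex[OF that] by (rule someI_ex)
  have "L (pure V W v w) = b v w" if "v \<in> car V" "w \<in> car W" for v w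
    by (rule un[OF RL[OF pure_in_tensor[OF that]] Rp[OF that]])
  moreover have "linear_map (V \<otimes> W) X L"
    unfolding linear_map_def
  proof (intro conjI ballI allI)
    fix c x y assume x: "x \<in> car (V \<otimes> W)"
    show "L x \<in> car X" using RL[OF x] by (simp add: R_def)
    show "L (scl (V \<otimes> W) c x) = scl X c (L x)"
      by (rule un[OF RL[OF vspaceD(3)[OF vspace_tensor x]] Rs[OF RL[OF x]]])
    assume y: "y \<in> car (V \<otimes> W)"
    show "L (x + y) = L x + L y"
      by (rule un[OF RL[OF vspaceD(2)[OF vspace_tensor x y]] Ra[OF RL[OF x] RL[OF y]]])
  qed
  ultimately show ?thesis by blast
qed

lemma
  assumes "vspace X" "bilinear_map V W X b"
  shows tlift_linear: "linear_map (V \<otimes> W) X (tlift V W X b)"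
    and tlift_pure: "v \<in> car V \<Longrightarrow> w \<in> car W \<Longrightarrow> tlift V W X b (pure V W v w) = b v w"
  using someI_ex[OF tlift_exists[OF assms]] unfolding tlift_def by blast+

text \<open>
  A linear map together with its source and target. The values of \<open>fn f\<close> outside
  \<open>car (src f)\<close> are irrelevant; \<open>\<doteq>\<close> is equality of linear maps.
\<close>

record ('k, 'a, 'b) arrow =
  src :: "('k, 'a) vs"
  tgt :: "('k, 'b) vs"
  fn :: "'a \<Rightarrow> 'b"

definition Hom ::
  "('k::field, 'a::ab_group_add) vs \<Rightarrow> ('k, 'b::ab_group_add) vs \<Rightarrow> ('k, 'a, 'b) arrow set" where
  "Hom V W = {f. src f = V \<and> tgt f = W \<and> linear_map V W (fn f)}"

definition Iso ::
  "('k::field, 'a::ab_group_add) vs \<Rightarrow> ('k, 'b::ab_group_add) vs \<Rightarrow> ('k, 'a, 'b) arrow set" where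
  "Iso V W = {f \<in> Hom V W. bij_betw (fn f) (car V) (car W)}"

definition arr_eq :: "('k, 'a, 'b) arrow \<Rightarrow> ('k, 'a, 'b) arrow \<Rightarrow> bool" (infix \<open>\<doteq>\<close> 50) where
  "f \<doteq> g \<longleftrightarrow> src f = src g \<and> tgt f = tgt g \<and> (\<forall>x\<in>car (src f). fn f x = fn g x)"

definition idm :: "('k, 'a) vs \<Rightarrow> ('k, 'a, 'a) arrow" where
  "idm V = \<lparr>src = V, tgt = V, fn = (\<lambda>x. x)\<rparr>"

definition comp :: "('k, 'b, 'c) arrow \<Rightarrow> ('k, 'a, 'b) arrow \<Rightarrow> ('k, 'a, 'c) arrow"
    (infixr \<open>\<cdot>\<close> 65) where
  "g \<cdot> f = \<lparr>src = src f, tgt = tgt g, fn = fn g \<circ> fn f\<rparr>"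

definition inv_arr :: "('k, 'a, 'b) arrow \<Rightarrow> ('k, 'b, 'a) arrow" where
  "inv_arr f = \<lparr>src = tgt f, tgt = src f, fn = inv_into (car (src f)) (fn f)\<rparr>"

definition tmap ::
  "('k::field, 'a::ab_group_add, 'b::ab_group_add) arrow
    \<Rightarrow> ('k, 'c::ab_group_add, 'd::ab_group_add) arrow
    \<Rightarrow> ('k, ('k, 'a, 'c) tens, ('k, 'b, 'd) tens) arrow" (infixr \<open>\<boxtimes>\<close> 75) where
  "f \<boxtimes> g = \<lparr>src = src f \<otimes> src g, tgt = tgt f \<otimes> tgt g,
            fn = tlift (src f) (src g) (tgt f \<otimes> tgt g)
                   (\<lambda>v w. pure (tgt f) (tgt g) (fn f v) (fn g w))\<rparr>"

text \<open>The canonical maps \<open>(A \<otimes> B) \<otimes> C \<rightarrow> A \<otimes> (B \<otimes> C)\<close>, \<open>K \<otimes> V \<rightarrow> V\<close> and \<open>V \<otimes> K \<rightarrow> V\<close>.\<close>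

definition assoc ::
  "('k::field, 'a::ab_group_add) vs \<Rightarrow> ('k, 'b::ab_group_add) vs \<Rightarrow> ('k, 'c::ab_group_add) vs
    \<Rightarrow> ('k, ('k, ('k, 'a, 'b) tens, 'c) tens, ('k, 'a, ('k, 'b, 'c) tens) tens) arrow" where
  "assoc A B C = \<lparr>src = (A \<otimes> B) \<otimes> C, tgt = A \<otimes> (B \<otimes> C),
     fn = tlift (A \<otimes> B) C (A \<otimes> (B \<otimes> C))
       (\<lambda>t c. tlift A B (A \<otimes> (B \<otimes> C)) (\<lambda>a b. pure A (B \<otimes> C) a (pure B C b c)) t)\<rparr>"

abbreviation assoc' ::
  "('k::field, 'a::ab_group_add) vs \<Rightarrow> ('k, 'b::ab_group_add) vs \<Rightarrow> ('k, 'c::ab_group_add) vs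
    \<Rightarrow> ('k, ('k, 'a, ('k, 'b, 'c) tens) tens, ('k, ('k, 'a, 'b) tens, 'c) tens) arrow" where
  "assoc' A B C \<equiv> inv_arr (assoc A B C)"

definition lunit :: "('k::field, 'a::ab_group_add) vs \<Rightarrow> ('k, ('k, 'k, 'a) tens, 'a) arrow" where
  "lunit V = \<lparr>src = ground \<otimes> V, tgt = V, fn = tlift ground V V (\<lambda>c v. scl V c v)\<rparr>"

definition runit :: "('k::field, 'a::ab_group_add) vs \<Rightarrow> ('k, ('k, 'a, 'k) tens, 'a) arrow" where
  "runit V = \<lparr>src = V \<otimes> ground, tgt = V, fn = tlift V ground V (\<lambda>v c. scl V c v)\<rparr>"

text \<open>\<open>id \<otimes> f \<otimes> id : (A \<otimes> B) \<otimes> (C \<otimes> D) \<rightarrow> (A \<otimes> C) \<otimes> (B \<otimes> D)\<close> for \<open>f : B \<otimes> C \<rightarrow> C \<otimes> B\<close>.\<close>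

definition middle where
  "middle A B C D f =
     assoc' A C (B \<otimes> D) \<cdot> (idm A \<boxtimes> assoc C B D) \<cdot> (idm A \<boxtimes> (f \<boxtimes> idm D)) \<cdot>
     (idm A \<boxtimes> assoc' B C D) \<cdot> assoc A B (C \<otimes> D)"

definition braiding where
  "braiding V \<Psi> \<longleftrightarrow> vspace V \<and> \<Psi> \<in> Iso (V \<otimes> V) (V \<otimes> V) \<and>
     (\<Psi> \<boxtimes> idm V) \<cdot> assoc' V V V \<cdot> (idm V \<boxtimes> \<Psi>) \<cdot> assoc V V V \<cdot> (\<Psi> \<boxtimes> idm V)
     \<doteq> assoc' V V V \<cdot> (idm V \<boxtimes> \<Psi>) \<cdot> assoc V V V \<cdot> (\<Psi> \<boxtimes> idm V) \<cdot>
       assoc' V V V \<cdot> (idm V \<boxtimes> \<Psi>) \<cdot> assoc V V V"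

definition left_braided where
  "left_braided V \<Psi>VV W \<Psi>VW \<longleftrightarrow>
     braiding V \<Psi>VV \<and> vspace W \<and> \<Psi>VW \<in> Iso (V \<otimes> W) (W \<otimes> V) \<and>
     (\<Psi>VW \<boxtimes> idm V) \<cdot> assoc' V W V \<cdot> (idm V \<boxtimes> \<Psi>VW) \<cdot> assoc V V W \<cdot> (\<Psi>VV \<boxtimes> idm W)
     \<doteq> assoc' W V V \<cdot> (idm W \<boxtimes> \<Psi>VV) \<cdot> assoc W V V \<cdot> (\<Psi>VW \<boxtimes> idm V) \<cdot>
       assoc' V W V \<cdot> (idm V \<boxtimes> \<Psi>VW) \<cdot> assoc V V W"

definition right_braided where
  "right_braided W \<Psi>WW V \<Psi>VW \<longleftrightarrow>
     braiding W \<Psi>WW \<and> vspace V \<and> \<Psi>VW \<in> Iso (V \<otimes> W) (W \<otimes> V) \<and>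
     (idm W \<boxtimes> \<Psi>VW) \<cdot> assoc W V W \<cdot> (\<Psi>VW \<boxtimes> idm W) \<cdot> assoc' V W W \<cdot> (idm V \<boxtimes> \<Psi>WW)
     \<doteq> assoc W W V \<cdot> (\<Psi>WW \<boxtimes> idm V) \<cdot> assoc' W W V \<cdot> (idm W \<boxtimes> \<Psi>VW) \<cdot>
       assoc W V W \<cdot> (\<Psi>VW \<boxtimes> idm W) \<cdot> assoc' V W W"

text \<open>
  The unit of an algebra is an option: \<open>Some e\<close> for a unital algebra with unit \<open>e\<close>,
  \<open>None\<close> if no unit is part of the structure.
\<close>

definition algebra where
  "algebra A m u \<longleftrightarrow> vspace A \<and> m \<in> Hom (A \<otimes> A) A \<and>
     m \<cdot> (m \<boxtimes> idm A) \<doteq> m \<cdot> (idm A \<boxtimes> m) \<cdot> assoc A A A \<and>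
     (\<forall>e. u = Some e \<longrightarrow> e \<in> car A \<and>
        (\<forall>a\<in>car A. fn m (pure A A e a) = a \<and> fn m (pure A A a e) = a))"

definition coalgebra where
  "coalgebra C \<Delta> \<epsilon> \<longleftrightarrow> vspace C \<and> \<Delta> \<in> Hom C (C \<otimes> C) \<and> \<epsilon> \<in> Hom C ground \<and>
     assoc C C C \<cdot> (\<Delta> \<boxtimes> idm C) \<cdot> \<Delta> \<doteq> (idm C \<boxtimes> \<Delta>) \<cdot> \<Delta> \<and>
     lunit C \<cdot> (\<epsilon> \<boxtimes> idm C) \<cdot> \<Delta> \<doteq> idm C \<and>
     runit C \<cdot> (idm C \<boxtimes> \<epsilon>) \<cdot> \<Delta> \<doteq> idm C"

text \<open>In the next four definitions \<open>\<Psi> : V \<otimes> W \<rightarrow> W \<otimes> V\<close>.\<close>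

definition compat_mult_left where
  "compat_mult_left V m u W \<Psi> \<longleftrightarrow>
     \<Psi> \<cdot> (m \<boxtimes> idm W)
     \<doteq> (idm W \<boxtimes> m) \<cdot> assoc W V V \<cdot> (\<Psi> \<boxtimes> idm V) \<cdot> assoc' V W V \<cdot> (idm V \<boxtimes> \<Psi>) \<cdot> assoc V V W \<and>
     (\<forall>e. u = Some e \<longrightarrow> (\<forall>w\<in>car W. fn \<Psi> (pure V W e w) = pure W V w e))"

definition compat_mult_right where
  "compat_mult_right V W m u \<Psi> \<longleftrightarrow>
     \<Psi> \<cdot> (idm V \<boxtimes> m)
     \<doteq> (m \<boxtimes> idm V) \<cdot> assoc' W W V \<cdot> (idm W \<boxtimes> \<Psi>) \<cdot> assoc W V W \<cdot> (\<Psi> \<boxtimes> idm W) \<cdot> assoc' V W W \<and>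
     (\<forall>e. u = Some e \<longrightarrow> (\<forall>v\<in>car V. fn \<Psi> (pure V W v e) = pure W V e v))"

definition compat_comult_left where
  "compat_comult_left V \<Delta> \<epsilon> W \<Psi> \<longleftrightarrow>
     (idm W \<boxtimes> \<Delta>) \<cdot> \<Psi>
     \<doteq> assoc W V V \<cdot> (\<Psi> \<boxtimes> idm V) \<cdot> assoc' V W V \<cdot> (idm V \<boxtimes> \<Psi>) \<cdot> assoc V V W \<cdot> (\<Delta> \<boxtimes> idm W) \<and>
     runit W \<cdot> (idm W \<boxtimes> \<epsilon>) \<cdot> \<Psi> \<doteq> lunit W \<cdot> (\<epsilon> \<boxtimes> idm W)"

definition compat_comult_right where
  "compat_comult_right V W \<Delta> \<epsilon> \<Psi> \<longleftrightarrow>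
     (\<Delta> \<boxtimes> idm V) \<cdot> \<Psi>
     \<doteq> assoc' W W V \<cdot> (idm W \<boxtimes> \<Psi>) \<cdot> assoc W V W \<cdot> (\<Psi> \<boxtimes> idm W) \<cdot> assoc' V W W \<cdot> (idm V \<boxtimes> \<Delta>) \<and>
     lunit V \<cdot> (\<epsilon> \<boxtimes> idm V) \<cdot> \<Psi> \<doteq> runit V \<cdot> (idm V \<boxtimes> \<epsilon>)"

definition braided_algebra where
  "braided_algebra A m u \<Psi> \<longleftrightarrow> algebra A m u \<and> braiding A \<Psi> \<and>
     compat_mult_left A m u A \<Psi> \<and> compat_mult_right A A m u \<Psi>"

definition braided_coalgebra where
  "braided_coalgebra C \<Delta> \<epsilon> \<Psi> \<longleftrightarrow> coalgebra C \<Delta> \<epsilon> \<and> braiding C \<Psi> \<and>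
     compat_comult_left C \<Delta> \<epsilon> C \<Psi> \<and> compat_comult_right C C \<Delta> \<epsilon> \<Psi>"

definition braided_bialgebra where
  "braided_bialgebra H m e \<Delta> \<epsilon> \<Psi> \<longleftrightarrow>
     braided_algebra H m (Some e) \<Psi> \<and> braided_coalgebra H \<Delta> \<epsilon> \<Psi> \<and>
     \<Delta> \<cdot> m \<doteq> (m \<boxtimes> m) \<cdot> middle H H H H \<Psi> \<cdot> (\<Delta> \<boxtimes> \<Delta>) \<and>
     fn \<Delta> e = pure H H e e \<and>
     (\<forall>a\<in>car H. \<forall>b\<in>car H. fn \<epsilon> (fn m (pure H H a b)) = fn \<epsilon> a * fn \<epsilon> b) \<and>
     fn \<epsilon> e = 1"

definition braided_left_module where
  "braided_left_module A m u \<Psi>AA W \<Psi>AW \<nu> \<longleftrightarrow>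
     braided_algebra A m u \<Psi>AA \<and> left_braided A \<Psi>AA W \<Psi>AW \<and> compat_mult_left A m u W \<Psi>AW \<and>
     \<nu> \<in> Hom (A \<otimes> W) W \<and>
     \<nu> \<cdot> (idm A \<boxtimes> \<nu>) \<cdot> assoc A A W \<doteq> \<nu> \<cdot> (m \<boxtimes> idm W) \<and>
     (\<forall>e. u = Some e \<longrightarrow> (\<forall>w\<in>car W. fn \<nu> (pure A W e w) = w)) \<and>
     \<Psi>AW \<cdot> (idm A \<boxtimes> \<nu>)
     \<doteq> (\<nu> \<boxtimes> idm A) \<cdot> assoc' A W A \<cdot> (idm A \<boxtimes> \<Psi>AW) \<cdot> assoc A A W \<cdot> (\<Psi>AA \<boxtimes> idm W) \<cdot> assoc' A A W"

definition braided_right_module where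
  "braided_right_module A m u \<Psi>AA V \<Psi>VA \<nu> \<longleftrightarrow>
     braided_algebra A m u \<Psi>AA \<and> right_braided A \<Psi>AA V \<Psi>VA \<and> compat_mult_right V A m u \<Psi>VA \<and>
     \<nu> \<in> Hom (V \<otimes> A) V \<and>
     \<nu> \<cdot> (\<nu> \<boxtimes> idm A) \<doteq> \<nu> \<cdot> (idm V \<boxtimes> m) \<cdot> assoc V A A \<and>
     (\<forall>e. u = Some e \<longrightarrow> (\<forall>v\<in>car V. fn \<nu> (pure V A v e) = v)) \<and>
     \<Psi>VA \<cdot> (\<nu> \<boxtimes> idm A)
     \<doteq> (idm A \<boxtimes> \<nu>) \<cdot> assoc A V A \<cdot> (\<Psi>VA \<boxtimes> idm A) \<cdot> assoc' V A A \<cdot> (idm V \<boxtimes> \<Psi>AA) \<cdot> assoc V A A"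

definition braided_right_comodule where
  "braided_right_comodule H \<Delta> \<epsilon> \<Psi>HH V \<Psi>HV \<rho> \<longleftrightarrow>
     braided_coalgebra H \<Delta> \<epsilon> \<Psi>HH \<and> left_braided H \<Psi>HH V \<Psi>HV \<and> compat_comult_left H \<Delta> \<epsilon> V \<Psi>HV \<and>
     \<rho> \<in> Hom V (V \<otimes> H) \<and>
     assoc V H H \<cdot> (\<rho> \<boxtimes> idm H) \<cdot> \<rho> \<doteq> (idm V \<boxtimes> \<Delta>) \<cdot> \<rho> \<and>
     runit V \<cdot> (idm V \<boxtimes> \<epsilon>) \<cdot> \<rho> \<doteq> idm V \<and>
     (\<rho> \<boxtimes> idm H) \<cdot> \<Psi>HV
     \<doteq> assoc' V H H \<cdot> (idm V \<boxtimes> \<Psi>HH) \<cdot> assoc V H H \<cdot> (\<Psi>HV \<boxtimes> idm H) \<cdot> assoc' H V H \<cdot> (idm H \<boxtimes> \<rho>)"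

definition braided_left_comodule where
  "braided_left_comodule H \<Delta> \<epsilon> \<Psi>HH V \<Psi>VH \<rho> \<longleftrightarrow>
     braided_coalgebra H \<Delta> \<epsilon> \<Psi>HH \<and> right_braided H \<Psi>HH V \<Psi>VH \<and> compat_comult_right V H \<Delta> \<epsilon> \<Psi>VH \<and>
     \<rho> \<in> Hom V (H \<otimes> V) \<and>
     (idm H \<boxtimes> \<rho>) \<cdot> \<rho> \<doteq> assoc H H V \<cdot> (\<Delta> \<boxtimes> idm V) \<cdot> \<rho> \<and>
     lunit V \<cdot> (\<epsilon> \<boxtimes> idm V) \<cdot> \<rho> \<doteq> idm V \<and>
     (idm H \<boxtimes> \<rho>) \<cdot> \<Psi>VH
     \<doteq> assoc H H V \<cdot> (\<Psi>HH \<boxtimes> idm V) \<cdot> assoc' H H V \<cdot> (idm H \<boxtimes> \<Psi>VH) \<cdot> assoc H V H \<cdot> (\<rho> \<boxtimes> idm H)"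

text \<open>
  Here \<open>(H, mH, eH, \<Delta>, \<epsilon>, \<Psi>HH)\<close> is a braided bialgebra, \<open>(B, mB, uB, \<Psi>BB)\<close> a braided algebra.
\<close>

definition left_module_algebra_braiding where
  "left_module_algebra_braiding H mH eH \<Delta> \<epsilon> \<Psi>HH B mB uB \<Psi>BB \<Psi>HB \<longleftrightarrow>
     braided_bialgebra H mH eH \<Delta> \<epsilon> \<Psi>HH \<and> braided_algebra B mB uB \<Psi>BB \<and>
     left_braided H \<Psi>HH B \<Psi>HB \<and> compat_mult_left H mH (Some eH) B \<Psi>HB \<and>
     compat_mult_right H B mB uB \<Psi>HB \<and> compat_comult_left H \<Delta> \<epsilon> B \<Psi>HB"

definition right_module_algebra_braiding where
  "right_module_algebra_braiding H mH eH \<Delta> \<epsilon> \<Psi>HH B mB uB \<Psi>BB \<Psi>BH \<longleftrightarrow>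
     braided_bialgebra H mH eH \<Delta> \<epsilon> \<Psi>HH \<and> braided_algebra B mB uB \<Psi>BB \<and>
     right_braided H \<Psi>HH B \<Psi>BH \<and> compat_mult_right B H mH (Some eH) \<Psi>BH \<and>
     compat_mult_left B mB uB H \<Psi>BH \<and> compat_comult_right B H \<Delta> \<epsilon> \<Psi>BH"

definition braided_left_module_algebra where
  "braided_left_module_algebra H mH eH \<Delta> \<epsilon> \<Psi>HH B mB uB \<Psi>BB \<Psi>HB \<nu> \<longleftrightarrow>
     left_module_algebra_braiding H mH eH \<Delta> \<epsilon> \<Psi>HH B mB uB \<Psi>BB \<Psi>HB \<and>
     braided_left_module H mH (Some eH) \<Psi>HH B \<Psi>HB \<nu> \<and>
     \<nu> \<cdot> (idm H \<boxtimes> mB) \<doteq> mB \<cdot> (\<nu> \<boxtimes> \<nu>) \<cdot> middle H H B B \<Psi>HB \<cdot> (\<Delta> \<boxtimes> idm (B \<otimes> B)) \<and>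
     (\<forall>e. uB = Some e \<longrightarrow> (\<forall>h\<in>car H. fn \<nu> (pure H B h e) = scl B (fn \<epsilon> h) e))"

definition braided_right_comodule_algebra where
  "braided_right_comodule_algebra H mH eH \<Delta> \<epsilon> \<Psi>HH B mB uB \<Psi>BB \<Psi>HB \<rho> \<longleftrightarrow>
     left_module_algebra_braiding H mH eH \<Delta> \<epsilon> \<Psi>HH B mB uB \<Psi>BB \<Psi>HB \<and>
     braided_right_comodule H \<Delta> \<epsilon> \<Psi>HH B \<Psi>HB \<rho> \<and>
     \<rho> \<cdot> mB \<doteq> (mB \<boxtimes> mH) \<cdot> middle B H B H \<Psi>HB \<cdot> (\<rho> \<boxtimes> \<rho>) \<and>
     (\<forall>e. uB = Some e \<longrightarrow> fn \<rho> e = pure B H e eH)"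

definition braided_right_module_algebra where
  "braided_right_module_algebra H mH eH \<Delta> \<epsilon> \<Psi>HH B mB uB \<Psi>BB \<Psi>BH \<nu> \<longleftrightarrow>
     right_module_algebra_braiding H mH eH \<Delta> \<epsilon> \<Psi>HH B mB uB \<Psi>BB \<Psi>BH \<and>
     braided_right_module H mH (Some eH) \<Psi>HH B \<Psi>BH \<nu> \<and>
     \<nu> \<cdot> (mB \<boxtimes> idm H) \<doteq> mB \<cdot> (\<nu> \<boxtimes> \<nu>) \<cdot> middle B B H H \<Psi>BH \<cdot> (idm (B \<otimes> B) \<boxtimes> \<Delta>) \<and>
     (\<forall>e. uB = Some e \<longrightarrow> (\<forall>h\<in>car H. fn \<nu> (pure B H e h) = scl B (fn \<epsilon> h) e))"

definition braided_left_comodule_algebra where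
  "braided_left_comodule_algebra H mH eH \<Delta> \<epsilon> \<Psi>HH B mB uB \<Psi>BB \<Psi>BH \<rho> \<longleftrightarrow>
     right_module_algebra_braiding H mH eH \<Delta> \<epsilon> \<Psi>HH B mB uB \<Psi>BB \<Psi>BH \<and>
     braided_left_comodule H \<Delta> \<epsilon> \<Psi>HH B \<Psi>BH \<rho> \<and>
     \<rho> \<cdot> mB \<doteq> (mH \<boxtimes> mB) \<cdot> middle H B H B \<Psi>BH \<cdot> (\<rho> \<boxtimes> \<rho>) \<and>
     (\<forall>e. uB = Some e \<longrightarrow> fn \<rho> e = pure H B eH e)"

text \<open>\<open>U \<subseteq> H'\<close> as a vector space of its own.\<close>

definition dual_sub ::
  "('k::field, 'h::ab_group_add) vs \<Rightarrow> ('h \<Rightarrow> 'k) set \<Rightarrow> ('k, 'h \<Rightarrow> 'k) vs" where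
  "dual_sub H U = (dual H)\<lparr>car := U\<rparr>"

definition nondegenerate_subspace ::
  "('k::field, 'h::ab_group_add) vs \<Rightarrow> ('h \<Rightarrow> 'k) set \<Rightarrow> bool" where
  "nondegenerate_subspace H U \<longleftrightarrow>
     U \<subseteq> car (dual H) \<and> module.subspace (scl (dual H)) U \<and>
     (\<forall>a\<in>car H. \<forall>b\<in>car H. (\<forall>f\<in>U. f a = f b) \<longrightarrow> a = b)"

text \<open>\<open>\<langle>\<langle>\<xi> \<otimes> \<eta>, t\<rangle>\<rangle>\<close> for \<open>t \<in> X \<otimes> Y\<close>, \<open>\<xi> \<in> Y'\<close>, \<open>\<eta> \<in> X'\<close>; the order is reversed.\<close>

definition pairing ::
  "('k::field, 'a::ab_group_add) vs \<Rightarrow> ('k, 'b::ab_group_add) vs \<Rightarrow> ('b \<Rightarrow> 'k) \<Rightarrow> ('a \<Rightarrow> 'k)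
    \<Rightarrow> ('k, 'a, 'b) tens \<Rightarrow> 'k" where
  "pairing X Y \<xi> \<eta> t = tlift X Y ground (\<lambda>x y. \<xi> y * \<eta> x) t"

text \<open>The element of \<open>(P \<otimes> Q)'\<close> with value \<open>\<beta> p q\<close> on \<open>p \<otimes> q\<close>.\<close>

definition tform ::
  "('k::field, 'p::ab_group_add) vs \<Rightarrow> ('k, 'q::ab_group_add) vs \<Rightarrow> ('p \<Rightarrow> 'q \<Rightarrow> 'k)
    \<Rightarrow> ('k, 'p, 'q) tens \<Rightarrow> 'k" where
  "tform P Q \<beta> = functional (P \<otimes> Q) (tlift P Q ground \<beta>)"

text \<open>
  The embedding \<open>X \<otimes> Y \<rightarrow> (P \<otimes> Q)'\<close>, \<open>(x \<otimes> y) (p \<otimes> q) = \<langle>x, p\<rangle> \<langle>y, q\<rangle>\<close>, for pairings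
  \<open>\<langle>_, _\<rangle>\<close> of \<open>X\<close> with \<open>P\<close> and of \<open>Y\<close> with \<open>Q\<close>.
\<close>

definition embed ::
  "('k::field, 'x::ab_group_add) vs \<Rightarrow> ('x \<Rightarrow> 'p \<Rightarrow> 'k) \<Rightarrow> ('k, 'p::ab_group_add) vs
    \<Rightarrow> ('k, 'y::ab_group_add) vs \<Rightarrow> ('y \<Rightarrow> 'q \<Rightarrow> 'k) \<Rightarrow> ('k, 'q::ab_group_add) vs
    \<Rightarrow> ('k, ('k, 'x, 'y) tens, ('k, 'p, 'q) tens \<Rightarrow> 'k) arrow" where
  "embed X b P Y c Q = \<lparr>src = X \<otimes> Y, tgt = dual (P \<otimes> Q),
     fn = tlift X Y (dual (P \<otimes> Q)) (\<lambda>x y. tform P Q (\<lambda>p q. b x p * c y q))\<rparr>"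

text \<open>
  A map \<open>\<Phi> : X \<otimes> Y \<rightarrow> (P \<otimes> Q)'\<close>, where \<open>\<iota> : Y \<otimes> X \<rightarrow> (P \<otimes> Q)'\<close> is the embedding. Identifying
  \<open>Y \<otimes> X\<close> with its image, \<open>bijective_onto \<iota> \<Phi>\<close> says that \<open>\<Phi>\<close> is a bijection
  \<open>X \<otimes> Y \<rightarrow> Y \<otimes> X\<close>, and \<open>corestrict \<iota> \<Phi>\<close> is this bijection.
\<close>

definition bijective_onto :: "('k, 'b, 'c) arrow \<Rightarrow> ('k, 'a, 'c) arrow \<Rightarrow> bool" where
  "bijective_onto \<iota> \<Phi> \<longleftrightarrow> bij_betw (fn \<Phi>) (car (src \<Phi>)) (fn \<iota> ` car (src \<iota>))"

definition corestrict :: "('k, 'b, 'c) arrow \<Rightarrow> ('k, 'a, 'c) arrow \<Rightarrow> ('k, 'a, 'b) arrow" where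
  "corestrict \<iota> \<Phi> = \<lparr>src = src \<Phi>, tgt = src \<iota>, fn = inv_into (car (src \<iota>)) (fn \<iota>) \<circ> fn \<Phi>\<rparr>"

definition emb_UU where
  "emb_UU H U = embed (dual_sub H U) (\<lambda>f a. f a) H (dual_sub H U) (\<lambda>f a. f a) H"

definition emb_VU where
  "emb_VU H V U = embed V (\<lambda>v e. e v) (dual V) (dual_sub H U) (\<lambda>f a. f a) H"

definition emb_UV where
  "emb_UV H V U = embed (dual_sub H U) (\<lambda>f a. f a) H V (\<lambda>v e. e v) (dual V)"

definition psi_UU where
  "psi_UU H \<Psi>HH U = \<lparr>src = dual_sub H U \<otimes> dual_sub H U, tgt = dual (H \<otimes> H),
     fn = tlift (dual_sub H U) (dual_sub H U) (dual (H \<otimes> H))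
       (\<lambda>f g. tform H H (\<lambda>b a. pairing H H f g (fn \<Psi>HH (pure H H a b))))\<rparr>"

text \<open>
  \<open>\<Psi>\<^sub>U\<^sub>H\<^sup>\<circ>\<close> and \<open>\<Psi>\<^sub>H\<^sub>U\<^sup>\<circ>\<close> are given by the defining formulas of \<open>\<Psi>\<^sub>U\<^sub>V\<^sup>\<circ>\<close> and
  \<open>\<Psi>\<^sub>V\<^sub>U\<^sup>\<circ>\<close> for \<open>V = H\<close> with braiding \<open>\<Psi>\<^sub>H\<^sub>H\<close>, so there is no separate definition.
\<close>

definition psi_UV where
  "psi_UV H V \<Psi>HV U = \<lparr>src = dual_sub H U \<otimes> V, tgt = dual (dual V \<otimes> H),
     fn = tlift (dual_sub H U) V (dual (dual V \<otimes> H))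
       (\<lambda>f v. tform (dual V) H (\<lambda>e a. pairing H V e f (fn (inv_arr \<Psi>HV) (pure V H v a))))\<rparr>"

definition psi_VU where
  "psi_VU H V \<Psi>VH U = \<lparr>src = V \<otimes> dual_sub H U, tgt = dual (H \<otimes> dual V),
     fn = tlift V (dual_sub H U) (dual (H \<otimes> dual V))
       (\<lambda>v f. tform H (dual V) (\<lambda>a e. pairing V H f e (fn (inv_arr \<Psi>VH) (pure H V a v))))\<rparr>"

abbreviation bij_UU where
  "bij_UU H \<Psi>HH U \<equiv> bijective_onto (emb_UU H U) (psi_UU H \<Psi>HH U)"

abbreviation bij_UV where
  "bij_UV H V \<Psi>HV U \<equiv> bijective_onto (emb_VU H V U) (psi_UV H V \<Psi>HV U)"

abbreviation bij_VU where
  "bij_VU H V \<Psi>VH U \<equiv> bijective_onto (emb_UV H V U) (psi_VU H V \<Psi>VH U)"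

definition Psi_UU where
  "Psi_UU H \<Psi>HH U = corestrict (emb_UU H U) (psi_UU H \<Psi>HH U)"

definition Psi_UV where
  "Psi_UV H V \<Psi>HV U = corestrict (emb_VU H V U) (psi_UV H V \<Psi>HV U)"

definition Psi_VU where
  "Psi_VU H V \<Psi>VH U = corestrict (emb_UV H V U) (psi_VU H V \<Psi>VH U)"

definition dual_mult where
  "dual_mult H \<Delta> \<Psi>HH f g = functional H (\<lambda>a. pairing H H f g (fn (inv_arr \<Psi>HH) (fn \<Delta> a)))"

definition dual_unit where
  "dual_unit H \<epsilon> = functional H (fn \<epsilon>)"

definition mult_U where
  "mult_U H \<Delta> \<Psi>HH U = \<lparr>src = dual_sub H U \<otimes> dual_sub H U, tgt = dual_sub H U,
     fn = tlift (dual_sub H U) (dual_sub H U) (dual_sub H U) (dual_mult H \<Delta> \<Psi>HH)\<rparr>"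

definition unit_U where
  "unit_U H \<epsilon> U = (if dual_unit H \<epsilon> \<in> U then Some (dual_unit H \<epsilon>) else None)"

text \<open>
  \<open>\<omega> \<in> U \<otimes> U\<close> represents the coproduct of \<open>f\<close>, that is,
  \<open>\<langle>\<langle>\<omega>, a \<otimes> b\<rangle>\<rangle> = f (m (\<Psi> (a \<otimes> b)))\<close> for all \<open>a, b\<close>.
\<close>

definition dual_coproduct where
  "dual_coproduct H m \<Psi>HH U f \<omega> \<longleftrightarrow>
     \<omega> \<in> car (dual_sub H U \<otimes> dual_sub H U) \<and>
     (\<forall>a\<in>car H. \<forall>b\<in>car H.
        tlift (dual_sub H U) (dual_sub H U) ground (\<lambda>\<xi> \<eta>. pairing H H \<xi> \<eta> (pure H H a b)) \<omega>
        = f (fn m (fn \<Psi>HH (pure H H a b))))"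

definition comult_U where
  "comult_U H m \<Psi>HH U = \<lparr>src = dual_sub H U, tgt = dual_sub H U \<otimes> dual_sub H U,
     fn = (\<lambda>f. THE \<omega>. dual_coproduct H m \<Psi>HH U f \<omega>)\<rparr>"

definition counit_U where
  "counit_U H e U = \<lparr>src = dual_sub H U, tgt = ground, fn = (\<lambda>f. f e)\<rparr>"

definition standard_dual where
  "standard_dual H m e \<Delta> \<epsilon> \<Psi>HH U \<longleftrightarrow>
     braided_bialgebra H m e \<Delta> \<epsilon> \<Psi>HH \<and> nondegenerate_subspace H U \<and>
     dual_unit H \<epsilon> \<in> U \<and> (\<forall>f\<in>U. \<forall>g\<in>U. dual_mult H \<Delta> \<Psi>HH f g \<in> U) \<and>
     (\<forall>f\<in>U. \<exists>\<omega>. dual_coproduct H m \<Psi>HH U f \<omega>) \<and> bij_UU H \<Psi>HH U"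

definition standard_left_dual where
  "standard_left_dual H m e \<Delta> \<epsilon> \<Psi>HH U \<longleftrightarrow>
     standard_dual H m e \<Delta> \<epsilon> \<Psi>HH U \<and> bij_UV H H \<Psi>HH U"

definition standard_right_dual where
  "standard_right_dual H m e \<Delta> \<epsilon> \<Psi>HH U \<longleftrightarrow>
     standard_dual H m e \<Delta> \<epsilon> \<Psi>HH U \<and> bij_VU H H \<Psi>HH U"

definition functional_arr :: "('k::field, 'h) vs \<Rightarrow> ('h \<Rightarrow> 'k) \<Rightarrow> ('k, 'h, 'k) arrow" where
  "functional_arr H f = \<lparr>src = H, tgt = ground, fn = f\<rparr>"

definition action_left where
  "action_left H V \<Psi>HV \<rho> U = \<lparr>src = dual_sub H U \<otimes> V, tgt = V,
     fn = tlift (dual_sub H U) V V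
       (\<lambda>f. fn (lunit V \<cdot> (functional_arr H f \<boxtimes> idm V) \<cdot> inv_arr \<Psi>HV \<cdot> \<rho>))\<rparr>"

definition action_right where
  "action_right H V \<Psi>VH \<rho> U = \<lparr>src = V \<otimes> dual_sub H U, tgt = V,
     fn = tlift V (dual_sub H U) V
       (\<lambda>v f. fn (runit V \<cdot> (idm V \<boxtimes> functional_arr H f) \<cdot> inv_arr \<Psi>VH \<cdot> \<rho>) v)\<rparr>"

end

theory Submission
  imports Defs
begin

text \<open>
  Every structure map of \<open>U\<close> is obtained from a structure map of \<open>H\<close> by turning it upside down
  along the pairing \<open>\<langle>\<langle>_, _\<rangle>\<rangle>\<close>. That pairing is planar: in \<open>\<langle>\<langle>f \<otimes> g, a \<otimes> b\<rangle>\<rangle> = f b * g a\<close> the inner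
  factors are paired with each other and the outer factors with each other. Functionals are determined
  by their values, and a tensor is determined by its slices, as a basis expansion shows (\<open>rslice_zero\<close>); so an
  element of a tensor power of \<open>U\<close> is determined by its planar pairings with tensors over \<open>H\<close>
  (\<open>left_nondegenerate_nested\<close>). Therefore an equation between maps on the side of \<open>U\<close> holds as soon as the
  transposed equation holds on the side of \<open>H\<close>.

  For maps that involve only \<open>U\<close> the transpose is an adjoint: \<open>\<Psi>\<^sub>U\<^sub>U\<close> is adjoint to \<open>\<Psi>\<^sub>H\<^sub>H\<close>, the
  product of \<open>U\<close> to \<open>\<Psi>\<^sup>-\<^sup>1 \<Delta>\<close> and its coproduct to \<open>m \<Psi>\<close>. Hence \<open>U\<close> is a braided bialgebra because \<open>H\<close>
  with the twisted product \<open>m \<Psi>\<close> and the twisted coproduct \<open>\<Psi>\<^sup>-\<^sup>1 \<Delta>\<close> is one. Associativity and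
  coassociativity survive the twist by the hexagon-like compatibilities of \<open>\<Psi>\<close> (\<open>twisted_mult_assoc\<close>,
  \<open>twisted_comult_coassoc\<close>). The bialgebra axiom survives because a crossing that is compatible with two
  products is an isomorphism between the two braided tensor product algebras, and dually for coproducts
  (\<open>crossing_multiplicative\<close>, \<open>crossing_comultiplicative\<close>, \<open>twisted_bialgebra\<close>).

  For a map such as \<open>\<Psi>\<^sub>U\<^sub>V\<^sup>\<circ>\<close>, in which a strand \<open>V\<close> takes part, the transpose keeps \<open>V\<close> as it is and bends
  only the other strand: \<open>\<Psi>\<^sub>U\<^sub>V\<^sup>\<circ>\<close> is the mate of \<open>\<Psi>\<^sub>H\<^sub>V\<^sup>-\<^sup>1\<close> (\<open>mates_Psi_UV\<close>). All axioms about \<open>\<Psi>\<^sub>U\<^sub>V\<^sup>\<circ>\<close> say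
  that some map slides through a crossing of strands, on the left or on the right. Passing to mates
  exchanges left and right (\<open>slidesL_by_mates\<close>, \<open>mates_crossL\<close>, \<open>mates_crossR\<close>), and so does inverting the
  crossing (\<open>slidesL_slidesR\<close>). The two exchanges together turn each axiom about \<open>\<Psi>\<^sub>U\<^sub>V\<^sup>\<circ>\<close> into an
  axiom about \<open>\<Psi>\<^sub>H\<^sub>V\<close>, in which the products and coproducts of \<open>U\<close> have become twisted coproducts and products
  of \<open>H\<close>.

  Finally, \<open>\<nu>\<^sub>L (f \<otimes> v) = (f \<otimes> id) (S v)\<close> with \<open>S = \<Psi>\<^sub>H\<^sub>V\<^sup>-\<^sup>1 \<rho>\<^sub>R\<close>. The map \<open>S\<close> is a left coaction of \<open>H\<close> for
  the twisted coproduct \<open>\<Psi>\<^sup>-\<^sup>1 \<Delta>\<close>, and it is compatible with \<open>\<Psi>\<close> (\<open>twisted_right_coaction\<close>); these are the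
  transposes of the module axioms. In the algebra case \<open>S\<close> is multiplicative, again by
  \<open>crossing_multiplicative\<close>, and this is the transpose of the module algebra axiom (\<open>left_action_algebra\<close>).
  Part (2) is the mirror image: \<open>\<Psi>\<^sub>V\<^sub>U\<^sup>\<circ>\<close> and \<open>\<Psi>\<^sub>V\<^sub>H\<^sup>-\<^sup>1\<close> are mates for the evaluation pairing read from the
  other side, so that the lemmas on mates apply with \<open>H\<close> and \<open>U\<close> exchanged.
\<close>

section \<open>Linear maps\<close>

definition lin :: "('k::field, 'a::ab_group_add, 'b::ab_group_add) arrow \<Rightarrow> bool" where
  "lin f \<longleftrightarrow> vspace (src f) \<and> vspace (tgt f) \<and> linear_map (src f) (tgt f) (fn f)"

lemma lin_fn_mem: "lin f \<Longrightarrow> tgt f = B \<Longrightarrow> x \<in> car (src f) \<Longrightarrow> fn f x \<in> car B"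
  by (auto simp: lin_def linear_map_def)

lemma linear_map_identity: "A = X \<Longrightarrow> linear_map A X (\<lambda>x. x)"
  by (simp add: linear_map_def)

lemma linear_map_compose:
  "linear_map B X f \<Longrightarrow> linear_map A B g \<Longrightarrow> linear_map A X (\<lambda>x. f (g x))"
  by (auto simp: linear_map_def)

lemma linear_map_fn_compose:
  "lin f \<Longrightarrow> tgt f = X \<Longrightarrow> linear_map A (src f) g \<Longrightarrow> linear_map A X (\<lambda>x. fn f (g x))"
  by (auto simp: lin_def intro: linear_map_compose)

lemma linear_map_fn: "lin f \<Longrightarrow> tgt f = X \<Longrightarrow> src f = A \<Longrightarrow> linear_map A X (fn f)"
  by (auto simp: lin_def)

lemma linear_map_pure_left:
  "X = B \<otimes> C \<Longrightarrow> linear_map A B g \<Longrightarrow> c \<in> car C \<Longrightarrow> linear_map A X (\<lambda>x. pure B C (g x) c)"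
  using linear_map_compose[of B "B \<otimes> C" "\<lambda>b. pure B C b c"] pure_bilinear[of B C]
  by (auto simp: bilinear_map_def)

lemma linear_map_pure_right:
  "X = B \<otimes> C \<Longrightarrow> linear_map A C g \<Longrightarrow> b \<in> car B \<Longrightarrow> linear_map A X (\<lambda>x. pure B C b (g x))"
  using linear_map_compose[of C "B \<otimes> C" "\<lambda>c. pure B C b c"] pure_bilinear[of B C]
  by (auto simp: bilinear_map_def)

lemma linear_map_scl_left:
  "vspace X \<Longrightarrow> linear_map A ground q \<Longrightarrow> v \<in> car X \<Longrightarrow> linear_map A X (\<lambda>x. scl X (q x) v)"
  by (auto simp: linear_map_def ground_def vspaceD)

lemma linear_map_scl_right:
  "vspace X \<Longrightarrow> linear_map A X g \<Longrightarrow> linear_map A X (\<lambda>x. scl X c (g x))"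
  by (auto simp: linear_map_def vspaceD mult.commute)

lemma linear_map_mult:
  "linear_map A ground q \<Longrightarrow> linear_map A ground (\<lambda>x. q x * c)"
  "linear_map A ground q \<Longrightarrow> linear_map A ground (\<lambda>x. c * q x)"
  by (auto simp: linear_map_def ground_def algebra_simps)

lemma linear_map_tlift:
  "vspace X \<Longrightarrow> bilinear_map V W X b \<Longrightarrow> linear_map A (V \<otimes> W) g
   \<Longrightarrow> linear_map A X (\<lambda>x. tlift V W X b (g x))"
  by (rule linear_map_compose[OF tlift_linear])

lemma linear_map_cong:
  "linear_map V X g \<Longrightarrow> (\<And>v. v \<in> car V \<Longrightarrow> f v = g v) \<Longrightarrow> vspace V \<Longrightarrow> linear_map V X f"
  by (auto simp: linear_map_def vspaceD)

lemmas linear_intros =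
  linear_map_identity linear_map_fn_compose linear_map_fn linear_map_pure_left linear_map_pure_right
  linear_map_scl_left linear_map_scl_right linear_map_mult linear_map_tlift

lemma bilinear_mapI:
  "(\<And>x. x \<in> car V \<Longrightarrow> linear_map W X (b x)) \<Longrightarrow> (\<And>y. y \<in> car W \<Longrightarrow> linear_map V X (\<lambda>x. b x y))
   \<Longrightarrow> bilinear_map V W X b"
  by (simp add: bilinear_map_def)

lemma tensor_ext_ball:
  assumes "linear_map (V \<otimes> W) X L" "linear_map (V \<otimes> W) X M"
    and "\<And>v w. v \<in> car V \<Longrightarrow> w \<in> car W \<Longrightarrow> L (pure V W v w) = M (pure V W v w)"
  shows "\<forall>t\<in>car (V \<otimes> W). L t = M t"
  using tensor_ext[OF assms] by blast

text \<open>
  Additivity and homogeneity in the parameter are equations between linear maps of the tensor, so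
  they follow from the case of a pure tensor.
\<close>

lemma linear_map_parameter:
  fixes V :: "('k::field, 'a::ab_group_add) vs" and W :: "('k, 'b::ab_group_add) vs"
  assumes A: "vspace A" and X: "vspace X"
    and t: "t \<in> car (V \<otimes> W)"
    and G: "\<And>a. a \<in> car A \<Longrightarrow> linear_map (V \<otimes> W) X (G a)"
    and P: "\<And>v w. v \<in> car V \<Longrightarrow> w \<in> car W \<Longrightarrow> linear_map A X (\<lambda>a. G a (pure V W v w))"
  shows "linear_map A X (\<lambda>a. G a t)"
proof -
  have add: "linear_map (V \<otimes> W) X (\<lambda>t. G a t + G b t)" if "a \<in> car A" "b \<in> car A" for a b
    using G[OF that(1)] G[OF that(2)] X by (auto simp: linear_map_def vspaceD algebra_simps)
  have "\<forall>t\<in>car (V \<otimes> W). G (a + b) t = G a t + G b t" if "a \<in> car A" "b \<in> car A" for a b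
    using P that by (intro tensor_ext_ball[OF G add]) (auto simp: linear_map_def vspaceD[OF A])
  moreover have "\<forall>t\<in>car (V \<otimes> W). G (scl A c a) t = scl X c (G a t)" if "a \<in> car A" for a c
    using P that by (intro tensor_ext_ball[OF G linear_map_scl_right[OF X G]])
      (auto simp: linear_map_def vspaceD[OF A])
  ultimately show ?thesis
    using G t by (auto simp: linear_map_def)
qed

section \<open>The calculus of arrows\<close>

lemma src_tgt [simp]:
  "src (idm A) = A" "tgt (idm A) = A" "src (g \<cdot> f) = src f" "tgt (g \<cdot> f) = tgt g"
  "src (inv_arr f) = tgt f" "tgt (inv_arr f) = src f"
  "src (f \<boxtimes> h) = src f \<otimes> src h" "tgt (f \<boxtimes> h) = tgt f \<otimes> tgt h"
  "src (assoc A B C) = (A \<otimes> B) \<otimes> C" "tgt (assoc A B C) = A \<otimes> (B \<otimes> C)"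
  "src (lunit V) = ground \<otimes> V" "tgt (lunit V) = V" "src (runit V) = V \<otimes> ground" "tgt (runit V) = V"
  "src (functional_arr A q) = A" "tgt (functional_arr A q) = ground" "fn (functional_arr A q) = q"
  "fn (idm A) x = x" "fn (g \<cdot> f) x = fn g (fn f x)"
  by (simp_all add: idm_def comp_def inv_arr_def tmap_def assoc_def lunit_def runit_def functional_arr_def)

lemma arr_eqI:
  "src f = src g \<Longrightarrow> tgt f = tgt g \<Longrightarrow> (\<And>x. x \<in> car (src g) \<Longrightarrow> fn f x = fn g x) \<Longrightarrow> f \<doteq> g"
  by (simp add: arr_eq_def)

lemma arr_eqD: "f \<doteq> g \<Longrightarrow> x \<in> car (src g) \<Longrightarrow> fn f x = fn g x"
  by (simp add: arr_eq_def)

lemma Hom_iff: "vspace A \<Longrightarrow> vspace B \<Longrightarrow> f \<in> Hom A B \<longleftrightarrow> src f = A \<and> tgt f = B \<and> lin f"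
  by (auto simp: Hom_def lin_def)

definition iso :: "('k::field, 'a::ab_group_add, 'b::ab_group_add) arrow \<Rightarrow> bool" where
  "iso f \<longleftrightarrow> lin f \<and> bij_betw (fn f) (car (src f)) (car (tgt f))"

lemma Iso_iff: "vspace A \<Longrightarrow> vspace B \<Longrightarrow> f \<in> Iso A B \<longleftrightarrow> src f = A \<and> tgt f = B \<and> iso f"
  by (auto simp: Iso_def iso_def Hom_iff)

lemma iso_lin: "iso f \<Longrightarrow> lin f" by (simp add: iso_def)

lemma lin_vspace: "lin f \<Longrightarrow> vspace (src f)" "lin f \<Longrightarrow> vspace (tgt f)"
  by (simp_all add: lin_def)

lemma lin_idm: "vspace A \<Longrightarrow> lin (idm A)"
  by (simp add: lin_def linear_map_def)

lemma lin_comp: "lin g \<Longrightarrow> lin f \<Longrightarrow> src g = tgt f \<Longrightarrow> lin (g \<cdot> f)"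
  by (auto simp: lin_def linear_map_def)

lemma lin_functional_arr: "vspace A \<Longrightarrow> linear_map A ground q \<Longrightarrow> lin (functional_arr A q)"
  by (simp add: lin_def vspace_ground)

lemma inv_arr_left: "iso f \<Longrightarrow> x \<in> car (src f) \<Longrightarrow> fn (inv_arr f) (fn f x) = x"
  by (auto simp: iso_def bij_betw_def inv_arr_def)

lemma inv_arr_right: "iso f \<Longrightarrow> y \<in> car (tgt f) \<Longrightarrow> fn f (fn (inv_arr f) y) = y"
  by (auto simp: iso_def bij_betw_def inv_arr_def f_inv_into_f)

lemma inv_arr_eqI: "iso f \<Longrightarrow> x \<in> car (src f) \<Longrightarrow> fn f x = y \<Longrightarrow> fn (inv_arr f) y = x"
  using inv_arr_left by blast

lemma iso_inv_arr: "iso f \<Longrightarrow> iso (inv_arr f)"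
proof -
  assume f: "iso f"
  then have b: "bij_betw (fn f) (car (src f)) (car (tgt f))"
    and L: "linear_map (src f) (tgt f) (fn f)" and v: "vspace (src f)" "vspace (tgt f)"
    by (auto simp: iso_def lin_def)
  have bi: "bij_betw (fn (inv_arr f)) (car (tgt f)) (car (src f))"
    using bij_betw_inv_into[OF b] by (simp add: inv_arr_def)
  have m: "fn (inv_arr f) y \<in> car (src f)" if "y \<in> car (tgt f)" for y
    using bi that by (auto simp: bij_betw_def)
  have "linear_map (tgt f) (src f) (fn (inv_arr f))"
    unfolding linear_map_def
  proof (intro conjI ballI allI)
    fix x y c assume x: "x \<in> car (tgt f)"
    show "fn (inv_arr f) x \<in> car (src f)" by (rule m[OF x])
    show "fn (inv_arr f) (scl (tgt f) c x) = scl (src f) c (fn (inv_arr f) x)"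
      using L m[OF x] v x by (intro inv_arr_eqI[OF f]) (auto simp: linear_map_def vspaceD inv_arr_right[OF f])
    assume y: "y \<in> car (tgt f)"
    show "fn (inv_arr f) (x + y) = fn (inv_arr f) x + fn (inv_arr f) y"
      using L m[OF x] m[OF y] v x y
      by (intro inv_arr_eqI[OF f]) (auto simp: linear_map_def vspaceD inv_arr_right[OF f])
  qed
  then show ?thesis using bi v by (simp add: iso_def lin_def)
qed

lemma isoI:
  assumes "lin f" "lin g" "src g = tgt f" "tgt g = src f"
    and "\<And>x. x \<in> car (src f) \<Longrightarrow> fn g (fn f x) = x" "\<And>y. y \<in> car (tgt f) \<Longrightarrow> fn f (fn g y) = y"
  shows "iso f"
proof -
  have "bij_betw (fn f) (car (src f)) (car (tgt f))"
    by (rule bij_betw_byWitness[where f' = "fn g"]) (use assms in \<open>auto simp: lin_fn_mem\<close>)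
  then show ?thesis using assms(1) by (simp add: iso_def)
qed

lemma inv_arr_unique:
  assumes "iso f" "lin g" "src g = tgt f" "tgt g = src f"
    and "\<And>y. y \<in> car (tgt f) \<Longrightarrow> fn f (fn g y) = y"
    and "y \<in> car (tgt f)"
  shows "fn (inv_arr f) y = fn g y"
  using assms by (intro inv_arr_eqI) (auto simp: lin_fn_mem)

lemma tmap_bilinear:
  assumes "lin f" "lin g"
  shows "bilinear_map (src f) (src g) (tgt f \<otimes> tgt g) (\<lambda>v w. pure (tgt f) (tgt g) (fn f v) (fn g w))"
  using assms by (auto intro!: bilinear_mapI linear_intros intro: lin_fn_mem)

lemma lin_tmap: "lin f \<Longrightarrow> lin g \<Longrightarrow> lin (f \<boxtimes> g)"
  using tlift_linear[OF vspace_tensor tmap_bilinear] by (simp add: lin_def vspace_tensor tmap_def)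

lemma tmap_pure:
  "lin f \<Longrightarrow> lin g \<Longrightarrow> src f = A \<Longrightarrow> src g = B \<Longrightarrow> a \<in> car A \<Longrightarrow> b \<in> car B
   \<Longrightarrow> fn (f \<boxtimes> g) (pure A B a b) = pure (tgt f) (tgt g) (fn f a) (fn g b)"
  using tlift_pure[OF vspace_tensor tmap_bilinear] by (auto simp: tmap_def)

lemma assoc_bilinear_inner:
  "c \<in> car C \<Longrightarrow> bilinear_map A B (A \<otimes> (B \<otimes> C)) (\<lambda>a b. pure A (B \<otimes> C) a (pure B C b c))"
  by (auto intro!: bilinear_mapI linear_intros pure_in_tensor)

lemma assoc_bilinear:
  assumes C: "vspace C"
  shows "bilinear_map (A \<otimes> B) C (A \<otimes> (B \<otimes> C))
       (\<lambda>t c. tlift A B (A \<otimes> (B \<otimes> C)) (\<lambda>a b. pure A (B \<otimes> C) a (pure B C b c)) t)"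
proof (rule bilinear_mapI)
  fix t assume "t \<in> car (A \<otimes> B)"
  then show "linear_map C (A \<otimes> (B \<otimes> C))
      (\<lambda>c. tlift A B (A \<otimes> (B \<otimes> C)) (\<lambda>a b. pure A (B \<otimes> C) a (pure B C b c)) t)"
  proof (rule linear_map_parameter[OF C vspace_tensor])
    fix a b assume ab: "a \<in> car A" "b \<in> car B"
    have "linear_map C (A \<otimes> (B \<otimes> C)) (\<lambda>c. pure A (B \<otimes> C) a (pure B C b c))"
      using ab by (intro linear_intros) auto
    then show "linear_map C (A \<otimes> (B \<otimes> C))
        (\<lambda>c. tlift A B (A \<otimes> (B \<otimes> C)) (\<lambda>a b. pure A (B \<otimes> C) a (pure B C b c)) (pure A B a b))"
      using ab by (auto simp: linear_map_def tlift_pure[OF vspace_tensor assoc_bilinear_inner] vspaceD[OF C])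
  qed (rule tlift_linear[OF vspace_tensor assoc_bilinear_inner])
next
  fix c assume "c \<in> car C"
  then show "linear_map (A \<otimes> B) (A \<otimes> (B \<otimes> C))
     (\<lambda>t. tlift A B (A \<otimes> (B \<otimes> C)) (\<lambda>a b. pure A (B \<otimes> C) a (pure B C b c)) t)"
    by (intro tlift_linear[OF vspace_tensor assoc_bilinear_inner])
qed

lemma lin_assoc: "vspace C \<Longrightarrow> lin (assoc A B C)"
  using tlift_linear[OF vspace_tensor assoc_bilinear] by (simp add: lin_def vspace_tensor assoc_def)

lemma assoc_pure:
  assumes "vspace C" "a \<in> car A" "b \<in> car B" "c \<in> car C"
  shows "fn (assoc A B C) (pure (A \<otimes> B) C (pure A B a b) c) = pure A (B \<otimes> C) a (pure B C b c)"
  using assms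
  by (simp add: assoc_def tlift_pure[OF vspace_tensor assoc_bilinear] pure_in_tensor
      tlift_pure[OF vspace_tensor assoc_bilinear_inner])

lemma rassoc_bilinear_inner:
  "a \<in> car A \<Longrightarrow> bilinear_map B C ((A \<otimes> B) \<otimes> C) (\<lambda>b c. pure (A \<otimes> B) C (pure A B a b) c)"
  by (auto intro!: bilinear_mapI linear_intros pure_in_tensor)

lemma rassoc_bilinear:
  assumes A: "vspace A"
  shows "bilinear_map A (B \<otimes> C) ((A \<otimes> B) \<otimes> C)
       (\<lambda>a. tlift B C ((A \<otimes> B) \<otimes> C) (\<lambda>b c. pure (A \<otimes> B) C (pure A B a b) c))"
proof (rule bilinear_mapI)
  fix t assume "t \<in> car (B \<otimes> C)"
  then show "linear_map A ((A \<otimes> B) \<otimes> C)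
      (\<lambda>a. tlift B C ((A \<otimes> B) \<otimes> C) (\<lambda>b c. pure (A \<otimes> B) C (pure A B a b) c) t)"
  proof (rule linear_map_parameter[OF A vspace_tensor])
    fix b c assume bc: "b \<in> car B" "c \<in> car C"
    have "linear_map A ((A \<otimes> B) \<otimes> C) (\<lambda>a. pure (A \<otimes> B) C (pure A B a b) c)"
      using bc by (intro linear_intros) auto
    then show "linear_map A ((A \<otimes> B) \<otimes> C)
        (\<lambda>a. tlift B C ((A \<otimes> B) \<otimes> C) (\<lambda>b c. pure (A \<otimes> B) C (pure A B a b) c) (pure B C b c))"
      using bc by (auto simp: linear_map_def tlift_pure[OF vspace_tensor rassoc_bilinear_inner] vspaceD[OF A])
  qed (rule tlift_linear[OF vspace_tensor rassoc_bilinear_inner])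
next
  fix a assume "a \<in> car A"
  then show "linear_map (B \<otimes> C) ((A \<otimes> B) \<otimes> C)
     (tlift B C ((A \<otimes> B) \<otimes> C) (\<lambda>b c. pure (A \<otimes> B) C (pure A B a b) c))"
    by (intro tlift_linear[OF vspace_tensor rassoc_bilinear_inner])
qed

lemma iso_assoc_and_inverse:
  fixes A :: "('k::field, 'a::ab_group_add) vs" and B :: "('k, 'b::ab_group_add) vs"
    and C :: "('k, 'c::ab_group_add) vs"
  assumes A: "vspace A" and C: "vspace C"
  shows "iso (assoc A B C)"
    and "a \<in> car A \<Longrightarrow> b \<in> car B \<Longrightarrow> c \<in> car C \<Longrightarrow>
      fn (assoc' A B C) (pure A (B \<otimes> C) a (pure B C b c)) = pure (A \<otimes> B) C (pure A B a b) c"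
proof -
  define R where "R = \<lparr>src = A \<otimes> (B \<otimes> C), tgt = (A \<otimes> B) \<otimes> C,
     fn = tlift A (B \<otimes> C) ((A \<otimes> B) \<otimes> C)
       (\<lambda>a. tlift B C ((A \<otimes> B) \<otimes> C) (\<lambda>b c. pure (A \<otimes> B) C (pure A B a b) c))\<rparr>"
  have R: "lin R" "src R = A \<otimes> (B \<otimes> C)" "tgt R = (A \<otimes> B) \<otimes> C"
    using tlift_linear[OF vspace_tensor rassoc_bilinear[OF A]] by (simp_all add: R_def lin_def vspace_tensor)
  have Rp: "fn R (pure A (B \<otimes> C) a (pure B C b c)) = pure (A \<otimes> B) C (pure A B a b) c"
    if "a \<in> car A" "b \<in> car B" "c \<in> car C" for a b c
    using that by (simp add: R_def tlift_pure[OF vspace_tensor rassoc_bilinear[OF A]] pure_in_tensor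
        tlift_pure[OF vspace_tensor rassoc_bilinear_inner])
  note L = lin_assoc[OF C, of A B]
  have RA: "\<forall>t\<in>car ((A \<otimes> B) \<otimes> C). fn R (fn (assoc A B C) t) = t"
  proof (rule tensor_ext_ball)
    fix s c assume s: "s \<in> car (A \<otimes> B)" and c: "c \<in> car C"
    have "\<forall>s\<in>car (A \<otimes> B). fn R (fn (assoc A B C) (pure (A \<otimes> B) C s c)) = pure (A \<otimes> B) C s c"
      by (rule tensor_ext_ball[of _ _ "(A \<otimes> B) \<otimes> C"])
        (use c in \<open>auto intro!: linear_intros simp: R L assoc_pure[OF C] Rp\<close>)
    then show "fn R (fn (assoc A B C) (pure (A \<otimes> B) C s c)) = pure (A \<otimes> B) C s c"
      using s by blast
  qed (auto intro!: linear_intros simp: R L)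
  have AR: "\<forall>t\<in>car (A \<otimes> (B \<otimes> C)). fn (assoc A B C) (fn R t) = t"
  proof (rule tensor_ext_ball)
    fix a s assume s: "s \<in> car (B \<otimes> C)" and a: "a \<in> car A"
    have "\<forall>s\<in>car (B \<otimes> C). fn (assoc A B C) (fn R (pure A (B \<otimes> C) a s)) = pure A (B \<otimes> C) a s"
      by (rule tensor_ext_ball[of _ _ "A \<otimes> (B \<otimes> C)"])
        (use a in \<open>auto intro!: linear_intros simp: R L assoc_pure[OF C] Rp\<close>)
    then show "fn (assoc A B C) (fn R (pure A (B \<otimes> C) a s)) = pure A (B \<otimes> C) a s"
      using s by blast
  qed (auto intro!: linear_intros simp: R L)
  show I: "iso (assoc A B C)"
    by (rule isoI[of _ R]) (use R L RA AR in auto)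
  show "fn (assoc' A B C) (pure A (B \<otimes> C) a (pure B C b c)) = pure (A \<otimes> B) C (pure A B a b) c"
    if "a \<in> car A" "b \<in> car B" "c \<in> car C"
    using that by (intro inv_arr_eqI[OF I]) (auto simp: pure_in_tensor assoc_pure[OF C])
qed

lemmas iso_assoc = iso_assoc_and_inverse(1)
lemmas assoc'_pure = iso_assoc_and_inverse(2)

lemma lin_lunit: "vspace V \<Longrightarrow> lin (lunit V)"
  and lunit_pure: "vspace V \<Longrightarrow> v \<in> car V \<Longrightarrow> fn (lunit V) (pure ground V c v) = scl V c v"
proof -
  assume V: "vspace V"
  have b: "bilinear_map ground V V (\<lambda>c v. scl V c v)"
    using V by (intro bilinear_mapI linear_intros) auto
  show "lin (lunit V)"
    using tlift_linear[OF V b] V by (simp add: lin_def lunit_def vspace_tensor)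
  show "v \<in> car V \<Longrightarrow> fn (lunit V) (pure ground V c v) = scl V c v"
    using tlift_pure[OF V b] by (simp add: lunit_def ground_def)
qed

lemma lin_runit: "vspace V \<Longrightarrow> lin (runit V)"
  and runit_pure: "vspace V \<Longrightarrow> v \<in> car V \<Longrightarrow> fn (runit V) (pure V ground v c) = scl V c v"
proof -
  assume V: "vspace V"
  have b: "bilinear_map V ground V (\<lambda>v c. scl V c v)"
    using V by (intro bilinear_mapI linear_intros) auto
  show "lin (runit V)"
    using tlift_linear[OF V b] V by (simp add: lin_def runit_def vspace_tensor)
  show "v \<in> car V \<Longrightarrow> fn (runit V) (pure V ground v c) = scl V c v"
    using tlift_pure[OF V b] by (simp add: runit_def ground_def)
qed

lemma car_ground: "c \<in> car ground" "scl ground = (*)"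
  by (simp_all add: ground_def)

lemma lin_inv_arr: "iso f \<Longrightarrow> lin (inv_arr f)"
  by (rule iso_lin[OF iso_inv_arr])

lemma lin_inv_assoc: "vspace A \<Longrightarrow> vspace C \<Longrightarrow> lin (assoc' A B C)"
  by (rule lin_inv_arr[OF iso_assoc])

lemma pure_mem: "C = A \<otimes> B \<Longrightarrow> a \<in> car A \<Longrightarrow> b \<in> car B \<Longrightarrow> pure A B a b \<in> car C"
  by (simp add: pure_in_tensor)

lemma scl_mem: "vspace A \<Longrightarrow> a \<in> car A \<Longrightarrow> scl A c a \<in> car A"
  by (rule vspaceD)

lemma pure_scl:
  assumes "a \<in> car A" "b \<in> car B"
  shows "pure A B (scl A c a) b = scl (A \<otimes> B) c (pure A B a b)"
    and "pure A B a (scl B c b) = scl (A \<otimes> B) c (pure A B a b)"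
  using pure_bilinear[of A B] assms by (auto simp: bilinear_map_def linear_map_def)

lemma fn_scl: "lin f \<Longrightarrow> A = src f \<Longrightarrow> a \<in> car A \<Longrightarrow> fn f (scl A c a) = scl (tgt f) c (fn f a)"
  by (auto simp: lin_def linear_map_def)

text \<open>
  The rules that decide typing, linearity and the action on pure tensors of composite arrows.
\<close>

lemmas arr_simps =
  lin_idm lin_comp lin_tmap lin_assoc lin_inv_assoc lin_lunit lin_runit lin_functional_arr lin_fn_mem
  vspace_tensor vspace_ground pure_mem scl_mem car_ground tmap_pure assoc_pure assoc'_pure
  lunit_pure runit_pure linear_intros

section \<open>Functoriality of the tensor product\<close>

lemma tmap_tmap:
  assumes "lin f" "lin g" "lin f'" "lin g'" "src f = tgt f'" "src g = tgt g'"
    and x: "x \<in> car (src f' \<otimes> src g')"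
  shows "fn (f \<boxtimes> g) (fn (f' \<boxtimes> g') x) = fn ((f \<cdot> f') \<boxtimes> (g \<cdot> g')) x"
proof -
  have "\<forall>x\<in>car (src f' \<otimes> src g'). fn (f \<boxtimes> g) (fn (f' \<boxtimes> g') x) = fn ((f \<cdot> f') \<boxtimes> (g \<cdot> g')) x"
    by (rule tensor_ext_ball[of _ _ "tgt f \<otimes> tgt g"]) (simp_all add: arr_simps assms)
  then show ?thesis using x by blast
qed

lemma tmap_cong:
  assumes "lin f" "lin g" "lin f'" "lin g'" "src f = src f'" "src g = src g'" "tgt f = tgt f'" "tgt g = tgt g'"
    and "\<And>a. a \<in> car (src f') \<Longrightarrow> fn f a = fn f' a" "\<And>b. b \<in> car (src g') \<Longrightarrow> fn g b = fn g' b"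
    and x: "x \<in> car (src f' \<otimes> src g')"
  shows "fn (f \<boxtimes> g) x = fn (f' \<boxtimes> g') x"
proof -
  have "\<forall>x\<in>car (src f' \<otimes> src g'). fn (f \<boxtimes> g) x = fn (f' \<boxtimes> g') x"
    by (rule tensor_ext_ball[of _ _ "tgt f' \<otimes> tgt g'"]) (simp_all add: arr_simps assms)
  then show ?thesis using x by blast
qed

lemma tmap_idm:
  assumes "vspace A" "vspace B" "x \<in> car (A \<otimes> B)"
  shows "fn (idm A \<boxtimes> idm B) x = x"
proof -
  have "\<forall>x\<in>car (A \<otimes> B). fn (idm A \<boxtimes> idm B) x = x"
    by (rule tensor_ext_ball[of _ _ "A \<otimes> B"]) (simp_all add: arr_simps assms)
  then show ?thesis using assms by blast
qed

lemma tmap_comp_left: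
  assumes "lin f" "lin g" "src f = tgt g" "vspace C" "x \<in> car (src g \<otimes> C)"
  shows "fn ((f \<cdot> g) \<boxtimes> idm C) x = fn (f \<boxtimes> idm C) (fn (g \<boxtimes> idm C) x)"
  using assms by (subst tmap_tmap) (auto simp: arr_simps intro!: tmap_cong)

lemma tmap_comp_right:
  assumes "lin f" "lin g" "src f = tgt g" "vspace C" "x \<in> car (C \<otimes> src g)"
  shows "fn (idm C \<boxtimes> (f \<cdot> g)) x = fn (idm C \<boxtimes> f) (fn (idm C \<boxtimes> g) x)"
  using assms by (subst tmap_tmap) (auto simp: arr_simps intro!: tmap_cong)

lemma tmap_split_left_first:
  assumes "lin f" "lin g" "src f = A" "tgt g = B" "x \<in> car (A \<otimes> src g)"
  shows "fn (idm (tgt f) \<boxtimes> g) (fn (f \<boxtimes> idm (src g)) x) = fn (f \<boxtimes> g) x"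
  using assms lin_vspace[of f] lin_vspace[of g] 
  by (subst tmap_tmap) (auto simp: arr_simps intro!: tmap_cong)

lemma tmap_split_right_first:
  assumes "lin f" "lin g" "x \<in> car (src f \<otimes> src g)"
  shows "fn (f \<boxtimes> idm (tgt g)) (fn (idm (src f) \<boxtimes> g) x) = fn (f \<boxtimes> g) x"
  using assms lin_vspace[of f] lin_vspace[of g] 
  by (subst tmap_tmap) (auto simp: arr_simps intro!: tmap_cong)

lemma tmap_inv_cancel:
  assumes f: "iso f" and C: "vspace C"
  shows "A = src f \<Longrightarrow> x \<in> car (A \<otimes> C) \<Longrightarrow> fn (inv_arr f \<boxtimes> idm C) (fn (f \<boxtimes> idm C) x) = x"
    and "B = tgt f \<Longrightarrow> y \<in> car (B \<otimes> C) \<Longrightarrow> fn (f \<boxtimes> idm C) (fn (inv_arr f \<boxtimes> idm C) y) = y"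
    and "A = src f \<Longrightarrow> z \<in> car (C \<otimes> A) \<Longrightarrow> fn (idm C \<boxtimes> inv_arr f) (fn (idm C \<boxtimes> f) z) = z"
    and "B = tgt f \<Longrightarrow> w \<in> car (C \<otimes> B) \<Longrightarrow> fn (idm C \<boxtimes> f) (fn (idm C \<boxtimes> inv_arr f) w) = w"
proof -
  note L = iso_lin[OF f] lin_inv_arr[OF f] lin_vspace[OF iso_lin[OF f]]
  have "\<forall>x\<in>car (src f \<otimes> C). fn (inv_arr f \<boxtimes> idm C) (fn (f \<boxtimes> idm C) x) = x"
    by (rule tensor_ext_ball[of _ _ "src f \<otimes> C"]) (simp_all add: arr_simps L C inv_arr_left f)
  moreover have "\<forall>x\<in>car (tgt f \<otimes> C). fn (f \<boxtimes> idm C) (fn (inv_arr f \<boxtimes> idm C) x) = x"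
    by (rule tensor_ext_ball[of _ _ "tgt f \<otimes> C"]) (simp_all add: arr_simps L C inv_arr_right f)
  moreover have "\<forall>x\<in>car (C \<otimes> src f). fn (idm C \<boxtimes> inv_arr f) (fn (idm C \<boxtimes> f) x) = x"
    by (rule tensor_ext_ball[of _ _ "C \<otimes> src f"]) (simp_all add: arr_simps L C inv_arr_left f)
  moreover have "\<forall>x\<in>car (C \<otimes> tgt f). fn (idm C \<boxtimes> f) (fn (idm C \<boxtimes> inv_arr f) x) = x"
    by (rule tensor_ext_ball[of _ _ "C \<otimes> tgt f"]) (simp_all add: arr_simps L C inv_arr_right f)
  ultimately show "A = src f \<Longrightarrow> x \<in> car (A \<otimes> C) \<Longrightarrow> fn (inv_arr f \<boxtimes> idm C) (fn (f \<boxtimes> idm C) x) = x"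
    and "B = tgt f \<Longrightarrow> y \<in> car (B \<otimes> C) \<Longrightarrow> fn (f \<boxtimes> idm C) (fn (inv_arr f \<boxtimes> idm C) y) = y"
    and "A = src f \<Longrightarrow> z \<in> car (C \<otimes> A) \<Longrightarrow> fn (idm C \<boxtimes> inv_arr f) (fn (idm C \<boxtimes> f) z) = z"
    and "B = tgt f \<Longrightarrow> w \<in> car (C \<otimes> B) \<Longrightarrow> fn (idm C \<boxtimes> f) (fn (idm C \<boxtimes> inv_arr f) w) = w"
    by blast+
qed

lemma tensor3_ext_ball:
  assumes "linear_map ((A \<otimes> B) \<otimes> C) X L" "linear_map ((A \<otimes> B) \<otimes> C) X M"
    and "\<And>a b c. a \<in> car A \<Longrightarrow> b \<in> car B \<Longrightarrow> c \<in> car C \<Longrightarrow>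
      L (pure (A \<otimes> B) C (pure A B a b) c) = M (pure (A \<otimes> B) C (pure A B a b) c)"
  shows "\<forall>t\<in>car ((A \<otimes> B) \<otimes> C). L t = M t"
proof (rule tensor_ext_ball[OF assms(1,2)])
  fix s c assume s: "s \<in> car (A \<otimes> B)" and c: "c \<in> car C"
  have "\<forall>s\<in>car (A \<otimes> B). L (pure (A \<otimes> B) C s c) = M (pure (A \<otimes> B) C s c)"
    by (rule tensor_ext_ball[of _ _ X])
      (use c in \<open>auto intro!: assms linear_map_compose[OF assms(1)] linear_map_compose[OF assms(2)] simp: arr_simps\<close>)
  with s show "L (pure (A \<otimes> B) C s c) = M (pure (A \<otimes> B) C s c)" by blast
qed

lemma assoc_natural:
  assumes "lin f" "lin g" "lin h"
    and "src f = A" "src g = B" "src h = C" "tgt f = A'" "tgt g = B'" "tgt h = C'"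
  shows "x \<in> car ((A \<otimes> B) \<otimes> C) \<Longrightarrow>
      fn (assoc A' B' C') (fn ((f \<boxtimes> g) \<boxtimes> h) x) = fn (f \<boxtimes> (g \<boxtimes> h)) (fn (assoc A B C) x)"
    and "y \<in> car (A \<otimes> (B \<otimes> C)) \<Longrightarrow>
      fn (assoc' A' B' C') (fn (f \<boxtimes> (g \<boxtimes> h)) y) = fn ((f \<boxtimes> g) \<boxtimes> h) (fn (assoc' A B C) y)"
proof -
  note V = lin_vspace[OF assms(1)] lin_vspace[OF assms(2)] lin_vspace[OF assms(3)]
  have vs: "vspace A" "vspace B" "vspace C" "vspace A'" "vspace B'" "vspace C'"
    using V assms by auto
  have 1: "\<forall>x\<in>car ((A \<otimes> B) \<otimes> C).
      fn (assoc A' B' C') (fn ((f \<boxtimes> g) \<boxtimes> h) x) = fn (f \<boxtimes> (g \<boxtimes> h)) (fn (assoc A B C) x)"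
    by (rule tensor3_ext_ball[of _ _ _ "A' \<otimes> (B' \<otimes> C')"]) (simp_all add: arr_simps vs assms)
  then show "x \<in> car ((A \<otimes> B) \<otimes> C) \<Longrightarrow>
      fn (assoc A' B' C') (fn ((f \<boxtimes> g) \<boxtimes> h) x) = fn (f \<boxtimes> (g \<boxtimes> h)) (fn (assoc A B C) x)" by blast
  assume y: "y \<in> car (A \<otimes> (B \<otimes> C))"
  have z: "fn (assoc' A B C) y \<in> car ((A \<otimes> B) \<otimes> C)" using y by (simp add: arr_simps vs)
  show "fn (assoc' A' B' C') (fn (f \<boxtimes> (g \<boxtimes> h)) y) = fn ((f \<boxtimes> g) \<boxtimes> h) (fn (assoc' A B C) y)"
    using 1[rule_format, OF z] y
    by (intro inv_arr_eqI) (simp_all add: iso_assoc vs arr_simps assms inv_arr_right)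
qed

lemma idm_tensor:
  assumes "lin f" "vspace A" "vspace B"
  shows "x \<in> car (src f \<otimes> (A \<otimes> B)) \<Longrightarrow> fn (f \<boxtimes> idm (A \<otimes> B)) x = fn (f \<boxtimes> (idm A \<boxtimes> idm B)) x"
    and "y \<in> car ((A \<otimes> B) \<otimes> src f) \<Longrightarrow> fn (idm (A \<otimes> B) \<boxtimes> f) y = fn ((idm A \<boxtimes> idm B) \<boxtimes> f) y"
  using assms by (auto intro!: tmap_cong simp: arr_simps tmap_idm)

lemma assoc_natural1:
  assumes "lin f" "A = src f" "A' = tgt f" "vspace B" "vspace C"
  shows "x \<in> car ((A \<otimes> B) \<otimes> C) \<Longrightarrow>
      fn (assoc A' B C) (fn ((f \<boxtimes> idm B) \<boxtimes> idm C) x) = fn (f \<boxtimes> idm (B \<otimes> C)) (fn (assoc A B C) x)"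
    and "y \<in> car (A \<otimes> (B \<otimes> C)) \<Longrightarrow>
      fn (assoc' A' B C) (fn (f \<boxtimes> idm (B \<otimes> C)) y) = fn ((f \<boxtimes> idm B) \<boxtimes> idm C) (fn (assoc' A B C) y)"
  using assms lin_vspace[of f] assoc_natural[of f "idm B" "idm C"] by (simp_all add: idm_tensor arr_simps)

lemma assoc_natural3:
  assumes "lin f" "C = src f" "C' = tgt f" "vspace A" "vspace B"
  shows "x \<in> car ((A \<otimes> B) \<otimes> C) \<Longrightarrow>
      fn (assoc A B C') (fn (idm (A \<otimes> B) \<boxtimes> f) x) = fn (idm A \<boxtimes> (idm B \<boxtimes> f)) (fn (assoc A B C) x)"
    and "y \<in> car (A \<otimes> (B \<otimes> C)) \<Longrightarrow>
      fn (assoc' A B C') (fn (idm A \<boxtimes> (idm B \<boxtimes> f)) y) = fn (idm (A \<otimes> B) \<boxtimes> f) (fn (assoc' A B C) y)"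
  using assms lin_vspace[of f] assoc_natural[of "idm A" "idm B" f] by (simp_all add: idm_tensor arr_simps)

section \<open>Sliding arrows through a crossing\<close>

text \<open>
  \<open>crossL\<close> carries two parallel strands \<open>A\<close> from the left across \<open>W\<close>, \<open>crossR\<close> from the right. The
  brackets are chosen so that a map on \<open>A \<otimes> A\<close> can be composed with either end of them directly.
\<close>

definition crossL where
  "crossL A W \<Psi> = assoc W A A \<cdot> (\<Psi> \<boxtimes> idm A) \<cdot> assoc' A W A \<cdot> (idm A \<boxtimes> \<Psi>) \<cdot> assoc A A W"

definition crossR where
  "crossR W A \<Psi> = assoc' A A W \<cdot> (idm A \<boxtimes> \<Psi>) \<cdot> assoc A W A \<cdot> (\<Psi> \<boxtimes> idm A) \<cdot> assoc' W A A"

definition crossing where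
  "crossing A W \<Psi> \<longleftrightarrow> vspace A \<and> vspace W \<and> iso \<Psi> \<and> src \<Psi> = A \<otimes> W \<and> tgt \<Psi> = W \<otimes> A"

text \<open>
  A map \<open>t\<close> between tensor powers of the strand \<open>A\<close> may be applied before or after the crossing with
  \<open>W\<close>; \<open>\<Psi>\<close> and \<open>\<Psi>'\<close> are the crossings for the source and the target of \<open>t\<close>. In \<open>slidesL\<close> the strand
  \<open>A\<close> comes from the left, in \<open>slidesR\<close> from the right.
\<close>

definition slidesL where
  "slidesL W \<Psi> \<Psi>' t \<longleftrightarrow> (\<forall>x\<in>car (src t \<otimes> W). fn \<Psi>' (fn (t \<boxtimes> idm W) x) = fn (idm W \<boxtimes> t) (fn \<Psi> x))"

definition slidesR where
  "slidesR W \<Psi> \<Psi>' t \<longleftrightarrow> (\<forall>x\<in>car (W \<otimes> src t). fn \<Psi>' (fn (idm W \<boxtimes> t) x) = fn (t \<boxtimes> idm W) (fn \<Psi> x))"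

lemma crossL_src_tgt [simp]: "src (crossL A W \<Psi>) = (A \<otimes> A) \<otimes> W" "tgt (crossL A W \<Psi>) = W \<otimes> (A \<otimes> A)"
  by (simp_all add: crossL_def)

lemma crossR_src_tgt [simp]: "src (crossR W A \<Psi>) = W \<otimes> (A \<otimes> A)" "tgt (crossR W A \<Psi>) = (A \<otimes> A) \<otimes> W"
  by (simp_all add: crossR_def)

lemma crossingD:
  assumes "crossing A W \<Psi>"
  shows "vspace A" "vspace W" "iso \<Psi>" "lin \<Psi>" "lin (inv_arr \<Psi>)" "src \<Psi> = A \<otimes> W" "tgt \<Psi> = W \<otimes> A"
  using assms by (auto simp: crossing_def iso_lin lin_inv_arr)

lemma crossing_inv: "crossing A W \<Psi> \<Longrightarrow> crossing W A (inv_arr \<Psi>)"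
  by (simp add: crossing_def iso_inv_arr)

lemma inv_inv_arr: "crossing A W \<Psi> \<Longrightarrow> x \<in> car (A \<otimes> W) \<Longrightarrow> fn (inv_arr (inv_arr \<Psi>)) x = fn \<Psi> x"
  using crossingD[of A W \<Psi>] by (intro inv_arr_eqI) (simp_all add: iso_inv_arr arr_simps inv_arr_left)

lemma lin_crossL: "crossing A W \<Psi> \<Longrightarrow> lin (crossL A W \<Psi>)"
  and lin_crossR: "crossing W A \<Phi> \<Longrightarrow> lin (crossR W A \<Phi>)"
  using crossingD by (simp_all add: crossL_def crossR_def arr_simps crossingD)

text \<open>
  Two strands are undone one at a time in the opposite order, and this is what \<open>crossR\<close> does with
  the inverse crossing.
\<close>

lemma crossL_inv:
  assumes "crossing A W \<Psi>"
  shows "x \<in> car ((A \<otimes> A) \<otimes> W) \<Longrightarrow> fn (crossR W A (inv_arr \<Psi>)) (fn (crossL A W \<Psi>) x) = x"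
    and "y \<in> car (W \<otimes> (A \<otimes> A)) \<Longrightarrow> fn (crossL A W \<Psi>) (fn (crossR W A (inv_arr \<Psi>)) y) = y"
  using crossingD[OF assms]
  by (simp_all add: crossL_def crossR_def arr_simps inv_arr_left inv_arr_right iso_assoc tmap_inv_cancel)

lemma crossR_inv:
  assumes "crossing W A \<Phi>"
  shows "x \<in> car ((A \<otimes> A) \<otimes> W) \<Longrightarrow> fn (crossR W A \<Phi>) (fn (crossL A W (inv_arr \<Phi>)) x) = x"
    and "y \<in> car (W \<otimes> (A \<otimes> A)) \<Longrightarrow> fn (crossL A W (inv_arr \<Phi>)) (fn (crossR W A \<Phi>) y) = y"
  using crossingD[OF assms]
  by (simp_all add: crossL_def crossR_def arr_simps inv_arr_left inv_arr_right iso_assoc tmap_inv_cancel)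

lemma crossing_crossL: "crossing A W \<Psi> \<Longrightarrow> crossing (A \<otimes> A) W (crossL A W \<Psi>)"
  by (auto simp: crossing_def vspace_tensor intro!: isoI[of _ "crossR W A (inv_arr \<Psi>)"])
    (simp_all add: crossL_inv lin_crossL lin_crossR crossing_def iso_inv_arr)

lemma crossing_crossR: "crossing W A \<Phi> \<Longrightarrow> crossing W (A \<otimes> A) (crossR W A \<Phi>)"
  by (auto simp: crossing_def vspace_tensor intro!: isoI[of _ "crossL A W (inv_arr \<Phi>)"])
    (simp_all add: crossR_inv lin_crossL lin_crossR crossing_def iso_inv_arr)

lemma inv_crossL: "crossing A W \<Psi> \<Longrightarrow> y \<in> car (W \<otimes> (A \<otimes> A)) \<Longrightarrow>
    fn (inv_arr (crossL A W \<Psi>)) y = fn (crossR W A (inv_arr \<Psi>)) y"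
  using crossingD[OF crossing_crossL[of A W \<Psi>]]
  by (intro inv_arr_unique) (simp_all add: crossL_inv lin_crossR crossing_inv)

lemma inv_crossR: "crossing W A \<Phi> \<Longrightarrow> y \<in> car ((A \<otimes> A) \<otimes> W) \<Longrightarrow>
    fn (inv_arr (crossR W A \<Phi>)) y = fn (crossL A W (inv_arr \<Phi>)) y"
  using crossingD[OF crossing_crossR[of W A \<Phi>]]
  by (intro inv_arr_unique) (simp_all add: crossR_inv lin_crossL crossing_inv)

lemma slidesL_comp:
  assumes "slidesL W c1 c2 t" "slidesL W c2 c3 s" "lin t" "lin s" "src s = tgt t" "lin c1"
    "src c1 = src t \<otimes> W" "tgt c1 = W \<otimes> src t" "vspace W"
  shows "slidesL W c1 c3 (s \<cdot> t)"
  using assms by (simp add: slidesL_def tmap_comp_left tmap_comp_right arr_simps)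

lemma slidesR_comp:
  assumes "slidesR W c1 c2 t" "slidesR W c2 c3 s" "lin t" "lin s" "src s = tgt t" "lin c1"
    "src c1 = W \<otimes> src t" "tgt c1 = src t \<otimes> W" "vspace W"
  shows "slidesR W c1 c3 (s \<cdot> t)"
  using assms by (simp add: slidesR_def tmap_comp_left tmap_comp_right arr_simps)

text \<open>
  Reading a sliding rule backwards through the inverse crossings makes the moving strand start on the
  other side.
\<close>

lemma slidesL_invert_crossings:
  assumes s: "slidesL W c1 c2 t" and t: "lin t" "src t = A" "tgt t = B"
    and c: "crossing A W c1" "crossing B W c2"
  shows "slidesR W (inv_arr c1) (inv_arr c2) t"
  unfolding slidesR_def
proof
  note C = crossingD[OF c(1)] crossingD[OF c(2)] t
  fix x assume "x \<in> car (W \<otimes> src t)"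
  then have x: "x \<in> car (W \<otimes> A)" by (simp add: t)
  show "fn (inv_arr c2) (fn (idm W \<boxtimes> t) x) = fn (t \<boxtimes> idm W) (fn (inv_arr c1) x)"
    by (rule inv_arr_eqI)
      (use s x in \<open>simp_all add: slidesL_def C arr_simps inv_arr_right\<close>)
qed

lemma slidesR_invert_crossings:
  assumes s: "slidesR W c1 c2 t" and t: "lin t" "src t = A" "tgt t = B"
    and c: "crossing W A c1" "crossing W B c2"
  shows "slidesL W (inv_arr c1) (inv_arr c2) t"
  unfolding slidesL_def
proof
  note C = crossingD[OF c(1)] crossingD[OF c(2)] t
  fix x assume "x \<in> car (src t \<otimes> W)"
  then have x: "x \<in> car (A \<otimes> W)" by (simp add: t)
  show "fn (inv_arr c2) (fn (t \<boxtimes> idm W) x) = fn (idm W \<boxtimes> t) (fn (inv_arr c1) x)"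
    by (rule inv_arr_eqI)
      (use s x in \<open>simp_all add: slidesR_def C arr_simps inv_arr_right\<close>)
qed

lemma slidesL_inv:
  assumes s: "slidesL W c1 c2 t" and t: "iso t" "src t = A" "tgt t = B"
    and c: "crossing A W c1" "crossing B W c2"
  shows "slidesL W c2 c1 (inv_arr t)"
  unfolding slidesL_def
proof
  note C = crossingD[OF c(1)] crossingD[OF c(2)] t iso_lin[OF t(1)] lin_inv_arr[OF t(1)]
  fix x assume "x \<in> car (src (inv_arr t) \<otimes> W)"
  then have x: "x \<in> car (B \<otimes> W)" by (simp add: t)
  let ?y = "fn (inv_arr t \<boxtimes> idm W) x"
  have y: "?y \<in> car (A \<otimes> W)" using x by (simp add: C arr_simps)
  have "fn (idm W \<boxtimes> inv_arr t) (fn c2 x) = fn (idm W \<boxtimes> inv_arr t) (fn c2 (fn (t \<boxtimes> idm W) ?y))"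
    using x by (simp add: tmap_inv_cancel C)
  also have "\<dots> = fn (idm W \<boxtimes> inv_arr t) (fn (idm W \<boxtimes> t) (fn c1 ?y))"
    using s y by (simp add: slidesL_def C)
  also have "\<dots> = fn c1 ?y"
    using y by (simp add: tmap_inv_cancel C arr_simps)
  finally show "fn c1 ?y = fn (idm W \<boxtimes> inv_arr t) (fn c2 x)" ..
qed

lemma slidesR_inv:
  assumes s: "slidesR W c1 c2 t" and t: "iso t" "src t = A" "tgt t = B"
    and c: "crossing W A c1" "crossing W B c2"
  shows "slidesR W c2 c1 (inv_arr t)"
  unfolding slidesR_def
proof
  note C = crossingD[OF c(1)] crossingD[OF c(2)] t iso_lin[OF t(1)] lin_inv_arr[OF t(1)]
  fix x assume "x \<in> car (W \<otimes> src (inv_arr t))"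
  then have x: "x \<in> car (W \<otimes> B)" by (simp add: t)
  let ?y = "fn (idm W \<boxtimes> inv_arr t) x"
  have y: "?y \<in> car (W \<otimes> A)" using x by (simp add: C arr_simps)
  have "fn (inv_arr t \<boxtimes> idm W) (fn c2 x) = fn (inv_arr t \<boxtimes> idm W) (fn c2 (fn (idm W \<boxtimes> t) ?y))"
    using x by (simp add: tmap_inv_cancel C)
  also have "\<dots> = fn (inv_arr t \<boxtimes> idm W) (fn (t \<boxtimes> idm W) (fn c1 ?y))"
    using s y by (simp add: slidesR_def C)
  also have "\<dots> = fn c1 ?y"
    using y by (simp add: tmap_inv_cancel C arr_simps)
  finally show "fn c1 ?y = fn (inv_arr t \<boxtimes> idm W) (fn c2 x)" ..
qed

lemma slidesL_cong:
  assumes "slidesL W c1 c2 t" "lin t" "src t = A" "tgt t = B" "vspace W"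
    and "\<And>x. x \<in> car (A \<otimes> W) \<Longrightarrow> fn c1 x = fn d1 x" "\<And>x. x \<in> car (B \<otimes> W) \<Longrightarrow> fn c2 x = fn d2 x"
  shows "slidesL W d1 d2 t"
  using assms by (simp add: slidesL_def arr_simps)

lemma slidesR_cong:
  assumes "slidesR W c1 c2 t" "lin t" "src t = A" "tgt t = B" "vspace W"
    and "\<And>x. x \<in> car (W \<otimes> A) \<Longrightarrow> fn c1 x = fn d1 x" "\<And>x. x \<in> car (W \<otimes> B) \<Longrightarrow> fn c2 x = fn d2 x"
  shows "slidesR W d1 d2 t"
  using assms by (simp add: slidesR_def arr_simps)

section \<open>The axioms as sliding rules\<close>

text \<open>
  All braiding, compatibility and module axioms are of one of these forms: the Yang--Baxter equation and
  its one-sided versions for \<open>endo\<close>, compatibility with a product for \<open>mult\<close>, with a coproduct for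
  \<open>comult\<close>.
\<close>

definition endo_slidesL where "endo_slidesL A W \<Psi> s \<longleftrightarrow> slidesL W (crossL A W \<Psi>) (crossL A W \<Psi>) s"
definition mult_slidesL where "mult_slidesL A W \<Psi> m \<longleftrightarrow> slidesL W (crossL A W \<Psi>) \<Psi> m"
definition comult_slidesL where "comult_slidesL A W \<Psi> d \<longleftrightarrow> slidesL W \<Psi> (crossL A W \<Psi>) d"
definition endo_slidesR where "endo_slidesR W A \<Psi> s \<longleftrightarrow> slidesR W (crossR W A \<Psi>) (crossR W A \<Psi>) s"
definition mult_slidesR where "mult_slidesR W A \<Psi> m \<longleftrightarrow> slidesR W (crossR W A \<Psi>) \<Psi> m"
definition comult_slidesR where "comult_slidesR W A \<Psi> d \<longleftrightarrow> slidesR W \<Psi> (crossR W A \<Psi>) d"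

definition endo where "endo A s \<longleftrightarrow> iso s \<and> src s = A \<otimes> A \<and> tgt s = A \<otimes> A"
definition mult where "mult A m \<longleftrightarrow> lin m \<and> src m = A \<otimes> A \<and> tgt m = A"
definition comult where "comult A d \<longleftrightarrow> lin d \<and> src d = A \<and> tgt d = A \<otimes> A"

lemma endoD: "endo A s \<Longrightarrow> iso s" "endo A s \<Longrightarrow> lin s" "endo A s \<Longrightarrow> src s = A \<otimes> A"
    "endo A s \<Longrightarrow> tgt s = A \<otimes> A" "endo A s \<Longrightarrow> lin (inv_arr s)"
  by (simp_all add: endo_def iso_lin lin_inv_arr)
lemma multD: "mult A m \<Longrightarrow> lin m" "mult A m \<Longrightarrow> src m = A \<otimes> A" "mult A m \<Longrightarrow> tgt m = A"
  by (simp_all add: mult_def)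
lemma comultD: "comult A d \<Longrightarrow> lin d" "comult A d \<Longrightarrow> src d = A" "comult A d \<Longrightarrow> tgt d = A \<otimes> A"
  by (simp_all add: comult_def)

lemmas slides_defs = endo_slidesL_def mult_slidesL_def comult_slidesL_def
  endo_slidesR_def mult_slidesR_def comult_slidesR_def

text \<open>
  The axioms assumed for a crossing \<open>\<Omega>\<close> thus become axioms for \<open>\<Omega>\<^sup>-\<^sup>1\<close> with the sides exchanged, since
  the inverse of \<open>crossL\<close> is \<open>crossR\<close> of the inverse.
\<close>

lemma slidesL_slidesR:
  assumes c: "crossing A W \<Psi>"
  shows "endo A s \<Longrightarrow> endo_slidesL A W \<Psi> s \<Longrightarrow> endo_slidesR W A (inv_arr \<Psi>) s"
    and "mult A m \<Longrightarrow> mult_slidesL A W \<Psi> m \<Longrightarrow> mult_slidesR W A (inv_arr \<Psi>) m"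
    and "comult A d \<Longrightarrow> comult_slidesL A W \<Psi> d \<Longrightarrow> comult_slidesR W A (inv_arr \<Psi>) d"
  unfolding slides_defs
  by (rule slidesR_cong[OF slidesL_invert_crossings[where A = "A \<otimes> A" and B = "A \<otimes> A"]]
       slidesR_cong[OF slidesL_invert_crossings[where A = "A \<otimes> A" and B = A]]
       slidesR_cong[OF slidesL_invert_crossings[where A = A and B = "A \<otimes> A"]],
      (assumption | simp add: endoD multD comultD c crossing_crossL crossingD[OF c] inv_crossL)+)+

lemma slidesR_slidesL:
  assumes c: "crossing W A \<Phi>"
  shows "endo A s \<Longrightarrow> endo_slidesR W A \<Phi> s \<Longrightarrow> endo_slidesL A W (inv_arr \<Phi>) s"
    and "mult A m \<Longrightarrow> mult_slidesR W A \<Phi> m \<Longrightarrow> mult_slidesL A W (inv_arr \<Phi>) m"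
    and "comult A d \<Longrightarrow> comult_slidesR W A \<Phi> d \<Longrightarrow> comult_slidesL A W (inv_arr \<Phi>) d"
  unfolding slides_defs
  by (rule slidesL_cong[OF slidesR_invert_crossings[where A = "A \<otimes> A" and B = "A \<otimes> A"]]
       slidesL_cong[OF slidesR_invert_crossings[where A = "A \<otimes> A" and B = A]]
       slidesL_cong[OF slidesR_invert_crossings[where A = A and B = "A \<otimes> A"]],
      (assumption | simp add: endoD multD comultD c crossing_crossR crossingD[OF c] inv_crossR)+)+

text \<open>
  Sliding rules compose, so a product or coproduct that slides through a crossing may be twisted by
  the braiding without losing this property.
\<close>

lemma twisted_slidesL:
  assumes c: "crossing A W \<Psi>" and s: "endo A s" "endo_slidesL A W \<Psi> s"
  shows "endo_slidesL A W \<Psi> (inv_arr s)"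
    and "mult A m \<Longrightarrow> mult_slidesL A W \<Psi> m \<Longrightarrow> mult_slidesL A W \<Psi> (m \<cdot> s)"
    and "comult A d \<Longrightarrow> comult_slidesL A W \<Psi> d \<Longrightarrow> comult_slidesL A W \<Psi> (inv_arr s \<cdot> d)"
proof -
  note C = crossingD[OF c] endoD[OF s(1)]
  show i: "endo_slidesL A W \<Psi> (inv_arr s)"
    using s(2) unfolding slides_defs
    by (rule slidesL_inv[where A = "A \<otimes> A" and B = "A \<otimes> A"]) (simp_all add: C crossing_crossL c)
  show "mult A m \<Longrightarrow> mult_slidesL A W \<Psi> m \<Longrightarrow> mult_slidesL A W \<Psi> (m \<cdot> s)"
    using s(2) unfolding slides_defs
    by (rule slidesL_comp) (simp_all add: C multD lin_crossL c)
  show "comult A d \<Longrightarrow> comult_slidesL A W \<Psi> d \<Longrightarrow> comult_slidesL A W \<Psi> (inv_arr s \<cdot> d)"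
    using i unfolding slides_defs
    by (rule slidesL_comp[rotated]) (simp_all add: C comultD lin_crossL c)
qed

lemma twisted_slidesR:
  assumes c: "crossing W A \<Psi>" and s: "endo A s" "endo_slidesR W A \<Psi> s"
  shows "endo_slidesR W A \<Psi> (inv_arr s)"
    and "mult A m \<Longrightarrow> mult_slidesR W A \<Psi> m \<Longrightarrow> mult_slidesR W A \<Psi> (m \<cdot> s)"
    and "comult A d \<Longrightarrow> comult_slidesR W A \<Psi> d \<Longrightarrow> comult_slidesR W A \<Psi> (inv_arr s \<cdot> d)"
proof -
  note C = crossingD[OF c] endoD[OF s(1)]
  show i: "endo_slidesR W A \<Psi> (inv_arr s)"
    using s(2) unfolding slides_defs
    by (rule slidesR_inv[where A = "A \<otimes> A" and B = "A \<otimes> A"]) (simp_all add: C crossing_crossR c)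
  show "mult A m \<Longrightarrow> mult_slidesR W A \<Psi> m \<Longrightarrow> mult_slidesR W A \<Psi> (m \<cdot> s)"
    using s(2) unfolding slides_defs
    by (rule slidesR_comp) (simp_all add: C multD lin_crossR c)
  show "comult A d \<Longrightarrow> comult_slidesR W A \<Psi> d \<Longrightarrow> comult_slidesR W A \<Psi> (inv_arr s \<cdot> d)"
    using i unfolding slides_defs
    by (rule slidesR_comp[rotated]) (simp_all add: C comultD lin_crossR c)
qed

lemma eq_inv_assoc_iff:
  assumes "vspace A" "vspace C" "p \<in> car ((A \<otimes> B) \<otimes> C)" "z \<in> car (A \<otimes> (B \<otimes> C))"
  shows "p = fn (assoc' A B C) z \<longleftrightarrow> fn (assoc A B C) p = z"
  using assms inv_arr_left[OF iso_assoc, of A C p B] inv_arr_right[OF iso_assoc, of A C z B] by auto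

lemma eq_assoc_iff:
  assumes "vspace A" "vspace C" "z \<in> car ((A \<otimes> B) \<otimes> C)" "p \<in> car (A \<otimes> (B \<otimes> C))"
  shows "p = fn (assoc A B C) z \<longleftrightarrow> fn (assoc' A B C) p = z"
  using assms inv_arr_left[OF iso_assoc, of A C z B] inv_arr_right[OF iso_assoc, of A C p B] by auto

lemma crossing_Iso: "crossing A W \<Psi> \<longleftrightarrow> vspace A \<and> vspace W \<and> \<Psi> \<in> Iso (A \<otimes> W) (W \<otimes> A)"
  by (auto simp: crossing_def Iso_iff vspace_tensor)

lemma braiding_iffL:
  "braiding A s \<longleftrightarrow> crossing A A s \<and> endo_slidesL A A s s"
proof (cases "crossing A A s")
  case True
  note C = crossingD[OF True]
  show ?thesis
    using True C(1)
    by (simp add: braiding_def crossing_Iso endo_slidesL_def slidesL_def arr_eq_def crossL_def C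
        inv_arr_left inv_arr_right iso_assoc arr_simps eq_inv_assoc_iff)
qed (auto simp: braiding_def crossing_Iso)

lemma left_braided_iff:
  "left_braided A s W \<Psi> \<longleftrightarrow> braiding A s \<and> crossing A W \<Psi> \<and> endo_slidesL A W \<Psi> s"
proof (cases "braiding A s \<and> crossing A W \<Psi>")
  case True
  then have c: "crossing A A s" "crossing A W \<Psi>" by (auto simp: braiding_iffL)
  note C = crossingD[OF c(1)] crossingD[OF c(2)]
  show ?thesis
    using True C(2)
    by (simp add: left_braided_def crossing_Iso endo_slidesL_def slidesL_def arr_eq_def crossL_def C
        inv_arr_left inv_arr_right iso_assoc arr_simps eq_inv_assoc_iff)
qed (auto simp: left_braided_def crossing_Iso braiding_iffL)

lemma right_braided_iff:
  "right_braided A s W \<Psi> \<longleftrightarrow> braiding A s \<and> crossing W A \<Psi> \<and> endo_slidesR W A \<Psi> s"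
proof (cases "braiding A s \<and> crossing W A \<Psi>")
  case True
  then have c: "crossing A A s" "crossing W A \<Psi>" by (auto simp: braiding_iffL)
  note C = crossingD[OF c(1)] crossingD[OF c(2)]
  show ?thesis
    using True C(2)
    by (simp add: right_braided_def crossing_Iso endo_slidesR_def slidesR_def arr_eq_def crossR_def C
        inv_arr_left inv_arr_right iso_assoc arr_simps eq_assoc_iff)
qed (auto simp: right_braided_def crossing_Iso braiding_iffL)

lemma inv_assoc_eq_iff:
  assumes "vspace A" "vspace C" "a = fn (assoc' A B C) p" "b = fn (assoc' A B C) q"
    "p \<in> car (A \<otimes> (B \<otimes> C))" "q \<in> car (A \<otimes> (B \<otimes> C))"
  shows "a = b \<longleftrightarrow> q = p"
  using assms inv_arr_right[OF iso_assoc, of A C p B] inv_arr_right[OF iso_assoc, of A C q B] unfolding src_tgt by metis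

text \<open>
  Both sliding rules for a braiding through itself are the Yang--Baxter equation: up to rebracketing
  and applying \<open>assoc\<close> at the source, the two sides of one are the two sides of the other in the
  opposite order.
\<close>

lemma braiding_right_braided: "braiding A s \<longleftrightarrow> crossing A A s \<and> endo_slidesR A A s s"
proof (cases "crossing A A s")
  case True
  note C = crossingD[OF True]
  have bij: "(\<forall>x\<in>car (A \<otimes> (A \<otimes> A)). P x) \<longleftrightarrow> (\<forall>x\<in>car ((A \<otimes> A) \<otimes> A). P (fn (assoc A A A) x))" for P
  proof -
    have "car (A \<otimes> (A \<otimes> A)) = fn (assoc A A A) ` car ((A \<otimes> A) \<otimes> A)"
      using iso_assoc[of A A A] C(1) by (simp add: iso_def bij_betw_def)
    then show ?thesis by simp
  qed
  have "fn (crossR A A s) (fn (idm A \<boxtimes> s) (fn (assoc A A A) y)) = fn (s \<boxtimes> idm A) (fn (crossR A A s) (fn (assoc A A A) y))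
      \<longleftrightarrow> fn (crossL A A s) (fn (s \<boxtimes> idm A) y) = fn (idm A \<boxtimes> s) (fn (crossL A A s) y)"
    if y: "y \<in> car ((A \<otimes> A) \<otimes> A)" for y
  proof -
    let ?q = "fn (crossL A A s) (fn (s \<boxtimes> idm A) y)" and ?p = "fn (idm A \<boxtimes> s) (fn (crossL A A s) y)"
    have "fn (crossR A A s) (fn (idm A \<boxtimes> s) (fn (assoc A A A) y)) = fn (assoc' A A A) ?p"
      using y by (simp add: crossL_def crossR_def C arr_simps inv_arr_left inv_arr_right iso_assoc)
    moreover have "fn (s \<boxtimes> idm A) (fn (crossR A A s) (fn (assoc A A A) y)) = fn (assoc' A A A) ?q"
      using y by (simp add: crossL_def crossR_def C arr_simps inv_arr_left inv_arr_right iso_assoc)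
    moreover have "?p \<in> car (A \<otimes> (A \<otimes> A))" "?q \<in> car (A \<otimes> (A \<otimes> A))"
      using y by (simp_all add: C arr_simps lin_crossL True)
    ultimately show ?thesis
      by (rule inv_assoc_eq_iff[OF C(1) C(1)])
  qed
  then have "endo_slidesR A A s s \<longleftrightarrow> endo_slidesL A A s s"
    by (simp add: endo_slidesR_def endo_slidesL_def slidesR_def slidesL_def C bij)
  then show ?thesis using True by (simp add: braiding_iffL)
qed (auto simp: braiding_def crossing_Iso)

lemma compat_mult_left_iff:
  assumes "crossing A W \<Psi>" "mult A m"
  shows "compat_mult_left A m u W \<Psi> \<longleftrightarrow> mult_slidesL A W \<Psi> m \<and>
    (\<forall>e. u = Some e \<longrightarrow> (\<forall>w\<in>car W. fn \<Psi> (pure A W e w) = pure W A w e))"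
  using crossingD[OF assms(1)] multD[OF assms(2)]
  by (simp add: compat_mult_left_def mult_slidesL_def slidesL_def arr_eq_def crossL_def)

lemma compat_mult_right_iff:
  assumes "crossing W A \<Psi>" "mult A m"
  shows "compat_mult_right W A m u \<Psi> \<longleftrightarrow> mult_slidesR W A \<Psi> m \<and>
    (\<forall>e. u = Some e \<longrightarrow> (\<forall>w\<in>car W. fn \<Psi> (pure W A w e) = pure A W e w))"
  using crossingD[OF assms(1)] multD[OF assms(2)]
  by (simp add: compat_mult_right_def mult_slidesR_def slidesR_def arr_eq_def crossR_def)

lemma compat_comult_left_iff:
  assumes "crossing A W \<Psi>" "comult A d" "lin \<epsilon>" "src \<epsilon> = A" "tgt \<epsilon> = ground"
  shows "compat_comult_left A d \<epsilon> W \<Psi> \<longleftrightarrow> comult_slidesL A W \<Psi> d \<and>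
    (\<forall>x\<in>car (A \<otimes> W). fn (runit W) (fn (idm W \<boxtimes> \<epsilon>) (fn \<Psi> x)) = fn (lunit W) (fn (\<epsilon> \<boxtimes> idm W) x))"
  using crossingD[OF assms(1)] comultD[OF assms(2)] assms(3-)
  by (simp add: compat_comult_left_def comult_slidesL_def slidesL_def arr_eq_def crossL_def) metis

lemma compat_comult_right_iff:
  assumes "crossing W A \<Psi>" "comult A d" "lin \<epsilon>" "src \<epsilon> = A" "tgt \<epsilon> = ground"
  shows "compat_comult_right W A d \<epsilon> \<Psi> \<longleftrightarrow> comult_slidesR W A \<Psi> d \<and>
    (\<forall>x\<in>car (W \<otimes> A). fn (lunit W) (fn (\<epsilon> \<boxtimes> idm W) (fn \<Psi> x)) = fn (runit W) (fn (idm W \<boxtimes> \<epsilon>) x))"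
  using crossingD[OF assms(1)] comultD[OF assms(2)] assms(3-)
  by (simp add: compat_comult_right_def comult_slidesR_def slidesR_def arr_eq_def crossR_def) metis

section \<open>Twisting by the braiding\<close>

text \<open>
  Both sides of the associativity of \<open>m \<Psi>\<close> amount to multiplying after the half twist of three
  strands. Sliding \<open>m\<close> through \<open>\<Psi>\<close> brings them to the two expressions for the half twist, which the
  Yang--Baxter equation identifies.
\<close>

lemma twisted_mult_assoc:
  assumes \<Psi>: "crossing A A \<Psi>" "endo_slidesL A A \<Psi> \<Psi>" and m: "mult A m"
    "mult_slidesL A A \<Psi> m" "mult_slidesR A A \<Psi> m"
    and a: "m \<cdot> (m \<boxtimes> idm A) \<doteq> m \<cdot> (idm A \<boxtimes> m) \<cdot> assoc A A A"
  shows "(m \<cdot> \<Psi>) \<cdot> ((m \<cdot> \<Psi>) \<boxtimes> idm A) \<doteq> (m \<cdot> \<Psi>) \<cdot> (idm A \<boxtimes> (m \<cdot> \<Psi>)) \<cdot> assoc A A A"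
proof (rule arr_eqI)
  note C = crossingD[OF \<Psi>(1)] multD[OF m(1)]
  fix x assume "x \<in> car (src ((m \<cdot> \<Psi>) \<cdot> (idm A \<boxtimes> (m \<cdot> \<Psi>)) \<cdot> assoc A A A))"
  then have x: "x \<in> car ((A \<otimes> A) \<otimes> A)" by simp
  have as: "fn m (fn (m \<boxtimes> idm A) y) = fn m (fn (idm A \<boxtimes> m) (fn (assoc A A A) y))"
    if "y \<in> car ((A \<otimes> A) \<otimes> A)" for y
    using arr_eqD[OF a, of y] that by simp
  have "fn \<Psi> (fn (m \<boxtimes> idm A) (fn (\<Psi> \<boxtimes> idm A) x)) =
      fn (idm A \<boxtimes> m) (fn (crossL A A \<Psi>) (fn (\<Psi> \<boxtimes> idm A) x))"
    using m(2) x by (simp add: slides_defs slidesL_def C arr_simps)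
  also have "\<dots> = fn (idm A \<boxtimes> m) (fn (idm A \<boxtimes> \<Psi>) (fn (crossL A A \<Psi>) x))"
    using \<Psi>(2) x by (simp add: slides_defs slidesL_def C arr_simps)
  also have "\<dots> = fn (idm A \<boxtimes> m) (fn (assoc A A A) (fn (crossR A A \<Psi>) (fn (idm A \<boxtimes> \<Psi>) (fn (assoc A A A) x))))"
    using x by (simp add: crossL_def crossR_def inv_arr_right iso_assoc C arr_simps)
  finally have 1: "fn m (fn \<Psi> (fn (m \<boxtimes> idm A) (fn (\<Psi> \<boxtimes> idm A) x))) =
      fn m (fn (m \<boxtimes> idm A) (fn (crossR A A \<Psi>) (fn (idm A \<boxtimes> \<Psi>) (fn (assoc A A A) x))))"
    using x by (simp add: as C arr_simps lin_crossR \<Psi>)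
  also have "\<dots> = fn m (fn \<Psi> (fn (idm A \<boxtimes> m) (fn (idm A \<boxtimes> \<Psi>) (fn (assoc A A A) x))))"
    using m(3) x by (simp add: slides_defs slidesR_def C arr_simps)
  finally show "fn ((m \<cdot> \<Psi>) \<cdot> ((m \<cdot> \<Psi>) \<boxtimes> idm A)) x = fn ((m \<cdot> \<Psi>) \<cdot> (idm A \<boxtimes> (m \<cdot> \<Psi>)) \<cdot> assoc A A A) x"
    using x by (simp add: tmap_comp_left tmap_comp_right C arr_simps)
qed (use crossingD[OF \<Psi>(1)] multD[OF m(1)] in simp_all)

lemma twisted_comult_coassoc:
  assumes \<Phi>: "crossing A A \<Phi>" "endo_slidesL A A \<Phi> \<Phi>" and d: "comult A d"
    "comult_slidesL A A \<Phi> d" "comult_slidesR A A \<Phi> d"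
    and a: "assoc A A A \<cdot> (d \<boxtimes> idm A) \<cdot> d \<doteq> (idm A \<boxtimes> d) \<cdot> d"
  shows "assoc A A A \<cdot> ((\<Phi> \<cdot> d) \<boxtimes> idm A) \<cdot> (\<Phi> \<cdot> d) \<doteq> (idm A \<boxtimes> (\<Phi> \<cdot> d)) \<cdot> (\<Phi> \<cdot> d)"
proof (rule arr_eqI)
  note C = crossingD[OF \<Phi>(1)] comultD[OF d(1)]
  fix x assume "x \<in> car (src ((idm A \<boxtimes> (\<Phi> \<cdot> d)) \<cdot> (\<Phi> \<cdot> d)))"
  then have x: "x \<in> car A" by (simp add: C)
  have as: "fn (idm A \<boxtimes> d) (fn d x) = fn (assoc A A A) (fn (d \<boxtimes> idm A) (fn d x))"
    using arr_eqD[OF a, of x] x C by simp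
  let ?y = "fn (d \<boxtimes> idm A) (fn d x)"
  have y: "?y \<in> car ((A \<otimes> A) \<otimes> A)" using x by (simp add: C arr_simps)
  have "fn (assoc A A A) (fn (\<Phi> \<boxtimes> idm A) (fn (d \<boxtimes> idm A) (fn \<Phi> (fn d x)))) =
      fn (assoc A A A) (fn (\<Phi> \<boxtimes> idm A) (fn (crossR A A \<Phi>) (fn (assoc A A A) ?y)))"
    using d(3) x by (simp add: slides_defs slidesR_def C arr_simps as[symmetric])
  also have "\<dots> = fn (crossL A A \<Phi>) (fn (\<Phi> \<boxtimes> idm A) ?y)"
    using y by (simp add: crossL_def crossR_def inv_arr_left inv_arr_right iso_assoc C arr_simps)
  also have "\<dots> = fn (idm A \<boxtimes> \<Phi>) (fn (crossL A A \<Phi>) ?y)"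
    using \<Phi>(2) y by (simp add: slides_defs slidesL_def C arr_simps)
  also have "\<dots> = fn (idm A \<boxtimes> \<Phi>) (fn (idm A \<boxtimes> d) (fn \<Phi> (fn d x)))"
    using d(2) x by (simp add: slides_defs slidesL_def C arr_simps)
  finally show "fn (assoc A A A \<cdot> ((\<Phi> \<cdot> d) \<boxtimes> idm A) \<cdot> (\<Phi> \<cdot> d)) x = fn ((idm A \<boxtimes> (\<Phi> \<cdot> d)) \<cdot> (\<Phi> \<cdot> d)) x"
    using x by (simp add: tmap_comp_left tmap_comp_right C arr_simps)
qed (use crossingD[OF \<Phi>(1)] comultD[OF d(1)] in simp_all)

lemma middle_src_tgt [simp]:
  "src (middle A B C D f) = (A \<otimes> B) \<otimes> (C \<otimes> D)" "tgt (middle A B C D f) = (A \<otimes> C) \<otimes> (B \<otimes> D)"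
  by (simp_all add: middle_def)

lemma lin_middle:
  "lin f \<Longrightarrow> src f = B \<otimes> C \<Longrightarrow> tgt f = C \<otimes> B \<Longrightarrow> vspace A \<Longrightarrow> vspace B \<Longrightarrow> vspace C \<Longrightarrow> vspace D
   \<Longrightarrow> lin (middle A B C D f)"
  by (simp add: middle_def arr_simps)

lemma middle_pure:
  assumes "lin f" "src f = B \<otimes> C" "tgt f = C \<otimes> B" "vspace A" "vspace B" "vspace C" "vspace D"
    "a \<in> car A" "b \<in> car B" "c \<in> car C" "d \<in> car D"
  shows "fn (middle A B C D f) (pure (A \<otimes> B) (C \<otimes> D) (pure A B a b) (pure C D c d)) =
    fn (assoc' A C (B \<otimes> D)) (pure A (C \<otimes> (B \<otimes> D)) a (fn (assoc C B D) (pure (C \<otimes> B) D (fn f (pure B C b c)) d)))"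
  using assms by (simp add: middle_def arr_simps)

lemma tensor22_ext_ball:
  assumes "linear_map ((A \<otimes> B) \<otimes> (C \<otimes> D)) X L" "linear_map ((A \<otimes> B) \<otimes> (C \<otimes> D)) X M"
    and "\<And>a b c d. a \<in> car A \<Longrightarrow> b \<in> car B \<Longrightarrow> c \<in> car C \<Longrightarrow> d \<in> car D \<Longrightarrow>
      L (pure (A \<otimes> B) (C \<otimes> D) (pure A B a b) (pure C D c d)) = M (pure (A \<otimes> B) (C \<otimes> D) (pure A B a b) (pure C D c d))"
  shows "\<forall>t\<in>car ((A \<otimes> B) \<otimes> (C \<otimes> D)). L t = M t"
proof (rule tensor3_ext_ball[OF assms(1,2)])
  fix a b s assume s: "s \<in> car (C \<otimes> D)" and ab: "a \<in> car A" "b \<in> car B"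
  have "\<forall>s\<in>car (C \<otimes> D). L (pure (A \<otimes> B) (C \<otimes> D) (pure A B a b) s) = M (pure (A \<otimes> B) (C \<otimes> D) (pure A B a b) s)"
    by (rule tensor_ext_ball[of _ _ X])
      (use ab in \<open>auto intro!: assms linear_map_compose[OF assms(1)] linear_map_compose[OF assms(2)] simp: arr_simps\<close>)
  with s show "L (pure (A \<otimes> B) (C \<otimes> D) (pure A B a b) s) = M (pure (A \<otimes> B) (C \<otimes> D) (pure A B a b) s)" by blast
qed

text \<open>
  The crossing is an isomorphism of algebras from \<open>V \<otimes> H\<close> to \<open>H \<otimes> V\<close>, where the middle factors of the
  braided tensor products are interchanged by \<open>\<Phi>\<^sup>-\<^sup>1\<close> and by \<open>\<Phi>\<close>. On factors \<open>v, h, w, k\<close>, sliding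
  both products through \<open>\<Phi>\<close> produces four crossings, of \<open>v\<close> and \<open>w\<close> with \<open>h\<close> and \<open>k\<close>. The crossing of
  \<open>w\<close> with \<open>h\<close> cancels against \<open>\<Phi>\<^sup>-\<^sup>1\<close>; those of \<open>v\<close> with \<open>h\<close> and of \<open>w\<close> with \<open>k\<close> make up \<open>\<Phi> \<otimes> \<Phi>\<close>, and
  that of \<open>v\<close> with \<open>k\<close> is the middle crossing on the right-hand side.
\<close>

lemma crossing_multiplicative:
  assumes c: "crossing V H \<Phi>" and mV: "mult V mV" "mult_slidesL V H \<Phi> mV"
    and mH: "mult H mH" "mult_slidesR V H \<Phi> mH"
    and x: "x \<in> car ((V \<otimes> H) \<otimes> (V \<otimes> H))"
  shows "fn \<Phi> (fn (mV \<boxtimes> mH) (fn (middle V H V H (inv_arr \<Phi>)) x)) =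
    fn (mH \<boxtimes> mV) (fn (middle H V H V \<Phi>) (fn (\<Phi> \<boxtimes> \<Phi>) x))"
proof -
  note C = crossingD[OF c] multD[OF mV(1)] multD[OF mH(1)]
  have L: "fn \<Phi> (fn (mV \<boxtimes> idm H) y) = fn (idm H \<boxtimes> mV) (fn (crossL V H \<Phi>) y)" if "y \<in> car ((V \<otimes> V) \<otimes> H)" for y
    using mV(2) that by (simp add: slides_defs slidesL_def C)
  have R: "fn \<Phi> (fn (idm V \<boxtimes> mH) y) = fn (mH \<boxtimes> idm V) (fn (crossR V H \<Phi>) y)" if "y \<in> car (V \<otimes> (H \<otimes> H))" for y
    using mH(2) that by (simp add: slides_defs slidesR_def C)
  have Lp: "fn \<Phi> (pure V H (fn mV (pure V V v w)) h) =
      fn (idm H \<boxtimes> mV) (fn (assoc H V V) (fn (\<Phi> \<boxtimes> idm V) (fn (assoc' V H V) (pure V (H \<otimes> V) v (fn \<Phi> (pure V H w h))))))"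
    if "v \<in> car V" "w \<in> car V" "h \<in> car H" for v w h
    using L[of "pure (V \<otimes> V) H (pure V V v w) h"] that by (simp add: crossL_def C arr_simps)
  have Rp: "fn \<Phi> (pure V H v (fn mH (pure H H h k))) =
      fn (mH \<boxtimes> idm V) (fn (assoc' H H V) (fn (idm H \<boxtimes> \<Phi>) (fn (assoc H V H) (pure (H \<otimes> V) H (fn \<Phi> (pure V H v h)) k))))"
    if "v \<in> car V" "h \<in> car H" "k \<in> car H" for v h k
    using R[of "pure V (H \<otimes> H) v (pure H H h k)"] that by (simp add: crossR_def C arr_simps)
  let ?X = "H \<otimes> V"
  \<comment> \<open>The values of \<open>inv_arr \<Phi>\<close> and of the four crossings \<open>\<Phi>\<close> are replaced one after the other by arbitrary
    tensors, which may then be taken to be pure. The numbers give the order in which they are applied.\<close>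
  have 5: "\<forall>q\<in>car (H \<otimes> V). 
      fn (idm H \<boxtimes> mV) (fn (assoc H V V) (pure (H \<otimes> V) V (fn (mH \<boxtimes> idm V) (fn (assoc' H H V) (pure H (H \<otimes> V) h q))) w)) =
      fn (mH \<boxtimes> mV) (fn (assoc' H H (V \<otimes> V)) (pure H (H \<otimes> (V \<otimes> V)) h (fn (assoc H V V) (pure (H \<otimes> V) V q w))))"
    if "h \<in> car H" "w \<in> car V" for h w
    by (rule tensor_ext_ball[of _ _ ?X]) (use that in \<open>simp_all add: C arr_simps\<close>)
  have 4: "\<forall>u\<in>car (H \<otimes> V). 
      fn (idm H \<boxtimes> mV) (fn (assoc H V V) (pure (H \<otimes> V) V
        (fn (mH \<boxtimes> idm V) (fn (assoc' H H V) (fn (idm H \<boxtimes> \<Phi>) (fn (assoc H V H) (pure (H \<otimes> V) H u k))))) w)) =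
      fn (mH \<boxtimes> mV) (fn (middle H V H V \<Phi>) (pure (H \<otimes> V) (H \<otimes> V) u (pure H V k w)))"
    if "k \<in> car H" "w \<in> car V" for k w
    by (rule tensor_ext_ball[of _ _ ?X]) (use that in \<open>simp_all add: C arr_simps middle_def 5\<close>)
  have 3: "\<forall>z\<in>car (H \<otimes> V). 
      fn (idm H \<boxtimes> mV) (fn (assoc H V V) (fn (\<Phi> \<boxtimes> idm V) (fn (assoc' V H V) (pure V (H \<otimes> V) v
        (fn (mH \<boxtimes> idm V) (fn (assoc' H H V) (pure H (H \<otimes> V) h z))))))) =
      fn (mH \<boxtimes> mV) (fn (middle H V H V \<Phi>) (pure (H \<otimes> V) (H \<otimes> V) (fn \<Phi> (pure V H v h)) z))"
    if "v \<in> car V" "h \<in> car H" for v h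
    by (rule tensor_ext_ball[of _ _ ?X]) (use that in \<open>simp_all add: C arr_simps Rp 4 lin_middle\<close>)
  have 2: "\<forall>y\<in>car (H \<otimes> V). 
      fn (idm H \<boxtimes> mV) (fn (assoc H V V) (fn (\<Phi> \<boxtimes> idm V) (fn (assoc' V H V) (pure V (H \<otimes> V) v
        (fn (mH \<boxtimes> idm V) (fn (assoc' H H V) (fn (idm H \<boxtimes> \<Phi>) (fn (assoc H V H) (pure (H \<otimes> V) H y k))))))))) =
      fn (mH \<boxtimes> mV) (fn (middle H V H V \<Phi>) (fn (\<Phi> \<boxtimes> \<Phi>) 
        (fn (assoc' V H (V \<otimes> H)) (pure V (H \<otimes> (V \<otimes> H)) v (fn (assoc H V H) (pure (H \<otimes> V) H y k))))))"
    if "v \<in> car V" "k \<in> car H" for v k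
    by (rule tensor_ext_ball[of _ _ ?X]) (use that in \<open>simp_all add: C arr_simps 3 lin_middle\<close>)
  have 1: "\<forall>t\<in>car (V \<otimes> H). 
      fn \<Phi> (fn (mV \<boxtimes> mH) (fn (assoc' V V (H \<otimes> H)) (pure V (V \<otimes> (H \<otimes> H)) v (fn (assoc V H H) (pure (V \<otimes> H) H t k))))) =
      fn (mH \<boxtimes> mV) (fn (middle H V H V \<Phi>) (fn (\<Phi> \<boxtimes> \<Phi>) 
        (fn (assoc' V H (V \<otimes> H)) (pure V (H \<otimes> (V \<otimes> H)) v (fn (assoc H V H) (pure (H \<otimes> V) H (fn \<Phi> t) k))))))"
    if "v \<in> car V" "k \<in> car H" for v k
    by (rule tensor_ext_ball[of _ _ ?X]) (use that in \<open>simp_all add: C arr_simps Lp, simp_all add: C arr_simps Rp 2 lin_middle\<close>)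
  have "\<forall>x\<in>car ((V \<otimes> H) \<otimes> (V \<otimes> H)). 
    fn \<Phi> (fn (mV \<boxtimes> mH) (fn (middle V H V H (inv_arr \<Phi>)) x)) =
    fn (mH \<boxtimes> mV) (fn (middle H V H V \<Phi>) (fn (\<Phi> \<boxtimes> \<Phi>) x))"
  proof (rule tensor22_ext_ball[of _ _ _ _ ?X])
    fix v h w k assume a: "v \<in> car V" "h \<in> car H" "w \<in> car V" "k \<in> car H"
    then have "fn (inv_arr \<Phi>) (pure H V h w) \<in> car (V \<otimes> H)" by (simp add: C arr_simps)
    from 1[OF a(1,4), rule_format, OF this]
    show "fn \<Phi> (fn (mV \<boxtimes> mH) (fn (middle V H V H (inv_arr \<Phi>)) (pure (V \<otimes> H) (V \<otimes> H) (pure V H v h) (pure V H w k)))) =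
      fn (mH \<boxtimes> mV) (fn (middle H V H V \<Phi>) (fn (\<Phi> \<boxtimes> \<Phi>) (pure (V \<otimes> H) (V \<otimes> H) (pure V H v h) (pure V H w k))))"
      using a by (simp add: middle_pure C arr_simps inv_arr_right lin_middle)
  qed (simp_all add: C arr_simps lin_middle)
  with x show ?thesis by blast
qed

text \<open>
  This is \<open>crossing_multiplicative\<close> upside down: sliding both coproducts through \<open>\<Psi>\<close> produces four
  crossings, one of which cancels against \<open>\<Psi>\<^sup>-\<^sup>1\<close>.
\<close>

lemma crossing_comultiplicative:
  assumes c: "crossing A W \<Psi>" and dA: "comult A dA" "comult_slidesL A W \<Psi> dA"
    and dW: "comult W dW" "comult_slidesR A W \<Psi> dW"
    and x: "x \<in> car (A \<otimes> W)"
  shows "fn (middle W W A A (inv_arr \<Psi>)) (fn (dW \<boxtimes> dA) (fn \<Psi> x)) =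
    fn (\<Psi> \<boxtimes> \<Psi>) (fn (middle A A W W \<Psi>) (fn (dA \<boxtimes> dW) x))"
proof -
  note C = crossingD[OF c] comultD[OF dA(1)] comultD[OF dW(1)] lin_middle lin_crossR[OF c] lin_crossL[OF c]
  let ?M = "middle W W A A (inv_arr \<Psi>)" and ?X = "(W \<otimes> A) \<otimes> (W \<otimes> A)"
    and ?F = "\<lambda>a r. fn (assoc (W \<otimes> W) A A) (fn (crossR A W \<Psi> \<boxtimes> idm A) (fn (assoc' A (W \<otimes> W) A) (pure A ((W \<otimes> W) \<otimes> A) a r)))"
  have L: "fn (idm W \<boxtimes> dA) (fn \<Psi> y) = fn (crossL A W \<Psi>) (fn (dA \<boxtimes> idm W) y)" if "y \<in> car (A \<otimes> W)" for y
    using dA(2) that by (simp add: slides_defs slidesL_def C)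
  have R: "fn (dW \<boxtimes> idm A) (fn \<Psi> y) = fn (crossR A W \<Psi>) (fn (idm A \<boxtimes> dW) y)" if "y \<in> car (A \<otimes> W)" for y
    using dW(2) that by (simp add: slides_defs slidesR_def C)
  have crossR_pure: "fn (crossR A W \<Psi>) (pure A (W \<otimes> W) a (pure W W v w)) =
      fn (assoc' W W A) (fn (idm W \<boxtimes> \<Psi>) (fn (assoc W A W) (pure (W \<otimes> A) W (fn \<Psi> (pure A W a v)) w)))"
    if "a \<in> car A" "v \<in> car W" "w \<in> car W" for a v w
    using that by (simp add: crossR_def C arr_simps)
  \<comment> \<open>As for products, the values of the crossings are replaced one after the other by arbitrary tensors,
    the last one first. In step 3 it cancels against \<open>inv_arr \<Psi>\<close>.\<close>
  have 4: "\<forall>u\<in>car (W \<otimes> A). fn ?M (fn (assoc (W \<otimes> W) A A) (pure ((W \<otimes> W) \<otimes> A) A (fn (assoc' W W A) (pure W (W \<otimes> A) v u)) a)) =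
      fn (assoc' W A (W \<otimes> A)) (pure W (A \<otimes> (W \<otimes> A)) v (fn (assoc A W A) (pure (A \<otimes> W) A (fn (inv_arr \<Psi>) u) a)))"
    if "v \<in> car W" "a \<in> car A" for v a
    by (rule tensor_ext_ball[of _ _ ?X]) (use that in \<open>simp_all add: C arr_simps middle_pure\<close>)
  have 3: "\<forall>q\<in>car (W \<otimes> A). fn ?M (fn (assoc (W \<otimes> W) A A) (pure ((W \<otimes> W) \<otimes> A) A
       (fn (assoc' W W A) (fn (idm W \<boxtimes> \<Psi>) (fn (assoc W A W) (pure (W \<otimes> A) W q w)))) a)) =
      pure (W \<otimes> A) (W \<otimes> A) q (pure W A w a)"
    if "w \<in> car W" "a \<in> car A" for w a
    by (rule tensor_ext_ball[of _ _ ?X]) (use that in \<open>simp_all add: C arr_simps 4 inv_arr_left\<close>)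
  have 2: "\<forall>p\<in>car (W \<otimes> A). fn ?M (?F a (fn (assoc' W W A) (pure W (W \<otimes> A) v p))) =
      pure (W \<otimes> A) (W \<otimes> A) (fn \<Psi> (pure A W a v)) p"
    if "v \<in> car W" "a \<in> car A" for v a
    by (rule tensor_ext_ball[of _ _ ?X]) (use that in \<open>simp_all add: C arr_simps crossR_pure 3\<close>)
  have 1: "\<forall>q\<in>car (W \<otimes> A). fn ?M (?F a (fn (assoc' W W A) (fn (idm W \<boxtimes> \<Psi>) (fn (assoc W A W) (pure (W \<otimes> A) W q w))))) =
      fn (\<Psi> \<boxtimes> \<Psi>) (fn (assoc' A W (A \<otimes> W)) (pure A (W \<otimes> (A \<otimes> W)) a (fn (assoc W A W) (pure (W \<otimes> A) W q w))))"
    if "w \<in> car W" "a \<in> car A" for w a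
    by (rule tensor_ext_ball[of _ _ ?X]) (use that in \<open>simp_all add: C arr_simps 2\<close>)
  have 0: "\<forall>y\<in>car (W \<otimes> W). fn ?M (?F a (fn (crossR A W \<Psi>) (pure A (W \<otimes> W) b y))) =
      fn (\<Psi> \<boxtimes> \<Psi>) (fn (middle A A W W \<Psi>) (pure (A \<otimes> A) (W \<otimes> W) (pure A A a b) y))"
    if "a \<in> car A" "b \<in> car A" for a b
    by (rule tensor_ext_ball[of _ _ ?X]) (use that in \<open>simp_all add: C arr_simps crossR_pure middle_pure 1\<close>)
  have N: "\<forall>q\<in>car (W \<otimes> A). fn (dW \<boxtimes> idm (A \<otimes> A)) (fn (assoc W A A) (pure (W \<otimes> A) A q a)) =
      fn (assoc (W \<otimes> W) A A) (pure ((W \<otimes> W) \<otimes> A) A (fn (dW \<boxtimes> idm A) q) a)"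
    if "a \<in> car A" for a
  proof (rule tensor_ext_ball[of _ _ "(W \<otimes> W) \<otimes> (A \<otimes> A)"])
    fix w b assume "w \<in> car W" "b \<in> car A"
    have "\<forall>s\<in>car (W \<otimes> W). pure (W \<otimes> W) (A \<otimes> A) s (pure A A b a) =
      fn (assoc (W \<otimes> W) A A) (pure ((W \<otimes> W) \<otimes> A) A (pure (W \<otimes> W) A s b) a)"
      by (rule tensor_ext_ball[of _ _ "(W \<otimes> W) \<otimes> (A \<otimes> A)"])
        (use that \<open>b \<in> car A\<close> in \<open>simp_all add: C arr_simps\<close>)
    then show "fn (dW \<boxtimes> idm (A \<otimes> A)) (fn (assoc W A A) (pure (W \<otimes> A) A (pure W A w b) a)) =
      fn (assoc (W \<otimes> W) A A) (pure ((W \<otimes> W) \<otimes> A) A (fn (dW \<boxtimes> idm A) (pure W A w b)) a)"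
      using that \<open>w \<in> car W\<close> \<open>b \<in> car A\<close> by (simp add: C arr_simps)
  qed (use that in \<open>simp_all add: C arr_simps\<close>)
  have M: "\<forall>t\<in>car (W \<otimes> A). fn (dW \<boxtimes> idm (A \<otimes> A)) (fn (assoc W A A) (fn (\<Psi> \<boxtimes> idm A) (fn (assoc' A W A) (pure A (W \<otimes> A) a t)))) =
      ?F a (fn (dW \<boxtimes> idm A) t)"
    if "a \<in> car A" for a
    by (rule tensor_ext_ball[of _ _ "(W \<otimes> W) \<otimes> (A \<otimes> A)"]) (use that in \<open>simp_all add: C arr_simps N R\<close>)
  have S: "\<forall>s\<in>car (A \<otimes> A). fn ?M (fn (dW \<boxtimes> idm (A \<otimes> A)) (fn (crossL A W \<Psi>) (pure (A \<otimes> A) W s w))) =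
      fn (\<Psi> \<boxtimes> \<Psi>) (fn (middle A A W W \<Psi>) (pure (A \<otimes> A) (W \<otimes> W) s (fn dW w)))"
    if "w \<in> car W" for w
  proof (rule tensor_ext_ball[of _ _ ?X])
    fix a b assume a: "a \<in> car A" and b: "b \<in> car A"
    have "fn (crossL A W \<Psi>) (pure (A \<otimes> A) W (pure A A a b) w) =
      fn (assoc W A A) (fn (\<Psi> \<boxtimes> idm A) (fn (assoc' A W A) (pure A (W \<otimes> A) a (fn \<Psi> (pure A W b w)))))"
      using a b that by (simp add: crossL_def C arr_simps)
    then show "fn ?M (fn (dW \<boxtimes> idm (A \<otimes> A)) (fn (crossL A W \<Psi>) (pure (A \<otimes> A) W (pure A A a b) w))) =
      fn (\<Psi> \<boxtimes> \<Psi>) (fn (middle A A W W \<Psi>) (pure (A \<otimes> A) (W \<otimes> W) (pure A A a b) (fn dW w)))"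
      using a b that by (simp add: M R 0 C arr_simps)
  qed (use that in \<open>simp_all add: C arr_simps\<close>)
  have "\<forall>x\<in>car (A \<otimes> W). fn ?M (fn (dW \<boxtimes> idm (A \<otimes> A)) (fn (crossL A W \<Psi>) (fn (dA \<boxtimes> idm W) x))) =
    fn (\<Psi> \<boxtimes> \<Psi>) (fn (middle A A W W \<Psi>) (fn (dA \<boxtimes> dW) x))"
    by (rule tensor_ext_ball[of _ _ ?X]) (simp_all add: C arr_simps S)
  moreover have "fn (dW \<boxtimes> dA) (fn \<Psi> x) = fn (dW \<boxtimes> idm (A \<otimes> A)) (fn (idm W \<boxtimes> dA) (fn \<Psi> x))"
    using x tmap_split_right_first[of dW dA "fn \<Psi> x"] by (simp add: C arr_simps)
  ultimately show ?thesis using x by (simp add: L)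
qed

section \<open>Slices\<close>

definition sliceL where "sliceL A Y q = lunit Y \<cdot> (functional_arr A q \<boxtimes> idm Y)"
definition sliceR where "sliceR Y B q = runit Y \<cdot> (idm Y \<boxtimes> functional_arr B q)"

lemma slice_src_tgt [simp]:
  "src (sliceL A Y q) = A \<otimes> Y" "tgt (sliceL A Y q) = Y" "src (sliceR Y B q) = Y \<otimes> B" "tgt (sliceR Y B q) = Y"
  by (simp_all add: sliceL_def sliceR_def)

lemma lin_slice:
  "vspace A \<Longrightarrow> vspace Y \<Longrightarrow> linear_map A ground q \<Longrightarrow> lin (sliceL A Y q)"
  "vspace B \<Longrightarrow> vspace Y \<Longrightarrow> linear_map B ground r \<Longrightarrow> lin (sliceR Y B r)"
  by (simp_all add: sliceL_def sliceR_def arr_simps)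

lemma slice_pure:
  "vspace A \<Longrightarrow> vspace Y \<Longrightarrow> linear_map A ground q \<Longrightarrow> a \<in> car A \<Longrightarrow> y \<in> car Y \<Longrightarrow>
    fn (sliceL A Y q) (pure A Y a y) = scl Y (q a) y"
  "vspace B \<Longrightarrow> vspace Y \<Longrightarrow> linear_map B ground r \<Longrightarrow> b \<in> car B \<Longrightarrow> y \<in> car Y \<Longrightarrow>
    fn (sliceR Y B r) (pure Y B y b) = scl Y (r b) y"
  by (simp_all add: sliceL_def sliceR_def arr_simps)

lemmas slice_simps = lin_slice slice_pure

lemma linear_map_slice:
  assumes "vspace C" "vspace Y" "vspace A"
    and q: "\<And>c. c \<in> car C \<Longrightarrow> linear_map A ground (q c)" "\<And>a. a \<in> car A \<Longrightarrow> linear_map C ground (\<lambda>c. q c a)"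
  shows "t \<in> car (A \<otimes> Y) \<Longrightarrow> linear_map C Y (\<lambda>c. fn (sliceL A Y (q c)) t)"
    and "u \<in> car (Y \<otimes> A) \<Longrightarrow> linear_map C Y (\<lambda>c. fn (sliceR Y A (q c)) u)"
proof -
  note e = linear_map_cong[OF _ _ assms(1)]
  show "t \<in> car (A \<otimes> Y) \<Longrightarrow> linear_map C Y (\<lambda>c. fn (sliceL A Y (q c)) t)"
    by (rule linear_map_parameter[OF assms(1,2)], assumption)
      (auto intro!: linear_intros lin_slice assms intro: e[OF linear_map_scl_left[OF assms(2) q(2)]] simp: slice_pure assms)
  show "u \<in> car (Y \<otimes> A) \<Longrightarrow> linear_map C Y (\<lambda>c. fn (sliceR Y A (q c)) u)"
    by (rule linear_map_parameter[OF assms(1,2)], assumption)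
      (auto intro!: linear_intros lin_slice assms intro: e[OF linear_map_scl_left[OF assms(2) q(2)]] simp: slice_pure assms)
qed

text \<open>
  A basis \<open>S\<close> of a vector space together with its coordinate functionals \<open>e\<close>.
\<close>

definition basis_of :: "('k::field, 'a::ab_group_add) vs \<Rightarrow> 'a set \<Rightarrow> ('a \<Rightarrow> 'a \<Rightarrow> 'k) \<Rightarrow> bool" where
  "basis_of Y S e \<longleftrightarrow> S \<subseteq> car Y \<and> (\<forall>s. linear_map Y ground (e s)) \<and>
     (\<forall>y\<in>car Y. finite {s. e s y \<noteq> 0} \<and> {s. e s y \<noteq> 0} \<subseteq> S \<and> (\<Sum>s | e s y \<noteq> 0. scl Y (e s y) s) = y)"

lemma basis_exists:
  fixes Y :: "('k::field, 'a::ab_group_add) vs"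
  assumes Y: "vspace Y"
  shows "\<exists>S e. basis_of Y S e"
proof -
  interpret Y: vector_space "scl Y" using Y by (simp add: vspace_def)
  obtain S where S: "S \<subseteq> car Y" "Y.independent S" "car Y \<subseteq> Y.span S"
    using Y.maximal_independent_subset by blast
  define e where "e s y = Y.representation S y s" for s y
  have "linear_map Y ground (e s)" for s
    using S vspaceD[OF Y] unfolding linear_map_def e_def
    by (auto simp: ground_def Y.representation_add Y.representation_scale subset_iff)
  moreover have "finite {s. e s y \<noteq> 0}" for y
    unfolding e_def by (rule Y.finite_representation)
  moreover have "e s y \<noteq> 0 \<Longrightarrow> s \<in> S" for s y
    unfolding e_def by (rule Y.representation_ne_zero)
  moreover have "(\<Sum>s | e s y \<noteq> 0. scl Y (e s y) s) = y" if "y \<in> car Y" for y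
    unfolding e_def using S that by (intro Y.sum_nonzero_representation_eq) auto
  ultimately have "basis_of Y S e" using S(1) by (auto simp: basis_of_def)
  then show ?thesis by blast
qed

lemma linear_map_sum:
  assumes "linear_map V X L" "vspace V" "finite F" "\<And>i. i \<in> F \<Longrightarrow> g i \<in> car V"
  shows "L (\<Sum>i\<in>F. g i) = (\<Sum>i\<in>F. L (g i)) \<and> (\<Sum>i\<in>F. g i) \<in> car V"
  using assms(3,4)
proof (induction F)
  case empty
  then show ?case using linear_map_0[OF assms(1,2)] vspaceD[OF assms(2)] by simp
next
  case (insert i F)
  then show ?case using assms(1) vspaceD[OF assms(2)] by (simp add: linear_map_def)
qed

text \<open>
  The index set may be enlarged, so that the expansions of two summands can be taken over a common one.
\<close>

lemma tensor_basis_expansion: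
  fixes Y :: "('k::field, 'a::ab_group_add) vs" and B :: "('k, 'b::ab_group_add) vs"
  assumes Y: "vspace Y" and B: "vspace B"
    and be: "basis_of Y S e"
    and t: "t \<in> car (Y \<otimes> B)"
  shows "\<exists>F. finite F \<and> F \<subseteq> S \<and> (\<forall>G. finite G \<longrightarrow> F \<subseteq> G \<longrightarrow> G \<subseteq> S \<longrightarrow>
      t = (\<Sum>s\<in>G. pure Y B s (fn (sliceL Y B (e s)) t)))"
proof -
  have S: "S \<subseteq> car Y" and e: "\<And>s. linear_map Y ground (e s)"
    and fin: "\<And>y. y \<in> car Y \<Longrightarrow> finite {s. e s y \<noteq> 0}" and sup: "\<And>y. y \<in> car Y \<Longrightarrow> {s. e s y \<noteq> 0} \<subseteq> S"
    and rep: "\<And>y. y \<in> car Y \<Longrightarrow> (\<Sum>s | e s y \<noteq> 0. scl Y (e s y) s) = y"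
    using be by (simp_all add: basis_of_def)
  show ?thesis
  using t
proof (induction rule: tensor_induct)
  case zero
  have "pure Y B s (fn (sliceL Y B (e s)) 0) = 0" if "s \<in> S" for s
  proof -
    have "linear_map (Y \<otimes> B) (Y \<otimes> B) (\<lambda>t. pure Y B s (fn (sliceL Y B (e s)) t))"
      using S that by (auto intro!: linear_intros lin_slice Y B e)
    from linear_map_0[OF this vspace_tensor] show ?thesis by simp
  qed
  then show ?case by (intro exI[of _ "{}"]) (auto intro!: sum.neutral simp: subset_iff)
next
  case (add c v w r)
  then obtain F where F: "finite F" "F \<subseteq> S" "\<And>G. finite G \<Longrightarrow> F \<subseteq> G \<Longrightarrow> G \<subseteq> S \<Longrightarrow>
      r = (\<Sum>s\<in>G. pure Y B s (fn (sliceL Y B (e s)) r))" by blast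
  let ?E = "{s. e s v \<noteq> 0}"
  show ?case
  proof (intro exI[of _ "F \<union> ?E"] conjI allI impI)
    show "finite (F \<union> ?E)" "F \<union> ?E \<subseteq> S" using F fin sup \<open>v \<in> car Y\<close> by auto
    fix G assume G: "finite G" "F \<union> ?E \<subseteq> G" "G \<subseteq> S"
    let ?p = "pure Y B v w"
    have p: "?p \<in> car (Y \<otimes> B)" using add by (simp add: pure_in_tensor)
    have 1: "pure Y B s (fn (sliceL Y B (e s)) (scl (Y \<otimes> B) c ?p + r)) =
        scl (Y \<otimes> B) c (pure Y B (scl Y (e s v) s) w) + pure Y B s (fn (sliceL Y B (e s)) r)" if "s \<in> G" for s
    proof -
      have s: "s \<in> car Y" using that G S by auto
      have "linear_map (Y \<otimes> B) (Y \<otimes> B) (\<lambda>t. pure Y B s (fn (sliceL Y B (e s)) t))"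
        using s by (auto intro!: linear_intros lin_slice Y B e)
      moreover have "fn (sliceL Y B (e s)) (pure Y B v w) = scl B (e s v) w"
        using add by (simp add: slice_pure Y B e)
      ultimately show ?thesis
        using p \<open>v \<in> car Y\<close> \<open>w \<in> car B\<close> \<open>r \<in> car (Y \<otimes> B)\<close> s vspaceD(3)[OF vspace_tensor p]
        by (simp add: linear_map_def pure_scl)
    qed
    have pl: "linear_map Y (Y \<otimes> B) (\<lambda>y. scl (Y \<otimes> B) c (pure Y B y w))"
      using add by (auto intro!: linear_intros vspace_tensor)
    have "(\<Sum>s\<in>G. pure Y B s (fn (sliceL Y B (e s)) (scl (Y \<otimes> B) c ?p + r))) =
        (\<Sum>s\<in>G. scl (Y \<otimes> B) c (pure Y B (scl Y (e s v) s) w)) + r"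
      using 1 F(3)[of G] G by (simp add: sum.distrib)
    also have "(\<Sum>s\<in>G. scl (Y \<otimes> B) c (pure Y B (scl Y (e s v) s) w)) =
        scl (Y \<otimes> B) c (pure Y B (\<Sum>s\<in>G. scl Y (e s v) s) w)"
      using linear_map_sum[OF pl Y G(1)] G(3) S vspaceD(3)[OF Y] by (simp add: subset_iff)
    also have "(\<Sum>s\<in>G. scl Y (e s v) s) = (\<Sum>s\<in>?E. scl Y (e s v) s)"
    proof (rule sum.mono_neutral_right)
      have "scl Y 0 x = 0" for x using vspaceD(6)[OF Y, of 0 0 x] by simp
      then show "\<forall>i\<in>G - ?E. scl Y (e i v) i = 0" by simp
    qed (use G in auto)
    also have "\<dots> = v" using rep add by simp
    finally show "scl (Y \<otimes> B) c ?p + r =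
      (\<Sum>s\<in>G. pure Y B s (fn (sliceL Y B (e s)) (scl (Y \<otimes> B) c ?p + r)))" ..
  qed
qed
qed

section \<open>Dualities\<close>

record ('k, 'a, 'b) duality =
  lsp :: "('k, 'a) vs"
  rsp :: "('k, 'b) vs"
  form :: "'a \<Rightarrow> 'b \<Rightarrow> 'k"

definition dual_pair :: "('k::field, 'a::ab_group_add, 'b::ab_group_add) duality \<Rightarrow> bool" where
  "dual_pair D \<longleftrightarrow> vspace (lsp D) \<and> vspace (rsp D) \<and> bilinear_map (lsp D) (rsp D) ground (form D)"

definition left_nondegenerate :: "('k::field, 'a::ab_group_add, 'b::ab_group_add) duality \<Rightarrow> bool" where
  "left_nondegenerate D \<longleftrightarrow> dual_pair D \<and>
    (\<forall>a\<in>car (lsp D). (\<forall>x\<in>car (rsp D). form D a x = 0) \<longrightarrow> a = 0)"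

text \<open>
  Reading a duality from the other side exchanges the roles of a space and its dual.
\<close>

definition flip :: "('k, 'a, 'b) duality \<Rightarrow> ('k, 'b, 'a) duality" where
  "flip D = \<lparr>lsp = rsp D, rsp = lsp D, form = (\<lambda>x a. form D a x)\<rparr>"

text \<open>
  The planar pairing of \<open>A \<otimes> C\<close> with \<open>D \<otimes> B\<close>: the inner factors are paired with each other and so are the
  outer ones. With this order no strands have to cross, and the transpose of a crossing is a crossing.
\<close>

definition nested :: "('k::field, 'a::ab_group_add, 'b::ab_group_add) duality
    \<Rightarrow> ('k, 'c::ab_group_add, 'd::ab_group_add) duality
    \<Rightarrow> ('k, ('k, 'a, 'c) tens, ('k, 'd, 'b) tens) duality" (infixr \<open>\<odot>\<close> 75) where
  "D \<odot> E = \<lparr>lsp = lsp D \<otimes> lsp E, rsp = rsp E \<otimes> rsp D,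
     form = (\<lambda>s t. tlift (lsp D) (lsp E) ground
       (\<lambda>a b. tlift (rsp E) (rsp D) ground (\<lambda>y x. form D a x * form E b y) t) s)\<rparr>"

lemma duality_sel [simp]:
  "lsp (flip D) = rsp D" "rsp (flip D) = lsp D" "form (flip D) = (\<lambda>x a. form D a x)"
  "lsp (D \<odot> E) = lsp D \<otimes> lsp E" "rsp (D \<odot> E) = rsp E \<otimes> rsp D" "flip (flip D) = D"
  by (simp_all add: flip_def nested_def)

lemma dual_pairD:
  assumes "dual_pair D"
  shows "vspace (lsp D)" "vspace (rsp D)"
    "linear_map C (lsp D) g \<Longrightarrow> x \<in> car (rsp D) \<Longrightarrow> linear_map C ground (\<lambda>c. form D (g c) x)"
    "a \<in> car (lsp D) \<Longrightarrow> linear_map C (rsp D) h \<Longrightarrow> linear_map C ground (\<lambda>c. form D a (h c))"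
    "a \<in> car (lsp D) \<Longrightarrow> linear_map (rsp D) ground (form D a)"
  using assms linear_map_compose[of "lsp D" ground "\<lambda>a. form D a x" C g]
    linear_map_compose[of "rsp D" ground "form D a" C h]
  by (auto simp: dual_pair_def bilinear_map_def)

lemma dual_pair_flip: "dual_pair D \<Longrightarrow> dual_pair (flip D)"
  by (auto simp: dual_pair_def bilinear_map_def)

lemma
  assumes D: "dual_pair D" and E: "dual_pair E"
  shows dual_pair_nested: "dual_pair (D \<odot> E)"
    and nested_pure: "a \<in> car (lsp D) \<Longrightarrow> b \<in> car (lsp E) \<Longrightarrow> y \<in> car (rsp E) \<Longrightarrow> x \<in> car (rsp D) \<Longrightarrow>
      form (D \<odot> E) (pure (lsp D) (lsp E) a b) (pure (rsp E) (rsp D) y x) = form D a x * form E b y"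
proof -
  note C = dual_pairD[OF D] dual_pairD[OF E]
  have 1: "bilinear_map (rsp E) (rsp D) ground (\<lambda>y x. form D a x * form E b y)"
    if "a \<in> car (lsp D)" "b \<in> car (lsp E)" for a b
    using that by (intro bilinear_mapI) (auto intro!: linear_map_mult C linear_map_identity)
  note t1 = tlift_linear[OF vspace_ground 1] and p1 = tlift_pure[OF vspace_ground 1]
  have 2: "bilinear_map (lsp D) (lsp E) ground
      (\<lambda>a b. tlift (rsp E) (rsp D) ground (\<lambda>y x. form D a x * form E b y) t)"
    if t: "t \<in> car (rsp E \<otimes> rsp D)" for t
  proof (rule bilinear_mapI)
    fix a assume a: "a \<in> car (lsp D)"
    show "linear_map (lsp E) ground (\<lambda>b. tlift (rsp E) (rsp D) ground (\<lambda>y x. form D a x * form E b y) t)"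
    proof (rule linear_map_parameter[OF _ _ t])
      fix y x assume yx: "y \<in> car (rsp E)" "x \<in> car (rsp D)"
      have "linear_map (lsp E) ground (\<lambda>b. form D a x * form E b y)"
        using a yx by (auto intro!: linear_map_mult C linear_map_identity)
      then show "linear_map (lsp E) ground
          (\<lambda>b. tlift (rsp E) (rsp D) ground (\<lambda>y x. form D a x * form E b y) (pure (rsp E) (rsp D) y x))"
        by (rule linear_map_cong) (use a yx in \<open>simp_all add: p1 C\<close>)
    qed (use a in \<open>simp_all add: t1 C vspace_ground\<close>)
  next
    fix b assume b: "b \<in> car (lsp E)"
    show "linear_map (lsp D) ground (\<lambda>a. tlift (rsp E) (rsp D) ground (\<lambda>y x. form D a x * form E b y) t)"
    proof (rule linear_map_parameter[OF _ _ t])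
      fix y x assume yx: "y \<in> car (rsp E)" "x \<in> car (rsp D)"
      have "linear_map (lsp D) ground (\<lambda>a. form D a x * form E b y)"
        using b yx by (auto intro!: linear_map_mult C linear_map_identity)
      then show "linear_map (lsp D) ground
          (\<lambda>a. tlift (rsp E) (rsp D) ground (\<lambda>y x. form D a x * form E b y) (pure (rsp E) (rsp D) y x))"
        by (rule linear_map_cong) (use b yx in \<open>simp_all add: p1 C\<close>)
    qed (use b in \<open>simp_all add: t1 C vspace_ground\<close>)
  qed
  show p: "form (D \<odot> E) (pure (lsp D) (lsp E) a b) (pure (rsp E) (rsp D) y x) = form D a x * form E b y"
    if "a \<in> car (lsp D)" "b \<in> car (lsp E)" "y \<in> car (rsp E)" "x \<in> car (rsp D)" for a b y x
    using that by (simp add: nested_def tlift_pure[OF vspace_ground 2] p1 pure_in_tensor)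
  have 3: "linear_map (lsp D \<otimes> lsp E) ground (\<lambda>s. form (D \<odot> E) s t)" if "t \<in> car (rsp E \<otimes> rsp D)" for t
    using tlift_linear[OF vspace_ground 2[OF that]] by (simp add: nested_def)
  have "linear_map (rsp E \<otimes> rsp D) ground (form (D \<odot> E) s)" if s: "s \<in> car (lsp D \<otimes> lsp E)" for s
  proof (rule linear_map_parameter[OF vspace_tensor vspace_ground s 3])
    fix a b assume ab: "a \<in> car (lsp D)" "b \<in> car (lsp E)"
    show "linear_map (rsp E \<otimes> rsp D) ground (form (D \<odot> E) (pure (lsp D) (lsp E) a b))"
      by (rule linear_map_cong[OF t1[OF ab]]) (use ab in \<open>simp_all add: nested_def tlift_pure[OF vspace_ground 2] vspace_tensor\<close>)
  qed
  then show "dual_pair (D \<odot> E)"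
    using 3 by (auto simp: dual_pair_def vspace_tensor intro!: bilinear_mapI)
qed

text \<open>
  A slice evaluates one factor of a tensor by an element of the dual space and leaves the other
  factor alone.
\<close>

abbreviation lslice where "lslice D Y a \<equiv> sliceL (rsp D) Y (form D a)"
abbreviation rslice where "rslice Y E b \<equiv> sliceR Y (lsp E) (\<lambda>y. form E y b)"

lemma lin_lslice: "dual_pair D \<Longrightarrow> vspace Y \<Longrightarrow> a \<in> car (lsp D) \<Longrightarrow> lin (lslice D Y a)"
  and lin_rslice: "dual_pair E \<Longrightarrow> vspace Y \<Longrightarrow> b \<in> car (rsp E) \<Longrightarrow> lin (rslice Y E b)"
  by (auto intro!: lin_slice dual_pairD linear_map_identity)

lemma lslice_pure: "dual_pair D \<Longrightarrow> vspace Y \<Longrightarrow> a \<in> car (lsp D) \<Longrightarrow> x \<in> car (rsp D) \<Longrightarrow> y \<in> car Y \<Longrightarrow>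
    fn (lslice D Y a) (pure (rsp D) Y x y) = scl Y (form D a x) y"
  and rslice_pure: "dual_pair E \<Longrightarrow> vspace Y \<Longrightarrow> b \<in> car (rsp E) \<Longrightarrow> x \<in> car (lsp E) \<Longrightarrow> y \<in> car Y \<Longrightarrow>
    fn (rslice Y E b) (pure Y (lsp E) y x) = scl Y (form E x b) y"
  by (auto intro!: slice_pure dual_pairD linear_map_identity)

lemma linear_map_lslice:
  assumes "dual_pair D" "vspace Y" "linear_map C (lsp D) g" "t \<in> car (rsp D \<otimes> Y)" "vspace C"
  shows "linear_map C Y (\<lambda>c. fn (lslice D Y (g c)) t)"
  by (rule linear_map_compose[of "lsp D" Y "\<lambda>a. fn (lslice D Y a) t"])
    (use assms in \<open>auto intro!: linear_map_slice dual_pairD linear_map_identity\<close>)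

lemma linear_map_rslice:
  assumes "dual_pair E" "vspace Y" "linear_map C (rsp E) g" "t \<in> car (Y \<otimes> lsp E)" "vspace C"
  shows "linear_map C Y (\<lambda>c. fn (rslice Y E (g c)) t)"
  by (rule linear_map_compose[of "rsp E" Y "\<lambda>a. fn (rslice Y E a) t"])
    (use assms in \<open>auto intro!: linear_map_slice dual_pairD linear_map_identity\<close>)

text \<open>
  Expand \<open>t\<close> along a basis \<open>S\<close> of \<open>Y\<close>. Pairing the coefficient of \<open>s\<close> with \<open>b\<close> gives the coordinate
  at \<open>s\<close> of the slice of \<open>t\<close> by \<open>b\<close>, so all coefficients vanish by nondegeneracy.
\<close>

lemma rslice_zero:
  assumes E: "left_nondegenerate E" and Y: "vspace Y" and t: "t \<in> car (Y \<otimes> lsp E)"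
    and z: "\<And>b. b \<in> car (rsp E) \<Longrightarrow> fn (rslice Y E b) t = 0"
  shows "t = 0"
proof -
  have E': "dual_pair E" using E by (simp add: left_nondegenerate_def)
  note C = dual_pairD[OF E']
  obtain S e where be: "basis_of Y S e" using basis_exists[OF Y] by blast
  then have S: "S \<subseteq> car Y" and e: "\<And>s. linear_map Y ground (e s)" by (simp_all add: basis_of_def)
  obtain F where F: "finite F" "F \<subseteq> S" "\<And>G. finite G \<Longrightarrow> F \<subseteq> G \<Longrightarrow> G \<subseteq> S \<Longrightarrow>
      t = (\<Sum>s\<in>G. pure Y (lsp E) s (fn (sliceL Y (lsp E) (e s)) t))"
    using tensor_basis_expansion[OF Y C(1) be t] by blast
  have "fn (sliceL Y (lsp E) (e s)) t = 0" if "s \<in> F" for s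
  proof -
    have "\<forall>t\<in>car (Y \<otimes> lsp E). form E (fn (sliceL Y (lsp E) (e s)) t) b = e s (fn (rslice Y E b) t)"
      if b: "b \<in> car (rsp E)" for b
    proof (rule tensor_ext_ball[of _ _ ground])
      show "linear_map (Y \<otimes> lsp E) ground (\<lambda>t. e s (fn (rslice Y E b) t))"
        by (rule linear_map_compose[OF e], rule linear_map_fn) (use b Y in \<open>simp_all add: lin_rslice E'\<close>)
      show "linear_map (Y \<otimes> lsp E) ground (\<lambda>t. form E (fn (sliceL Y (lsp E) (e s)) t) b)"
        by (rule C(3), rule linear_map_fn) (use b Y e in \<open>simp_all add: lin_slice C\<close>)
      fix y x assume yx: "y \<in> car Y" "x \<in> car (lsp E)"
      have "form E (scl (lsp E) c x) b = c * form E x b" for c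
        using C(3)[of "lsp E" "\<lambda>x. x" b] b yx by (simp add: linear_map_identity linear_map_def ground_def)
      moreover have "e s (scl Y c y) = c * e s y" for c
        using e[of s] yx by (simp add: linear_map_def ground_def)
      ultimately show "form E (fn (sliceL Y (lsp E) (e s)) (pure Y (lsp E) y x)) b =
          e s (fn (rslice Y E b) (pure Y (lsp E) y x))"
        using b yx by (simp add: slice_pure Y C e rslice_pure E')
    qed
    then have "\<forall>b\<in>car (rsp E). form E (fn (sliceL Y (lsp E) (e s)) t) b = 0"
      using t z linear_map_0[OF e Y] by auto
    moreover have "fn (sliceL Y (lsp E) (e s)) t \<in> car (lsp E)"
      using t by (simp add: lin_fn_mem lin_slice Y C e)
    ultimately show ?thesis using E by (auto simp: left_nondegenerate_def)
  qed
  moreover have "pure Y (lsp E) s 0 = 0" if "s \<in> F" for s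
  proof -
    have "linear_map (lsp E) (Y \<otimes> lsp E) (\<lambda>x. pure Y (lsp E) s x)"
      using that F S by (auto intro!: linear_intros)
    from linear_map_0[OF this C(1)] show ?thesis .
  qed
  ultimately show ?thesis using F(3)[OF F(1) order_refl F(2)] by simp
qed

lemma eq_by_functionals:
  assumes V: "vspace V" and X: "vspace X" and L: "\<And>i. i \<in> I \<Longrightarrow> linear_map V X (L i)"
    and z: "\<And>v. v \<in> car V \<Longrightarrow> (\<And>i. i \<in> I \<Longrightarrow> L i v = 0) \<Longrightarrow> v = 0"
    and v: "v \<in> car V" and w: "w \<in> car V" and e: "\<And>i. i \<in> I \<Longrightarrow> L i v = L i w"
  shows "v = w"
proof -
  have neg: "x + scl Z (-1) x = 0" if "vspace Z" "x \<in> car Z" for Z :: "('a, 'z::ab_group_add) vs" and x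
    using vspaceD(6)[OF that(1), of 1 "-1" x] vspaceD(4)[OF that(1), of x] vspaceD(6)[OF that(1), of 0 0 x] by simp
  let ?m = "scl V (-1) w"
  have m: "?m \<in> car V" using vspaceD(3)[OF V w] .
  have "L i (v + ?m) = 0" if i: "i \<in> I" for i
  proof -
    have "L i (v + ?m) = L i w + scl X (-1) (L i w)"
      using L[OF i] v w m e[OF i] by (simp add: linear_map_def)
    moreover have "L i w \<in> car X" using L[OF i] w by (simp add: linear_map_def)
    ultimately show ?thesis using neg[OF X] by simp
  qed
  then have "v + ?m = 0" using z[OF vspaceD(2)[OF V v m]] by blast
  with neg[OF V w] show "v = w" by (metis add_right_cancel)
qed

lemma left_nondegenerate_dual_pair: "left_nondegenerate D \<Longrightarrow> dual_pair D"
  by (simp add: left_nondegenerate_def)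

lemma eq_by_form:
  assumes D: "left_nondegenerate D" and a: "a \<in> car (lsp D)" "b \<in> car (lsp D)"
    and e: "\<And>x. x \<in> car (rsp D) \<Longrightarrow> form D a x = form D b x"
  shows "a = b"
proof -
  note C = dual_pairD[OF left_nondegenerate_dual_pair[OF D]]
  show ?thesis
    by (rule eq_by_functionals[OF C(1) vspace_ground, of "car (rsp D)" "\<lambda>x a. form D a x"])
      (use D a e in \<open>auto simp: left_nondegenerate_def intro: C(3) linear_map_identity\<close>)
qed

lemma eq_by_rslice:
  assumes E: "left_nondegenerate E" and Y: "vspace Y" and t: "t \<in> car (Y \<otimes> lsp E)" "u \<in> car (Y \<otimes> lsp E)"
    and e: "\<And>b. b \<in> car (rsp E) \<Longrightarrow> fn (rslice Y E b) t = fn (rslice Y E b) u"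
  shows "t = u"
  by (rule eq_by_functionals[OF vspace_tensor Y, of "car (rsp E)" Y "lsp E" "\<lambda>b. fn (rslice Y E b)"])
    (use rslice_zero[OF E Y] t e in \<open>auto intro!: linear_map_fn lin_rslice left_nondegenerate_dual_pair E Y\<close>)

definition swap where
  "swap A Y = \<lparr>src = A \<otimes> Y, tgt = Y \<otimes> A, fn = tlift A Y (Y \<otimes> A) (\<lambda>a y. pure Y A y a)\<rparr>"

lemma swap_src_tgt [simp]: "src (swap A Y) = A \<otimes> Y" "tgt (swap A Y) = Y \<otimes> A"
  by (simp_all add: swap_def)

lemma swap: "lin (swap A Y)" "a \<in> car A \<Longrightarrow> y \<in> car Y \<Longrightarrow> fn (swap A Y) (pure A Y a y) = pure Y A y a"
proof -
  have b: "bilinear_map A Y (Y \<otimes> A) (\<lambda>a y. pure Y A y a)"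
    by (auto intro!: bilinear_mapI linear_intros)
  show "lin (swap A Y)" using tlift_linear[OF vspace_tensor b] by (simp add: lin_def swap_def vspace_tensor)
  show "a \<in> car A \<Longrightarrow> y \<in> car Y \<Longrightarrow> fn (swap A Y) (pure A Y a y) = pure Y A y a"
    using tlift_pure[OF vspace_tensor b] by (simp add: swap_def)
qed

lemma swap_swap: "t \<in> car (A \<otimes> Y) \<Longrightarrow> fn (swap Y A) (fn (swap A Y) t) = t"
proof -
  have "\<forall>t\<in>car (A \<otimes> Y). fn (swap Y A) (fn (swap A Y) t) = t"
    by (rule tensor_ext_ball[of _ _ "A \<otimes> Y"]) (simp_all add: arr_simps swap)
  then show "t \<in> car (A \<otimes> Y) \<Longrightarrow> fn (swap Y A) (fn (swap A Y) t) = t" by blast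
qed

lemma eq_by_lslice:
  assumes D: "left_nondegenerate (flip D)" and Y: "vspace Y" and t: "t \<in> car (rsp D \<otimes> Y)" "u \<in> car (rsp D \<otimes> Y)"
    and e: "\<And>a. a \<in> car (lsp D) \<Longrightarrow> fn (lslice D Y a) t = fn (lslice D Y a) u"
  shows "t = u"
proof -
  have D': "dual_pair D" using dual_pair_flip[OF left_nondegenerate_dual_pair[OF D]] by simp
  have s: "fn (sliceR Y (rsp D) (form D a)) (fn (swap (rsp D) Y) r) = fn (lslice D Y a) r"
    if "r \<in> car (rsp D \<otimes> Y)" "a \<in> car (lsp D)" for r a
  proof -
    have "\<forall>r\<in>car (rsp D \<otimes> Y). fn (sliceR Y (rsp D) (form D a)) (fn (swap (rsp D) Y) r) = fn (lslice D Y a) r"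
      by (rule tensor_ext_ball[of _ _ Y])
        (use that(2) in \<open>simp_all add: arr_simps swap slice_simps dual_pairD[OF D'] Y\<close>)
    with that show ?thesis by blast
  qed
  have "fn (swap (rsp D) Y) t = fn (swap (rsp D) Y) u"
    by (rule eq_by_rslice[OF D Y]) (use t e in \<open>simp_all add: arr_simps swap s\<close>)
  then show ?thesis using t by (metis swap_swap)
qed

lemma form_nested_pure:
  assumes D: "dual_pair D" and E: "dual_pair E" and a: "a \<in> car (lsp D)" "b \<in> car (lsp E)" and t: "t \<in> car (rsp E \<otimes> rsp D)"
  shows "form (D \<odot> E) (pure (lsp D) (lsp E) a b) t = tlift (rsp E) (rsp D) ground (\<lambda>y x. form D a x * form E b y) t"
proof -
  note C = dual_pairD[OF D] dual_pairD[OF E] dual_pairD[OF dual_pair_nested[OF D E]]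
  have b: "bilinear_map (rsp E) (rsp D) ground (\<lambda>y x. form D a x * form E b y)"
    using a by (intro bilinear_mapI) (auto intro!: linear_map_mult C(4,5,9,10) linear_map_identity)
  have "\<forall>t\<in>car (rsp E \<otimes> rsp D). form (D \<odot> E) (pure (lsp D) (lsp E) a b) t = tlift (rsp E) (rsp D) ground (\<lambda>y x. form D a x * form E b y) t"
    by (rule tensor_ext_ball[OF _ tlift_linear[OF vspace_ground b]])
      (use a C(15) in \<open>simp_all add: nested_pure D E tlift_pure[OF vspace_ground b] pure_in_tensor\<close>)
  with t show ?thesis by blast
qed

lemma form_nested_rslice:
  assumes D: "dual_pair D" and E: "dual_pair E" and y: "y \<in> car (rsp E)" and x: "x \<in> car (rsp D)" and s: "s \<in> car (lsp D \<otimes> lsp E)"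
  shows "form (D \<odot> E) s (pure (rsp E) (rsp D) y x) = form D (fn (rslice (lsp D) E y) s) x"
proof -
  note DE = dual_pair_nested[OF D E] and C = dual_pairD[OF D] dual_pairD[OF E]
  have "\<forall>s\<in>car (lsp D \<otimes> lsp E). form (D \<odot> E) s (pure (rsp E) (rsp D) y x) = form D (fn (rslice (lsp D) E y) s) x"
  proof (rule tensor_ext_ball[of _ _ ground])
    show "linear_map (lsp D \<otimes> lsp E) ground (\<lambda>s. form (D \<odot> E) s (pure (rsp E) (rsp D) y x))"
      using dual_pairD(3)[OF DE linear_map_identity[of "lsp D \<otimes> lsp E"]] x y by (simp add: pure_in_tensor)
    show "linear_map (lsp D \<otimes> lsp E) ground (\<lambda>s. form D (fn (rslice (lsp D) E y) s) x)"
      by (rule C(3), rule linear_map_fn) (use x y in \<open>simp_all add: lin_rslice E C\<close>)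
    fix a b assume ab: "a \<in> car (lsp D)" "b \<in> car (lsp E)"
    have "form D (scl (lsp D) c a) x = c * form D a x" for c
      using C(3)[of "lsp D" "\<lambda>x. x" x] x ab by (simp add: linear_map_identity linear_map_def ground_def)
    then show "form (D \<odot> E) (pure (lsp D) (lsp E) a b) (pure (rsp E) (rsp D) y x) =
        form D (fn (rslice (lsp D) E y) (pure (lsp D) (lsp E) a b)) x"
      using x y ab by (simp add: nested_pure D E rslice_pure C)
  qed
  with s show ?thesis by blast
qed

lemma form_nested_lslice:
  assumes D: "dual_pair D" and E: "dual_pair E" and y: "y \<in> car (rsp E)" and x: "x \<in> car (rsp D)" and s: "s \<in> car (lsp D \<otimes> lsp E)"
  shows "form (D \<odot> E) s (pure (rsp E) (rsp D) y x) = form E (fn (sliceL (lsp D) (lsp E) (\<lambda>a. form D a x)) s) y"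
proof -
  note DE = dual_pair_nested[OF D E] and C = dual_pairD[OF D] dual_pairD[OF E]
  have q: "linear_map (lsp D) ground (\<lambda>a. form D a x)" using C(3)[of "lsp D" "\<lambda>x. x" x] x by (simp add: linear_map_identity)
  have "\<forall>s\<in>car (lsp D \<otimes> lsp E). form (D \<odot> E) s (pure (rsp E) (rsp D) y x) = form E (fn (sliceL (lsp D) (lsp E) (\<lambda>a. form D a x)) s) y"
  proof (rule tensor_ext_ball[of _ _ ground])
    show "linear_map (lsp D \<otimes> lsp E) ground (\<lambda>s. form (D \<odot> E) s (pure (rsp E) (rsp D) y x))"
      using dual_pairD(3)[OF DE linear_map_identity[of "lsp D \<otimes> lsp E"]] x y by (simp add: pure_in_tensor)
    show "linear_map (lsp D \<otimes> lsp E) ground (\<lambda>s. form E (fn (sliceL (lsp D) (lsp E) (\<lambda>a. form D a x)) s) y)"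
      by (rule C(8), rule linear_map_fn) (use x y q in \<open>simp_all add: lin_slice C\<close>)
    fix a b assume ab: "a \<in> car (lsp D)" "b \<in> car (lsp E)"
    have "form E (scl (lsp E) c b) y = c * form E b y" for c
      using C(8)[of "lsp E" "\<lambda>x. x" y] y ab by (simp add: linear_map_identity linear_map_def ground_def)
    then show "form (D \<odot> E) (pure (lsp D) (lsp E) a b) (pure (rsp E) (rsp D) y x) =
        form E (fn (sliceL (lsp D) (lsp E) (\<lambda>a. form D a x)) (pure (lsp D) (lsp E) a b)) y"
      using x y ab by (simp add: nested_pure D E slice_pure C q)
  qed
  with s show ?thesis by blast
qed

text \<open>
  The planar pairing is a slice followed by a pairing, and both detect zero.
\<close>

lemma left_nondegenerate_nested:
  assumes D: "left_nondegenerate D" and E: "left_nondegenerate E"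
  shows "left_nondegenerate (D \<odot> E)"
proof -
  note D' = left_nondegenerate_dual_pair[OF D] and E' = left_nondegenerate_dual_pair[OF E]
  note DE = dual_pair_nested[OF D' E'] and C = dual_pairD[OF D'] dual_pairD[OF E']
  note k = form_nested_rslice[OF D' E']
  have "s = 0" if s: "s \<in> car (lsp D \<otimes> lsp E)" and z: "\<And>t. t \<in> car (rsp E \<otimes> rsp D) \<Longrightarrow> form (D \<odot> E) s t = 0" for s
  proof (rule rslice_zero[OF E C(1) s])
    fix y assume y: "y \<in> car (rsp E)"
    have m: "fn (rslice (lsp D) E y) s \<in> car (lsp D)"
      using s y by (simp add: lin_fn_mem lin_rslice E' C)
    have "\<forall>x\<in>car (rsp D). form D (fn (rslice (lsp D) E y) s) x = 0"
      using k[OF y _ s] z[OF pure_in_tensor[OF y]] by simp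
    with m D show "fn (rslice (lsp D) E y) s = 0" by (auto simp: left_nondegenerate_def)
  qed
  then show ?thesis using DE by (auto simp: left_nondegenerate_def)
qed

section \<open>Adjoint arrows\<close>

definition adjoint where
  "adjoint D E t s \<longleftrightarrow> dual_pair D \<and> dual_pair E \<and>
     lin t \<and> src t = lsp D \<and> tgt t = lsp E \<and> lin s \<and> src s = rsp E \<and> tgt s = rsp D \<and>
     (\<forall>a\<in>car (lsp D). \<forall>y\<in>car (rsp E). form E (fn t a) y = form D a (fn s y))"

lemma adjointD:
  assumes "adjoint D E t s"
  shows "dual_pair D" "dual_pair E" "lin t" "src t = lsp D" "tgt t = lsp E"
    "lin s" "src s = rsp E" "tgt s = rsp D"
    "a \<in> car (lsp D) \<Longrightarrow> y \<in> car (rsp E) \<Longrightarrow> form E (fn t a) y = form D a (fn s y)"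
    "vspace (lsp D)" "vspace (rsp D)" "vspace (lsp E)" "vspace (rsp E)"
  using assms by (auto simp: adjoint_def dual_pair_def)

lemma adjoint_idm: "dual_pair D \<Longrightarrow> adjoint D D (idm (lsp D)) (idm (rsp D))"
  by (simp add: adjoint_def lin_idm dual_pairD)

lemma adjoint_comp: "adjoint E F u v \<Longrightarrow> adjoint D E t s \<Longrightarrow> adjoint D F (u \<cdot> t) (s \<cdot> v)"
  by (simp add: adjoint_def lin_comp lin_fn_mem)

lemma adjoint_inv:
  assumes a: "adjoint D E t s" and t: "iso t" and s: "iso s"
  shows "adjoint E D (inv_arr t) (inv_arr s)"
proof -
  note A = adjointD[OF a] 
  have "form D (fn (inv_arr t) b) x = form E b (fn (inv_arr s) x)" if "b \<in> car (lsp E)" "x \<in> car (rsp D)" for b x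
    using that A(9)[of "fn (inv_arr t) b" "fn (inv_arr s) x"] t s
    by (simp add: A inv_arr_right lin_fn_mem lin_inv_arr)
  then show ?thesis using t s by (simp add: adjoint_def A lin_inv_arr)
qed

lemma adjoint_cong:
  assumes "adjoint D E t s" "lin t'" "src t' = lsp D" "tgt t' = lsp E" "lin s'" "src s' = rsp E" "tgt s' = rsp D"
    and "\<And>a. a \<in> car (lsp D) \<Longrightarrow> fn t' a = fn t a" "\<And>y. y \<in> car (rsp E) \<Longrightarrow> fn s' y = fn s y"
  shows "adjoint D E t' s'"
  using assms by (simp add: adjoint_def)

lemma linear_map_form:
  assumes "dual_pair D"
  shows "linear_map C (lsp D) g \<Longrightarrow> x \<in> car (rsp D) \<Longrightarrow> linear_map C ground (\<lambda>c. form D (g c) x)"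
    "a \<in> car (lsp D) \<Longrightarrow> linear_map C' (rsp D) h \<Longrightarrow> linear_map C' ground (\<lambda>c. form D a (h c))"
    "a \<in> car (lsp D) \<Longrightarrow> rsp D = B \<Longrightarrow> linear_map B ground (form D a)"
    "x \<in> car (rsp D) \<Longrightarrow> lsp D = A \<Longrightarrow> linear_map A ground (\<lambda>c. form D c x)"
  using dual_pairD[OF assms] by (auto intro: linear_map_identity)

lemma adjoint_nestedI:
  assumes D: "dual_pair D1" "dual_pair D2" and E: "dual_pair E1" "dual_pair E2"
    and t: "lin t" "src t = lsp D1 \<otimes> lsp D2" "tgt t = lsp E1 \<otimes> lsp E2"
    and s: "lin s" "src s = rsp E2 \<otimes> rsp E1" "tgt s = rsp D2 \<otimes> rsp D1"
    and p: "\<And>a b y x. a \<in> car (lsp D1) \<Longrightarrow> b \<in> car (lsp D2) \<Longrightarrow> y \<in> car (rsp E2) \<Longrightarrow> x \<in> car (rsp E1) \<Longrightarrow>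
      form (E1 \<odot> E2) (fn t (pure (lsp D1) (lsp D2) a b)) (pure (rsp E2) (rsp E1) y x) =
      form (D1 \<odot> D2) (pure (lsp D1) (lsp D2) a b) (fn s (pure (rsp E2) (rsp E1) y x))"
  shows "adjoint (D1 \<odot> D2) (E1 \<odot> E2) t s"
proof -
  note P = dual_pair_nested[OF D] dual_pair_nested[OF E]
  note F = linear_map_form[OF P(1)] linear_map_form[OF P(2)]
  have 1: "\<forall>y\<in>car (rsp E2 \<otimes> rsp E1). form (E1 \<odot> E2) (fn t (pure (lsp D1) (lsp D2) a b)) y =
      form (D1 \<odot> D2) (pure (lsp D1) (lsp D2) a b) (fn s y)"
    if "a \<in> car (lsp D1)" "b \<in> car (lsp D2)" for a b
    by (rule tensor_ext_ball[of _ _ ground]) (use that p in \<open>simp_all add: F arr_simps t s\<close>)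
  have "\<forall>a\<in>car (lsp D1 \<otimes> lsp D2). form (E1 \<odot> E2) (fn t a) y = form (D1 \<odot> D2) a (fn s y)"
    if y: "y \<in> car (rsp E2 \<otimes> rsp E1)" for y
    by (rule tensor_ext_ball[of _ _ ground]) (use y 1 in \<open>simp_all add: F arr_simps t s\<close>)
  then show ?thesis using P t s by (simp add: adjoint_def)
qed

lemma adjoint_tmap:
  assumes t: "adjoint D E t s" and t': "adjoint D' E' t' s'"
  shows "adjoint (D \<odot> D') (E \<odot> E') (t \<boxtimes> t') (s' \<boxtimes> s)"
  using adjointD[OF t] adjointD[OF t']
  by (intro adjoint_nestedI) (simp_all add: arr_simps nested_pure)

text \<open>
  Transposition reverses the order of the factors, so it exchanges the two bracketings of a threefold
  tensor product and matches \<open>assoc\<close> with \<open>assoc\<close> rather than with its inverse.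
\<close>

lemma adjoint_assoc:
  assumes D: "dual_pair D" and E: "dual_pair E" and F: "dual_pair F"
  shows "adjoint ((D \<odot> E) \<odot> F) (D \<odot> (E \<odot> F)) (assoc (lsp D) (lsp E) (lsp F)) (assoc (rsp F) (rsp E) (rsp D))"
proof (rule adjoint_nestedI)
  note C = dual_pairD[OF D] dual_pairD[OF E] dual_pairD[OF F] 
  note P = D E F dual_pair_nested[OF D E] dual_pair_nested[OF E F] dual_pair_nested[OF dual_pair_nested[OF D E] F]
    dual_pair_nested[OF D dual_pair_nested[OF E F]]
  note L = linear_map_form[OF P(6)] linear_map_form[OF P(7)] 
  let ?l = "assoc (lsp D) (lsp E) (lsp F)" and ?r = "assoc (rsp F) (rsp E) (rsp D)"
  let ?p = "\<lambda>a c. pure (lsp D \<otimes> lsp E) (lsp F) a c" and ?q = "\<lambda>y x. pure (rsp F \<otimes> rsp E) (rsp D) y x"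
  fix a c y x assume "a \<in> car (lsp (D \<odot> E))" and c: "c \<in> car (lsp F)" and "y \<in> car (rsp (E \<odot> F))" and x: "x \<in> car (rsp D)"
  then have a: "a \<in> car (lsp D \<otimes> lsp E)" and y: "y \<in> car (rsp F \<otimes> rsp E)" by simp_all
  have 1: "\<forall>y\<in>car (rsp F \<otimes> rsp E). form (D \<odot> (E \<odot> F)) (fn ?l (?p (pure (lsp D) (lsp E) a b) c)) (?q y x) =
      form ((D \<odot> E) \<odot> F) (?p (pure (lsp D) (lsp E) a b) c) (fn ?r (?q y x))"
    if "a \<in> car (lsp D)" "b \<in> car (lsp E)" for a b
    by (rule tensor_ext_ball[of _ _ ground]) (use that c x in \<open>simp_all add: L arr_simps C\<close>,
      insert P, simp add: nested_pure[where D = D and E = "E \<odot> F", simplified]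
        nested_pure[where D = "D \<odot> E" and E = F, simplified] nested_pure pure_in_tensor)
  have "\<forall>a\<in>car (lsp D \<otimes> lsp E). form (D \<odot> (E \<odot> F)) (fn ?l (?p a c)) (?q y x) =
      form ((D \<odot> E) \<odot> F) (?p a c) (fn ?r (?q y x))"
    by (rule tensor_ext_ball[of _ _ ground]) (use y 1 c x in \<open>simp_all add: L arr_simps C\<close>)
  with a show "form (D \<odot> (E \<odot> F)) (fn ?l (pure (lsp (D \<odot> E)) (lsp F) a c)) (pure (rsp (E \<odot> F)) (rsp D) y x) =
      form ((D \<odot> E) \<odot> F) (pure (lsp (D \<odot> E)) (lsp F) a c) (fn ?r (pure (rsp (E \<odot> F)) (rsp D) y x))"
    by simp
qed (use assms in \<open>simp_all add: dual_pair_nested lin_assoc dual_pairD\<close>)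

section \<open>Mates\<close>

text \<open>
  The transpose of a map in which a further strand takes part. A map \<open>T : A \<otimes> X \<rightarrow> Y \<otimes> B\<close> carries the
  strand \<open>A\<close> from the left to the right across \<open>X\<close>; bending this strand gives \<open>S : X \<otimes> B' \<rightarrow> A' \<otimes> Y\<close>,
  which carries the dual strand from the right to the left. Both have the same slices.
\<close>

definition mates where
  "mates D E X Y T S \<longleftrightarrow> dual_pair D \<and> dual_pair E \<and> vspace X \<and> vspace Y \<and>
     lin T \<and> src T = lsp D \<otimes> X \<and> tgt T = Y \<otimes> lsp E \<and>
     lin S \<and> src S = X \<otimes> rsp E \<and> tgt S = rsp D \<otimes> Y \<and>
     (\<forall>a\<in>car (lsp D). \<forall>x\<in>car X. \<forall>b\<in>car (rsp E).
        fn (rslice Y E b) (fn T (pure (lsp D) X a x)) = fn (lslice D Y a) (fn S (pure X (rsp E) x b)))"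

lemma matesD:
  assumes "mates D E X Y T S"
  shows "dual_pair D" "dual_pair E" "vspace X" "vspace Y" "vspace (lsp D)" "vspace (rsp D)" "vspace (lsp E)" "vspace (rsp E)"
    "lin T" "src T = lsp D \<otimes> X" "tgt T = Y \<otimes> lsp E" "lin S" "src S = X \<otimes> rsp E" "tgt S = rsp D \<otimes> Y"
    "a \<in> car (lsp D) \<Longrightarrow> x \<in> car X \<Longrightarrow> b \<in> car (rsp E) \<Longrightarrow>
      fn (rslice Y E b) (fn T (pure (lsp D) X a x)) = fn (lslice D Y a) (fn S (pure X (rsp E) x b))"
  using assms by (auto simp: mates_def dual_pair_def)

lemma lslice_tmap:
  assumes g: "adjoint D D' t s" and Y: "vspace Y" and a: "a \<in> car (lsp D)" and u: "u \<in> car (rsp D' \<otimes> Y)"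
  shows "fn (lslice D Y a) (fn (s \<boxtimes> idm Y) u) = fn (lslice D' Y (fn t a)) u"
proof -
  have "\<forall>u\<in>car (rsp D' \<otimes> Y). fn (lslice D Y a) (fn (s \<boxtimes> idm Y) u) = fn (lslice D' Y (fn t a)) u"
    by (rule tensor_ext_ball[of _ _ Y])
      (use a in \<open>simp_all add: adjointD[OF g] arr_simps lin_lslice lslice_pure Y\<close>)
  with u show ?thesis by blast
qed

lemma rslice_tmap:
  assumes g: "adjoint E E' t s" and Y: "vspace Y" and b: "b \<in> car (rsp E')" and u: "u \<in> car (Y \<otimes> lsp E)"
  shows "fn (rslice Y E' b) (fn (idm Y \<boxtimes> t) u) = fn (rslice Y E (fn s b)) u"
proof -
  have "\<forall>u\<in>car (Y \<otimes> lsp E). fn (rslice Y E' b) (fn (idm Y \<boxtimes> t) u) = fn (rslice Y E (fn s b)) u"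
    by (rule tensor_ext_ball[of _ _ Y])
      (use b in \<open>simp_all add: adjointD[OF g] arr_simps lin_rslice rslice_pure Y\<close>)
  with u show ?thesis by blast
qed

lemma lslice_natural:
  assumes D: "dual_pair D" and g: "lin g" "src g = Y" "tgt g = Z" and a: "a \<in> car (lsp D)" and u: "u \<in> car (rsp D \<otimes> Y)"
  shows "fn (lslice D Z a) (fn (idm (rsp D) \<boxtimes> g) u) = fn g (fn (lslice D Y a) u)"
proof -
  have V: "vspace Y" "vspace Z" using lin_vspace[OF g(1)] g by auto
  have "\<forall>u\<in>car (rsp D \<otimes> Y). fn (lslice D Z a) (fn (idm (rsp D) \<boxtimes> g) u) = fn g (fn (lslice D Y a) u)"
    by (rule tensor_ext_ball[of _ _ Z])
      (use a in \<open>simp_all add: D dual_pairD[OF D] arr_simps lin_lslice lslice_pure V g fn_scl\<close>)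
  with u show ?thesis by blast
qed

lemma rslice_natural:
  assumes E: "dual_pair E" and g: "lin g" "src g = Y" "tgt g = Z" and b: "b \<in> car (rsp E)" and u: "u \<in> car (Y \<otimes> lsp E)"
  shows "fn (rslice Z E b) (fn (g \<boxtimes> idm (lsp E)) u) = fn g (fn (rslice Y E b) u)"
proof -
  have V: "vspace Y" "vspace Z" using lin_vspace[OF g(1)] g by auto
  have "\<forall>u\<in>car (Y \<otimes> lsp E). fn (rslice Z E b) (fn (g \<boxtimes> idm (lsp E)) u) = fn g (fn (rslice Y E b) u)"
    by (rule tensor_ext_ball[of _ _ Z])
      (use b in \<open>simp_all add: E dual_pairD[OF E] arr_simps lin_rslice rslice_pure V g fn_scl\<close>)
  with u show ?thesis by blast
qed

lemma mates_precompose: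
  assumes m: "mates D E X Y T S" and g: "adjoint D' D t s"
  shows "mates D' E X Y (T \<cdot> (t \<boxtimes> idm X)) ((s \<boxtimes> idm Y) \<cdot> S)"
  using adjointD[OF g] matesD[OF m]
  by (simp add: mates_def arr_simps lslice_tmap[OF g])

lemma mates_postcompose:
  assumes m: "mates D E X Y T S" and g: "adjoint E E' t s"
  shows "mates D E' X Y ((idm Y \<boxtimes> t) \<cdot> T) (S \<cdot> (idm X \<boxtimes> s))"
  using adjointD[OF g] matesD[OF m]
  by (simp add: mates_def arr_simps rslice_tmap[OF g])

lemma mates_source:
  assumes m: "mates D E X Y T S" and g: "lin g" "src g = X'" "tgt g = X"
  shows "mates D E X' Y (T \<cdot> (idm (lsp D) \<boxtimes> g)) (S \<cdot> (g \<boxtimes> idm (rsp E)))"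
  using matesD[OF m] g lin_vspace[OF g(1)] by (auto simp add: mates_def arr_simps)

lemma mates_target:
  assumes m: "mates D E X Y T S" and g: "lin g" "src g = Y" "tgt g = Z"
  shows "mates D E X Z ((g \<boxtimes> idm (lsp E)) \<cdot> T) ((idm (rsp D) \<boxtimes> g) \<cdot> S)"
  using matesD[OF m] g lin_vspace[OF g(1)]
  by (auto simp add: mates_def arr_simps lslice_natural rslice_natural)

text \<open>The two mates have the same slices, and by nondegeneracy the slices separate points.\<close>

lemma mates_unique_left:
  assumes m: "mates D E X Y T S" "mates D E X Y T' S'" and E: "left_nondegenerate E"
    and e: "\<And>x. x \<in> car (X \<otimes> rsp E) \<Longrightarrow> fn S x = fn S' x" and x: "x \<in> car (lsp D \<otimes> X)"
  shows "fn T x = fn T' x"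
proof -
  note M = matesD[OF m(1)] matesD(9-)[OF m(2)]
  have "\<forall>x\<in>car (lsp D \<otimes> X). fn T x = fn T' x"
  proof (rule tensor_ext_ball[of _ _ "Y \<otimes> lsp E"])
    fix a v assume "a \<in> car (lsp D)" "v \<in> car X"
    then show "fn T (pure (lsp D) X a v) = fn T' (pure (lsp D) X a v)"
      by (intro eq_by_rslice[OF E M(4)]) (simp_all add: M e arr_simps)
  qed (simp_all add: M linear_map_fn)
  with x show ?thesis by blast
qed

lemma mates_unique_right:
  assumes m: "mates D E X Y T S" "mates D E X Y T' S'" and D: "left_nondegenerate (flip D)"
    and e: "\<And>x. x \<in> car (lsp D \<otimes> X) \<Longrightarrow> fn T x = fn T' x" and x: "x \<in> car (X \<otimes> rsp E)"
  shows "fn S x = fn S' x"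
proof -
  note M = matesD[OF m(1)] matesD(9-)[OF m(2)]
  have "\<forall>x\<in>car (X \<otimes> rsp E). fn S x = fn S' x"
  proof (rule tensor_ext_ball[of _ _ "rsp D \<otimes> Y"])
    fix v b assume vb: "v \<in> car X" "b \<in> car (rsp E)"
    have "fn (lslice D Y a) (fn S (pure X (rsp E) v b)) = fn (lslice D Y a) (fn S' (pure X (rsp E) v b))"
      if "a \<in> car (lsp D)" for a
      using that vb e[of "pure (lsp D) X a v"] M(15)[of a v b] M(22)[of a v b] by (simp add: pure_in_tensor)
    then show "fn S (pure X (rsp E) v b) = fn S' (pure X (rsp E) v b)"
      using vb by (intro eq_by_lslice[OF D M(4)]) (simp_all add: M arr_simps)
  qed (simp_all add: M linear_map_fn)
  with x show ?thesis by blast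
qed

lemma lslice_nested:
  assumes D: "dual_pair D" "dual_pair E" and Y: "vspace Y"
    and a: "a \<in> car (lsp D)" "b \<in> car (lsp E)" and y: "y \<in> car (rsp E)" and u: "u \<in> car (rsp D \<otimes> Y)"
  shows "fn (lslice (D \<odot> E) Y (pure (lsp D) (lsp E) a b)) (fn (assoc' (rsp E) (rsp D) Y) (pure (rsp E) (rsp D \<otimes> Y) y u)) =
    scl Y (form E b y) (fn (lslice D Y a) u)"
proof -
  note C = D dual_pairD(1,2)[OF D(1)] dual_pairD(1,2)[OF D(2)] dual_pair_nested[OF D]
  have l: "lin (lslice (D \<odot> E) Y (pure (lsp D) (lsp E) a b))"
    by (rule lin_lslice[OF dual_pair_nested[OF D] Y]) (use a in \<open>simp add: pure_in_tensor\<close>)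
  have p: "fn (lslice (D \<odot> E) Y (pure (lsp D) (lsp E) a b)) (pure (rsp E \<otimes> rsp D) Y (pure (rsp E) (rsp D) z x) v) =
      scl Y (form D a x * form E b z) v" if "z \<in> car (rsp E)" "x \<in> car (rsp D)" "v \<in> car Y" for z x v
    using lslice_pure[OF dual_pair_nested[OF D] Y, of "pure (lsp D) (lsp E) a b" "pure (rsp E) (rsp D) z x" v] that a
    by (simp add: pure_in_tensor nested_pure D)
  have "\<forall>u\<in>car (rsp D \<otimes> Y). fn (lslice (D \<odot> E) Y (pure (lsp D) (lsp E) a b)) (fn (assoc' (rsp E) (rsp D) Y) (pure (rsp E) (rsp D \<otimes> Y) y u)) =
    scl Y (form E b y) (fn (lslice D Y a) u)"
    by (rule tensor_ext_ball[of _ _ Y])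
      (use a y l in \<open>simp_all add: C p[unfolded duality_sel] arr_simps lin_lslice lslice_pure Y vspaceD mult.commute\<close>)
  with u show ?thesis by blast
qed

lemma rslice_nested:
  assumes D: "dual_pair D" "dual_pair E" and Y: "vspace Y"
    and y: "y \<in> car (rsp E)" "x \<in> car (rsp D)" and b: "b \<in> car (lsp E)" and u: "u \<in> car (Y \<otimes> lsp D)"
  shows "fn (rslice Y (D \<odot> E) (pure (rsp E) (rsp D) y x)) (fn (assoc Y (lsp D) (lsp E)) (pure (Y \<otimes> lsp D) (lsp E) u b)) =
    scl Y (form E b y) (fn (rslice Y D x) u)"
proof -
  note C = D dual_pairD(1,2)[OF D(1)] dual_pairD(1,2)[OF D(2)] dual_pair_nested[OF D]
  have l: "lin (rslice Y (D \<odot> E) (pure (rsp E) (rsp D) y x))"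
    by (rule lin_rslice[OF dual_pair_nested[OF D] Y]) (use y in \<open>simp add: pure_in_tensor\<close>)
  have p: "fn (rslice Y (D \<odot> E) (pure (rsp E) (rsp D) y x)) (pure Y (lsp D \<otimes> lsp E) v (pure (lsp D) (lsp E) a b)) =
      scl Y (form D a x * form E b y) v" if "a \<in> car (lsp D)" "b \<in> car (lsp E)" "v \<in> car Y" for a b v
    using rslice_pure[OF dual_pair_nested[OF D] Y, of "pure (rsp E) (rsp D) y x" "pure (lsp D) (lsp E) a b" v] that y
    by (simp add: pure_in_tensor nested_pure D)
  have "\<forall>u\<in>car (Y \<otimes> lsp D). fn (rslice Y (D \<odot> E) (pure (rsp E) (rsp D) y x)) (fn (assoc Y (lsp D) (lsp E)) (pure (Y \<otimes> lsp D) (lsp E) u b)) =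
    scl Y (form E b y) (fn (rslice Y D x) u)"
    by (rule tensor_ext_ball[of _ _ Y])
      (use b y l in \<open>simp_all add: C p[unfolded duality_sel] arr_simps lin_rslice rslice_pure Y vspaceD mult.commute\<close>)
  with u show ?thesis by blast
qed

lemma mates_nested_leftI:
  assumes D: "dual_pair D1" "dual_pair D2" "dual_pair E" and V: "vspace X" "vspace Y"
    and T: "lin T" "src T = (lsp D1 \<otimes> lsp D2) \<otimes> X" "tgt T = Y \<otimes> lsp E"
    and S: "lin S" "src S = X \<otimes> rsp E" "tgt S = (rsp D2 \<otimes> rsp D1) \<otimes> Y"
    and p: "\<And>a b x y. a \<in> car (lsp D1) \<Longrightarrow> b \<in> car (lsp D2) \<Longrightarrow> x \<in> car X \<Longrightarrow> y \<in> car (rsp E) \<Longrightarrow>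
      fn (rslice Y E y) (fn T (pure (lsp D1 \<otimes> lsp D2) X (pure (lsp D1) (lsp D2) a b) x)) =
      fn (lslice (D1 \<odot> D2) Y (pure (lsp D1) (lsp D2) a b)) (fn S (pure X (rsp E) x y))"
  shows "mates (D1 \<odot> D2) E X Y T S"
proof -
  note N = dual_pair_nested[OF D(1,2)]
  have "\<forall>a\<in>car (lsp D1 \<otimes> lsp D2). fn (rslice Y E y) (fn T (pure (lsp D1 \<otimes> lsp D2) X a x)) =
      fn (lslice (D1 \<odot> D2) Y a) (fn S (pure X (rsp E) x y))" if xy: "x \<in> car X" "y \<in> car (rsp E)" for x y
  proof (rule tensor_ext_ball[of _ _ Y])
    show "linear_map (lsp D1 \<otimes> lsp D2) Y (\<lambda>a. fn (lslice (D1 \<odot> D2) Y a) (fn S (pure X (rsp E) x y)))"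
      by (rule linear_map_lslice[OF N V(2)]) (use xy in \<open>simp_all add: S arr_simps linear_map_identity\<close>)
  qed (use xy p in \<open>simp_all add: D V T S arr_simps lin_rslice\<close>)
  then show ?thesis using D V T S N by (simp add: mates_def)
qed

lemma mates_nested_rightI:
  assumes D: "dual_pair D" "dual_pair E1" "dual_pair E2" and V: "vspace X" "vspace Y"
    and T: "lin T" "src T = lsp D \<otimes> X" "tgt T = Y \<otimes> (lsp E1 \<otimes> lsp E2)"
    and S: "lin S" "src S = X \<otimes> (rsp E2 \<otimes> rsp E1)" "tgt S = rsp D \<otimes> Y"
    and p: "\<And>a x y z. a \<in> car (lsp D) \<Longrightarrow> x \<in> car X \<Longrightarrow> y \<in> car (rsp E2) \<Longrightarrow> z \<in> car (rsp E1) \<Longrightarrow>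
      fn (rslice Y (E1 \<odot> E2) (pure (rsp E2) (rsp E1) y z)) (fn T (pure (lsp D) X a x)) =
      fn (lslice D Y a) (fn S (pure X (rsp E2 \<otimes> rsp E1) x (pure (rsp E2) (rsp E1) y z)))"
  shows "mates D (E1 \<odot> E2) X Y T S"
proof -
  note N = dual_pair_nested[OF D(2,3)]
  have "\<forall>y\<in>car (rsp E2 \<otimes> rsp E1). fn (rslice Y (E1 \<odot> E2) y) (fn T (pure (lsp D) X a x)) =
      fn (lslice D Y a) (fn S (pure X (rsp E2 \<otimes> rsp E1) x y))" if ax: "a \<in> car (lsp D)" "x \<in> car X" for a x
  proof (rule tensor_ext_ball[of _ _ Y])
    show "linear_map (rsp E2 \<otimes> rsp E1) Y (\<lambda>y. fn (rslice Y (E1 \<odot> E2) y) (fn T (pure (lsp D) X a x)))"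
      by (rule linear_map_rslice[OF N V(2)]) (use ax in \<open>simp_all add: T arr_simps linear_map_identity\<close>)
  qed (use ax p in \<open>simp_all add: D V T S arr_simps lin_lslice\<close>)
  then show ?thesis using D V T S N by (simp add: mates_def)
qed

lemma mates_nestedI:
  assumes D: "dual_pair D1" "dual_pair D2" "dual_pair E1" "dual_pair E2" and V: "vspace X" "vspace Y"
    and T: "lin T" "src T = (lsp D1 \<otimes> lsp D2) \<otimes> X" "tgt T = Y \<otimes> (lsp E1 \<otimes> lsp E2)"
    and S: "lin S" "src S = X \<otimes> (rsp E2 \<otimes> rsp E1)" "tgt S = (rsp D2 \<otimes> rsp D1) \<otimes> Y"
    and p: "\<And>a b x y z. a \<in> car (lsp D1) \<Longrightarrow> b \<in> car (lsp D2) \<Longrightarrow> x \<in> car X \<Longrightarrow> y \<in> car (rsp E2) \<Longrightarrow> z \<in> car (rsp E1) \<Longrightarrow>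
      fn (rslice Y (E1 \<odot> E2) (pure (rsp E2) (rsp E1) y z)) (fn T (pure (lsp D1 \<otimes> lsp D2) X (pure (lsp D1) (lsp D2) a b) x)) =
      fn (lslice (D1 \<odot> D2) Y (pure (lsp D1) (lsp D2) a b)) (fn S (pure X (rsp E2 \<otimes> rsp E1) x (pure (rsp E2) (rsp E1) y z)))"
  shows "mates (D1 \<odot> D2) (E1 \<odot> E2) X Y T S"
proof -
  note N = dual_pair_nested[OF D(1,2)] dual_pair_nested[OF D(3,4)]
  show ?thesis
  proof (rule mates_nested_rightI[OF N(1) D(3,4) V])
    fix a x y z assume "a \<in> car (lsp (D1 \<odot> D2))" and x: "x \<in> car X" and y: "y \<in> car (rsp E2)" and z: "z \<in> car (rsp E1)"
    then have a: "a \<in> car (lsp D1 \<otimes> lsp D2)" by simp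
    have l: "lin (rslice Y (E1 \<odot> E2) (pure (rsp E2) (rsp E1) y z))"
      by (rule lin_rslice[OF N(2) V(2)]) (simp add: y z pure_in_tensor)
    have "\<forall>a\<in>car (lsp D1 \<otimes> lsp D2). 
      fn (rslice Y (E1 \<odot> E2) (pure (rsp E2) (rsp E1) y z)) (fn T (pure (lsp D1 \<otimes> lsp D2) X a x)) =
      fn (lslice (D1 \<odot> D2) Y a) (fn S (pure X (rsp E2 \<otimes> rsp E1) x (pure (rsp E2) (rsp E1) y z)))"
    proof (rule tensor_ext_ball[of _ _ Y])
      show "linear_map (lsp D1 \<otimes> lsp D2) Y (\<lambda>a. fn (lslice (D1 \<odot> D2) Y a) (fn S (pure X (rsp E2 \<otimes> rsp E1) x (pure (rsp E2) (rsp E1) y z))))"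
        by (rule linear_map_lslice[OF N(1) V(2)]) (use x y z in \<open>simp_all add: S arr_simps linear_map_identity\<close>)
      show "linear_map (lsp D1 \<otimes> lsp D2) Y (\<lambda>a. fn (rslice Y (E1 \<odot> E2) (pure (rsp E2) (rsp E1) y z)) (fn T (pure (lsp D1 \<otimes> lsp D2) X a x)))"
        by (rule linear_map_fn_compose[OF l]) (use x in \<open>simp_all add: T arr_simps\<close>)
    qed (use x y z p in simp_all)
    with a show "fn (rslice Y (E1 \<odot> E2) (pure (rsp E2) (rsp E1) y z)) (fn T (pure (lsp (D1 \<odot> D2)) X a x)) =
      fn (lslice (D1 \<odot> D2) Y a) (fn S (pure X (rsp E2 \<otimes> rsp E1) x (pure (rsp E2) (rsp E1) y z)))"
      by simp
  qed (simp_all add: T S)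
qed

text \<open>
  Passing two strands one after the other corresponds to passing the two dual strands one after
  the other: each slice is evaluated by using the given mates twice.
\<close>

lemma mates_crossL:
  assumes m: "mates D D W W T S"
  shows "mates (D \<odot> D) (D \<odot> D) W W (crossL (lsp D) W T) (crossR W (rsp D) S)"
proof (rule mates_nestedI)
  note M = matesD[OF m] and D = matesD(1)[OF m]
  note R = lin_rslice lin_lslice rslice_pure lslice_pure
  fix a b x y z
  assume a: "a \<in> car (lsp D)" and b: "b \<in> car (lsp D)" and x: "x \<in> car W" and y: "y \<in> car (rsp D)" and z: "z \<in> car (rsp D)"
  let ?rr = "rslice W (D \<odot> D) (pure (rsp D) (rsp D) y z)" and ?ll = "lslice (D \<odot> D) W (pure (lsp D) (lsp D) a b)"
  have rr: "lin ?rr" by (rule lin_rslice[OF dual_pair_nested[OF D D] M(3)]) (simp add: y z pure_in_tensor)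
  have ll: "lin ?ll" by (rule lin_lslice[OF dual_pair_nested[OF D D] M(3)]) (simp add: a b pure_in_tensor)
  have 1: "\<forall>t\<in>car (W \<otimes> lsp D). fn ?rr (fn (assoc W (lsp D) (lsp D)) (fn (T \<boxtimes> idm (lsp D)) (fn (assoc' (lsp D) W (lsp D)) (pure (lsp D) (W \<otimes> lsp D) a t))))
      = fn (rslice W D z) (fn T (pure (lsp D) W a (fn (rslice W D y) t)))"
  proof (rule tensor_ext_ball[of _ _ W])
    show "linear_map (W \<otimes> lsp D) W (\<lambda>t. fn ?rr (fn (assoc W (lsp D) (lsp D)) (fn (T \<boxtimes> idm (lsp D)) (fn (assoc' (lsp D) W (lsp D)) (pure (lsp D) (W \<otimes> lsp D) a t)))))"
      by (rule linear_map_fn_compose[OF rr]) (use a in \<open>simp_all add: M arr_simps\<close>)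
  qed (use a y z in \<open>simp_all add: M arr_simps R rslice_nested[unfolded duality_sel] pure_scl fn_scl\<close>)
  have 2: "\<forall>u\<in>car (rsp D \<otimes> W). fn (lslice D W a) (fn S (pure W (rsp D) (fn (lslice D W b) u) z)) =
     fn ?ll (fn (assoc' (rsp D) (rsp D) W) (fn (idm (rsp D) \<boxtimes> S) (fn (assoc (rsp D) W (rsp D)) (pure (rsp D \<otimes> W) (rsp D) u z))))"
  proof (rule tensor_ext_ball[of _ _ W])
    show "linear_map (rsp D \<otimes> W) W (\<lambda>u. fn ?ll (fn (assoc' (rsp D) (rsp D) W) (fn (idm (rsp D) \<boxtimes> S) (fn (assoc (rsp D) W (rsp D)) (pure (rsp D \<otimes> W) (rsp D) u z)))))"
      by (rule linear_map_fn_compose[OF ll]) (use z in \<open>simp_all add: M arr_simps\<close>)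
  qed (use a b z in \<open>simp_all add: M arr_simps R lslice_nested[unfolded duality_sel] pure_scl fn_scl\<close>)
  have "fn (crossL (lsp D) W T) (pure (lsp D \<otimes> lsp D) W (pure (lsp D) (lsp D) a b) x) =
     fn (assoc W (lsp D) (lsp D)) (fn (T \<boxtimes> idm (lsp D)) (fn (assoc' (lsp D) W (lsp D)) (pure (lsp D) (W \<otimes> lsp D) a (fn T (pure (lsp D) W b x)))))"
    using a b x by (simp add: crossL_def M arr_simps)
  moreover have "fn (crossR W (rsp D) S) (pure W (rsp D \<otimes> rsp D) x (pure (rsp D) (rsp D) y z)) =
     fn (assoc' (rsp D) (rsp D) W) (fn (idm (rsp D) \<boxtimes> S) (fn (assoc (rsp D) W (rsp D)) (pure (rsp D \<otimes> W) (rsp D) (fn S (pure W (rsp D) x y)) z)))"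
    using x y z by (simp add: crossR_def M arr_simps)
  moreover have "fn (rslice W D z) (fn T (pure (lsp D) W a (fn (rslice W D y) (fn T (pure (lsp D) W b x))))) =
     fn (lslice D W a) (fn S (pure W (rsp D) (fn (lslice D W b) (fn S (pure W (rsp D) x y))) z))"
    using a b x y z by (simp add: M arr_simps lin_lslice)
  ultimately show "fn ?rr (fn (crossL (lsp D) W T) (pure (lsp D \<otimes> lsp D) W (pure (lsp D) (lsp D) a b) x)) =
      fn ?ll (fn (crossR W (rsp D) S) (pure W (rsp D \<otimes> rsp D) x (pure (rsp D) (rsp D) y z)))"
    using a b x y z 1 2 by (simp add: M arr_simps)
qed (use matesD[OF m] in \<open>simp_all add: crossL_def crossR_def arr_simps\<close>)

text \<open>
  The contraction \<open>(v \<otimes> a) \<otimes> (x \<otimes> w) \<mapsto> \<langle>a, x\<rangle> v \<otimes> w\<close>. It reduces to slices as soon as one of its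
  arguments is a pure tensor.
\<close>

definition contract where
  "contract W D Z t u = tlift W (lsp D) (W \<otimes> Z) (\<lambda>v a. pure W Z v (fn (lslice D Z a) u)) t"

context
  fixes D :: "('k::field, 'a::ab_group_add, 'b::ab_group_add) duality"
    and W :: "('k, 'w::ab_group_add) vs" and Z :: "('k, 'z::ab_group_add) vs"
  assumes D: "dual_pair D" and W: "vspace W" and Z: "vspace Z"
begin

lemma contract_bilinear:
  "u \<in> car (rsp D \<otimes> Z) \<Longrightarrow> bilinear_map W (lsp D) (W \<otimes> Z) (\<lambda>v a. pure W Z v (fn (lslice D Z a) u))"
  by (intro bilinear_mapI) (simp_all add: arr_simps D W Z lin_lslice linear_map_lslice dual_pairD)

lemma linear_map_contract_left:
  "u \<in> car (rsp D \<otimes> Z) \<Longrightarrow> linear_map (W \<otimes> lsp D) (W \<otimes> Z) (\<lambda>t. contract W D Z t u)"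
  unfolding contract_def by (rule tlift_linear[OF vspace_tensor contract_bilinear])

lemma contract_pure_left:
  "u \<in> car (rsp D \<otimes> Z) \<Longrightarrow> v \<in> car W \<Longrightarrow> a \<in> car (lsp D) \<Longrightarrow>
    contract W D Z (pure W (lsp D) v a) u = pure W Z v (fn (lslice D Z a) u)"
  unfolding contract_def by (simp add: tlift_pure[OF vspace_tensor contract_bilinear])

lemma linear_map_contract_right:
  assumes t: "t \<in> car (W \<otimes> lsp D)"
  shows "linear_map (rsp D \<otimes> Z) (W \<otimes> Z) (contract W D Z t)"
proof (rule linear_map_parameter[OF vspace_tensor vspace_tensor t linear_map_contract_left])
  fix v a assume va: "v \<in> car W" "a \<in> car (lsp D)"
  then have "linear_map (rsp D \<otimes> Z) (W \<otimes> Z) (\<lambda>u. pure W Z v (fn (lslice D Z a) u))"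
    by (simp add: arr_simps D Z lin_lslice)
  then show "linear_map (rsp D \<otimes> Z) (W \<otimes> Z) (\<lambda>u. contract W D Z (pure W (lsp D) v a) u)"
    by (rule linear_map_cong) (use va in \<open>simp_all add: contract_pure_left vspace_tensor\<close>)
qed

lemma contract_pure_right:
  assumes t: "t \<in> car (W \<otimes> lsp D)" and x: "x \<in> car (rsp D)" and w: "w \<in> car Z"
  shows "contract W D Z t (pure (rsp D) Z x w) = pure W Z (fn (rslice W D x) t) w"
proof -
  have "\<forall>t\<in>car (W \<otimes> lsp D). contract W D Z t (pure (rsp D) Z x w) = pure W Z (fn (rslice W D x) t) w"
    by (rule tensor_ext_ball[of _ _ "W \<otimes> Z"])
      (use x w in \<open>simp_all add: D W Z arr_simps linear_map_contract_left contract_pure_left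
        lin_rslice rslice_pure lslice_pure pure_scl\<close>)
  with t show ?thesis by blast
qed

end

lemma mates_crossR:
  assumes m: "mates D D W W T S"
  shows "mates D D (W \<otimes> W) (W \<otimes> W) (crossR (lsp D) W T) (crossL W (rsp D) S)"
proof -
  note M = matesD[OF m] and D = matesD(1)[OF m] 
  note R = lin_rslice lin_lslice rslice_pure lslice_pure
  have p: "fn (rslice (W \<otimes> W) D y) (fn (crossR (lsp D) W T) (pure (lsp D) (W \<otimes> W) a (pure W W v w))) =
      fn (lslice D (W \<otimes> W) a) (fn (crossL W (rsp D) S) (pure (W \<otimes> W) (rsp D) (pure W W v w) y))"
    if a: "a \<in> car (lsp D)" and v: "v \<in> car W" and w: "w \<in> car W" and y: "y \<in> car (rsp D)" for a v w y
  proof -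
    let ?t = "fn T (pure (lsp D) W a v)" and ?u = "fn S (pure W (rsp D) w y)"
    have t: "?t \<in> car (W \<otimes> lsp D)" and u: "?u \<in> car (rsp D \<otimes> W)"
      using that by (simp_all add: M arr_simps)
    have 1: "\<forall>r\<in>car (W \<otimes> lsp D). fn (rslice (W \<otimes> W) D y) (fn (assoc' W W (lsp D)) (pure W (W \<otimes> lsp D) v r)) =
        pure W W v (fn (rslice W D y) r)" if "v \<in> car W" for v
      by (rule tensor_ext_ball[of _ _ "W \<otimes> W"]) (use that y in \<open>simp_all add: M arr_simps R pure_scl\<close>)
    \<comment> \<open>Both slices equal the contraction of the strand between the two crossings.\<close>
    have "\<forall>t\<in>car (W \<otimes> lsp D). fn (rslice (W \<otimes> W) D y) (fn (assoc' W W (lsp D)) (fn (idm W \<boxtimes> T) (fn (assoc W (lsp D) W) (pure (W \<otimes> lsp D) W t w)))) = contract W D W t ?u"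
      by (rule tensor_ext_ball[of _ _ "W \<otimes> W"]) (use that u in \<open>simp_all add: M arr_simps R linear_map_contract_left contract_pure_left 1\<close>)
    moreover have 2: "\<forall>r\<in>car (rsp D \<otimes> W). fn (lslice D (W \<otimes> W) a) (fn (assoc (rsp D) W W) (pure (rsp D \<otimes> W) W r w)) =
        pure W W (fn (lslice D W a) r) w" if "w \<in> car W" for w
      by (rule tensor_ext_ball[of _ _ "W \<otimes> W"]) (use that a in \<open>simp_all add: M arr_simps R pure_scl\<close>)
    have "\<forall>u\<in>car (rsp D \<otimes> W). fn (lslice D (W \<otimes> W) a) (fn (assoc (rsp D) W W) (fn (S \<boxtimes> idm W) (fn (assoc' W (rsp D) W) (pure W (rsp D \<otimes> W) v u)))) = contract W D W ?t u"
      by (rule tensor_ext_ball[of _ _ "W \<otimes> W"]) (use that t in \<open>simp_all add: M arr_simps R linear_map_contract_right contract_pure_right 2\<close>)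
    ultimately show ?thesis
      using that t u by (simp add: crossR_def crossL_def M arr_simps)
  qed
  have "\<forall>x\<in>car (W \<otimes> W). fn (rslice (W \<otimes> W) D y) (fn (crossR (lsp D) W T) (pure (lsp D) (W \<otimes> W) a x)) =
      fn (lslice D (W \<otimes> W) a) (fn (crossL W (rsp D) S) (pure (W \<otimes> W) (rsp D) x y))"
    if "a \<in> car (lsp D)" "y \<in> car (rsp D)" for a y
    by (rule tensor_ext_ball[of _ _ "W \<otimes> W"]) (use that p in \<open>simp_all add: M arr_simps R crossL_def crossR_def\<close>)
  then show ?thesis
    by (simp add: mates_def M D arr_simps crossL_def crossR_def)
qed

section \<open>Sliding rules pass to the dual\<close>

text \<open>
  A sliding rule is an equation between composites of a crossing with a map on the bent strand. The mates
  of these composites are the composites of the sliding rule on the dual side, with left and right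
  exchanged.
\<close>

lemma slidesL_by_mates:
  assumes T: "mates D1 D1 W W T1 S1" "mates D2 D2 W W T2 S2" and a: "adjoint D1 D2 t s"
    and D: "left_nondegenerate D2" and sl: "slidesR W S2 S1 s"
  shows "slidesL W T1 T2 t"
proof -
  note M = matesD[OF T(1)] matesD[OF T(2)] adjointD[OF a]
  have "fn (T2 \<cdot> (t \<boxtimes> idm W)) x = fn ((idm W \<boxtimes> t) \<cdot> T1) x" if "x \<in> car (lsp D1 \<otimes> W)" for x
    by (rule mates_unique_left[OF mates_precompose[OF T(2) a] mates_postcompose[OF T(1) a] D])
      (use that sl in \<open>simp_all add: slidesR_def M\<close>)
  then show ?thesis by (simp add: slidesL_def M)
qed

lemma slidesR_by_mates:
  assumes T: "mates D1 D1 W W T1 S1" "mates D2 D2 W W T2 S2" and a: "adjoint D1 D2 t s"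
    and D: "left_nondegenerate (flip D1)" and sl: "slidesL W T1 T2 t"
  shows "slidesR W S2 S1 s"
proof -
  note M = matesD[OF T(1)] matesD[OF T(2)] adjointD[OF a]
  have "fn ((s \<boxtimes> idm W) \<cdot> S2) x = fn (S1 \<cdot> (idm W \<boxtimes> s)) x" if "x \<in> car (W \<otimes> rsp D2)" for x
    by (rule mates_unique_right[OF mates_precompose[OF T(2) a] mates_postcompose[OF T(1) a] D])
      (use that sl in \<open>simp_all add: slidesL_def M\<close>)
  then show ?thesis by (simp add: slidesR_def M)
qed

lemma adjoint_unique:
  assumes "adjoint D E t s" "adjoint D E t' s'" "left_nondegenerate E"
    and "\<And>y. y \<in> car (rsp E) \<Longrightarrow> fn s y = fn s' y" and "a \<in> car (lsp D)"
  shows "fn t a = fn t' a"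
  using assms by (intro eq_by_form[OF assms(3)]) (simp_all add: adjoint_def lin_fn_mem)

lemma adjoint_arr_eq:
  assumes "adjoint D E t s" "adjoint D E t' s'" "left_nondegenerate E" "s \<doteq> s'"
  shows "t \<doteq> t'"
  using adjoint_unique[OF assms(1-3)] assms(4) adjointD[OF assms(1)] adjointD[OF assms(2)]
  by (intro arr_eqI) (simp_all add: arr_eq_def)

lemma slidesL_by_adjoint:
  assumes T: "adjoint (D1 \<odot> F) (F \<odot> D1) T1 S1" "adjoint (D2 \<odot> F) (F \<odot> D2) T2 S2"
    and a: "adjoint D1 D2 t s" and D: "left_nondegenerate (F \<odot> D2)" and F: "dual_pair F"
    and sl: "slidesL (rsp F) S2 S1 s"
  shows "slidesL (lsp F) T1 T2 t"
proof -
  note M = adjointD[OF T(1)] adjointD[OF T(2)] adjointD[OF a] dual_pairD[OF F]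
  note i = adjoint_idm[OF F]
  have "fn (T2 \<cdot> (t \<boxtimes> idm (lsp F))) x = fn ((idm (lsp F) \<boxtimes> t) \<cdot> T1) x" if "x \<in> car (lsp D1 \<otimes> lsp F)" for x
    by (rule adjoint_unique[OF adjoint_comp[OF T(2) adjoint_tmap[OF a i]] adjoint_comp[OF adjoint_tmap[OF i a] T(1)] D])
      (use that sl in \<open>simp_all add: slidesL_def M\<close>)
  then show ?thesis by (simp add: slidesL_def M)
qed

lemma slidesR_by_adjoint:
  assumes T: "adjoint (F \<odot> D1) (D1 \<odot> F) T1 S1" "adjoint (F \<odot> D2) (D2 \<odot> F) T2 S2"
    and a: "adjoint D1 D2 t s" and D: "left_nondegenerate (D2 \<odot> F)" and F: "dual_pair F"
    and sl: "slidesR (rsp F) S2 S1 s"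
  shows "slidesR (lsp F) T1 T2 t"
proof -
  note M = adjointD[OF T(1)] adjointD[OF T(2)] adjointD[OF a] dual_pairD[OF F]
  note i = adjoint_idm[OF F]
  have "fn (T2 \<cdot> (idm (lsp F) \<boxtimes> t)) x = fn ((t \<boxtimes> idm (lsp F)) \<cdot> T1) x" if "x \<in> car (lsp F \<otimes> lsp D1)" for x
    by (rule adjoint_unique[OF adjoint_comp[OF T(2) adjoint_tmap[OF i a]] adjoint_comp[OF adjoint_tmap[OF a i] T(1)] D])
      (use that sl in \<open>simp_all add: slidesR_def M\<close>)
  then show ?thesis by (simp add: slidesR_def M)
qed

lemma adjoint_assoc':
  assumes "dual_pair D" "dual_pair E" "dual_pair F"
  shows "adjoint (D \<odot> (E \<odot> F)) ((D \<odot> E) \<odot> F) (assoc' (lsp D) (lsp E) (lsp F)) (assoc' (rsp F) (rsp E) (rsp D))"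
  using adjoint_inv[OF adjoint_assoc[OF assms]] assms by (simp add: iso_assoc dual_pairD)

lemma adjoint_crossL:
  assumes D: "dual_pair D" and F: "dual_pair F" and T: "adjoint (D \<odot> F) (F \<odot> D) T S"
  shows "adjoint ((D \<odot> D) \<odot> F) (F \<odot> (D \<odot> D)) (crossL (lsp D) (lsp F) T) (crossL (rsp D) (rsp F) S)"
proof -
  note i = adjoint_idm[OF D]
  have "adjoint ((D \<odot> D) \<odot> F) (F \<odot> (D \<odot> D)) (crossL (lsp D) (lsp F) T)
     (((((assoc (rsp F) (rsp D) (rsp D)) \<cdot> (S \<boxtimes> idm (rsp D))) \<cdot> assoc' (rsp D) (rsp F) (rsp D)) \<cdot> (idm (rsp D) \<boxtimes> S)) \<cdot> assoc (rsp D) (rsp D) (rsp F))"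
    unfolding crossL_def
    by (rule adjoint_comp[OF adjoint_assoc[OF F D D] adjoint_comp[OF adjoint_tmap[OF T i]
        adjoint_comp[OF adjoint_assoc'[OF D F D] adjoint_comp[OF adjoint_tmap[OF i T] adjoint_assoc[OF D D F]]]]])
  then show ?thesis
    using adjointD(6-8)[OF T] by (elim adjoint_cong)
      (use dual_pairD[OF D] dual_pairD[OF F] adjointD[OF T] in \<open>simp_all add: crossL_def arr_simps\<close>)
qed

lemma adjoint_crossR:
  assumes D: "dual_pair D" and F: "dual_pair F" and T: "adjoint (F \<odot> D) (D \<odot> F) T S"
  shows "adjoint (F \<odot> (D \<odot> D)) ((D \<odot> D) \<odot> F) (crossR (lsp F) (lsp D) T) (crossR (rsp F) (rsp D) S)"
proof -
  note i = adjoint_idm[OF D]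
  have "adjoint (F \<odot> (D \<odot> D)) ((D \<odot> D) \<odot> F) (crossR (lsp F) (lsp D) T)
     (((((assoc' (rsp D) (rsp D) (rsp F)) \<cdot> (idm (rsp D) \<boxtimes> S)) \<cdot> assoc (rsp D) (rsp F) (rsp D)) \<cdot> (S \<boxtimes> idm (rsp D))) \<cdot> assoc' (rsp F) (rsp D) (rsp D))"
    unfolding crossR_def
    by (rule adjoint_comp[OF adjoint_assoc'[OF D D F] adjoint_comp[OF adjoint_tmap[OF i T]
        adjoint_comp[OF adjoint_assoc[OF D F D] adjoint_comp[OF adjoint_tmap[OF T i] adjoint_assoc'[OF F D D]]]]])
  then show ?thesis
    by (elim adjoint_cong)
      (use dual_pairD[OF D] dual_pairD[OF F] adjointD[OF T] in \<open>simp_all add: crossR_def arr_simps\<close>)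
qed

text \<open>
  The planar order keeps the two middle factors of a fourfold tensor product in the middle, so the
  transpose of a map on the middle factors is the transposed map on the middle factors.
\<close>

lemma adjoint_middle:
  assumes D: "dual_pair D" and T: "adjoint (D \<odot> D) (D \<odot> D) T S"
  shows "adjoint ((D \<odot> D) \<odot> (D \<odot> D)) ((D \<odot> D) \<odot> (D \<odot> D))
    (middle (lsp D) (lsp D) (lsp D) (lsp D) T) (middle (rsp D) (rsp D) (rsp D) (rsp D) S)"
proof -
  note C = D dual_pairD(1,2)[OF D] 
  note T' = adjointD(3-8)[OF T, unfolded duality_sel] adjointD(9)[OF T]
  note N = dual_pair_nested[OF D D] 
  note N4 = dual_pair_nested[OF N N]
  note F = linear_map_form[OF N4, unfolded duality_sel] linear_map_form[OF N, unfolded duality_sel]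
  let ?A = "lsp D" and ?B = "rsp D"
  let ?M = "middle ?A ?A ?A ?A T" and ?N = "middle ?B ?B ?B ?B S"
  let ?p = "\<lambda>s t. pure (?A \<otimes> ?A) (?A \<otimes> ?A) s t" and ?q = "\<lambda>s t. pure (?B \<otimes> ?B) (?B \<otimes> ?B) s t"
  let ?i = "\<lambda>a t d. fn (assoc' ?A ?A (?A \<otimes> ?A)) (pure ?A (?A \<otimes> (?A \<otimes> ?A)) a (fn (assoc ?A ?A ?A) (pure (?A \<otimes> ?A) ?A t d)))"
  let ?j = "\<lambda>w u z. fn (assoc' ?B ?B (?B \<otimes> ?B)) (pure ?B (?B \<otimes> (?B \<otimes> ?B)) w (fn (assoc ?B ?B ?B) (pure (?B \<otimes> ?B) ?B u z)))"
  have f4: "form ((D \<odot> D) \<odot> (D \<odot> D)) (?p (pure ?A ?A a b) (pure ?A ?A c d)) (?q (pure ?B ?B w x) (pure ?B ?B y z)) =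
      form D a z * form D b y * (form D c x * form D d w)"
    if "a \<in> car ?A" "b \<in> car ?A" "c \<in> car ?A" "d \<in> car ?A" "w \<in> car ?B" "x \<in> car ?B" "y \<in> car ?B" "z \<in> car ?B"
    for a b c d w x y z
    using that by (simp add: nested_pure[OF N N, unfolded duality_sel] nested_pure[OF D D] pure_in_tensor)
  \<comment> \<open>The values of \<open>T\<close> and \<open>S\<close> in the middle are replaced by arbitrary tensors; the outer factors only
    contribute scalars.\<close>
  have 1: "\<forall>t\<in>car (?A \<otimes> ?A). form ((D \<odot> D) \<odot> (D \<odot> D)) (?i a t d) (?q (pure ?B ?B w x) (pure ?B ?B y z)) =
      form D a z * form D d w * form (D \<odot> D) t (pure ?B ?B x y)"
    if "a \<in> car ?A" "d \<in> car ?A" "w \<in> car ?B" "x \<in> car ?B" "y \<in> car ?B" "z \<in> car ?B" for a d w x y z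
    by (rule tensor_ext_ball[of _ _ ground])
      (use that in \<open>simp_all add: F C arr_simps f4 nested_pure[OF D D]\<close>)
  have 2: "\<forall>u\<in>car (?B \<otimes> ?B). form ((D \<odot> D) \<odot> (D \<odot> D)) (?p (pure ?A ?A a b) (pure ?A ?A c d)) (?j w u z) =
      form D a z * form D d w * form (D \<odot> D) (pure ?A ?A b c) u"
    if "a \<in> car ?A" "b \<in> car ?A" "c \<in> car ?A" "d \<in> car ?A" "w \<in> car ?B" "z \<in> car ?B" for a b c d w z
    by (rule tensor_ext_ball[of _ _ ground])
      (use that in \<open>simp_all add: F C arr_simps f4 nested_pure[OF D D]\<close>)
  have M: "lin ?M" and N': "lin ?N" using C T' by (simp_all add: lin_middle)
  have 3: "\<forall>y\<in>car ((?B \<otimes> ?B) \<otimes> (?B \<otimes> ?B)). form ((D \<odot> D) \<odot> (D \<odot> D)) (fn ?M (?p (pure ?A ?A a b) (pure ?A ?A c d))) y =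
     form ((D \<odot> D) \<odot> (D \<odot> D)) (?p (pure ?A ?A a b) (pure ?A ?A c d)) (fn ?N y)"
    if "a \<in> car ?A" "b \<in> car ?A" "c \<in> car ?A" "d \<in> car ?A" for a b c d
  proof (rule tensor22_ext_ball[of _ _ _ _ ground])
    fix w x y z assume "w \<in> car ?B" "x \<in> car ?B" "y \<in> car ?B" "z \<in> car ?B"
    with that show "form ((D \<odot> D) \<odot> (D \<odot> D)) (fn ?M (?p (pure ?A ?A a b) (pure ?A ?A c d))) (?q (pure ?B ?B w x) (pure ?B ?B y z)) =
     form ((D \<odot> D) \<odot> (D \<odot> D)) (?p (pure ?A ?A a b) (pure ?A ?A c d)) (fn ?N (?q (pure ?B ?B w x) (pure ?B ?B y z)))"
      by (simp add: middle_pure C T' 1 2 arr_simps)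
  qed (use that in \<open>simp_all add: F C T' M N' arr_simps\<close>)
  have "\<forall>a\<in>car ((?A \<otimes> ?A) \<otimes> (?A \<otimes> ?A)). form ((D \<odot> D) \<odot> (D \<odot> D)) (fn ?M a) y = form ((D \<odot> D) \<odot> (D \<odot> D)) a (fn ?N y)"
    if "y \<in> car ((?B \<otimes> ?B) \<otimes> (?B \<otimes> ?B))" for y
    by (rule tensor22_ext_ball[of _ _ _ _ ground])
      (use that 3 in \<open>simp_all add: F C T' M N' arr_simps\<close>)
  then show ?thesis using N4 M N' by (simp add: adjoint_def)
qed

section \<open>Actions induced by coactions\<close>

text \<open>
  The action of \<open>a\<close> evaluates the first factor of a coaction \<open>S\<close> by \<open>a\<close>. No coaction axiom is part of the
  definition, because the module axioms are derived one by one from the corresponding property of \<open>S\<close>.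
\<close>

definition left_action where
  "left_action D X \<nu> S \<longleftrightarrow> dual_pair D \<and> vspace X \<and> lin \<nu> \<and> src \<nu> = lsp D \<otimes> X \<and> tgt \<nu> = X \<and>
     lin S \<and> src S = X \<and> tgt S = rsp D \<otimes> X \<and>
     (\<forall>a\<in>car (lsp D). \<forall>x\<in>car X. fn \<nu> (pure (lsp D) X a x) = fn (lslice D X a) (fn S x))"

definition right_action where
  "right_action D X \<nu> S \<longleftrightarrow> dual_pair D \<and> vspace X \<and> lin \<nu> \<and> src \<nu> = X \<otimes> rsp D \<and> tgt \<nu> = X \<and>
     lin S \<and> src S = X \<and> tgt S = X \<otimes> lsp D \<and>
     (\<forall>x\<in>car X. \<forall>b\<in>car (rsp D). fn \<nu> (pure X (rsp D) x b) = fn (rslice X D b) (fn S x))"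

lemma left_actionD:
  assumes "left_action D X \<nu> S"
  shows "dual_pair D" "vspace X" "lin \<nu>" "src \<nu> = lsp D \<otimes> X" "tgt \<nu> = X" "lin S" "src S = X" "tgt S = rsp D \<otimes> X"
    "vspace (lsp D)" "vspace (rsp D)"
    "a \<in> car (lsp D) \<Longrightarrow> x \<in> car X \<Longrightarrow> fn \<nu> (pure (lsp D) X a x) = fn (lslice D X a) (fn S x)"
  using assms by (auto simp: left_action_def dual_pair_def)

lemma right_actionD:
  assumes "right_action D X \<nu> S"
  shows "dual_pair D" "vspace X" "lin \<nu>" "src \<nu> = X \<otimes> rsp D" "tgt \<nu> = X" "lin S" "src S = X" "tgt S = X \<otimes> lsp D"
    "vspace (lsp D)" "vspace (rsp D)"
    "b \<in> car (rsp D) \<Longrightarrow> x \<in> car X \<Longrightarrow> fn \<nu> (pure X (rsp D) x b) = fn (rslice X D b) (fn S x)"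
  using assms by (auto simp: right_action_def dual_pair_def)

lemma lin_lslice_nested: "dual_pair D \<Longrightarrow> vspace X \<Longrightarrow> a \<in> car (lsp D) \<Longrightarrow> b \<in> car (lsp D) \<Longrightarrow>
    lin (sliceL (rsp D \<otimes> rsp D) X (form (D \<odot> D) (pure (lsp D) (lsp D) a b)))"
  using lin_lslice[of "D \<odot> D" X "pure (lsp D) (lsp D) a b"] by (simp add: dual_pair_nested pure_in_tensor)

lemma lin_rslice_nested: "dual_pair D \<Longrightarrow> vspace X \<Longrightarrow> y \<in> car (rsp D) \<Longrightarrow> x \<in> car (rsp D) \<Longrightarrow>
    lin (sliceR X (lsp D \<otimes> lsp D) (\<lambda>a. form (D \<odot> D) a (pure (rsp D) (rsp D) y x)))"
  using lin_rslice[of "D \<odot> D" X "pure (rsp D) (rsp D) y x"] by (simp add: dual_pair_nested pure_in_tensor)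

lemmas slice_rules = lin_lslice lin_rslice lslice_pure rslice_pure lin_lslice_nested lin_rslice_nested
  lslice_nested[unfolded duality_sel] rslice_nested[unfolded duality_sel]

text \<open>
  Acting on a slice amounts to applying the coaction once more and taking a nested slice; this
  is what makes all module axioms into statements about \<open>S\<close>.
\<close>

lemma left_action_slice:
  assumes n: "left_action D X \<nu> S" and a: "a \<in> car (lsp D)" "b \<in> car (lsp D)" and u: "u \<in> car (rsp D \<otimes> X)"
  shows "fn \<nu> (pure (lsp D) X a (fn (lslice D X b) u)) =
    fn (lslice (D \<odot> D) X (pure (lsp D) (lsp D) a b)) (fn (assoc' (rsp D) (rsp D) X) (fn (idm (rsp D) \<boxtimes> S) u))"
proof -
  note N = left_actionD[OF n]
  have "\<forall>u\<in>car (rsp D \<otimes> X). fn \<nu> (pure (lsp D) X a (fn (lslice D X b) u)) =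
    fn (lslice (D \<odot> D) X (pure (lsp D) (lsp D) a b)) (fn (assoc' (rsp D) (rsp D) X) (fn (idm (rsp D) \<boxtimes> S) u))"
    by (rule tensor_ext_ball[of _ _ X])
      (use a in \<open>simp_all add: N(1-10) arr_simps slice_rules pure_scl fn_scl N(11)\<close>)
  with u show ?thesis by blast
qed

lemma right_action_slice:
  assumes n: "right_action D X \<nu> S" and b: "b \<in> car (rsp D)" "c \<in> car (rsp D)" and u: "u \<in> car (X \<otimes> lsp D)"
  shows "fn \<nu> (pure X (rsp D) (fn (rslice X D b) u) c) =
    fn (rslice X (D \<odot> D) (pure (rsp D) (rsp D) b c)) (fn (assoc X (lsp D) (lsp D)) (fn (S \<boxtimes> idm (lsp D)) u))"
proof -
  note N = right_actionD[OF n]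
  have "\<forall>u\<in>car (X \<otimes> lsp D). fn \<nu> (pure X (rsp D) (fn (rslice X D b) u) c) =
    fn (rslice X (D \<odot> D) (pure (rsp D) (rsp D) b c)) (fn (assoc X (lsp D) (lsp D)) (fn (S \<boxtimes> idm (lsp D)) u))"
    by (rule tensor_ext_ball[of _ _ X])
      (use b in \<open>simp_all add: N(1-10) arr_simps slice_rules pure_scl fn_scl N(11)\<close>)
  with u show ?thesis by blast
qed

lemma left_action_assoc:
  assumes n: "left_action D X \<nu> S" and m: "adjoint (D \<odot> D) D m d"
    and S: "\<And>x. x \<in> car X \<Longrightarrow> fn (idm (rsp D) \<boxtimes> S) (fn S x) = fn (assoc (rsp D) (rsp D) X) (fn (d \<boxtimes> idm X) (fn S x))"
  shows "\<nu> \<cdot> (idm (lsp D) \<boxtimes> \<nu>) \<cdot> assoc (lsp D) (lsp D) X \<doteq> \<nu> \<cdot> (m \<boxtimes> idm X)"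
proof -
  note N = left_actionD[OF n] and M = adjointD(3-8)[OF m, unfolded duality_sel]
  have "\<forall>x\<in>car ((lsp D \<otimes> lsp D) \<otimes> X).
      fn \<nu> (fn (idm (lsp D) \<boxtimes> \<nu>) (fn (assoc (lsp D) (lsp D) X) x)) = fn \<nu> (fn (m \<boxtimes> idm X) x)"
  proof (rule tensor3_ext_ball[of _ _ _ X])
    fix a b x assume a: "a \<in> car (lsp D)" "b \<in> car (lsp D)" and x: "x \<in> car X"
    have "fn (lslice D X (fn m (pure (lsp D) (lsp D) a b))) (fn S x) =
        fn (lslice (D \<odot> D) X (pure (lsp D) (lsp D) a b)) (fn (d \<boxtimes> idm X) (fn S x))"
      by (rule lslice_tmap[OF m N(2), symmetric]) (use a x in \<open>simp_all add: N(1-10) arr_simps\<close>)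
    also have "\<dots> = fn \<nu> (pure (lsp D) X a (fn (lslice D X b) (fn S x)))"
      using a x by (simp add: left_action_slice[OF n] S N(1-10) M arr_simps inv_arr_left iso_assoc)
    finally show "fn \<nu> (fn (idm (lsp D) \<boxtimes> \<nu>) (fn (assoc (lsp D) (lsp D) X) (pure (lsp D \<otimes> lsp D) X (pure (lsp D) (lsp D) a b) x))) =
      fn \<nu> (fn (m \<boxtimes> idm X) (pure (lsp D \<otimes> lsp D) X (pure (lsp D) (lsp D) a b) x))"
      using a x by (simp add: N M arr_simps)
  qed (simp_all add: N(1-10) M arr_simps)
  then show ?thesis by (intro arr_eqI) (simp_all add: N M)
qed

lemma right_action_assoc:
  assumes n: "right_action D X \<nu> S" and m: "adjoint D (D \<odot> D) d m"
    and S: "\<And>x. x \<in> car X \<Longrightarrow> fn (assoc X (lsp D) (lsp D)) (fn (S \<boxtimes> idm (lsp D)) (fn S x)) = fn (idm X \<boxtimes> d) (fn S x)"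
  shows "\<nu> \<cdot> (\<nu> \<boxtimes> idm (rsp D)) \<doteq> \<nu> \<cdot> (idm X \<boxtimes> m) \<cdot> assoc X (rsp D) (rsp D)"
proof -
  note N = right_actionD[OF n] and M = adjointD(3-8)[OF m, unfolded duality_sel]
  have "\<forall>x\<in>car ((X \<otimes> rsp D) \<otimes> rsp D).
      fn \<nu> (fn (\<nu> \<boxtimes> idm (rsp D)) x) = fn \<nu> (fn (idm X \<boxtimes> m) (fn (assoc X (rsp D) (rsp D)) x))"
  proof (rule tensor3_ext_ball[of _ _ _ X])
    fix x b c assume b: "b \<in> car (rsp D)" "c \<in> car (rsp D)" and x: "x \<in> car X"
    have "fn (rslice X D (fn m (pure (rsp D) (rsp D) b c))) (fn S x) =
        fn (rslice X (D \<odot> D) (pure (rsp D) (rsp D) b c)) (fn (idm X \<boxtimes> d) (fn S x))"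
      by (rule rslice_tmap[OF m N(2), symmetric]) (use b x in \<open>simp_all add: N(1-10) arr_simps\<close>)
    also have "\<dots> = fn \<nu> (pure X (rsp D) (fn (rslice X D b) (fn S x)) c)"
      using b x by (simp add: right_action_slice[OF n] S N(1-10) M arr_simps)
    finally show "fn \<nu> (fn (\<nu> \<boxtimes> idm (rsp D)) (pure (X \<otimes> rsp D) (rsp D) (pure X (rsp D) x b) c)) =
      fn \<nu> (fn (idm X \<boxtimes> m) (fn (assoc X (rsp D) (rsp D)) (pure (X \<otimes> rsp D) (rsp D) (pure X (rsp D) x b) c)))"
      using b x by (simp add: N M arr_simps)
  qed (simp_all add: N(1-10) M arr_simps)
  then show ?thesis by (intro arr_eqI) (simp_all add: N M)
qed

text \<open>
  The two sides of the compatibility between the braiding and the action are, by this and the next lemma,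
  mates of the two sides of the compatibility between \<open>\<Theta>\<close> and the coaction.
\<close>

lemma mates_left_action_then_cross:
  assumes n: "left_action D X \<nu> S" and T: "mates D D X X T \<Theta>"
  shows "mates (D \<odot> D) D X X (T \<cdot> (idm (lsp D) \<boxtimes> \<nu>) \<cdot> assoc (lsp D) (lsp D) X)
    (assoc' (rsp D) (rsp D) X \<cdot> (idm (rsp D) \<boxtimes> \<Theta>) \<cdot> assoc (rsp D) X (rsp D) \<cdot> (S \<boxtimes> idm (rsp D)))"
proof (rule mates_nested_leftI)
  note N = left_actionD[OF n] and M = matesD(9-14)[OF T] matesD(15)[OF T]
  fix a b x y assume a: "a \<in> car (lsp D)" "b \<in> car (lsp D)" and x: "x \<in> car X" and y: "y \<in> car (rsp D)"
  have "\<forall>u\<in>car (rsp D \<otimes> X). fn (lslice D X a) (fn \<Theta> (pure X (rsp D) (fn (lslice D X b) u) y)) =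
      fn (lslice (D \<odot> D) X (pure (lsp D) (lsp D) a b))
        (fn (assoc' (rsp D) (rsp D) X) (fn (idm (rsp D) \<boxtimes> \<Theta>) (fn (assoc (rsp D) X (rsp D)) (pure (rsp D \<otimes> X) (rsp D) u y))))"
    by (rule tensor_ext_ball[of _ _ X])
      (use a y in \<open>simp_all add: N(1-10) M(1-6) arr_simps slice_rules pure_scl fn_scl\<close>)
  then show "fn (rslice X D y) (fn (T \<cdot> (idm (lsp D) \<boxtimes> \<nu>) \<cdot> assoc (lsp D) (lsp D) X)
      (pure (lsp D \<otimes> lsp D) X (pure (lsp D) (lsp D) a b) x)) =
     fn (lslice (D \<odot> D) X (pure (lsp D) (lsp D) a b))
      (fn (assoc' (rsp D) (rsp D) X \<cdot> (idm (rsp D) \<boxtimes> \<Theta>) \<cdot> assoc (rsp D) X (rsp D) \<cdot> (S \<boxtimes> idm (rsp D))) (pure X (rsp D) x y))"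
    using a x y by (simp add: N M arr_simps slice_rules)
qed (use left_actionD[OF n] matesD[OF T] in \<open>simp_all add: arr_simps\<close>)

lemma mates_cross_then_left_action:
  assumes n: "left_action D X \<nu> S" and T: "mates D D X X T \<Theta>"
  shows "mates (D \<odot> D) D X X ((\<nu> \<boxtimes> idm (lsp D)) \<cdot> assoc' (lsp D) X (lsp D) \<cdot> (idm (lsp D) \<boxtimes> T) \<cdot> assoc (lsp D) (lsp D) X)
    (assoc' (rsp D) (rsp D) X \<cdot> (idm (rsp D) \<boxtimes> S) \<cdot> \<Theta>)"
proof (rule mates_nested_leftI)
  note N = left_actionD[OF n] and M = matesD(9-14)[OF T] matesD(15)[OF T]
  fix a b x y assume a: "a \<in> car (lsp D)" "b \<in> car (lsp D)" and x: "x \<in> car X" and y: "y \<in> car (rsp D)"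
  have "\<forall>t\<in>car (X \<otimes> lsp D). fn (rslice X D y) (fn (\<nu> \<boxtimes> idm (lsp D)) (fn (assoc' (lsp D) X (lsp D)) (pure (lsp D) (X \<otimes> lsp D) a t))) =
      fn \<nu> (pure (lsp D) X a (fn (rslice X D y) t))"
    by (rule tensor_ext_ball[of _ _ X])
      (use a y in \<open>simp_all add: N(1-10) M(1-6) arr_simps slice_rules pure_scl fn_scl\<close>)
  then show "fn (rslice X D y) (fn ((\<nu> \<boxtimes> idm (lsp D)) \<cdot> assoc' (lsp D) X (lsp D) \<cdot> (idm (lsp D) \<boxtimes> T) \<cdot> assoc (lsp D) (lsp D) X)
      (pure (lsp D \<otimes> lsp D) X (pure (lsp D) (lsp D) a b) x)) =
     fn (lslice (D \<odot> D) X (pure (lsp D) (lsp D) a b))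
      (fn (assoc' (rsp D) (rsp D) X \<cdot> (idm (rsp D) \<boxtimes> S) \<cdot> \<Theta>) (pure X (rsp D) x y))"
    using a x y by (simp add: N(1-10) M arr_simps left_action_slice[OF n, unfolded duality_sel])
qed (use left_actionD[OF n] matesD[OF T] in \<open>simp_all add: arr_simps\<close>)

lemma mates_right_action_then_cross:
  assumes n: "right_action D X \<nu> S" and T: "mates D D X X T \<Theta>"
  shows "mates D (D \<odot> D) X X (assoc X (lsp D) (lsp D) \<cdot> (T \<boxtimes> idm (lsp D)) \<cdot> assoc' (lsp D) X (lsp D) \<cdot> (idm (lsp D) \<boxtimes> S))
    (\<Theta> \<cdot> (\<nu> \<boxtimes> idm (rsp D)) \<cdot> assoc' X (rsp D) (rsp D))"
proof (rule mates_nested_rightI)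
  note N = right_actionD[OF n] and M = matesD(9-14)[OF T] matesD(15)[OF T]
  fix a x b c assume b: "b \<in> car (rsp D)" "c \<in> car (rsp D)" and x: "x \<in> car X" and a: "a \<in> car (lsp D)"
  have "\<forall>u\<in>car (X \<otimes> lsp D). fn (rslice X D c) (fn T (pure (lsp D) X a (fn (rslice X D b) u))) =
      fn (rslice X (D \<odot> D) (pure (rsp D) (rsp D) b c))
        (fn (assoc X (lsp D) (lsp D)) (fn (T \<boxtimes> idm (lsp D)) (fn (assoc' (lsp D) X (lsp D)) (pure (lsp D) (X \<otimes> lsp D) a u))))"
    by (rule tensor_ext_ball[of _ _ X])
      (use a b in \<open>simp_all add: N(1-10) M(1-6) arr_simps slice_rules pure_scl fn_scl\<close>)
  then show "fn (rslice X (D \<odot> D) (pure (rsp D) (rsp D) b c))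
      (fn (assoc X (lsp D) (lsp D) \<cdot> (T \<boxtimes> idm (lsp D)) \<cdot> assoc' (lsp D) X (lsp D) \<cdot> (idm (lsp D) \<boxtimes> S)) (pure (lsp D) X a x)) =
     fn (lslice D X a) (fn (\<Theta> \<cdot> (\<nu> \<boxtimes> idm (rsp D)) \<cdot> assoc' X (rsp D) (rsp D)) (pure X (rsp D \<otimes> rsp D) x (pure (rsp D) (rsp D) b c)))"
    using a b x by (simp add: N M(1-6) M(7)[symmetric] arr_simps slice_rules)
qed (use right_actionD[OF n] matesD[OF T] in \<open>simp_all add: arr_simps\<close>)

lemma mates_cross_then_right_action:
  assumes n: "right_action D X \<nu> S" and T: "mates D D X X T \<Theta>"
  shows "mates D (D \<odot> D) X X (assoc X (lsp D) (lsp D) \<cdot> (S \<boxtimes> idm (lsp D)) \<cdot> T)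
    ((idm (rsp D) \<boxtimes> \<nu>) \<cdot> assoc (rsp D) X (rsp D) \<cdot> (\<Theta> \<boxtimes> idm (rsp D)) \<cdot> assoc' X (rsp D) (rsp D))"
proof (rule mates_nested_rightI)
  note N = right_actionD[OF n] and M = matesD(9-14)[OF T] matesD(15)[OF T]
  fix a x b c assume b: "b \<in> car (rsp D)" "c \<in> car (rsp D)" and x: "x \<in> car X" and a: "a \<in> car (lsp D)"
  have "\<forall>t\<in>car (rsp D \<otimes> X). fn (lslice D X a) (fn (idm (rsp D) \<boxtimes> \<nu>) (fn (assoc (rsp D) X (rsp D)) (pure (rsp D \<otimes> X) (rsp D) t c))) =
      fn \<nu> (pure X (rsp D) (fn (lslice D X a) t) c)"
    by (rule tensor_ext_ball[of _ _ X])
      (use a b in \<open>simp_all add: N(1-10) M(1-6) arr_simps slice_rules pure_scl fn_scl\<close>)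
  then show "fn (rslice X (D \<odot> D) (pure (rsp D) (rsp D) b c)) (fn (assoc X (lsp D) (lsp D) \<cdot> (S \<boxtimes> idm (lsp D)) \<cdot> T) (pure (lsp D) X a x)) =
     fn (lslice D X a) (fn ((idm (rsp D) \<boxtimes> \<nu>) \<cdot> assoc (rsp D) X (rsp D) \<cdot> (\<Theta> \<boxtimes> idm (rsp D)) \<cdot> assoc' X (rsp D) (rsp D))
        (pure X (rsp D \<otimes> rsp D) x (pure (rsp D) (rsp D) b c)))"
    using a b x by (simp add: N(1-10) M(1-6) M(7)[symmetric] arr_simps right_action_slice[OF n, unfolded duality_sel])
qed (use right_actionD[OF n] matesD[OF T] in \<open>simp_all add: arr_simps\<close>)

text \<open>
  On pure tensors the right-hand side of the module algebra axiom, before multiplying, is a single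
  nested slice. The factor \<open>b\<close> crosses \<open>v\<close> before it acts on \<open>w\<close>; contracting the crossed strand with \<open>S w\<close>
  moves that crossing to the other side of the duality.
\<close>

lemma left_action_tensor:
  assumes n: "left_action D X \<nu> S" and T: "mates D D X X T \<Theta>"
    and a: "a \<in> car (lsp D)" "b \<in> car (lsp D)" and v: "v \<in> car X" and w: "w \<in> car X"
  shows "fn (\<nu> \<boxtimes> \<nu>) (fn (middle (lsp D) (lsp D) X X T) (pure (lsp D \<otimes> lsp D) (X \<otimes> X) (pure (lsp D) (lsp D) a b) (pure X X v w))) =
    fn (lslice (D \<odot> D) (X \<otimes> X) (pure (lsp D) (lsp D) a b)) (fn (assoc (rsp D \<otimes> rsp D) X X)
      (fn ((assoc' (rsp D) (rsp D) X \<cdot> (idm (rsp D) \<boxtimes> S) \<cdot> \<Theta>) \<boxtimes> idm X) (fn (assoc' X (rsp D) X) (pure X (rsp D \<otimes> X) v (fn S w)))))"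
proof -
  let ?A = "lsp D" and ?B = "rsp D"
  let ?G = "assoc' ?B ?B X \<cdot> (idm ?B \<boxtimes> S) \<cdot> \<Theta>"
  let ?ab = "pure ?A ?A a b"
  note N = left_actionD[OF n] and M = matesD(9-14)[OF T] 
  note m = matesD(15)[OF mates_cross_then_left_action[OF n T], unfolded duality_sel]
  \<comment> \<open>the tensor that remains to be contracted with \<open>S w\<close>: \<open>b\<close> has crossed \<open>v\<close>, and \<open>a\<close> has acted\<close>
  define t' where "t' = fn (\<nu> \<boxtimes> idm ?A) (fn (assoc' ?A X ?A) (pure ?A (X \<otimes> ?A) a (fn T (pure ?A X b v))))"
  have t': "t' \<in> car (X \<otimes> ?A)" unfolding t'_def using a v by (simp add: N(1-10) M arr_simps)
  have rs: "fn (rslice X D x) t' = fn (lslice (D \<odot> D) X ?ab) (fn ?G (pure X ?B v x))" if "x \<in> car ?B" for x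
    using m[of ?ab v x] a v that by (simp add: t'_def N(1-10) M arr_simps)
  have "\<forall>t\<in>car (X \<otimes> ?A). fn (\<nu> \<boxtimes> \<nu>) (fn (assoc' ?A X (?A \<otimes> X)) (pure ?A (X \<otimes> (?A \<otimes> X)) a (fn (assoc X ?A X) (pure (X \<otimes> ?A) X t w)))) =
      contract X D X (fn (\<nu> \<boxtimes> idm ?A) (fn (assoc' ?A X ?A) (pure ?A (X \<otimes> ?A) a t))) (fn S w)"
  proof (rule tensor_ext_ball[of _ _ "X \<otimes> X"])
    show "linear_map (X \<otimes> ?A) (X \<otimes> X) (\<lambda>t. contract X D X (fn (\<nu> \<boxtimes> idm ?A) (fn (assoc' ?A X ?A) (pure ?A (X \<otimes> ?A) a t))) (fn S w))"
      by (rule linear_map_compose[OF linear_map_contract_left]) (use a w in \<open>simp_all add: N(1-10) arr_simps\<close>)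
  qed (use a w in \<open>simp_all add: N(1-10) N(11) arr_simps lin_lslice lin_rslice contract_pure_left\<close>)
  then have 1: "fn (\<nu> \<boxtimes> \<nu>) (fn (middle ?A ?A X X T) (pure (?A \<otimes> ?A) (X \<otimes> X) ?ab (pure X X v w))) = contract X D X t' (fn S w)"
    using a v w by (simp add: middle_pure N(1-10) M arr_simps t'_def)
  have l: "lin (lslice (D \<odot> D) (X \<otimes> X) ?ab)" "lin (lslice (D \<odot> D) X ?ab)"
    using a by (simp_all add: lin_lslice_nested N(1-10) vspace_tensor)
  have lp: "fn (lslice (D \<odot> D) (X \<otimes> X) ?ab) (fn (assoc (?B \<otimes> ?B) X X) (pure ((?B \<otimes> ?B) \<otimes> X) X r x)) = pure X X (fn (lslice (D \<odot> D) X ?ab) r) x"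
    if r: "r \<in> car ((?B \<otimes> ?B) \<otimes> X)" and x: "x \<in> car X" for r x
  proof -
    have "\<forall>r\<in>car ((?B \<otimes> ?B) \<otimes> X). fn (lslice (D \<odot> D) (X \<otimes> X) ?ab) (fn (assoc (?B \<otimes> ?B) X X) (pure ((?B \<otimes> ?B) \<otimes> X) X r x)) = pure X X (fn (lslice (D \<odot> D) X ?ab) r) x"
    proof (rule tensor_ext_ball[of _ _ "X \<otimes> X"])
      fix s y assume "s \<in> car (?B \<otimes> ?B)" "y \<in> car X"
      then show "fn (lslice (D \<odot> D) (X \<otimes> X) ?ab) (fn (assoc (?B \<otimes> ?B) X X) (pure ((?B \<otimes> ?B) \<otimes> X) X (pure (?B \<otimes> ?B) X s y) x)) =
          pure X X (fn (lslice (D \<odot> D) X ?ab) (pure (?B \<otimes> ?B) X s y)) x"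
        using x a lslice_pure[OF dual_pair_nested[OF N(1) N(1)], of "X \<otimes> X" ?ab s "pure X X y x"]
          lslice_pure[OF dual_pair_nested[OF N(1) N(1)], of X ?ab s y]
        by (simp add: N(1-10) arr_simps pure_scl)
    qed (use x l in \<open>simp_all add: N(1-10) arr_simps\<close>)
    with r show ?thesis by blast
  qed
  have "\<forall>u\<in>car (?B \<otimes> X). contract X D X t' u =
    fn (lslice (D \<odot> D) (X \<otimes> X) ?ab) (fn (assoc (?B \<otimes> ?B) X X) (fn (?G \<boxtimes> idm X) (fn (assoc' X ?B X) (pure X (?B \<otimes> X) v u))))"
    by (rule tensor_ext_ball[of _ _ "X \<otimes> X"])
      (use v l t' in \<open>simp_all add: N(1-10) M arr_simps linear_map_contract_right contract_pure_right rs lp[unfolded duality_sel]\<close>)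
  then show ?thesis unfolding 1 using w by (simp add: N(1-10) arr_simps)
qed

lemma right_action_tensor:
  assumes n: "right_action D X \<nu> S" and T: "mates D D X X T \<Theta>"
    and b: "b \<in> car (rsp D)" "c \<in> car (rsp D)" and v: "v \<in> car X" and w: "w \<in> car X"
  shows "fn (\<nu> \<boxtimes> \<nu>) (fn (middle X X (rsp D) (rsp D) \<Theta>) (pure (X \<otimes> X) (rsp D \<otimes> rsp D) (pure X X v w) (pure (rsp D) (rsp D) b c))) =
    fn (rslice (X \<otimes> X) (D \<odot> D) (pure (rsp D) (rsp D) b c)) (fn (assoc' X X (lsp D \<otimes> lsp D))
      (fn (idm X \<boxtimes> (assoc X (lsp D) (lsp D) \<cdot> (S \<boxtimes> idm (lsp D)) \<cdot> T)) (fn (assoc X (lsp D) X) (pure (X \<otimes> lsp D) X (fn S v) w))))"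
proof -
  let ?A = "lsp D" and ?B = "rsp D"
  let ?G = "assoc X ?A ?A \<cdot> (S \<boxtimes> idm ?A) \<cdot> T"
  let ?bc = "pure ?B ?B b c"
  note N = right_actionD[OF n] and M = matesD(9-14)[OF T] 
  note m = matesD(15)[OF mates_cross_then_right_action[OF n T], unfolded duality_sel]
  define u' where "u' = fn (idm ?B \<boxtimes> \<nu>) (fn (assoc ?B X ?B) (pure (?B \<otimes> X) ?B (fn \<Theta> (pure X ?B w b)) c))"
  have u': "u' \<in> car (?B \<otimes> X)" unfolding u'_def using b w by (simp add: N(1-10) M arr_simps)
  have rs: "fn (lslice D X x) u' = fn (rslice X (D \<odot> D) ?bc) (fn ?G (pure ?A X x w))" if "x \<in> car ?A" for x
    using m[of x w ?bc] b w that by (simp add: u'_def N(1-10) M arr_simps)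
  have "\<forall>u\<in>car (?B \<otimes> X). fn (\<nu> \<boxtimes> \<nu>) (fn (assoc' X ?B (X \<otimes> ?B)) (pure X (?B \<otimes> (X \<otimes> ?B)) v (fn (assoc ?B X ?B) (pure (?B \<otimes> X) ?B u c)))) =
      contract X D X (fn S v) (fn (idm ?B \<boxtimes> \<nu>) (fn (assoc ?B X ?B) (pure (?B \<otimes> X) ?B u c)))"
  proof (rule tensor_ext_ball[of _ _ "X \<otimes> X"])
    show "linear_map (?B \<otimes> X) (X \<otimes> X) (\<lambda>u. contract X D X (fn S v) (fn (idm ?B \<boxtimes> \<nu>) (fn (assoc ?B X ?B) (pure (?B \<otimes> X) ?B u c))))"
      by (rule linear_map_compose[OF linear_map_contract_right]) (use b v in \<open>simp_all add: N(1-10) arr_simps\<close>)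
  qed (use b v in \<open>simp_all add: N(1-10) N(11) arr_simps lin_lslice lin_rslice contract_pure_right\<close>)
  then have 1: "fn (\<nu> \<boxtimes> \<nu>) (fn (middle X X ?B ?B \<Theta>) (pure (X \<otimes> X) (?B \<otimes> ?B) (pure X X v w) ?bc)) = contract X D X (fn S v) u'"
    using b v w by (simp add: middle_pure N(1-10) M arr_simps u'_def)
  have l: "lin (rslice (X \<otimes> X) (D \<odot> D) ?bc)" "lin (rslice X (D \<odot> D) ?bc)"
    using b by (simp_all add: lin_rslice_nested N(1-10) vspace_tensor)
  have lp: "fn (rslice (X \<otimes> X) (D \<odot> D) ?bc) (fn (assoc' X X (?A \<otimes> ?A)) (pure X (X \<otimes> (?A \<otimes> ?A)) x r)) = pure X X x (fn (rslice X (D \<odot> D) ?bc) r)"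
    if r: "r \<in> car (X \<otimes> (?A \<otimes> ?A))" and x: "x \<in> car X" for r x
  proof -
    have "\<forall>r\<in>car (X \<otimes> (?A \<otimes> ?A)). fn (rslice (X \<otimes> X) (D \<odot> D) ?bc) (fn (assoc' X X (?A \<otimes> ?A)) (pure X (X \<otimes> (?A \<otimes> ?A)) x r)) = pure X X x (fn (rslice X (D \<odot> D) ?bc) r)"
    proof (rule tensor_ext_ball[of _ _ "X \<otimes> X"])
      fix y s assume "s \<in> car (?A \<otimes> ?A)" "y \<in> car X"
      then show "fn (rslice (X \<otimes> X) (D \<odot> D) ?bc) (fn (assoc' X X (?A \<otimes> ?A)) (pure X (X \<otimes> (?A \<otimes> ?A)) x (pure X (?A \<otimes> ?A) y s))) =
          pure X X x (fn (rslice X (D \<odot> D) ?bc) (pure X (?A \<otimes> ?A) y s))"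
        using x b rslice_pure[OF dual_pair_nested[OF N(1) N(1)], of "X \<otimes> X" ?bc s "pure X X x y"]
          rslice_pure[OF dual_pair_nested[OF N(1) N(1)], of X ?bc s y]
        by (simp add: N(1-10) arr_simps pure_scl)
    qed (use x l in \<open>simp_all add: N(1-10) arr_simps\<close>)
    with r show ?thesis by blast
  qed
  have "\<forall>t\<in>car (X \<otimes> ?A). contract X D X t u' =
    fn (rslice (X \<otimes> X) (D \<odot> D) ?bc) (fn (assoc' X X (?A \<otimes> ?A)) (fn (idm X \<boxtimes> ?G) (fn (assoc X ?A X) (pure (X \<otimes> ?A) X t w))))"
    by (rule tensor_ext_ball[of _ _ "X \<otimes> X"])
      (use w l u' in \<open>simp_all add: N(1-10) M arr_simps linear_map_contract_left contract_pure_left rs lp[unfolded duality_sel]\<close>)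
  then show ?thesis unfolding 1 using v by (simp add: N(1-10) arr_simps)
qed

text \<open>
  Hypothesis \<open>K\<close> is the transpose of the module algebra axiom: it expresses \<open>S (v w)\<close> through \<open>S v\<close>, \<open>S w\<close>
  and the map \<open>\<mu>\<close> adjoint to the coproduct.
\<close>

lemma left_action_algebra:
  assumes n: "left_action D X \<nu> S" and T: "mates D D X X T \<Theta>" and d: "adjoint D (D \<odot> D) d \<mu>" and m: "mult X m"
    and K: "\<And>v w. v \<in> car X \<Longrightarrow> w \<in> car X \<Longrightarrow>
      fn (idm (rsp D) \<boxtimes> m) (fn (\<mu> \<boxtimes> idm (X \<otimes> X)) (fn (assoc (rsp D \<otimes> rsp D) X X)
        (fn ((assoc' (rsp D) (rsp D) X \<cdot> (idm (rsp D) \<boxtimes> S) \<cdot> \<Theta>) \<boxtimes> idm X) (fn (assoc' X (rsp D) X) (pure X (rsp D \<otimes> X) v (fn S w))))))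
      = fn S (fn m (pure X X v w))"
  shows "\<nu> \<cdot> (idm (lsp D) \<boxtimes> m) \<doteq> m \<cdot> (\<nu> \<boxtimes> \<nu>) \<cdot> middle (lsp D) (lsp D) X X T \<cdot> (d \<boxtimes> idm (X \<otimes> X))"
proof -
  let ?A = "lsp D" and ?B = "rsp D"
  note N = left_actionD[OF n] and M = matesD(9-14)[OF T] and P = adjointD(3-8)[OF d, unfolded duality_sel] and m' = multD[OF m]
  note DD = dual_pair_nested[OF N(1) N(1)]
  have "\<forall>x\<in>car (?A \<otimes> (X \<otimes> X)). fn \<nu> (fn (idm ?A \<boxtimes> m) x) = fn m (fn (\<nu> \<boxtimes> \<nu>) (fn (middle ?A ?A X X T) (fn (d \<boxtimes> idm (X \<otimes> X)) x)))"
  proof (rule tensor_ext_ball[of _ _ X])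
    fix f x assume f: "f \<in> car ?A" and x: "x \<in> car (X \<otimes> X)"
    have "\<forall>x\<in>car (X \<otimes> X). fn \<nu> (fn (idm ?A \<boxtimes> m) (pure ?A (X \<otimes> X) f x)) =
        fn m (fn (\<nu> \<boxtimes> \<nu>) (fn (middle ?A ?A X X T) (fn (d \<boxtimes> idm (X \<otimes> X)) (pure ?A (X \<otimes> X) f x))))"
    proof (rule tensor_ext_ball[of _ _ X])
      fix v w assume v: "v \<in> car X" and w: "w \<in> car X"
      define k where "k = fn (assoc (?B \<otimes> ?B) X X)
        (fn ((assoc' ?B ?B X \<cdot> (idm ?B \<boxtimes> S) \<cdot> \<Theta>) \<boxtimes> idm X) (fn (assoc' X ?B X) (pure X (?B \<otimes> X) v (fn S w))))"
      have k: "k \<in> car ((?B \<otimes> ?B) \<otimes> (X \<otimes> X))" unfolding k_def using v w by (simp add: N(1-10) M arr_simps)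
      have "\<forall>F\<in>car (?A \<otimes> ?A). fn (\<nu> \<boxtimes> \<nu>) (fn (middle ?A ?A X X T) (pure (?A \<otimes> ?A) (X \<otimes> X) F (pure X X v w))) = fn (lslice (D \<odot> D) (X \<otimes> X) F) k"
      proof (rule tensor_ext_ball[of _ _ "X \<otimes> X"])
        show "linear_map (?A \<otimes> ?A) (X \<otimes> X) (\<lambda>F. fn (lslice (D \<odot> D) (X \<otimes> X) F) k)"
          by (rule linear_map_lslice[OF DD vspace_tensor]) (use k in \<open>simp_all add: arr_simps\<close>)
      qed (use v w in \<open>simp_all add: N(1-10) M arr_simps lin_middle left_action_tensor[OF n T] k_def\<close>)
      then have "fn m (fn (\<nu> \<boxtimes> \<nu>) (fn (middle ?A ?A X X T) (pure (?A \<otimes> ?A) (X \<otimes> X) (fn d f) (pure X X v w)))) =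
          fn m (fn (lslice (D \<odot> D) (X \<otimes> X) (fn d f)) k)"
        using f by (simp add: P arr_simps)
      also have "\<dots> = fn m (fn (lslice D (X \<otimes> X) f) (fn (\<mu> \<boxtimes> idm (X \<otimes> X)) k))"
        using lslice_tmap[OF d vspace_tensor f, of k X X] k by simp
      also have "\<dots> = fn (lslice D X f) (fn (idm ?B \<boxtimes> m) (fn (\<mu> \<boxtimes> idm (X \<otimes> X)) k))"
        by (rule lslice_natural[symmetric, OF N(1) m' f]) (use k in \<open>simp add: N(1-10) P arr_simps\<close>)
      also have "\<dots> = fn (lslice D X f) (fn S (fn m (pure X X v w)))"
        using K[OF v w] by (simp add: k_def)
      finally show "fn \<nu> (fn (idm ?A \<boxtimes> m) (pure ?A (X \<otimes> X) f (pure X X v w))) =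
        fn m (fn (\<nu> \<boxtimes> \<nu>) (fn (middle ?A ?A X X T) (fn (d \<boxtimes> idm (X \<otimes> X)) (pure ?A (X \<otimes> X) f (pure X X v w)))))"
        using f v w by (simp add: N P m' arr_simps)
    qed (use f in \<open>simp_all add: N(1-10) M P m' arr_simps lin_middle\<close>)
    with x show "fn \<nu> (fn (idm ?A \<boxtimes> m) (pure ?A (X \<otimes> X) f x)) =
        fn m (fn (\<nu> \<boxtimes> \<nu>) (fn (middle ?A ?A X X T) (fn (d \<boxtimes> idm (X \<otimes> X)) (pure ?A (X \<otimes> X) f x))))" by blast
  qed (simp_all add: N(1-10) M P m' arr_simps lin_middle)
  then show ?thesis by (intro arr_eqI) (simp_all add: N(1-10) P m')
qed

lemma right_action_algebra:
  assumes n: "right_action D X \<nu> S" and T: "mates D D X X T \<Theta>" and d: "adjoint (D \<odot> D) D \<mu> d" and m: "mult X m"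
    and K: "\<And>v w. v \<in> car X \<Longrightarrow> w \<in> car X \<Longrightarrow>
      fn (m \<boxtimes> idm (lsp D)) (fn (idm (X \<otimes> X) \<boxtimes> \<mu>) (fn (assoc' X X (lsp D \<otimes> lsp D))
        (fn (idm X \<boxtimes> (assoc X (lsp D) (lsp D) \<cdot> (S \<boxtimes> idm (lsp D)) \<cdot> T)) (fn (assoc X (lsp D) X) (pure (X \<otimes> lsp D) X (fn S v) w)))))
      = fn S (fn m (pure X X v w))"
  shows "\<nu> \<cdot> (m \<boxtimes> idm (rsp D)) \<doteq> m \<cdot> (\<nu> \<boxtimes> \<nu>) \<cdot> middle X X (rsp D) (rsp D) \<Theta> \<cdot> (idm (X \<otimes> X) \<boxtimes> d)"
proof -
  let ?A = "lsp D" and ?B = "rsp D"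
  note N = right_actionD[OF n] and M = matesD(9-14)[OF T] and P = adjointD(3-8)[OF d, unfolded duality_sel] and m' = multD[OF m]
  note DD = dual_pair_nested[OF N(1) N(1)]
  have "\<forall>x\<in>car ((X \<otimes> X) \<otimes> ?B). fn \<nu> (fn (m \<boxtimes> idm ?B) x) = fn m (fn (\<nu> \<boxtimes> \<nu>) (fn (middle X X ?B ?B \<Theta>) (fn (idm (X \<otimes> X) \<boxtimes> d) x)))"
  proof (rule tensor3_ext_ball[of _ _ _ X])
    fix v w f assume f: "f \<in> car ?B" and v: "v \<in> car X" and w: "w \<in> car X"
    define k where "k = fn (assoc' X X (?A \<otimes> ?A))
        (fn (idm X \<boxtimes> (assoc X ?A ?A \<cdot> (S \<boxtimes> idm ?A) \<cdot> T)) (fn (assoc X ?A X) (pure (X \<otimes> ?A) X (fn S v) w)))"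
    have k: "k \<in> car ((X \<otimes> X) \<otimes> (?A \<otimes> ?A))" unfolding k_def using v w by (simp add: N(1-10) M arr_simps)
    have "\<forall>F\<in>car (?B \<otimes> ?B). fn (\<nu> \<boxtimes> \<nu>) (fn (middle X X ?B ?B \<Theta>) (pure (X \<otimes> X) (?B \<otimes> ?B) (pure X X v w) F)) = fn (rslice (X \<otimes> X) (D \<odot> D) F) k"
    proof (rule tensor_ext_ball[of _ _ "X \<otimes> X"])
      show "linear_map (?B \<otimes> ?B) (X \<otimes> X) (\<lambda>F. fn (rslice (X \<otimes> X) (D \<odot> D) F) k)"
        by (rule linear_map_rslice[OF DD vspace_tensor]) (use k in \<open>simp_all add: arr_simps\<close>)
    qed (use v w in \<open>simp_all add: N(1-10) M arr_simps lin_middle right_action_tensor[OF n T] k_def\<close>)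
    then have "fn m (fn (\<nu> \<boxtimes> \<nu>) (fn (middle X X ?B ?B \<Theta>) (pure (X \<otimes> X) (?B \<otimes> ?B) (pure X X v w) (fn d f)))) =
        fn m (fn (rslice (X \<otimes> X) (D \<odot> D) (fn d f)) k)"
      using f by (simp add: P arr_simps)
    also have "\<dots> = fn m (fn (rslice (X \<otimes> X) D f) (fn (idm (X \<otimes> X) \<boxtimes> \<mu>) k))"
      using rslice_tmap[OF d vspace_tensor f, of k X X] k by simp
    also have "\<dots> = fn (rslice X D f) (fn (m \<boxtimes> idm ?A) (fn (idm (X \<otimes> X) \<boxtimes> \<mu>) k))"
      by (rule rslice_natural[symmetric, OF N(1) m' f]) (use k in \<open>simp add: N(1-10) P arr_simps\<close>)
    also have "\<dots> = fn (rslice X D f) (fn S (fn m (pure X X v w)))"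
      using K[OF v w] by (simp add: k_def)
    finally show "fn \<nu> (fn (m \<boxtimes> idm ?B) (pure (X \<otimes> X) ?B (pure X X v w) f)) =
      fn m (fn (\<nu> \<boxtimes> \<nu>) (fn (middle X X ?B ?B \<Theta>) (fn (idm (X \<otimes> X) \<boxtimes> d) (pure (X \<otimes> X) ?B (pure X X v w) f))))"
      using f v w by (simp add: N P m' arr_simps)
  qed (simp_all add: N(1-10) M P m' arr_simps lin_middle)
  then show ?thesis by (intro arr_eqI) (simp_all add: N(1-10) P m')
qed

lemma middle_cong:
  assumes "lin f" "src f = B \<otimes> C" "tgt f = C \<otimes> B" "lin g" "src g = B \<otimes> C" "tgt g = C \<otimes> B"
    "vspace A" "vspace B" "vspace C" "vspace D" "\<And>y. y \<in> car (B \<otimes> C) \<Longrightarrow> fn f y = fn g y"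
    and x: "x \<in> car ((A \<otimes> B) \<otimes> (C \<otimes> D))"
  shows "fn (middle A B C D f) x = fn (middle A B C D g) x"
proof -
  have "\<forall>x\<in>car ((A \<otimes> B) \<otimes> (C \<otimes> D)). fn (middle A B C D f) x = fn (middle A B C D g) x"
    by (rule tensor22_ext_ball[of _ _ _ _ "(A \<otimes> C) \<otimes> (B \<otimes> D)"])
      (use assms in \<open>simp_all add: arr_simps lin_middle middle_pure\<close>)
  with x show ?thesis by blast
qed

section \<open>The coaction with respect to the twisted coproduct\<close>

text \<open>
  Let \<open>S = \<Omega>\<^sup>-\<^sup>1 \<rho>\<close>. The compatibility of \<open>\<rho>\<close> with \<open>\<Omega>\<close> expresses \<open>(id \<otimes> S) \<Omega>\<^sup>-\<^sup>1\<close> through \<open>\<rho> \<otimes> id\<close>, the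
  crossing of two strands \<open>H\<close> with \<open>V\<close>, and \<open>\<Psi>\<^sup>-\<^sup>1\<close>, where \<open>\<Psi>\<^sup>-\<^sup>1\<close> may be applied last because it slides
  through the crossing. Applied after \<open>\<rho>\<close>, this gives coassociativity for the coproduct \<open>\<Psi>\<^sup>-\<^sup>1 \<Delta>\<close>;
  cancelling \<open>\<Psi>\<^sup>-\<^sup>1\<close> gives the compatibility of \<open>S\<close> with \<open>\<Psi>\<close>.
\<close>

lemma twisted_right_coaction:
  assumes \<Psi>: "crossing H H \<Psi>" and \<Omega>: "crossing H V \<Omega>" "endo_slidesL H V \<Omega> \<Psi>"
    and d: "comult H d" "comult_slidesL H V \<Omega> d"
    and \<rho>: "lin \<rho>" "src \<rho> = V" "tgt \<rho> = V \<otimes> H"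
    and coassoc: "assoc V H H \<cdot> (\<rho> \<boxtimes> idm H) \<cdot> \<rho> \<doteq> (idm V \<boxtimes> d) \<cdot> \<rho>"
    and compat: "(\<rho> \<boxtimes> idm H) \<cdot> \<Omega>
     \<doteq> assoc' V H H \<cdot> (idm V \<boxtimes> \<Psi>) \<cdot> assoc V H H \<cdot> (\<Omega> \<boxtimes> idm H) \<cdot> assoc' H V H \<cdot> (idm H \<boxtimes> \<rho>)"
  shows "x \<in> car V \<Longrightarrow> fn (idm H \<boxtimes> (inv_arr \<Omega> \<cdot> \<rho>)) (fn (inv_arr \<Omega> \<cdot> \<rho>) x) =
      fn (assoc H H V) (fn ((inv_arr \<Psi> \<cdot> d) \<boxtimes> idm V) (fn (inv_arr \<Omega> \<cdot> \<rho>) x))"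
    and "y \<in> car (V \<otimes> H) \<Longrightarrow>
      fn (\<Psi> \<boxtimes> idm V) (fn (assoc' H H V) (fn (idm H \<boxtimes> (inv_arr \<Omega> \<cdot> \<rho>)) (fn (inv_arr \<Omega>) y))) =
      fn (assoc' H H V) (fn (idm H \<boxtimes> inv_arr \<Omega>) (fn (assoc H V H) (fn ((inv_arr \<Omega> \<cdot> \<rho>) \<boxtimes> idm H) y)))"
proof -
  let ?\<Theta> = "inv_arr \<Omega>" and ?\<Phi> = "inv_arr \<Psi>"
  note C = crossingD[OF \<Psi>] crossingD[OF \<Omega>(1)] comultD[OF d(1)] \<rho>
  have e: "endo H \<Psi>" by (simp add: endo_def C)
  have sR: "endo_slidesR V H ?\<Theta> \<Psi>" "comult_slidesR V H ?\<Theta> d"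
    using slidesL_slidesR[OF \<Omega>(1)] e \<Omega>(2) d by blast+
  have sR': "endo_slidesR V H ?\<Theta> ?\<Phi>"
    by (rule twisted_slidesR(1)[OF crossing_inv[OF \<Omega>(1)] e sR(1)])
  have cR: "lin (crossR V H ?\<Theta>)" by (rule lin_crossR[OF crossing_inv[OF \<Omega>(1)]])
  \<comment> \<open>the compatibility of \<open>\<rho>\<close> with \<open>\<Omega>\<close>, solved for \<open>inv_arr \<Omega>\<close>\<close>
  have c1: "fn (idm H \<boxtimes> \<rho>) (fn ?\<Theta> y) = fn (assoc H V H) (fn (?\<Theta> \<boxtimes> idm H) (fn (assoc' V H H)
      (fn (idm V \<boxtimes> ?\<Phi>) (fn (assoc V H H) (fn (\<rho> \<boxtimes> idm H) y)))))" if y: "y \<in> car (V \<otimes> H)" for y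
    using arr_eqD[OF compat, of "fn ?\<Theta> y"] y
    by (simp add: C arr_simps inv_arr_right inv_arr_left iso_assoc tmap_inv_cancel)
  have c2: "fn (idm H \<boxtimes> (?\<Theta> \<cdot> \<rho>)) (fn ?\<Theta> y) = fn (assoc H H V) (fn (?\<Phi> \<boxtimes> idm V)
      (fn (crossR V H ?\<Theta>) (fn (assoc V H H) (fn (\<rho> \<boxtimes> idm H) y))))" if y: "y \<in> car (V \<otimes> H)" for y
  proof -
    have "fn (idm H \<boxtimes> (?\<Theta> \<cdot> \<rho>)) (fn ?\<Theta> y) = fn (assoc H H V) (fn (crossR V H ?\<Theta>) (fn (idm V \<boxtimes> ?\<Phi>) (fn (assoc V H H) (fn (\<rho> \<boxtimes> idm H) y))))"
      using y by (simp add: C arr_simps c1 tmap_comp_right crossR_def inv_arr_right iso_assoc)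
    also have "\<dots> = fn (assoc H H V) (fn (?\<Phi> \<boxtimes> idm V) (fn (crossR V H ?\<Theta>) (fn (assoc V H H) (fn (\<rho> \<boxtimes> idm H) y))))"
      using y sR'[unfolded endo_slidesR_def slidesR_def, rule_format, of "fn (assoc V H H) (fn (\<rho> \<boxtimes> idm H) y)"] by (simp add: C arr_simps)
    finally show ?thesis .
  qed
  show "fn (idm H \<boxtimes> (?\<Theta> \<cdot> \<rho>)) (fn (?\<Theta> \<cdot> \<rho>) x) =
      fn (assoc H H V) (fn ((?\<Phi> \<cdot> d) \<boxtimes> idm V) (fn (?\<Theta> \<cdot> \<rho>) x))" if x: "x \<in> car V"
    using x c2[of "fn \<rho> x"] arr_eqD[OF coassoc, of x] sR(2)[unfolded comult_slidesR_def slidesR_def, rule_format, of "fn \<rho> x"]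
    by (simp add: C arr_simps tmap_comp_left)
  show "fn (\<Psi> \<boxtimes> idm V) (fn (assoc' H H V) (fn (idm H \<boxtimes> (?\<Theta> \<cdot> \<rho>)) (fn ?\<Theta> y))) =
      fn (assoc' H H V) (fn (idm H \<boxtimes> ?\<Theta>) (fn (assoc H V H) (fn ((?\<Theta> \<cdot> \<rho>) \<boxtimes> idm H) y)))" if y: "y \<in> car (V \<otimes> H)"
    unfolding c2[OF y] using y
    by (simp add: C arr_simps tmap_comp_left crossR_def inv_arr_left iso_assoc tmap_inv_cancel)
qed

lemma twisted_left_coaction:
  assumes \<Psi>: "crossing H H \<Psi>" and \<Omega>: "crossing V H \<Omega>" "endo_slidesR V H \<Omega> \<Psi>"
    and d: "comult H d" "comult_slidesR V H \<Omega> d"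
    and \<rho>: "lin \<rho>" "src \<rho> = V" "tgt \<rho> = H \<otimes> V"
    and coassoc: "(idm H \<boxtimes> \<rho>) \<cdot> \<rho> \<doteq> assoc H H V \<cdot> (d \<boxtimes> idm V) \<cdot> \<rho>"
    and compat: "(idm H \<boxtimes> \<rho>) \<cdot> \<Omega>
     \<doteq> assoc H H V \<cdot> (\<Psi> \<boxtimes> idm V) \<cdot> assoc' H H V \<cdot> (idm H \<boxtimes> \<Omega>) \<cdot> assoc H V H \<cdot> (\<rho> \<boxtimes> idm H)"
  shows "x \<in> car V \<Longrightarrow> fn (assoc V H H) (fn ((inv_arr \<Omega> \<cdot> \<rho>) \<boxtimes> idm H) (fn (inv_arr \<Omega> \<cdot> \<rho>) x)) =
      fn (idm V \<boxtimes> (inv_arr \<Psi> \<cdot> d)) (fn (inv_arr \<Omega> \<cdot> \<rho>) x)"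
    and "y \<in> car (H \<otimes> V) \<Longrightarrow>
      fn (idm V \<boxtimes> \<Psi>) (fn (assoc V H H) (fn ((inv_arr \<Omega> \<cdot> \<rho>) \<boxtimes> idm H) (fn (inv_arr \<Omega>) y))) =
      fn (assoc V H H) (fn (inv_arr \<Omega> \<boxtimes> idm H) (fn (assoc' H V H) (fn (idm H \<boxtimes> (inv_arr \<Omega> \<cdot> \<rho>)) y)))"
proof -
  let ?\<Theta> = "inv_arr \<Omega>" and ?\<Phi> = "inv_arr \<Psi>"
  note C = crossingD[OF \<Psi>] crossingD[OF \<Omega>(1)] comultD[OF d(1)] \<rho>
  have e: "endo H \<Psi>" by (simp add: endo_def C)
  have sL: "endo_slidesL H V ?\<Theta> \<Psi>" "comult_slidesL H V ?\<Theta> d"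
    using slidesR_slidesL[OF \<Omega>(1)] e \<Omega>(2) d by blast+
  have sL': "endo_slidesL H V ?\<Theta> ?\<Phi>"
    by (rule twisted_slidesL(1)[OF crossing_inv[OF \<Omega>(1)] e sL(1)])
  have cL: "lin (crossL H V ?\<Theta>)" by (rule lin_crossL[OF crossing_inv[OF \<Omega>(1)]])
  have c1: "fn (\<rho> \<boxtimes> idm H) (fn ?\<Theta> y) = fn (assoc' H V H) (fn (idm H \<boxtimes> ?\<Theta>) (fn (assoc H H V)
      (fn (?\<Phi> \<boxtimes> idm V) (fn (assoc' H H V) (fn (idm H \<boxtimes> \<rho>) y)))))" if y: "y \<in> car (H \<otimes> V)" for y
    using arr_eqD[OF compat, of "fn ?\<Theta> y"] y
    by (simp add: C arr_simps inv_arr_right inv_arr_left iso_assoc tmap_inv_cancel)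
  have c2: "fn ((?\<Theta> \<cdot> \<rho>) \<boxtimes> idm H) (fn ?\<Theta> y) = fn (assoc' V H H) (fn (idm V \<boxtimes> ?\<Phi>)
      (fn (crossL H V ?\<Theta>) (fn (assoc' H H V) (fn (idm H \<boxtimes> \<rho>) y))))" if y: "y \<in> car (H \<otimes> V)" for y
  proof -
    have "fn ((?\<Theta> \<cdot> \<rho>) \<boxtimes> idm H) (fn ?\<Theta> y) = fn (assoc' V H H) (fn (crossL H V ?\<Theta>) (fn (?\<Phi> \<boxtimes> idm V) (fn (assoc' H H V) (fn (idm H \<boxtimes> \<rho>) y))))"
      using y by (simp add: C arr_simps c1 tmap_comp_left crossL_def inv_arr_left iso_assoc)
    also have "\<dots> = fn (assoc' V H H) (fn (idm V \<boxtimes> ?\<Phi>) (fn (crossL H V ?\<Theta>) (fn (assoc' H H V) (fn (idm H \<boxtimes> \<rho>) y))))"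
      using y sL'[unfolded endo_slidesL_def slidesL_def, rule_format, of "fn (assoc' H H V) (fn (idm H \<boxtimes> \<rho>) y)"] by (simp add: C arr_simps)
    finally show ?thesis .
  qed
  show "fn (assoc V H H) (fn ((?\<Theta> \<cdot> \<rho>) \<boxtimes> idm H) (fn (?\<Theta> \<cdot> \<rho>) x)) =
      fn (idm V \<boxtimes> (?\<Phi> \<cdot> d)) (fn (?\<Theta> \<cdot> \<rho>) x)" if x: "x \<in> car V"
    using x c2[of "fn \<rho> x"] arr_eqD[OF coassoc, of x] sL(2)[unfolded comult_slidesL_def slidesL_def, rule_format, of "fn \<rho> x"] cL
    by (simp add: C arr_simps tmap_comp_right inv_arr_left inv_arr_right iso_assoc)
  show "fn (idm V \<boxtimes> \<Psi>) (fn (assoc V H H) (fn ((?\<Theta> \<cdot> \<rho>) \<boxtimes> idm H) (fn ?\<Theta> y))) =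
      fn (assoc V H H) (fn (?\<Theta> \<boxtimes> idm H) (fn (assoc' H V H) (fn (idm H \<boxtimes> (?\<Theta> \<cdot> \<rho>)) y)))" if y: "y \<in> car (H \<otimes> V)"
    unfolding c2[OF y] using y
    by (simp add: C arr_simps tmap_comp_right crossL_def inv_arr_right iso_assoc tmap_inv_cancel)
qed

text \<open>
  The coaction \<open>\<rho>\<close> is multiplicative into the braided tensor product algebra \<open>V \<otimes> H\<close>, and \<open>\<Omega>\<^sup>-\<^sup>1\<close> is an
  isomorphism of this algebra onto \<open>H \<otimes> V\<close>.
\<close>

lemma coaction_multiplicative:
  assumes \<Omega>: "crossing H V \<Omega>" and mH: "mult H mH" "mult_slidesL H V \<Omega> mH" and mV: "mult V mV" "mult_slidesR H V \<Omega> mV"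
    and \<rho>: "lin \<rho>" "src \<rho> = V" "tgt \<rho> = V \<otimes> H"
    and r: "\<rho> \<cdot> mV \<doteq> (mV \<boxtimes> mH) \<cdot> middle V H V H \<Omega> \<cdot> (\<rho> \<boxtimes> \<rho>)"
    and v: "v \<in> car V" and w: "w \<in> car V"
  shows "fn (inv_arr \<Omega> \<cdot> \<rho>) (fn mV (pure V V v w)) =
    fn (mH \<boxtimes> mV) (fn (middle H V H V (inv_arr \<Omega>)) (pure (H \<otimes> V) (H \<otimes> V) (fn (inv_arr \<Omega> \<cdot> \<rho>) v) (fn (inv_arr \<Omega> \<cdot> \<rho>) w)))"
proof -
  let ?\<Theta> = "inv_arr \<Omega>"
  note T = crossing_inv[OF \<Omega>]
  note C = crossingD[OF \<Omega>] crossingD[OF T] multD[OF mH(1)] multD[OF mV(1)] \<rho>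
  let ?x = "pure (V \<otimes> H) (V \<otimes> H) (fn \<rho> v) (fn \<rho> w)"
  have x: "?x \<in> car ((V \<otimes> H) \<otimes> (V \<otimes> H))" using v w by (simp add: C arr_simps)
  have "fn \<rho> (fn mV (pure V V v w)) = fn (mV \<boxtimes> mH) (fn (middle V H V H \<Omega>) ?x)"
    using arr_eqD[OF r, of "pure V V v w"] v w by (simp add: C arr_simps)
  also have "fn (middle V H V H \<Omega>) ?x = fn (middle V H V H (inv_arr ?\<Theta>)) ?x"
    by (rule middle_cong) (use x in \<open>simp_all add: C inv_inv_arr[OF \<Omega>]\<close>)
  finally have "fn ?\<Theta> (fn \<rho> (fn mV (pure V V v w))) = fn ?\<Theta> (fn (mV \<boxtimes> mH) (fn (middle V H V H (inv_arr ?\<Theta>)) ?x))"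
    by simp
  also have "\<dots> = fn (mH \<boxtimes> mV) (fn (middle H V H V ?\<Theta>) (fn (?\<Theta> \<boxtimes> ?\<Theta>) ?x))"
    by (rule crossing_multiplicative[OF T mV(1) slidesR_slidesL(2)[OF \<Omega> mV] mH(1) slidesL_slidesR(2)[OF \<Omega> mH] x])
  finally show ?thesis using v w by (simp add: C arr_simps)
qed

lemma left_coaction_multiplicative:
  assumes \<Omega>: "crossing V H \<Omega>" and mH: "mult H mH" "mult_slidesR V H \<Omega> mH" and mV: "mult V mV" "mult_slidesL V H \<Omega> mV"
    and \<rho>: "lin \<rho>" "src \<rho> = V" "tgt \<rho> = H \<otimes> V"
    and r: "\<rho> \<cdot> mV \<doteq> (mH \<boxtimes> mV) \<cdot> middle H V H V \<Omega> \<cdot> (\<rho> \<boxtimes> \<rho>)"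
    and v: "v \<in> car V" and w: "w \<in> car V"
  shows "fn (inv_arr \<Omega> \<cdot> \<rho>) (fn mV (pure V V v w)) =
    fn (mV \<boxtimes> mH) (fn (middle V H V H (inv_arr \<Omega>)) (pure (V \<otimes> H) (V \<otimes> H) (fn (inv_arr \<Omega> \<cdot> \<rho>) v) (fn (inv_arr \<Omega> \<cdot> \<rho>) w)))"
proof -
  let ?\<Theta> = "inv_arr \<Omega>"
  note T = crossing_inv[OF \<Omega>]
  note C = crossingD[OF \<Omega>] crossingD[OF T] multD[OF mH(1)] multD[OF mV(1)] \<rho>
  let ?x = "pure (H \<otimes> V) (H \<otimes> V) (fn \<rho> v) (fn \<rho> w)"
  have x: "?x \<in> car ((H \<otimes> V) \<otimes> (H \<otimes> V))" using v w by (simp add: C arr_simps)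
  have "fn \<rho> (fn mV (pure V V v w)) = fn (mH \<boxtimes> mV) (fn (middle H V H V \<Omega>) ?x)"
    using arr_eqD[OF r, of "pure V V v w"] v w by (simp add: C arr_simps)
  also have "fn (middle H V H V \<Omega>) ?x = fn (middle H V H V (inv_arr ?\<Theta>)) ?x"
    by (rule middle_cong) (use x in \<open>simp_all add: C inv_inv_arr[OF \<Omega>]\<close>)
  finally have "fn ?\<Theta> (fn \<rho> (fn mV (pure V V v w))) = fn ?\<Theta> (fn (mH \<boxtimes> mV) (fn (middle H V H V (inv_arr ?\<Theta>)) ?x))"
    by simp
  also have "\<dots> = fn (mV \<boxtimes> mH) (fn (middle V H V H ?\<Theta>) (fn (?\<Theta> \<boxtimes> ?\<Theta>) ?x))"
    by (rule crossing_multiplicative[OF T mH(1) slidesR_slidesL(2)[OF \<Omega> mH] mV(1) slidesL_slidesR(2)[OF \<Omega> mV] x])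
  finally show ?thesis using v w by (simp add: C arr_simps)
qed

text \<open>
  Here \<open>\<Psi>\<close> reorders the two factors in \<open>H\<close> that come from applying \<open>S\<close> after the crossing \<open>\<Theta>\<close>. By the
  compatibility \<open>c\<close> the result is the same as applying \<open>S\<close> first and crossing afterwards, and then
  \<open>m \<otimes> mV\<close> multiplies \<open>S v\<close> and \<open>S w\<close> in the braided tensor product.
\<close>

lemma left_coaction_product:
  assumes V: "vspace H" "vspace V" and \<Theta>: "lin \<Theta>" "src \<Theta> = V \<otimes> H" "tgt \<Theta> = H \<otimes> V" and S: "lin S" "src S = V" "tgt S = H \<otimes> V"
    and \<Psi>: "lin \<Psi>" "src \<Psi> = H \<otimes> H" "tgt \<Psi> = H \<otimes> H" and m: "mult H m" and mV: "mult V mV"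
    and c: "\<And>y. y \<in> car (V \<otimes> H) \<Longrightarrow> fn (\<Psi> \<boxtimes> idm V) (fn (assoc' H H V) (fn (idm H \<boxtimes> S) (fn \<Theta> y))) =
      fn (assoc' H H V) (fn (idm H \<boxtimes> \<Theta>) (fn (assoc H V H) (fn (S \<boxtimes> idm H) y)))"
    and p: "fn S (fn mV (pure V V v w)) = fn (m \<boxtimes> mV) (fn (middle H V H V \<Theta>) (pure (H \<otimes> V) (H \<otimes> V) (fn S v) (fn S w)))"
    and v: "v \<in> car V" and w: "w \<in> car V"
  shows "fn (idm H \<boxtimes> mV) (fn ((m \<cdot> \<Psi>) \<boxtimes> idm (V \<otimes> V)) (fn (assoc (H \<otimes> H) V V)
        (fn ((assoc' H H V \<cdot> (idm H \<boxtimes> S) \<cdot> \<Theta>) \<boxtimes> idm V) (fn (assoc' V H V) (pure V (H \<otimes> V) v (fn S w))))))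
      = fn S (fn mV (pure V V v w))"
proof -
  note C = V \<Theta> S \<Psi> multD[OF m] multD[OF mV]
  let ?G = "assoc' H H V \<cdot> (idm H \<boxtimes> S) \<cdot> \<Theta>" and ?R = "assoc' H H V \<cdot> (idm H \<boxtimes> \<Theta>) \<cdot> assoc H V H \<cdot> (S \<boxtimes> idm H)"
  have z: "fn (assoc' V H V) (pure V (H \<otimes> V) v u) \<in> car ((V \<otimes> H) \<otimes> V)" if "u \<in> car (H \<otimes> V)" for u
    using that v by (simp add: C arr_simps)
  have 1: "fn (\<Psi> \<boxtimes> idm (V \<otimes> V)) (fn (assoc (H \<otimes> H) V V) (fn (?G \<boxtimes> idm V) z)) = fn (assoc (H \<otimes> H) V V) (fn (?R \<boxtimes> idm V) z)"
    if z: "z \<in> car ((V \<otimes> H) \<otimes> V)" for z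
  proof -
    have "fn (\<Psi> \<boxtimes> idm (V \<otimes> V)) (fn (assoc (H \<otimes> H) V V) (fn (?G \<boxtimes> idm V) z)) =
        fn (assoc (H \<otimes> H) V V) (fn ((\<Psi> \<boxtimes> idm V) \<boxtimes> idm V) (fn (?G \<boxtimes> idm V) z))"
      by (rule assoc_natural1(1)[symmetric]) (use z in \<open>simp_all add: C arr_simps\<close>)
    also have "\<dots> = fn (assoc (H \<otimes> H) V V) (fn (((\<Psi> \<boxtimes> idm V) \<cdot> ?G) \<boxtimes> idm V) z)"
      by (subst tmap_comp_left) (use z in \<open>simp_all add: C arr_simps\<close>)
    also have "fn (((\<Psi> \<boxtimes> idm V) \<cdot> ?G) \<boxtimes> idm V) z = fn (?R \<boxtimes> idm V) z"
      by (rule tmap_cong) (use z c in \<open>simp_all add: C arr_simps\<close>)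
    finally show ?thesis .
  qed
  have 2: "\<forall>r\<in>car (H \<otimes> V). fn (assoc (H \<otimes> H) V V) (pure ((H \<otimes> H) \<otimes> V) V (fn (assoc' H H V) (pure H (H \<otimes> V) h r)) x) =
      fn (assoc' H H (V \<otimes> V)) (pure H (H \<otimes> (V \<otimes> V)) h (fn (assoc H V V) (pure (H \<otimes> V) V r x)))"
    if "h \<in> car H" "x \<in> car V" for h x
    by (rule tensor_ext_ball[of _ _ "(H \<otimes> H) \<otimes> (V \<otimes> V)"]) (use that in \<open>simp_all add: C arr_simps\<close>)
  have 3: "\<forall>s\<in>car (H \<otimes> V). fn (assoc (H \<otimes> H) V V) (pure ((H \<otimes> H) \<otimes> V) V (fn (assoc' H H V) (fn (idm H \<boxtimes> \<Theta>) (fn (assoc H V H) (pure (H \<otimes> V) H s h)))) x) =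
      fn (middle H V H V \<Theta>) (pure (H \<otimes> V) (H \<otimes> V) s (pure H V h x))"
    if "h \<in> car H" "x \<in> car V" for h x
    by (rule tensor_ext_ball[of _ _ "(H \<otimes> H) \<otimes> (V \<otimes> V)"]) (use that in \<open>simp_all add: C arr_simps 2 middle_pure lin_middle\<close>)
  have "\<forall>u\<in>car (H \<otimes> V). fn (assoc (H \<otimes> H) V V) (fn (?R \<boxtimes> idm V) (fn (assoc' V H V) (pure V (H \<otimes> V) v u))) =
      fn (middle H V H V \<Theta>) (pure (H \<otimes> V) (H \<otimes> V) (fn S v) u)"
    by (rule tensor_ext_ball[of _ _ "(H \<otimes> H) \<otimes> (V \<otimes> V)"]) (use v in \<open>simp_all add: C arr_simps 3 lin_middle\<close>)
  then have 4: "fn (assoc (H \<otimes> H) V V) (fn (?R \<boxtimes> idm V) (fn (assoc' V H V) (pure V (H \<otimes> V) v (fn S w)))) =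
      fn (middle H V H V \<Theta>) (pure (H \<otimes> V) (H \<otimes> V) (fn S v) (fn S w))"
    using w by (simp add: C arr_simps)
  let ?z = "fn (assoc' V H V) (pure V (H \<otimes> V) v (fn S w))"
  have z': "?z \<in> car ((V \<otimes> H) \<otimes> V)" using w by (intro z) (simp add: C arr_simps)
  have "fn ((m \<cdot> \<Psi>) \<boxtimes> idm (V \<otimes> V)) (fn (assoc (H \<otimes> H) V V) (fn (?G \<boxtimes> idm V) ?z)) =
      fn (m \<boxtimes> idm (V \<otimes> V)) (fn (\<Psi> \<boxtimes> idm (V \<otimes> V)) (fn (assoc (H \<otimes> H) V V) (fn (?G \<boxtimes> idm V) ?z)))"
    by (rule tmap_comp_left) (use z' in \<open>simp_all add: C arr_simps\<close>)
  also have "\<dots> = fn (m \<boxtimes> idm (V \<otimes> V)) (fn (middle H V H V \<Theta>) (pure (H \<otimes> V) (H \<otimes> V) (fn S v) (fn S w)))"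
    unfolding 1[OF z'] 4 ..
  finally show ?thesis
    unfolding p using v w tmap_split_left_first[of m mV "H \<otimes> H" V "fn (middle H V H V \<Theta>) (pure (H \<otimes> V) (H \<otimes> V) (fn S v) (fn S w))"]
    by (simp add: C arr_simps lin_middle)
qed

lemma right_coaction_product:
  assumes V: "vspace H" "vspace V" and \<Theta>: "lin \<Theta>" "src \<Theta> = H \<otimes> V" "tgt \<Theta> = V \<otimes> H" and S: "lin S" "src S = V" "tgt S = V \<otimes> H"
    and \<Psi>: "lin \<Psi>" "src \<Psi> = H \<otimes> H" "tgt \<Psi> = H \<otimes> H" and m: "mult H m" and mV: "mult V mV"
    and c: "\<And>y. y \<in> car (H \<otimes> V) \<Longrightarrow> fn (idm V \<boxtimes> \<Psi>) (fn (assoc V H H) (fn (S \<boxtimes> idm H) (fn \<Theta> y))) =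
      fn (assoc V H H) (fn (\<Theta> \<boxtimes> idm H) (fn (assoc' H V H) (fn (idm H \<boxtimes> S) y)))"
    and p: "fn S (fn mV (pure V V v w)) = fn (mV \<boxtimes> m) (fn (middle V H V H \<Theta>) (pure (V \<otimes> H) (V \<otimes> H) (fn S v) (fn S w)))"
    and v: "v \<in> car V" and w: "w \<in> car V"
  shows "fn (mV \<boxtimes> idm H) (fn (idm (V \<otimes> V) \<boxtimes> (m \<cdot> \<Psi>)) (fn (assoc' V V (H \<otimes> H))
        (fn (idm V \<boxtimes> (assoc V H H \<cdot> (S \<boxtimes> idm H) \<cdot> \<Theta>)) (fn (assoc V H V) (pure (V \<otimes> H) V (fn S v) w)))))
      = fn S (fn mV (pure V V v w))"
proof -
  note C = V \<Theta> S \<Psi> multD[OF m] multD[OF mV]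
  let ?G = "assoc V H H \<cdot> (S \<boxtimes> idm H) \<cdot> \<Theta>" and ?R = "assoc V H H \<cdot> (\<Theta> \<boxtimes> idm H) \<cdot> assoc' H V H \<cdot> (idm H \<boxtimes> S)"
  have 1: "fn (idm (V \<otimes> V) \<boxtimes> \<Psi>) (fn (assoc' V V (H \<otimes> H)) (fn (idm V \<boxtimes> ?G) z)) = fn (assoc' V V (H \<otimes> H)) (fn (idm V \<boxtimes> ?R) z)"
    if z: "z \<in> car (V \<otimes> (H \<otimes> V))" for z
  proof -
    have "fn (idm (V \<otimes> V) \<boxtimes> \<Psi>) (fn (assoc' V V (H \<otimes> H)) (fn (idm V \<boxtimes> ?G) z)) =
        fn (assoc' V V (H \<otimes> H)) (fn (idm V \<boxtimes> (idm V \<boxtimes> \<Psi>)) (fn (idm V \<boxtimes> ?G) z))"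
      by (rule assoc_natural3(2)[symmetric]) (use z in \<open>simp_all add: C arr_simps\<close>)
    also have "\<dots> = fn (assoc' V V (H \<otimes> H)) (fn (idm V \<boxtimes> ((idm V \<boxtimes> \<Psi>) \<cdot> ?G)) z)"
      by (subst tmap_comp_right) (use z in \<open>simp_all add: C arr_simps\<close>)
    also have "fn (idm V \<boxtimes> ((idm V \<boxtimes> \<Psi>) \<cdot> ?G)) z = fn (idm V \<boxtimes> ?R) z"
      by (rule tmap_cong) (use z c in \<open>simp_all add: C arr_simps\<close>)
    finally show ?thesis .
  qed
  have 3: "\<forall>s\<in>car (V \<otimes> H). fn (assoc' V V (H \<otimes> H)) (pure V (V \<otimes> (H \<otimes> H)) x (fn (assoc V H H) (fn (\<Theta> \<boxtimes> idm H) (fn (assoc' H V H) (pure H (V \<otimes> H) h s))))) =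
      fn (middle V H V H \<Theta>) (pure (V \<otimes> H) (V \<otimes> H) (pure V H x h) s)"
    if "h \<in> car H" "x \<in> car V" for h x
    by (rule tensor_ext_ball[of _ _ "(V \<otimes> V) \<otimes> (H \<otimes> H)"]) (use that in \<open>simp_all add: C arr_simps middle_pure lin_middle\<close>)
  have "\<forall>u\<in>car (V \<otimes> H). fn (assoc' V V (H \<otimes> H)) (fn (idm V \<boxtimes> ?R) (fn (assoc V H V) (pure (V \<otimes> H) V u w))) =
      fn (middle V H V H \<Theta>) (pure (V \<otimes> H) (V \<otimes> H) u (fn S w))"
    by (rule tensor_ext_ball[of _ _ "(V \<otimes> V) \<otimes> (H \<otimes> H)"]) (use w in \<open>simp_all add: C arr_simps 3 lin_middle\<close>)
  then have 4: "fn (assoc' V V (H \<otimes> H)) (fn (idm V \<boxtimes> ?R) (fn (assoc V H V) (pure (V \<otimes> H) V (fn S v) w))) =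
      fn (middle V H V H \<Theta>) (pure (V \<otimes> H) (V \<otimes> H) (fn S v) (fn S w))"
    using v by (simp add: C arr_simps)
  let ?z = "fn (assoc V H V) (pure (V \<otimes> H) V (fn S v) w)"
  have z': "?z \<in> car (V \<otimes> (H \<otimes> V))" using v w by (simp add: C arr_simps)
  have "fn (idm (V \<otimes> V) \<boxtimes> (m \<cdot> \<Psi>)) (fn (assoc' V V (H \<otimes> H)) (fn (idm V \<boxtimes> ?G) ?z)) =
      fn (idm (V \<otimes> V) \<boxtimes> m) (fn (idm (V \<otimes> V) \<boxtimes> \<Psi>) (fn (assoc' V V (H \<otimes> H)) (fn (idm V \<boxtimes> ?G) ?z)))"
    by (rule tmap_comp_right) (use z' in \<open>simp_all add: C arr_simps\<close>)
  also have "\<dots> = fn (idm (V \<otimes> V) \<boxtimes> m) (fn (middle V H V H \<Theta>) (pure (V \<otimes> H) (V \<otimes> H) (fn S v) (fn S w)))"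
    unfolding 1[OF z'] 4 ..
  finally show ?thesis
    unfolding p using v w tmap_split_right_first[of mV m "fn (middle V H V H \<Theta>) (pure (V \<otimes> H) (V \<otimes> H) (fn S v) (fn S w))"]
    by (simp add: C arr_simps lin_middle)
qed

section \<open>Elements of the dual of a tensor product\<close>

lemma car_dual: "f \<in> car (dual W) \<longleftrightarrow> linear_map W ground f \<and> (\<forall>x. x \<notin> car W \<longrightarrow> f x = 0)"
  by (simp add: dual_def)

lemma functional_in_dual: "vspace W \<Longrightarrow> linear_map W ground g \<Longrightarrow> functional W g \<in> car (dual W)"
  by (auto simp: car_dual functional_def linear_map_def vspaceD)

lemma linear_map_into_dual:
  assumes X: "vspace X" and F: "\<And>x. x \<in> car X \<Longrightarrow> F x \<in> car (dual W)"
    and l: "\<And>w. w \<in> car W \<Longrightarrow> linear_map X ground (\<lambda>x. F x w)"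
  shows "linear_map X (dual W) F"
  unfolding linear_map_def
proof (intro conjI ballI allI)
  fix x y c assume x: "x \<in> car X"
  show "F x \<in> car (dual W)" by (rule F[OF x])
  have s: "F (scl X c x) w = c * F x w" for w
    using l[of w] F[OF x] F[OF vspaceD(3)[OF X x]] x
    by (cases "w \<in> car W") (auto simp: linear_map_def ground_def car_dual)
  show "F (scl X c x) = scl (dual W) c (F x)" by (rule ext) (simp add: s dual_def)
  assume y: "y \<in> car X"
  have a: "F (x + y) w = F x w + F y w" for w
    using l[of w] F[OF x] F[OF y] F[OF vspaceD(2)[OF X x y]] x y
    by (cases "w \<in> car W") (auto simp: linear_map_def car_dual)
  show "F (x + y) = F x + F y" by (rule ext) (simp add: a)
qed

text \<open>
  A form \<open>G\<close> that is linear in each of its four arguments is a linear map from \<open>X \<otimes> Y\<close> to the dual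
  of \<open>P \<otimes> Q\<close>.
\<close>

context
  fixes X :: "('k::field, 'x::ab_group_add) vs" and Y :: "('k, 'y::ab_group_add) vs"
    and P :: "('k, 'p::ab_group_add) vs" and Q :: "('k, 'q::ab_group_add) vs"
    and G :: "'x \<Rightarrow> 'y \<Rightarrow> 'p \<Rightarrow> 'q \<Rightarrow> 'k"
  assumes X: "vspace X" and Y: "vspace Y"
    and PQ: "\<And>x y. x \<in> car X \<Longrightarrow> y \<in> car Y \<Longrightarrow> bilinear_map P Q ground (G x y)"
    and XY: "\<And>p q. p \<in> car P \<Longrightarrow> q \<in> car Q \<Longrightarrow> bilinear_map X Y ground (\<lambda>x y. G x y p q)"
begin

lemma tform_mem: "x \<in> car X \<Longrightarrow> y \<in> car Y \<Longrightarrow> tform P Q (G x y) \<in> car (dual (P \<otimes> Q))"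
  unfolding tform_def by (intro functional_in_dual vspace_tensor tlift_linear[OF vspace_ground PQ])

lemma tform_pure: "x \<in> car X \<Longrightarrow> y \<in> car Y \<Longrightarrow> p \<in> car P \<Longrightarrow> q \<in> car Q \<Longrightarrow> tform P Q (G x y) (pure P Q p q) = G x y p q"
  by (simp add: tform_def functional_def pure_in_tensor tlift_pure[OF vspace_ground PQ])

lemma tform_linear: "x \<in> car X \<Longrightarrow> y \<in> car Y \<Longrightarrow> linear_map (P \<otimes> Q) ground (tform P Q (G x y))"
  using tform_mem car_dual by blast

lemma tform_bilinear: "bilinear_map X Y (dual (P \<otimes> Q)) (\<lambda>x y. tform P Q (G x y))"
proof (rule bilinear_mapI)
  fix x assume x: "x \<in> car X"
  show "linear_map Y (dual (P \<otimes> Q)) (\<lambda>y. tform P Q (G x y))"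
  proof (rule linear_map_into_dual[OF Y tform_mem[OF x]])
    fix t assume "t \<in> car (P \<otimes> Q)"
    then show "linear_map Y ground (\<lambda>y. tform P Q (G x y) t)"
    proof (rule linear_map_parameter[OF Y vspace_ground _ tform_linear[OF x]])
      fix p q assume pq: "p \<in> car P" "q \<in> car Q"
      then have "linear_map Y ground (\<lambda>y. G x y p q)" using XY[OF pq] x by (simp add: bilinear_map_def)
      then show "linear_map Y ground (\<lambda>y. tform P Q (G x y) (pure P Q p q))"
        by (rule linear_map_cong) (use x pq Y in \<open>simp_all add: tform_pure\<close>)
    qed
  qed
next
  fix y assume y: "y \<in> car Y"
  show "linear_map X (dual (P \<otimes> Q)) (\<lambda>x. tform P Q (G x y))"
  proof (rule linear_map_into_dual[OF X tform_mem[OF _ y]])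
    fix t assume "t \<in> car (P \<otimes> Q)"
    then show "linear_map X ground (\<lambda>x. tform P Q (G x y) t)"
    proof (rule linear_map_parameter[OF X vspace_ground _ tform_linear[OF _ y]])
      fix p q assume pq: "p \<in> car P" "q \<in> car Q"
      then have "linear_map X ground (\<lambda>x. G x y p q)" using XY[OF pq] y by (simp add: bilinear_map_def)
      then show "linear_map X ground (\<lambda>x. tform P Q (G x y) (pure P Q p q))"
        by (rule linear_map_cong) (use y pq X in \<open>simp_all add: tform_pure\<close>)
    qed
  qed
qed

lemmas vspace_dual_tensor = vspace_dual[OF vspace_tensor[of P Q]]

lemma linear_map_tform_lift: "linear_map (X \<otimes> Y) (dual (P \<otimes> Q)) (tlift X Y (dual (P \<otimes> Q)) (\<lambda>x y. tform P Q (G x y)))"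
  by (rule tlift_linear[OF vspace_dual_tensor tform_bilinear])

lemma tform_lift_pure: "x \<in> car X \<Longrightarrow> y \<in> car Y \<Longrightarrow> p \<in> car P \<Longrightarrow> q \<in> car Q \<Longrightarrow>
    tlift X Y (dual (P \<otimes> Q)) (\<lambda>x y. tform P Q (G x y)) (pure X Y x y) (pure P Q p q) = G x y p q"
  by (simp add: tlift_pure[OF vspace_dual_tensor tform_bilinear] tform_pure)

end

lemma embed_src_tgt [simp]: "src (embed X b P Y c Q) = X \<otimes> Y" "tgt (embed X b P Y c Q) = dual (P \<otimes> Q)"
  by (simp_all add: embed_def)

text \<open>
  The embedding pairs the factors in parallel, whereas the nested pairing reverses them; hence the
  exchange of \<open>x\<close> and \<open>y\<close>.
\<close>

lemma
  assumes D: "dual_pair D" and E: "dual_pair E"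
  shows lin_embed: "lin (embed (lsp D) (form D) (rsp D) (lsp E) (form E) (rsp E))"
    and embed_eval: "t \<in> car (lsp D \<otimes> lsp E) \<Longrightarrow> x \<in> car (rsp D) \<Longrightarrow> y \<in> car (rsp E) \<Longrightarrow>
      fn (embed (lsp D) (form D) (rsp D) (lsp E) (form E) (rsp E)) t (pure (rsp D) (rsp E) x y) =
      form (D \<odot> E) t (pure (rsp E) (rsp D) y x)"
proof -
  let ?e = "embed (lsp D) (form D) (rsp D) (lsp E) (form E) (rsp E)"
  note C = dual_pairD[OF D] dual_pairD[OF E] dual_pairD[OF dual_pair_nested[OF D E]]
  have 1: "bilinear_map (rsp D) (rsp E) ground (\<lambda>p q. form D a p * form E b q)" if "a \<in> car (lsp D)" "b \<in> car (lsp E)" for a b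
    using that by (intro bilinear_mapI) (auto intro!: linear_map_mult C(4,5,9,10) linear_map_identity)
  have 2: "bilinear_map (lsp D) (lsp E) ground (\<lambda>a b. form D a p * form E b q)" if "p \<in> car (rsp D)" "q \<in> car (rsp E)" for p q
    using that by (intro bilinear_mapI) (auto intro!: linear_map_mult C(3,8) linear_map_identity)
  note G = C(1) C(6) 1 2
  have l: "linear_map (lsp D \<otimes> lsp E) (dual (rsp D \<otimes> rsp E)) (fn ?e)"
    using linear_map_tform_lift[OF G] by (simp add: embed_def)
  then show "lin ?e" by (simp add: lin_def vspace_tensor vspace_dual)
  have ev: "linear_map (dual W) ground (\<lambda>f. f w)" for W :: "('a, 'z::ab_group_add) vs" and w
    by (auto simp: linear_map_def dual_def ground_def)
  assume t: "t \<in> car (lsp D \<otimes> lsp E)" and x: "x \<in> car (rsp D)" and y: "y \<in> car (rsp E)"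
  have "\<forall>t\<in>car (lsp D \<otimes> lsp E). fn ?e t (pure (rsp D) (rsp E) x y) = form (D \<odot> E) t (pure (rsp E) (rsp D) y x)"
  proof (rule tensor_ext_ball[of _ _ ground])
    show "linear_map (lsp D \<otimes> lsp E) ground (\<lambda>t. fn ?e t (pure (rsp D) (rsp E) x y))"
      by (rule linear_map_compose[OF ev l])
    show "linear_map (lsp D \<otimes> lsp E) ground (\<lambda>t. form (D \<odot> E) t (pure (rsp E) (rsp D) y x))"
      using C(13)[OF linear_map_identity[OF refl]] x y by (simp add: pure_in_tensor)
    fix a b assume "a \<in> car (lsp D)" "b \<in> car (lsp E)"
    then show "fn ?e (pure (lsp D) (lsp E) a b) (pure (rsp D) (rsp E) x y) = form (D \<odot> E) (pure (lsp D) (lsp E) a b) (pure (rsp E) (rsp D) y x)"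
      using x y tform_lift_pure[OF G] by (simp add: embed_def nested_pure D E)
  qed
  with t show "fn ?e t (pure (rsp D) (rsp E) x y) = form (D \<odot> E) t (pure (rsp E) (rsp D) y x)" by blast
qed

lemma embed_inj:
  assumes D: "left_nondegenerate D" and E: "left_nondegenerate E"
  shows "inj_on (fn (embed (lsp D) (form D) (rsp D) (lsp E) (form E) (rsp E))) (car (lsp D \<otimes> lsp E))"
proof (rule inj_onI)
  note D' = left_nondegenerate_dual_pair[OF D] and E' = left_nondegenerate_dual_pair[OF E]
  note N = dual_pair_nested[OF D' E']
  fix s t assume s: "s \<in> car (lsp D \<otimes> lsp E)" and t: "t \<in> car (lsp D \<otimes> lsp E)"
    and e: "fn (embed (lsp D) (form D) (rsp D) (lsp E) (form E) (rsp E)) s = fn (embed (lsp D) (form D) (rsp D) (lsp E) (form E) (rsp E)) t"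
  have "\<forall>z\<in>car (rsp E \<otimes> rsp D). form (D \<odot> E) s z = form (D \<odot> E) t z"
  proof (rule tensor_ext_ball[of _ _ ground])
    fix y x assume "y \<in> car (rsp E)" "x \<in> car (rsp D)"
    then show "form (D \<odot> E) s (pure (rsp E) (rsp D) y x) = form (D \<odot> E) t (pure (rsp E) (rsp D) y x)"
      using embed_eval[OF D' E' s, of x y] embed_eval[OF D' E' t, of x y] e by simp
  qed (use dual_pairD(5)[OF N] s t in simp_all)
  then show "s = t" by (intro eq_by_form[OF left_nondegenerate_nested[OF D E]]) (use s t in auto)
qed

lemma corestrict_src_tgt [simp]: "src (corestrict \<iota> \<Phi>) = src \<Phi>" "tgt (corestrict \<iota> \<Phi>) = src \<iota>"
  by (simp_all add: corestrict_def)

text \<open>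
  Since \<open>\<iota>\<close> is injective and linear, linearity of the corestriction can be checked after applying \<open>\<iota>\<close>.
\<close>

lemma
  assumes i: "lin \<iota>" "inj_on (fn \<iota>) (car (src \<iota>))" and p: "lin \<Phi>" "tgt \<Phi> = tgt \<iota>" and b: "bijective_onto \<iota> \<Phi>"
  shows iso_corestrict: "iso (corestrict \<iota> \<Phi>)"
    and corestrict_eval: "x \<in> car (src \<Phi>) \<Longrightarrow> fn \<iota> (fn (corestrict \<iota> \<Phi>) x) = fn \<Phi> x"
proof -
  let ?c = "fn (corestrict \<iota> \<Phi>)"
  have b': "bij_betw (fn \<Phi>) (car (src \<Phi>)) (fn \<iota> ` car (src \<iota>))" using b by (simp add: bijective_onto_def)
  have im: "fn \<Phi> x \<in> fn \<iota> ` car (src \<iota>)" if "x \<in> car (src \<Phi>)" for x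
    using b' that by (auto simp: bij_betw_def)
  show ev: "fn \<iota> (?c x) = fn \<Phi> x" if "x \<in> car (src \<Phi>)" for x
    using im[OF that] by (simp add: corestrict_def f_inv_into_f)
  have mem: "?c x \<in> car (src \<iota>)" if "x \<in> car (src \<Phi>)" for x
    using im[OF that] by (simp add: corestrict_def inv_into_into)
  have V: "vspace (src \<Phi>)" "vspace (src \<iota>)" using lin_vspace i p by auto
  have L: "linear_map (src \<Phi>) (tgt \<iota>) (fn \<Phi>)" "linear_map (src \<iota>) (tgt \<iota>) (fn \<iota>)"
    using i p by (simp_all add: lin_def)
  have "linear_map (src \<Phi>) (src \<iota>) ?c"
    unfolding linear_map_def
  proof (intro conjI ballI allI)
    fix x y c assume x: "x \<in> car (src \<Phi>)"
    show "?c x \<in> car (src \<iota>)" by (rule mem[OF x])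
    show "?c (scl (src \<Phi>) c x) = scl (src \<iota>) c (?c x)"
      by (rule inj_onD[OF i(2)]) (use L x in \<open>simp_all add: ev mem V vspaceD linear_map_def\<close>)
    assume y: "y \<in> car (src \<Phi>)"
    show "?c (x + y) = ?c x + ?c y"
      by (rule inj_onD[OF i(2)]) (use L x y in \<open>simp_all add: ev mem V vspaceD linear_map_def\<close>)
  qed
  moreover have "bij_betw ?c (car (src \<Phi>)) (car (src \<iota>))"
  proof -
    have "bij_betw (inv_into (car (src \<iota>)) (fn \<iota>)) (fn \<iota> ` car (src \<iota>)) (car (src \<iota>))"
      using i(2) by (simp add: bij_betw_inv_into inj_on_imp_bij_betw)
    from bij_betw_trans[OF b' this] show ?thesis by (simp add: corestrict_def comp_def o_def)
  qed
  ultimately show "iso (corestrict \<iota> \<Phi>)" using V by (simp add: iso_def lin_def)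
qed

section \<open>Subspaces of the dual\<close>

definition evaluation :: "('k::field, 'h::ab_group_add) vs \<Rightarrow> ('h \<Rightarrow> 'k) set \<Rightarrow> ('k, 'h \<Rightarrow> 'k, 'h) duality" where
  "evaluation H U = \<lparr>lsp = dual_sub H U, rsp = H, form = (\<lambda>f a. f a)\<rparr>"

text \<open>
  This duality only serves to test equalities in \<open>V\<close> by functionals, as the values of \<open>\<Psi>\<^sub>U\<^sub>V\<^sup>\<circ>\<close> are given by
  their pairings with elements of \<open>V'\<close>.
\<close>

definition coevaluation :: "('k::field, 'v::ab_group_add) vs \<Rightarrow> ('k, 'v, 'v \<Rightarrow> 'k) duality" where
  "coevaluation V = \<lparr>lsp = V, rsp = dual V, form = (\<lambda>v e. e v)\<rparr>"

lemma evaluation_sel [simp]: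
  "lsp (evaluation H U) = dual_sub H U" "rsp (evaluation H U) = H" "form (evaluation H U) = (\<lambda>f a. f a)"
  "lsp (coevaluation V) = V" "rsp (coevaluation V) = dual V" "form (coevaluation V) = (\<lambda>v e. e v)"
  by (simp_all add: evaluation_def coevaluation_def)

lemma dual_sub_sel: "car (dual_sub H U) = U" "scl (dual_sub H U) = (\<lambda>c f x. c * f x)"
  by (simp_all add: dual_sub_def dual_def)

lemma coevaluation_nondegenerate:
  assumes V: "vspace V"
  shows "left_nondegenerate (coevaluation V)"
proof -
  have "dual_pair (coevaluation V)"
    using vspace_dual[OF V] V unfolding dual_pair_def
    by (auto intro!: bilinear_mapI simp: car_dual) (auto simp: linear_map_def dual_def ground_def)
  then show ?thesis using dual_separates[OF V] by (auto simp: left_nondegenerate_def)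
qed

lemma bilinear_map_cong:
  "bilinear_map V W X b \<Longrightarrow> (\<And>v w. v \<in> car V \<Longrightarrow> w \<in> car W \<Longrightarrow> c v w = b v w) \<Longrightarrow> vspace V \<Longrightarrow> vspace W
    \<Longrightarrow> bilinear_map V W X c"
  unfolding bilinear_map_def by (auto intro: linear_map_cong)

locale dual_subspace =
  fixes H :: "('k::field, 'h::ab_group_add) vs" and U :: "('h \<Rightarrow> 'k) set"
  assumes H: "vspace H" and U: "nondegenerate_subspace H U"
begin

abbreviation (input) "D \<equiv> evaluation H U"
abbreviation (input) "DU \<equiv> dual_sub H U"

lemma vspace_dual_sub: "vspace DU"
  using U vspace_dual[OF H] by (simp add: nondegenerate_subspace_def vspace_def dual_sub_def)

lemma dual_sub_linear: "f \<in> U \<Longrightarrow> linear_map H ground f" "f \<in> U \<Longrightarrow> x \<notin> car H \<Longrightarrow> f x = 0"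
  using U by (auto simp: nondegenerate_subspace_def car_dual)

lemma evaluation_nondegenerate: "left_nondegenerate D"
proof -
  have P: "dual_pair D"
    unfolding dual_pair_def
    by (auto intro!: bilinear_mapI simp: H vspace_dual_sub dual_sub_sel dual_sub_linear)
      (auto simp: linear_map_def dual_sub_sel ground_def)
  have "f = 0" if "f \<in> U" "\<And>a. a \<in> car H \<Longrightarrow> f a = 0" for f
    using that dual_sub_linear(2)[OF that(1)] by (intro ext) (auto simp: zero_fun_def)
  then show ?thesis using P by (auto simp: left_nondegenerate_def dual_sub_sel)
qed

lemmas evaluation_pair = left_nondegenerate_dual_pair[OF evaluation_nondegenerate]
lemmas evaluation_pair2 = dual_pair_nested[OF evaluation_pair evaluation_pair]
lemmas evaluation_nondegenerate2 = left_nondegenerate_nested[OF evaluation_nondegenerate evaluation_nondegenerate]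

lemma pairing_evaluation: "f \<in> U \<Longrightarrow> g \<in> U \<Longrightarrow> t \<in> car (H \<otimes> H) \<Longrightarrow> pairing H H f g t = form (D \<odot> D) (pure DU DU f g) t"
  using form_nested_pure[OF evaluation_pair evaluation_pair, of f g t] by (simp add: pairing_def dual_sub_sel)

lemmas lin_emb_UU = lin_embed[OF evaluation_pair evaluation_pair, simplified, folded emb_UU_def]
lemmas emb_UU_eval = embed_eval[OF evaluation_pair evaluation_pair, simplified, folded emb_UU_def]
lemmas emb_UU_inj = embed_inj[OF evaluation_nondegenerate evaluation_nondegenerate, simplified, folded emb_UU_def]

lemma emb_UU_src_tgt: "src (emb_UU H U) = DU \<otimes> DU" "tgt (emb_UU H U) = dual (H \<otimes> H)"
  by (simp_all add: emb_UU_def)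

text \<open>
  In the formula that defines \<open>\<Psi>\<^sub>U\<^sub>U\<close> the arguments \<open>b \<otimes> a\<close> on the left are in the opposite order to
  \<open>a \<otimes> b\<close> on the right. The embedding into \<open>(H \<otimes> H)'\<close> and the planar pairing differ by the same reversal,
  so in terms of the planar pairing the formula says that \<open>\<Psi>\<^sub>U\<^sub>U\<close> is adjoint to \<open>\<Psi>\<^sub>H\<^sub>H\<close>.
\<close>

lemma
  assumes \<Psi>: "lin \<Psi>" "src \<Psi> = H \<otimes> H" "tgt \<Psi> = H \<otimes> H" and b: "bij_UU H \<Psi> U"
  shows iso_Psi_UU: "iso (Psi_UU H \<Psi> U)"
    and Psi_UU_src_tgt: "src (Psi_UU H \<Psi> U) = DU \<otimes> DU" "tgt (Psi_UU H \<Psi> U) = DU \<otimes> DU"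
    and adjoint_Psi_UU: "adjoint (D \<odot> D) (D \<odot> D) (Psi_UU H \<Psi> U) \<Psi>"
proof -
  note F = linear_map_form[OF evaluation_pair2, unfolded duality_sel evaluation_sel]
  have 1: "bilinear_map H H ground (\<lambda>b a. pairing H H f g (fn \<Psi> (pure H H a b)))" if "f \<in> car DU" "g \<in> car DU" for f g
    by (rule bilinear_map_cong[of _ _ _ "\<lambda>b a. form (D \<odot> D) (pure DU DU f g) (fn \<Psi> (pure H H a b))"])
      (use that in \<open>auto intro!: bilinear_mapI simp: F \<Psi> arr_simps H vspace_dual_sub pairing_evaluation dual_sub_sel\<close>)
  have 2: "bilinear_map DU DU ground (\<lambda>f g. pairing H H f g (fn \<Psi> (pure H H a b)))" if "b \<in> car H" "a \<in> car H" for a b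
    by (rule bilinear_map_cong[of _ _ _ "\<lambda>f g. form (D \<odot> D) (pure DU DU f g) (fn \<Psi> (pure H H a b))"])
      (use that in \<open>auto intro!: bilinear_mapI simp: F \<Psi> arr_simps H vspace_dual_sub pairing_evaluation dual_sub_sel\<close>)
  note G = vspace_dual_sub vspace_dual_sub 1 2
  have p: "src (psi_UU H \<Psi> U) = DU \<otimes> DU" "tgt (psi_UU H \<Psi> U) = dual (H \<otimes> H)" by (simp_all add: psi_UU_def)
  have l: "lin (psi_UU H \<Psi> U)"
    using linear_map_tform_lift[OF G] by (simp add: lin_def p vspace_tensor vspace_dual) (simp add: psi_UU_def)
  note I = lin_emb_UU emb_UU_inj[folded emb_UU_src_tgt(1)] l p(2)[folded emb_UU_src_tgt(2)] b
  show i: "iso (Psi_UU H \<Psi> U)" unfolding Psi_UU_def by (rule iso_corestrict[OF I])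
  show s: "src (Psi_UU H \<Psi> U) = DU \<otimes> DU" "tgt (Psi_UU H \<Psi> U) = DU \<otimes> DU"
    by (simp_all add: Psi_UU_def p emb_UU_src_tgt)
  have e: "fn (emb_UU H U) (fn (Psi_UU H \<Psi> U) t) = fn (psi_UU H \<Psi> U) t" if "t \<in> car (DU \<otimes> DU)" for t
    using corestrict_eval[OF I] that by (simp add: Psi_UU_def p)
  show "adjoint (D \<odot> D) (D \<odot> D) (Psi_UU H \<Psi> U) \<Psi>"
  proof (rule adjoint_nestedI)
    fix f g a b assume "f \<in> car (lsp D)" "g \<in> car (lsp D)" "a \<in> car (rsp D)" "b \<in> car (rsp D)"
    then have f: "f \<in> U" "g \<in> U" and a: "a \<in> car H" "b \<in> car H" by (simp_all add: dual_sub_sel)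
    have fg: "pure DU DU f g \<in> car (DU \<otimes> DU)" using f by (simp add: pure_in_tensor dual_sub_sel)
    have "form (D \<odot> D) (fn (Psi_UU H \<Psi> U) (pure DU DU f g)) (pure H H a b) =
        fn (emb_UU H U) (fn (Psi_UU H \<Psi> U) (pure DU DU f g)) (pure H H b a)"
      by (rule emb_UU_eval[symmetric]) (use a fg in \<open>simp_all add: s lin_fn_mem iso_lin[OF i]\<close>)
    also have "\<dots> = pairing H H f g (fn \<Psi> (pure H H a b))"
      unfolding e[OF fg] using tform_lift_pure[OF G, of f g b a] f a by (simp add: psi_UU_def dual_sub_sel)
    finally show "form (D \<odot> D) (fn (Psi_UU H \<Psi> U) (pure (lsp D) (lsp D) f g)) (pure (rsp D) (rsp D) a b) =
        form (D \<odot> D) (pure (lsp D) (lsp D) f g) (fn \<Psi> (pure (rsp D) (rsp D) a b))"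
      using f a by (simp add: pairing_evaluation \<Psi> arr_simps)
  qed (use i s \<Psi> evaluation_pair in \<open>simp_all add: iso_lin\<close>)
qed

text \<open>
  The formula that defines \<open>\<Psi>\<^sub>U\<^sub>V\<^sup>\<circ>\<close> is the equation between the slices of the two mates, paired with an
  arbitrary \<open>e \<in> V'\<close>. As \<open>V'\<close> separates the points of \<open>V\<close>, the functional \<open>e\<close> can be removed.
\<close>

lemma
  fixes V :: "('k, 'v::ab_group_add) vs"
  assumes \<Omega>: "crossing H V \<Omega>" and b: "bij_UV H V \<Omega> U"
  shows crossing_Psi_UV: "crossing DU V (Psi_UV H V \<Omega> U)"
    and mates_Psi_UV: "mates D D V V (Psi_UV H V \<Omega> U) (inv_arr \<Omega>)"
proof -
  note C = crossingD[OF \<Omega>]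
  let ?E = "coevaluation V" and ?\<Theta> = "inv_arr \<Omega>"
  note E = coevaluation_nondegenerate[OF C(2)]
  note E' = left_nondegenerate_dual_pair[OF E]
  note N = dual_pair_nested[OF dual_pair_flip[OF E'] evaluation_pair]
  note F = linear_map_form[OF N, unfolded duality_sel evaluation_sel]
  have pair: "pairing H V e f t = form (flip ?E \<odot> D) (pure (dual V) DU e f) t"
    if "e \<in> car (dual V)" "f \<in> U" "t \<in> car (H \<otimes> V)" for e f t
    using form_nested_pure[OF dual_pair_flip[OF E'] evaluation_pair, of e f t] that by (simp add: pairing_def dual_sub_sel)
  note R = F C arr_simps vspace_dual_sub vspace_dual pair dual_sub_sel
  have 1: "bilinear_map (dual V) H ground (\<lambda>e a. pairing H V e f (fn ?\<Theta> (pure V H v a)))" if "f \<in> car DU" "v \<in> car V" for f v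
    by (rule bilinear_map_cong[of _ _ _ "\<lambda>e a. form (flip ?E \<odot> D) (pure (dual V) DU e f) (fn ?\<Theta> (pure V H v a))"])
      (use that in \<open>auto intro!: bilinear_mapI simp: R\<close>)
  have 2: "bilinear_map DU V ground (\<lambda>f v. pairing H V e f (fn ?\<Theta> (pure V H v a)))" if "e \<in> car (dual V)" "a \<in> car H" for e a
    by (rule bilinear_map_cong[of _ _ _ "\<lambda>f v. form (flip ?E \<odot> D) (pure (dual V) DU e f) (fn ?\<Theta> (pure V H v a))"])
      (use that in \<open>auto intro!: bilinear_mapI simp: R\<close>)
  note G = vspace_dual_sub C(2) 1 2
  have p: "src (psi_UV H V \<Omega> U) = DU \<otimes> V" "tgt (psi_UV H V \<Omega> U) = dual (dual V \<otimes> H)" by (simp_all add: psi_UV_def)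
  have l: "lin (psi_UV H V \<Omega> U)"
    using linear_map_tform_lift[OF G] by (simp add: lin_def p vspace_tensor vspace_dual) (simp add: psi_UV_def)
  have q: "src (emb_VU H V U) = V \<otimes> DU" "tgt (emb_VU H V U) = dual (dual V \<otimes> H)" by (simp_all add: emb_VU_def)
  note I = lin_embed[OF E' evaluation_pair, simplified, folded emb_VU_def]
    embed_inj[OF E evaluation_nondegenerate, simplified, folded emb_VU_def, folded q(1)] l p(2)[folded q(2)] b
  have i: "iso (Psi_UV H V \<Omega> U)" unfolding Psi_UV_def by (rule iso_corestrict[OF I])
  have s: "src (Psi_UV H V \<Omega> U) = DU \<otimes> V" "tgt (Psi_UV H V \<Omega> U) = V \<otimes> DU"
    by (simp_all add: Psi_UV_def p q)
  show "crossing DU V (Psi_UV H V \<Omega> U)" using i s vspace_dual_sub C(2) by (simp add: crossing_def)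
  have e: "fn (emb_VU H V U) (fn (Psi_UV H V \<Omega> U) t) = fn (psi_UV H V \<Omega> U) t" if "t \<in> car (DU \<otimes> V)" for t
    using corestrict_eval[OF I] that by (simp add: Psi_UV_def p)
  have "fn (rslice V D a) (fn (Psi_UV H V \<Omega> U) (pure DU V f v)) = fn (lslice D V f) (fn ?\<Theta> (pure V H v a))"
    if f: "f \<in> U" and v: "v \<in> car V" and a: "a \<in> car H" for f v a
  proof (rule eq_by_form[OF E])
    have fv: "pure DU V f v \<in> car (DU \<otimes> V)" using f v by (simp add: pure_in_tensor dual_sub_sel)
    have \<Theta>: "fn ?\<Theta> (pure V H v a) \<in> car (H \<otimes> V)" using v a by (simp add: C arr_simps)
    have m: "fn (Psi_UV H V \<Omega> U) (pure DU V f v) \<in> car (V \<otimes> DU)" using fv by (simp add: s lin_fn_mem iso_lin[OF i])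
    note L = lin_rslice[OF evaluation_pair C(2), simplified, OF a] lin_lslice[OF evaluation_pair C(2), simplified, unfolded dual_sub_sel, OF f]
    show "fn (rslice V D a) (fn (Psi_UV H V \<Omega> U) (pure DU V f v)) \<in> car (lsp ?E)"
      "fn (lslice D V f) (fn ?\<Theta> (pure V H v a)) \<in> car (lsp ?E)"
      using L m \<Theta> by (simp_all add: lin_fn_mem)
    fix x assume "x \<in> car (rsp ?E)"
    then have x: "x \<in> car (dual V)" by simp
    then have xl: "linear_map V ground x" by (simp add: car_dual)
    have "x (fn (rslice V D a) (fn (Psi_UV H V \<Omega> U) (pure DU V f v))) =
        form (?E \<odot> D) (fn (Psi_UV H V \<Omega> U) (pure DU V f v)) (pure H (dual V) a x)"
      using form_nested_rslice[OF E' evaluation_pair, of a x "fn (Psi_UV H V \<Omega> U) (pure DU V f v)"] a x m by simp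
    also have "\<dots> = fn (emb_VU H V U) (fn (Psi_UV H V \<Omega> U) (pure DU V f v)) (pure (dual V) H x a)"
      using embed_eval[OF E' evaluation_pair, simplified, folded emb_VU_def, OF m x a] by simp
    also have "\<dots> = pairing H V x f (fn ?\<Theta> (pure V H v a))"
      unfolding e[OF fv] using tform_lift_pure[OF G, of f v x a] f v x a by (simp add: psi_UV_def dual_sub_sel)
    also have "\<dots> = x (fn (lslice D V f) (fn ?\<Theta> (pure V H v a)))"
    proof -
      have b: "bilinear_map H V ground (\<lambda>h w. x w * f h)"
        using xl dual_sub_linear(1)[OF f] by (intro bilinear_mapI) (auto intro: linear_map_mult)
      have "\<forall>t\<in>car (H \<otimes> V). pairing H V x f t = x (fn (lslice D V f) t)"
        unfolding pairing_def
        by (rule tensor_ext_ball[OF tlift_linear[OF vspace_ground b] linear_map_compose[OF xl linear_map_fn]])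
          (use f xl L in \<open>simp_all add: tlift_pure[OF vspace_ground b] slice_pure H C(2) dual_sub_linear\<close>,
            simp add: linear_map_def ground_def)
      with \<Theta> show ?thesis by blast
    qed
    finally show "form ?E (fn (rslice V D a) (fn (Psi_UV H V \<Omega> U) (pure DU V f v))) x =
        form ?E (fn (lslice D V f) (fn ?\<Theta> (pure V H v a))) x" by simp
  qed
  then show "mates D D V V (Psi_UV H V \<Omega> U) ?\<Theta>"
    using evaluation_pair i s by (simp add: mates_def C iso_lin dual_sub_sel)
qed

text \<open>
  With the strand of \<open>U\<close> on the right, it is \<open>\<Omega>\<^sup>-\<^sup>1\<close> that moves a strand from the left to the right; it
  takes the first place among the mates, and the duality is read from the side of \<open>H\<close>.
\<close>

lemma
  fixes V :: "('k, 'v::ab_group_add) vs"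
  assumes \<Omega>: "crossing V H \<Omega>" and b: "bij_VU H V \<Omega> U"
  shows crossing_Psi_VU: "crossing V DU (Psi_VU H V \<Omega> U)"
    and mates_Psi_VU: "mates (flip D) (flip D) V V (inv_arr \<Omega>) (Psi_VU H V \<Omega> U)"
proof -
  note C = crossingD[OF \<Omega>]
  let ?E = "coevaluation V" and ?\<Theta> = "inv_arr \<Omega>"
  note E = coevaluation_nondegenerate[OF C(1)]
  note E' = left_nondegenerate_dual_pair[OF E]
  note N = dual_pair_nested[OF evaluation_pair dual_pair_flip[OF E']]
  note F = linear_map_form[OF N, unfolded duality_sel evaluation_sel]
  have pair: "pairing V H f e t = form (D \<odot> flip ?E) (pure DU (dual V) f e) t"
    if "e \<in> car (dual V)" "f \<in> U" "t \<in> car (V \<otimes> H)" for e f t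
    using form_nested_pure[OF evaluation_pair dual_pair_flip[OF E'], of f e t] that by (simp add: pairing_def dual_sub_sel)
  note R = F C arr_simps vspace_dual_sub vspace_dual pair dual_sub_sel
  have 1: "bilinear_map H (dual V) ground (\<lambda>a e. pairing V H f e (fn ?\<Theta> (pure H V a v)))" if "v \<in> car V" "f \<in> car DU" for f v
    by (rule bilinear_map_cong[of _ _ _ "\<lambda>a e. form (D \<odot> flip ?E) (pure DU (dual V) f e) (fn ?\<Theta> (pure H V a v))"])
      (use that in \<open>auto intro!: bilinear_mapI simp: R\<close>)
  have 2: "bilinear_map V DU ground (\<lambda>v f. pairing V H f e (fn ?\<Theta> (pure H V a v)))" if "a \<in> car H" "e \<in> car (dual V)" for e a
    by (rule bilinear_map_cong[of _ _ _ "\<lambda>v f. form (D \<odot> flip ?E) (pure DU (dual V) f e) (fn ?\<Theta> (pure H V a v))"])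
      (use that in \<open>auto intro!: bilinear_mapI simp: R\<close>)
  note G = C(1) vspace_dual_sub 1 2
  have p: "src (psi_VU H V \<Omega> U) = V \<otimes> DU" "tgt (psi_VU H V \<Omega> U) = dual (H \<otimes> dual V)" by (simp_all add: psi_VU_def)
  have l: "lin (psi_VU H V \<Omega> U)"
    using linear_map_tform_lift[OF G] by (simp add: lin_def p vspace_tensor vspace_dual) (simp add: psi_VU_def)
  have q: "src (emb_UV H V U) = DU \<otimes> V" "tgt (emb_UV H V U) = dual (H \<otimes> dual V)" by (simp_all add: emb_UV_def)
  note I = lin_embed[OF evaluation_pair E', simplified, folded emb_UV_def]
    embed_inj[OF evaluation_nondegenerate E, simplified, folded emb_UV_def, folded q(1)] l p(2)[folded q(2)] b
  have i: "iso (Psi_VU H V \<Omega> U)" unfolding Psi_VU_def by (rule iso_corestrict[OF I])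
  have s: "src (Psi_VU H V \<Omega> U) = V \<otimes> DU" "tgt (Psi_VU H V \<Omega> U) = DU \<otimes> V"
    by (simp_all add: Psi_VU_def p q)
  show "crossing V DU (Psi_VU H V \<Omega> U)" using i s vspace_dual_sub C(1) by (simp add: crossing_def)
  have e: "fn (emb_UV H V U) (fn (Psi_VU H V \<Omega> U) t) = fn (psi_VU H V \<Omega> U) t" if "t \<in> car (V \<otimes> DU)" for t
    using corestrict_eval[OF I] that by (simp add: Psi_VU_def p)
  have "fn (rslice V (flip D) f) (fn ?\<Theta> (pure H V a v)) = fn (lslice (flip D) V a) (fn (Psi_VU H V \<Omega> U) (pure V DU v f))"
    if f: "f \<in> U" and v: "v \<in> car V" and a: "a \<in> car H" for f v a
  proof (rule eq_by_form[OF E])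
    have vf: "pure V DU v f \<in> car (V \<otimes> DU)" using f v by (simp add: pure_in_tensor dual_sub_sel)
    have \<Theta>: "fn ?\<Theta> (pure H V a v) \<in> car (V \<otimes> H)" using v a by (simp add: C arr_simps)
    have m: "fn (Psi_VU H V \<Omega> U) (pure V DU v f) \<in> car (DU \<otimes> V)" using vf by (simp add: s lin_fn_mem iso_lin[OF i])
    note L = lin_lslice[OF dual_pair_flip[OF evaluation_pair] C(1), simplified, OF a]
      lin_rslice[OF dual_pair_flip[OF evaluation_pair] C(1), simplified, unfolded dual_sub_sel, OF f]
    show "fn (rslice V (flip D) f) (fn ?\<Theta> (pure H V a v)) \<in> car (lsp ?E)"
      "fn (lslice (flip D) V a) (fn (Psi_VU H V \<Omega> U) (pure V DU v f)) \<in> car (lsp ?E)"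
      using L m \<Theta> by (simp_all add: lin_fn_mem)
    fix x assume "x \<in> car (rsp ?E)"
    then have x: "x \<in> car (dual V)" by simp
    then have xl: "linear_map V ground x" by (simp add: car_dual)
    have "x (fn (lslice (flip D) V a) (fn (Psi_VU H V \<Omega> U) (pure V DU v f))) =
        form (D \<odot> ?E) (fn (Psi_VU H V \<Omega> U) (pure V DU v f)) (pure (dual V) H x a)"
      using form_nested_lslice[OF evaluation_pair E', of x a "fn (Psi_VU H V \<Omega> U) (pure V DU v f)"] a x m by simp
    also have "\<dots> = fn (emb_UV H V U) (fn (Psi_VU H V \<Omega> U) (pure V DU v f)) (pure H (dual V) a x)"
      using embed_eval[OF evaluation_pair E', simplified, folded emb_UV_def, OF m a x] by simp
    also have "\<dots> = pairing V H f x (fn ?\<Theta> (pure H V a v))"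
      unfolding e[OF vf] using tform_lift_pure[OF G, of v f a x] f v x a by (simp add: psi_VU_def dual_sub_sel)
    also have "\<dots> = x (fn (rslice V (flip D) f) (fn ?\<Theta> (pure H V a v)))"
    proof -
      have b: "bilinear_map V H ground (\<lambda>w h. f h * x w)"
        using xl dual_sub_linear(1)[OF f] by (intro bilinear_mapI) (auto intro: linear_map_mult)
      have "\<forall>t\<in>car (V \<otimes> H). pairing V H f x t = x (fn (rslice V (flip D) f) t)"
        unfolding pairing_def
        by (rule tensor_ext_ball[OF tlift_linear[OF vspace_ground b] linear_map_compose[OF xl linear_map_fn]])
          (use f xl L in \<open>simp_all add: tlift_pure[OF vspace_ground b] slice_pure H C(1) dual_sub_linear\<close>,
            simp add: linear_map_def ground_def)
      with \<Theta> show ?thesis by blast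
    qed
    finally show "form ?E (fn (rslice V (flip D) f) (fn ?\<Theta> (pure H V a v))) x =
        form ?E (fn (lslice (flip D) V a) (fn (Psi_VU H V \<Omega> U) (pure V DU v f))) x" by simp
  qed
  then show "mates (flip D) (flip D) V V ?\<Theta> (Psi_VU H V \<Omega> U)"
    using dual_pair_flip[OF evaluation_pair] i s by (simp add: mates_def C iso_lin dual_sub_sel)
qed

end

lemma linear_map_into_dual_sub:
  "linear_map X (dual H) F \<Longrightarrow> (\<And>x. x \<in> car X \<Longrightarrow> F x \<in> U) \<Longrightarrow> linear_map X (dual_sub H U) F"
  by (auto simp: linear_map_def dual_sub_sel) (simp add: dual_def)

context dual_subspace
begin

lemmas DU_rules = vspace_dual_sub dual_sub_sel linear_map_form[OF evaluation_pair2, unfolded duality_sel evaluation_sel]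

lemma
  assumes \<Psi>: "crossing H H \<Psi>" and \<Delta>: "comult H \<Delta>"
    and cl: "\<forall>f\<in>U. \<forall>g\<in>U. dual_mult H \<Delta> \<Psi> f g \<in> U"
  shows mult_mult_U: "mult DU (mult_U H \<Delta> \<Psi> U)"
    and adjoint_mult_U: "adjoint (D \<odot> D) D (mult_U H \<Delta> \<Psi> U) (inv_arr \<Psi> \<cdot> \<Delta>)"
proof -
  note C = crossingD[OF \<Psi>] comultD[OF \<Delta>]
  have ev: "dual_mult H \<Delta> \<Psi> f g a = form (D \<odot> D) (pure DU DU f g) (fn (inv_arr \<Psi>) (fn \<Delta> a))"
    if "f \<in> U" "g \<in> U" "a \<in> car H" for f g a
    using that by (simp add: dual_mult_def functional_def pairing_evaluation C arr_simps)
  have d: "dual_mult H \<Delta> \<Psi> f g \<in> car (dual H)" if "f \<in> U" "g \<in> U" for f g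
    using cl that U by (auto simp: nondegenerate_subspace_def)
  have b: "bilinear_map DU DU DU (dual_mult H \<Delta> \<Psi>)"
  proof (rule bilinear_mapI)
    fix f assume "f \<in> car DU"
    then have f: "f \<in> U" by (simp add: dual_sub_sel)
    show "linear_map DU DU (dual_mult H \<Delta> \<Psi> f)"
    proof (intro linear_map_into_dual_sub linear_map_into_dual)
      fix a assume a: "a \<in> car H"
      have "linear_map DU ground (\<lambda>g. form (D \<odot> D) (pure DU DU f g) (fn (inv_arr \<Psi>) (fn \<Delta> a)))"
        using f a by (simp add: DU_rules C arr_simps)
      then show "linear_map DU ground (\<lambda>g. dual_mult H \<Delta> \<Psi> f g a)"
        by (rule linear_map_cong) (use f a in \<open>simp_all add: ev DU_rules(1-3)\<close>)
    qed (use f cl d in \<open>simp_all add: DU_rules(1-3)\<close>)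
  next
    fix g assume "g \<in> car DU"
    then have g: "g \<in> U" by (simp add: dual_sub_sel)
    show "linear_map DU DU (\<lambda>f. dual_mult H \<Delta> \<Psi> f g)"
    proof (intro linear_map_into_dual_sub linear_map_into_dual)
      fix a assume a: "a \<in> car H"
      have "linear_map DU ground (\<lambda>f. form (D \<odot> D) (pure DU DU f g) (fn (inv_arr \<Psi>) (fn \<Delta> a)))"
        using g a by (simp add: DU_rules C arr_simps)
      then show "linear_map DU ground (\<lambda>f. dual_mult H \<Delta> \<Psi> f g a)"
        by (rule linear_map_cong) (use g a in \<open>simp_all add: ev DU_rules(1-3)\<close>)
    qed (use g cl d in \<open>simp_all add: DU_rules(1-3)\<close>)
  qed
  have s: "src (mult_U H \<Delta> \<Psi> U) = DU \<otimes> DU" "tgt (mult_U H \<Delta> \<Psi> U) = DU" by (simp_all add: mult_U_def)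
  show m: "mult DU (mult_U H \<Delta> \<Psi> U)"
    using tlift_linear[OF DU_rules(1) b] by (simp add: mult_def s lin_def DU_rules(1) vspace_tensor) (simp add: mult_U_def)
  have p: "fn (mult_U H \<Delta> \<Psi> U) (pure DU DU f g) = dual_mult H \<Delta> \<Psi> f g" if "f \<in> U" "g \<in> U" for f g
    using that by (simp add: mult_U_def tlift_pure[OF DU_rules(1) b] dual_sub_sel)
  have "\<forall>F\<in>car (DU \<otimes> DU). form D (fn (mult_U H \<Delta> \<Psi> U) F) a = form (D \<odot> D) F (fn (inv_arr \<Psi>) (fn \<Delta> a))" if a: "a \<in> car H" for a
  proof (rule tensor_ext_ball[of _ _ ground])
    show "linear_map (DU \<otimes> DU) ground (\<lambda>F. form D (fn (mult_U H \<Delta> \<Psi> U) F) a)"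
      using linear_map_form(1)[OF evaluation_pair, of "DU \<otimes> DU" "fn (mult_U H \<Delta> \<Psi> U)" a] m a
      by (simp add: linear_map_fn multD[OF m])
  qed (use a in \<open>simp_all add: DU_rules C arr_simps p ev\<close>)
  then show "adjoint (D \<odot> D) D (mult_U H \<Delta> \<Psi> U) (inv_arr \<Psi> \<cdot> \<Delta>)"
    using evaluation_pair evaluation_pair2 m by (simp add: adjoint_def multD C lin_comp)
qed

text \<open>
  The coproduct is given by a definite description; the element of \<open>U \<otimes> U\<close> that it describes is unique
  because the planar pairing is nondegenerate, and linearity follows from uniqueness.
\<close>

lemma
  assumes \<Psi>: "crossing H H \<Psi>" and m: "mult H m"
    and ex: "\<forall>f\<in>U. \<exists>\<omega>. dual_coproduct H m \<Psi> U f \<omega>"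
  shows comult_comult_U: "comult DU (comult_U H m \<Psi> U)"
    and adjoint_comult_U: "adjoint D (D \<odot> D) (comult_U H m \<Psi> U) (m \<cdot> \<Psi>)"
proof -
  note C = crossingD[OF \<Psi>] multD[OF m]
  note N = evaluation_nondegenerate2 
  have b: "bilinear_map DU DU ground (\<lambda>f g. pairing H H f g (pure H H x y))" if "x \<in> car H" "y \<in> car H" for x y
    by (rule bilinear_map_cong[of _ _ _ "\<lambda>f g. form (D \<odot> D) (pure DU DU f g) (pure H H x y)"])
      (use that in \<open>auto intro!: bilinear_mapI simp: DU_rules arr_simps pairing_evaluation\<close>)
  have e: "tlift DU DU ground (\<lambda>f g. pairing H H f g (pure H H x y)) w = form (D \<odot> D) w (pure H H x y)"
    if "x \<in> car H" "y \<in> car H" and w: "w \<in> car (DU \<otimes> DU)" for x y w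
  proof -
    have "\<forall>w\<in>car (DU \<otimes> DU). tlift DU DU ground (\<lambda>f g. pairing H H f g (pure H H x y)) w = form (D \<odot> D) w (pure H H x y)"
      by (rule tensor_ext_ball[OF tlift_linear[OF vspace_ground b]])
        (use that in \<open>simp_all add: tlift_pure[OF vspace_ground b] DU_rules pure_in_tensor pairing_evaluation linear_map_identity\<close>)
    with w show ?thesis by blast
  qed
  have co: "w \<in> car (DU \<otimes> DU) \<and> (\<forall>t\<in>car (H \<otimes> H). form (D \<odot> D) w t = f (fn m (fn \<Psi> t)))"
    if f: "f \<in> U" and w: "dual_coproduct H m \<Psi> U f w" for f w
  proof -
    have w': "w \<in> car (DU \<otimes> DU)" using w by (simp add: dual_coproduct_def)
    have "\<forall>t\<in>car (H \<otimes> H). form (D \<odot> D) w t = f (fn m (fn \<Psi> t))"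
      by (rule tensor_ext_ball[of _ _ ground])
        (use w w' e f in \<open>auto simp: DU_rules dual_coproduct_def C linear_map_identity linear_map_fn
          intro!: linear_map_compose[OF dual_sub_linear(1)[OF f]] linear_map_fn_compose\<close>)
    with w' show ?thesis by blast
  qed
  let ?d = "fn (comult_U H m \<Psi> U)"
  have d: "dual_coproduct H m \<Psi> U f (?d f)" if f: "f \<in> U" for f
  proof -
    obtain w where w: "dual_coproduct H m \<Psi> U f w" using ex f by blast
    have "w' = w" if w': "dual_coproduct H m \<Psi> U f w'" for w'
      by (rule eq_by_form[OF N]) (use co[OF f w] co[OF f w'] in simp_all)
    with w have "dual_coproduct H m \<Psi> U f (THE w. dual_coproduct H m \<Psi> U f w)" by (rule theI)
    then show ?thesis by (simp add: comult_U_def)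
  qed
  have d': "?d f \<in> car (DU \<otimes> DU) \<and> (\<forall>t\<in>car (H \<otimes> H). form (D \<odot> D) (?d f) t = f (fn m (fn \<Psi> t)))" if "f \<in> U" for f
    by (rule co[OF that d[OF that]])
  have s: "src (comult_U H m \<Psi> U) = DU" "tgt (comult_U H m \<Psi> U) = DU \<otimes> DU" by (simp_all add: comult_U_def)
  have scl1: "form (D \<odot> D) (scl (DU \<otimes> DU) c w) t = c * form (D \<odot> D) w t"
    and add1: "w' \<in> car (DU \<otimes> DU) \<Longrightarrow> form (D \<odot> D) (w + w') t = form (D \<odot> D) w t + form (D \<odot> D) w' t"
    if "w \<in> car (DU \<otimes> DU)" "t \<in> car (H \<otimes> H)" for c w w' t
    using linear_map_form(4)[OF evaluation_pair2, of t "DU \<otimes> DU"] that by (simp_all add: linear_map_def ground_def)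
  have "linear_map DU (DU \<otimes> DU) ?d"
    unfolding linear_map_def
  proof (intro conjI ballI allI)
    fix f g c assume "f \<in> car DU"
    then have f: "f \<in> U" by (simp add: dual_sub_sel)
    show "?d f \<in> car (DU \<otimes> DU)" using d'[OF f] by simp
    have cf: "scl DU c f \<in> U" using vspaceD(3)[OF DU_rules(1), of f c] f by (simp add: dual_sub_sel)
    show "?d (scl DU c f) = scl (DU \<otimes> DU) c (?d f)"
      by (rule eq_by_form[OF N]) (use d'[OF f] d'[OF cf] in \<open>simp_all add: scl_mem vspace_tensor scl1\<close>, simp add: dual_sub_sel)
    assume "g \<in> car DU"
    then have g: "g \<in> U" by (simp add: dual_sub_sel)
    have fg: "f + g \<in> U" using vspaceD(2)[OF DU_rules(1), of f g] f g by (simp add: dual_sub_sel)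
    show "?d (f + g) = ?d f + ?d g"
      by (rule eq_by_form[OF N]) (use d'[OF f] d'[OF g] d'[OF fg] in \<open>simp_all add: vspaceD(2) vspace_tensor add1\<close>)
  qed
  then show c: "comult DU (comult_U H m \<Psi> U)" by (simp add: comult_def lin_def s DU_rules(1) vspace_tensor)
  then show "adjoint D (D \<odot> D) (comult_U H m \<Psi> U) (m \<cdot> \<Psi>)"
    using evaluation_pair evaluation_pair2 d' by (simp add: adjoint_def comultD C lin_comp dual_sub_sel)
qed

lemma left_action_action_left:
  fixes V :: "('k, 'v::ab_group_add) vs"
  assumes \<Omega>: "crossing H V \<Omega>" and \<rho>: "lin \<rho>" "src \<rho> = V" "tgt \<rho> = V \<otimes> H"
  shows "left_action D V (action_left H V \<Omega> \<rho> U) (inv_arr \<Omega> \<cdot> \<rho>)"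
proof -
  note C = crossingD[OF \<Omega>] \<rho>
  have e: "fn (lunit V \<cdot> (functional_arr H f \<boxtimes> idm V) \<cdot> inv_arr \<Omega> \<cdot> \<rho>) = (\<lambda>v. fn (lslice D V f) (fn (inv_arr \<Omega> \<cdot> \<rho>) v))" for f
    by (rule ext) (simp add: sliceL_def)
  have b: "bilinear_map DU V V (\<lambda>f v. fn (lslice D V f) (fn (inv_arr \<Omega> \<cdot> \<rho>) v))"
    using C by (intro bilinear_mapI)
      (auto intro!: linear_map_lslice[OF evaluation_pair, simplified] lin_lslice[OF evaluation_pair, simplified]
        linear_map_fn_compose linear_map_fn linear_map_identity lin_fn_mem lin_comp simp: DU_rules(1))
  have "fn (action_left H V \<Omega> \<rho> U) = tlift DU V V (\<lambda>f v. fn (lslice D V f) (fn (inv_arr \<Omega> \<cdot> \<rho>) v))"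
    unfolding action_left_def e by simp
  moreover have "src (action_left H V \<Omega> \<rho> U) = DU \<otimes> V" "tgt (action_left H V \<Omega> \<rho> U) = V" by (simp_all add: action_left_def)
  ultimately show ?thesis
    using tlift_linear[OF C(2) b] tlift_pure[OF C(2) b] evaluation_pair lin_comp[of "inv_arr \<Omega>" \<rho>] C
    by (simp add: left_action_def lin_def[of "action_left H V \<Omega> \<rho> U"] vspace_tensor dual_sub_sel)
qed

lemma right_action_action_right:
  fixes V :: "('k, 'v::ab_group_add) vs"
  assumes \<Omega>: "crossing V H \<Omega>" and \<rho>: "lin \<rho>" "src \<rho> = V" "tgt \<rho> = H \<otimes> V"
  shows "right_action (flip D) V (action_right H V \<Omega> \<rho> U) (inv_arr \<Omega> \<cdot> \<rho>)"
proof -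
  note C = crossingD[OF \<Omega>] \<rho>
  have e: "(\<lambda>v f. fn (runit V \<cdot> (idm V \<boxtimes> functional_arr H f) \<cdot> inv_arr \<Omega> \<cdot> \<rho>) v) = (\<lambda>v f. fn (rslice V (flip D) f) (fn (inv_arr \<Omega> \<cdot> \<rho>) v))"
    by (intro ext) (simp add: sliceR_def)
  have b: "bilinear_map V DU V (\<lambda>v f. fn (rslice V (flip D) f) (fn (inv_arr \<Omega> \<cdot> \<rho>) v))"
    using C by (intro bilinear_mapI)
      (auto intro!: linear_map_rslice[OF dual_pair_flip[OF evaluation_pair], simplified] lin_rslice[OF dual_pair_flip[OF evaluation_pair], simplified]
        linear_map_fn_compose linear_map_fn linear_map_identity lin_fn_mem lin_comp simp: DU_rules(1))
  have "fn (action_right H V \<Omega> \<rho> U) = tlift V DU V (\<lambda>v f. fn (rslice V (flip D) f) (fn (inv_arr \<Omega> \<cdot> \<rho>) v))"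
    unfolding action_right_def e by simp
  moreover have "src (action_right H V \<Omega> \<rho> U) = V \<otimes> DU" "tgt (action_right H V \<Omega> \<rho> U) = V" by (simp_all add: action_right_def)
  ultimately show ?thesis
    using tlift_linear[OF C(1) b] tlift_pure[OF C(1) b] dual_pair_flip[OF evaluation_pair] lin_comp[of "inv_arr \<Omega>" \<rho>] C
    by (simp add: right_action_def lin_def[of "action_right H V \<Omega> \<rho> U"] vspace_tensor dual_sub_sel)
qed

end

text \<open>
  This and the next lemma restate the definitions in terms of sliding rules, so that the axioms for \<open>U\<close> can
  be read off from those for \<open>H\<close>.
\<close>

lemma braided_algebra_iff:
  "braided_algebra A m u \<Psi> \<longleftrightarrow> crossing A A \<Psi> \<and> endo_slidesL A A \<Psi> \<Psi> \<and> mult A m \<and>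
     m \<cdot> (m \<boxtimes> idm A) \<doteq> m \<cdot> (idm A \<boxtimes> m) \<cdot> assoc A A A \<and> mult_slidesL A A \<Psi> m \<and> mult_slidesR A A \<Psi> m \<and>
     (\<forall>e. u = Some e \<longrightarrow> e \<in> car A \<and> (\<forall>a\<in>car A. fn m (pure A A e a) = a \<and> fn m (pure A A a e) = a \<and>
        fn \<Psi> (pure A A e a) = pure A A a e \<and> fn \<Psi> (pure A A a e) = pure A A e a))" (is "?l \<longleftrightarrow> ?r")
proof (cases "crossing A A \<Psi> \<and> mult A m")
  case True
  then have c: "crossing A A \<Psi>" and m: "mult A m" by auto
  have "m \<in> Hom (A \<otimes> A) A" using m crossingD(1)[OF c] by (simp add: Hom_iff vspace_tensor mult_def)
  then show ?thesis
    using True crossingD(1)[OF c]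
    by (auto simp: braided_algebra_def algebra_def braiding_iffL compat_mult_left_iff[OF c m] compat_mult_right_iff[OF c m])
next
  case False
  have "mult A m" if ?l
    using that by (auto simp: braided_algebra_def algebra_def Hom_iff vspace_tensor mult_def)
  moreover have "crossing A A \<Psi>" if ?l
    using that by (auto simp: braided_algebra_def braiding_iffL)
  ultimately show ?thesis using False by blast
qed

definition linear_form where "linear_form A \<epsilon> \<longleftrightarrow> lin \<epsilon> \<and> src \<epsilon> = A \<and> tgt \<epsilon> = ground"

lemma linear_formD: "linear_form A \<epsilon> \<Longrightarrow> lin \<epsilon>" "linear_form A \<epsilon> \<Longrightarrow> src \<epsilon> = A" "linear_form A \<epsilon> \<Longrightarrow> tgt \<epsilon> = ground"
    "linear_form A \<epsilon> \<Longrightarrow> linear_map A ground (fn \<epsilon>)"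
  by (auto simp: linear_form_def lin_def)

lemma braided_coalgebra_iff:
  "braided_coalgebra A d \<epsilon> \<Psi> \<longleftrightarrow> crossing A A \<Psi> \<and> endo_slidesL A A \<Psi> \<Psi> \<and> comult A d \<and> linear_form A \<epsilon> \<and>
     assoc A A A \<cdot> (d \<boxtimes> idm A) \<cdot> d \<doteq> (idm A \<boxtimes> d) \<cdot> d \<and> comult_slidesL A A \<Psi> d \<and> comult_slidesR A A \<Psi> d \<and>
     (\<forall>a\<in>car A. fn (lunit A) (fn (\<epsilon> \<boxtimes> idm A) (fn d a)) = a \<and> fn (runit A) (fn (idm A \<boxtimes> \<epsilon>) (fn d a)) = a) \<and>
     (\<forall>x\<in>car (A \<otimes> A). fn (runit A) (fn (idm A \<boxtimes> \<epsilon>) (fn \<Psi> x)) = fn (lunit A) (fn (\<epsilon> \<boxtimes> idm A) x) \<and>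
        fn (lunit A) (fn (\<epsilon> \<boxtimes> idm A) (fn \<Psi> x)) = fn (runit A) (fn (idm A \<boxtimes> \<epsilon>) x))" (is "?l \<longleftrightarrow> ?r")
proof (cases "crossing A A \<Psi> \<and> comult A d \<and> linear_form A \<epsilon>")
  case True
  then have c: "crossing A A \<Psi>" and d: "comult A d" and e: "linear_form A \<epsilon>" by auto
  have H: "d \<in> Hom A (A \<otimes> A)" "\<epsilon> \<in> Hom A ground"
    using d e crossingD(1)[OF c] by (simp_all add: Hom_iff vspace_tensor vspace_ground comult_def linear_form_def)
  have "lunit A \<cdot> (\<epsilon> \<boxtimes> idm A) \<cdot> d \<doteq> idm A \<longleftrightarrow> (\<forall>a\<in>car A. fn (lunit A) (fn (\<epsilon> \<boxtimes> idm A) (fn d a)) = a)"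
    "runit A \<cdot> (idm A \<boxtimes> \<epsilon>) \<cdot> d \<doteq> idm A \<longleftrightarrow> (\<forall>a\<in>car A. fn (runit A) (fn (idm A \<boxtimes> \<epsilon>) (fn d a)) = a)"
    using comultD[OF d] by (simp_all add: arr_eq_def)
  then show ?thesis
    using True H crossingD(1)[OF c]
    by (simp add: braided_coalgebra_def coalgebra_def braiding_iffL compat_comult_left_iff[OF c d linear_formD(1-3)[OF e]]
        compat_comult_right_iff[OF c d linear_formD(1-3)[OF e]]) blast
next
  case False
  have "comult A d \<and> linear_form A \<epsilon>" if ?l
    using that by (auto simp: braided_coalgebra_def coalgebra_def Hom_iff vspace_tensor vspace_ground comult_def linear_form_def)
  moreover have "crossing A A \<Psi>" if ?l
    using that by (auto simp: braided_coalgebra_def braiding_iffL)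
  ultimately show ?thesis using False by blast
qed

section \<open>Dualising the sliding rules\<close>

context
  fixes D :: "('k::field, 'a::ab_group_add, 'b::ab_group_add) duality" and T S
  assumes D: "left_nondegenerate D" and T: "adjoint (D \<odot> D) (D \<odot> D) T S"
begin

private lemma D': "dual_pair D" by (rule left_nondegenerate_dual_pair[OF D])
private lemmas N = left_nondegenerate_nested[OF D D]
private lemmas L = adjoint_crossL[OF D' D' T]
private lemmas R = adjoint_crossR[OF D' D' T]

lemma dual_endo_slidesL: "endo_slidesL (rsp D) (rsp D) S S \<Longrightarrow> endo_slidesL (lsp D) (lsp D) T T"
  unfolding endo_slidesL_def by (rule slidesL_by_adjoint[OF L L T left_nondegenerate_nested[OF D N] D'])

lemma dual_mult_slidesL: "adjoint (D \<odot> D) D m d \<Longrightarrow> comult_slidesL (rsp D) (rsp D) S d \<Longrightarrow> mult_slidesL (lsp D) (lsp D) T m"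
  unfolding mult_slidesL_def comult_slidesL_def by (rule slidesL_by_adjoint[OF L T _ N D'])

lemma dual_comult_slidesL: "adjoint D (D \<odot> D) d m \<Longrightarrow> mult_slidesL (rsp D) (rsp D) S m \<Longrightarrow> comult_slidesL (lsp D) (lsp D) T d"
  unfolding mult_slidesL_def comult_slidesL_def by (rule slidesL_by_adjoint[OF T L _ left_nondegenerate_nested[OF D N] D'])

lemma dual_mult_slidesR: "adjoint (D \<odot> D) D m d \<Longrightarrow> comult_slidesR (rsp D) (rsp D) S d \<Longrightarrow> mult_slidesR (lsp D) (lsp D) T m"
  unfolding mult_slidesR_def comult_slidesR_def by (rule slidesR_by_adjoint[OF R T _ N D'])

lemma dual_comult_slidesR: "adjoint D (D \<odot> D) d m \<Longrightarrow> mult_slidesR (rsp D) (rsp D) S m \<Longrightarrow> comult_slidesR (lsp D) (lsp D) T d"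
  unfolding mult_slidesR_def comult_slidesR_def by (rule slidesR_by_adjoint[OF T R _ left_nondegenerate_nested[OF N D] D'])

end

text \<open>
  The two sides of associativity are adjoint to the two sides of coassociativity.
\<close>

lemma dual_assoc:
  assumes D: "left_nondegenerate D" and m: "adjoint (D \<odot> D) D m d"
    and d: "assoc (rsp D) (rsp D) (rsp D) \<cdot> (d \<boxtimes> idm (rsp D)) \<cdot> d \<doteq> (idm (rsp D) \<boxtimes> d) \<cdot> d"
  shows "m \<cdot> (m \<boxtimes> idm (lsp D)) \<doteq> m \<cdot> (idm (lsp D) \<boxtimes> m) \<cdot> assoc (lsp D) (lsp D) (lsp D)"
proof -
  note D' = left_nondegenerate_dual_pair[OF D]
  note i = adjoint_idm[OF D']
  show ?thesis
    by (rule adjoint_arr_eq[OF adjoint_comp[OF m adjoint_tmap[OF m i]]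
          adjoint_comp[OF m adjoint_comp[OF adjoint_tmap[OF i m] adjoint_assoc[OF D' D' D']]] D])
      (use d in \<open>auto simp: arr_eq_def\<close>)
qed

lemma dual_coassoc:
  assumes D: "left_nondegenerate D" and d: "adjoint D (D \<odot> D) d m"
    and m: "m \<cdot> (m \<boxtimes> idm (rsp D)) \<doteq> m \<cdot> (idm (rsp D) \<boxtimes> m) \<cdot> assoc (rsp D) (rsp D) (rsp D)"
  shows "assoc (lsp D) (lsp D) (lsp D) \<cdot> (d \<boxtimes> idm (lsp D)) \<cdot> d \<doteq> (idm (lsp D) \<boxtimes> d) \<cdot> d"
proof -
  note D' = left_nondegenerate_dual_pair[OF D]
  note i = adjoint_idm[OF D']
  show ?thesis
    by (rule adjoint_arr_eq[OF adjoint_comp[OF adjoint_assoc[OF D' D' D'] adjoint_comp[OF adjoint_tmap[OF d i] d]]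
          adjoint_comp[OF adjoint_tmap[OF i d] d] left_nondegenerate_nested[OF D left_nondegenerate_nested[OF D D]]])
      (use m in \<open>auto simp: arr_eq_def\<close>)
qed

text \<open>
  Twist in two steps. Since \<open>\<Psi>\<^sup>-\<^sup>1\<close> is an isomorphism of braided tensor product algebras, the coproduct
  \<open>\<Psi>\<^sup>-\<^sup>1 \<Delta>\<close> is multiplicative with respect to \<open>\<Psi>\<^sup>-\<^sup>1\<close> in place of \<open>\<Psi>\<close>. Since \<open>\<Psi>\<close> is an isomorphism of
  braided tensor product coalgebras, replacing \<open>m\<close> by \<open>m \<Psi>\<close> turns \<open>\<Psi>\<^sup>-\<^sup>1\<close> back into \<open>\<Psi>\<close>. Both steps need
  that products and coproducts slide through the braiding, which the first twist preserves.
\<close>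

lemma twisted_bialgebra:
  assumes \<Psi>: "crossing H H \<Psi>" "endo_slidesL H H \<Psi> \<Psi>" "endo_slidesR H H \<Psi> \<Psi>"
    and m: "mult H m" "mult_slidesL H H \<Psi> m" "mult_slidesR H H \<Psi> m"
    and d: "comult H d" "comult_slidesL H H \<Psi> d" "comult_slidesR H H \<Psi> d"
    and b: "d \<cdot> m \<doteq> (m \<boxtimes> m) \<cdot> middle H H H H \<Psi> \<cdot> (d \<boxtimes> d)"
    and y: "y \<in> car (H \<otimes> H)"
  shows "fn (inv_arr \<Psi> \<cdot> d) (fn (m \<cdot> \<Psi>) y) =
    fn ((m \<cdot> \<Psi>) \<boxtimes> (m \<cdot> \<Psi>)) (fn (middle H H H H \<Psi>) (fn ((inv_arr \<Psi> \<cdot> d) \<boxtimes> (inv_arr \<Psi> \<cdot> d)) y))"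
proof -
  let ?\<Phi> = "inv_arr \<Psi>"
  let ?d = "?\<Phi> \<cdot> d"
  note I = crossing_inv[OF \<Psi>(1)]
  note C = crossingD[OF \<Psi>(1)] crossingD[OF I] multD[OF m(1)] comultD[OF d(1)]
  have e: "endo H \<Psi>" by (simp add: endo_def C)
  have d': "comult H ?d" "comult_slidesL H H \<Psi> ?d" "comult_slidesR H H \<Psi> ?d"
    using twisted_slidesL(3)[OF \<Psi>(1) e \<Psi>(2) d(1,2)] twisted_slidesR(3)[OF \<Psi>(1) e \<Psi>(3) d(1,3)]
    by (simp_all add: comult_def C arr_simps)
  let ?x = "fn (d \<boxtimes> d) (fn \<Psi> y)"
  have x: "?x \<in> car ((H \<otimes> H) \<otimes> (H \<otimes> H))" using y by (simp add: C arr_simps)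
  have "fn ?d (fn m (fn \<Psi> y)) = fn ?\<Phi> (fn (m \<boxtimes> m) (fn (middle H H H H \<Psi>) ?x))"
    using arr_eqD[OF b, of "fn \<Psi> y"] y by (simp add: C arr_simps)
  also have "fn (middle H H H H \<Psi>) ?x = fn (middle H H H H (inv_arr ?\<Phi>)) ?x"
    by (rule middle_cong) (use x in \<open>simp_all add: C inv_inv_arr[OF \<Psi>(1)]\<close>)
  also have "fn ?\<Phi> (fn (m \<boxtimes> m) \<dots>) = fn (m \<boxtimes> m) (fn (middle H H H H ?\<Phi>) (fn (?\<Phi> \<boxtimes> ?\<Phi>) ?x))"
    by (rule crossing_multiplicative[OF I m(1) slidesR_slidesL(2)[OF \<Psi>(1) m(1,3)] m(1) slidesL_slidesR(2)[OF \<Psi>(1) m(1,2)] x])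
  also have "fn (?\<Phi> \<boxtimes> ?\<Phi>) ?x = fn (?d \<boxtimes> ?d) (fn \<Psi> y)"
    by (rule tmap_tmap) (use y in \<open>simp_all add: C arr_simps\<close>)
  also have "fn (middle H H H H ?\<Phi>) \<dots> = fn (\<Psi> \<boxtimes> \<Psi>) (fn (middle H H H H \<Psi>) (fn (?d \<boxtimes> ?d) y))"
    by (rule crossing_comultiplicative[OF \<Psi>(1) d'(1,2) d'(1,3) y])
  also have "fn (m \<boxtimes> m) \<dots> = fn ((m \<cdot> \<Psi>) \<boxtimes> (m \<cdot> \<Psi>)) (fn (middle H H H H \<Psi>) (fn (?d \<boxtimes> ?d) y))"
    by (rule tmap_tmap) (use y in \<open>simp_all add: C arr_simps lin_middle\<close>)
  finally show ?thesis by simp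
qed

text \<open>
  Turning the planar pairing around exchanges its two sides together with the order of the factors. This
  allows every statement about a duality to be used for \<open>U\<close> in the role of \<open>H\<close> and conversely.
\<close>

lemma form_nested_flip:
  assumes D: "dual_pair D" and E: "dual_pair E" and s: "s \<in> car (lsp D \<otimes> lsp E)" and t: "t \<in> car (rsp E \<otimes> rsp D)"
  shows "form (flip E \<odot> flip D) t s = form (D \<odot> E) s t"
proof -
  note N = dual_pair_nested[OF D E] dual_pair_nested[OF dual_pair_flip[OF E] dual_pair_flip[OF D]]
  note F = linear_map_form[OF N(1), unfolded duality_sel] linear_map_form[OF N(2), unfolded duality_sel]
  note p = nested_pure[OF D E] nested_pure[OF dual_pair_flip[OF E] dual_pair_flip[OF D], unfolded duality_sel]
  have 1: "\<forall>t\<in>car (rsp E \<otimes> rsp D). form (flip E \<odot> flip D) t (pure (lsp D) (lsp E) a b) = form (D \<odot> E) (pure (lsp D) (lsp E) a b) t"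
    if "a \<in> car (lsp D)" "b \<in> car (lsp E)" for a b
    by (rule tensor_ext_ball[of _ _ ground]) (use that in \<open>simp_all add: F p arr_simps\<close>)
  have "\<forall>s\<in>car (lsp D \<otimes> lsp E). form (flip E \<odot> flip D) t s = form (D \<odot> E) s t"
    by (rule tensor_ext_ball[of _ _ ground]) (use t 1 in \<open>simp_all add: F arr_simps\<close>)
  with s show ?thesis by blast
qed

lemma adjoint_flip:
  assumes D: "dual_pair D"
  shows "adjoint (D \<odot> D) (D \<odot> D) t s \<Longrightarrow> adjoint (flip D \<odot> flip D) (flip D \<odot> flip D) s t"
    and "adjoint (D \<odot> D) D m d \<Longrightarrow> adjoint (flip D) (flip D \<odot> flip D) d m"
    and "adjoint D (D \<odot> D) d' m' \<Longrightarrow> adjoint (flip D \<odot> flip D) (flip D) m' d'"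
  using dual_pair_flip[OF D] dual_pair_nested[OF dual_pair_flip[OF D] dual_pair_flip[OF D]]
  by (simp_all add: adjoint_def form_nested_flip[OF D D] lin_fn_mem)

context
  fixes D :: "('k::field, 'a::ab_group_add, 'b::ab_group_add) duality" and W :: "('k, 'w::ab_group_add) vs" and T S
  assumes T: "mates D D W W T S"
begin

private lemmas TT = mates_crossL[OF T]

lemma mate_slidesL:
  assumes D: "left_nondegenerate D"
  shows "adjoint (D \<odot> D) (D \<odot> D) t s \<Longrightarrow> endo_slidesR W (rsp D) S s \<Longrightarrow> endo_slidesL (lsp D) W T t"
    and "adjoint (D \<odot> D) D m d \<Longrightarrow> comult_slidesR W (rsp D) S d \<Longrightarrow> mult_slidesL (lsp D) W T m"
    and "adjoint D (D \<odot> D) d' m' \<Longrightarrow> mult_slidesR W (rsp D) S m' \<Longrightarrow> comult_slidesL (lsp D) W T d'"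
  unfolding slides_defs
  using slidesL_by_mates[OF TT TT _ left_nondegenerate_nested[OF D D]] slidesL_by_mates[OF TT T _ D]
    slidesL_by_mates[OF T TT _ left_nondegenerate_nested[OF D D]] by blast+

lemma mate_slidesR:
  assumes D: "left_nondegenerate (flip D)" and D2: "left_nondegenerate (flip (D \<odot> D))"
  shows "adjoint (D \<odot> D) (D \<odot> D) t s \<Longrightarrow> endo_slidesL (lsp D) W T t \<Longrightarrow> endo_slidesR W (rsp D) S s"
    and "adjoint D (D \<odot> D) d m \<Longrightarrow> comult_slidesL (lsp D) W T d \<Longrightarrow> mult_slidesR W (rsp D) S m"
    and "adjoint (D \<odot> D) D m' d' \<Longrightarrow> mult_slidesL (lsp D) W T m' \<Longrightarrow> comult_slidesR W (rsp D) S d'"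
  unfolding slides_defs
  using slidesR_by_mates[OF TT TT _ D2] slidesR_by_mates[OF T TT _ D]
    slidesR_by_mates[OF TT T _ D2] by blast+

end

lemma flip_nested_nondegenerate:
  assumes D: "left_nondegenerate (flip D)"
  shows "left_nondegenerate (flip (D \<odot> D))"
proof -
  have D': "dual_pair D" using dual_pair_flip[OF left_nondegenerate_dual_pair[OF D]] by simp
  have "form (D \<odot> D) s t = form (flip D \<odot> flip D) t s" if "s \<in> car (lsp D \<otimes> lsp D)" "t \<in> car (rsp D \<otimes> rsp D)" for s t
    using form_nested_flip[OF D' D' that] by simp
  then show ?thesis
    using left_nondegenerate_nested[OF D D] dual_pair_flip[OF dual_pair_nested[OF D' D']]
    by (auto simp: left_nondegenerate_def)
qed

section \<open>The dual braided bialgebra\<close>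

lemma counit_U_simps [simp]: "src (counit_U H e U) = dual_sub H U" "tgt (counit_U H e U) = ground" "fn (counit_U H e U) = (\<lambda>f. f e)"
  by (simp_all add: counit_U_def)

lemma dual_unit_eval: "a \<in> car H \<Longrightarrow> dual_unit H \<epsilon> a = fn \<epsilon> a"
  by (simp add: dual_unit_def functional_def)

context dual_subspace
begin

lemmas R = DU_rules
lemmas E = evaluation_nondegenerate
lemmas E2 = evaluation_nondegenerate2
lemmas E' = evaluation_pair
lemmas ev_pure = nested_pure[OF evaluation_pair evaluation_pair, unfolded evaluation_sel dual_sub_sel]

lemma functional_scl: "f \<in> U \<Longrightarrow> a \<in> car H \<Longrightarrow> f (scl H c a) = c * f a"
  using dual_sub_linear(1) by (simp add: linear_map_def ground_def)

text \<open>
  The unit of \<open>U\<close> is the counit of \<open>H\<close>, so pairing with it contracts one factor. This reduces the unit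
  axioms for \<open>U\<close>, including those for the braiding, to the counit axioms for \<open>H\<close>.
\<close>

lemma form_dual_unit:
  assumes \<epsilon>: "linear_form H \<epsilon>" and u: "dual_unit H \<epsilon> \<in> U" and f: "f \<in> U" and t: "t \<in> car (H \<otimes> H)"
  shows "form (D \<odot> D) (pure DU DU f (dual_unit H \<epsilon>)) t = f (fn (lunit H) (fn (\<epsilon> \<boxtimes> idm H) t))"
    and "form (D \<odot> D) (pure DU DU (dual_unit H \<epsilon>) f) t = f (fn (runit H) (fn (idm H \<boxtimes> \<epsilon>) t))"
proof -
  note C = linear_formD[OF \<epsilon>] H
  note l = linear_map_compose[OF dual_sub_linear(1)[OF f]]
  have "\<forall>t\<in>car (H \<otimes> H). form (D \<odot> D) (pure DU DU f (dual_unit H \<epsilon>)) t = f (fn (lunit H) (fn (\<epsilon> \<boxtimes> idm H) t))"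
    by (rule tensor_ext_ball[OF _ l])
      (use f u in \<open>simp_all add: R C arr_simps ev_pure dual_unit_eval functional_scl\<close>)
  with t show "form (D \<odot> D) (pure DU DU f (dual_unit H \<epsilon>)) t = f (fn (lunit H) (fn (\<epsilon> \<boxtimes> idm H) t))" by blast
  have "\<forall>t\<in>car (H \<otimes> H). form (D \<odot> D) (pure DU DU (dual_unit H \<epsilon>) f) t = f (fn (runit H) (fn (idm H \<boxtimes> \<epsilon>) t))"
    by (rule tensor_ext_ball[OF _ l])
      (use f u in \<open>simp_all add: R C arr_simps ev_pure dual_unit_eval functional_scl\<close>)
  with t show "form (D \<odot> D) (pure DU DU (dual_unit H \<epsilon>) f) t = f (fn (runit H) (fn (idm H \<boxtimes> \<epsilon>) t))" by blast
qed

lemma linear_form_counit_U: "e \<in> car H \<Longrightarrow> linear_form DU (counit_U H e U)"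
  using linear_map_form(4)[OF E', of e DU] by (simp add: linear_form_def lin_def R vspace_ground)

lemma form_counit:
  assumes e: "e \<in> car H" and a: "a \<in> car H" and F: "F \<in> car (DU \<otimes> DU)"
  shows "form (D \<odot> D) F (pure H H a e) = fn (lunit DU) (fn (counit_U H e U \<boxtimes> idm DU) F) a"
    and "form (D \<odot> D) F (pure H H e a) = fn (runit DU) (fn (idm DU \<boxtimes> counit_U H e U) F) a"
proof -
  note C = linear_formD(1)[OF linear_form_counit_U[OF e]]
  have l: "linear_map V DU g \<Longrightarrow> linear_map V ground (\<lambda>x. g x a)" for V :: "('k, 'y::ab_group_add) vs" and g
    using linear_map_form(1)[OF E', of V g a] a by simp
  have "\<forall>F\<in>car (DU \<otimes> DU). form (D \<odot> D) F (pure H H a e) = fn (lunit DU) (fn (counit_U H e U \<boxtimes> idm DU) F) a"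
    by (rule tensor_ext_ball[OF _ l]) (use a e in \<open>simp_all add: R C arr_simps ev_pure\<close>)
  with F show "form (D \<odot> D) F (pure H H a e) = fn (lunit DU) (fn (counit_U H e U \<boxtimes> idm DU) F) a" by blast
  have "\<forall>F\<in>car (DU \<otimes> DU). form (D \<odot> D) F (pure H H e a) = fn (runit DU) (fn (idm DU \<boxtimes> counit_U H e U) F) a"
    by (rule tensor_ext_ball[OF _ l]) (use a e in \<open>simp_all add: R C arr_simps ev_pure\<close>)
  with F show "form (D \<odot> D) F (pure H H e a) = fn (runit DU) (fn (idm DU \<boxtimes> counit_U H e U) F) a" by blast
qed

lemma DU_eqI: "f \<in> U \<Longrightarrow> g \<in> U \<Longrightarrow> (\<And>a. a \<in> car H \<Longrightarrow> f a = g a) \<Longrightarrow> f = g"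
  using eq_by_form[OF E, of f g] by (simp add: dual_sub_sel)

text \<open>
  The axioms are dual to those of the braided coalgebra \<open>H\<close> with coproduct \<open>\<Psi>\<^sup>-\<^sup>1 \<Delta>\<close>. The argument \<open>u\<close> covers
  subalgebras with and without unit.
\<close>

lemma dual_braided_algebra:
  assumes c: "braided_coalgebra H \<Delta> \<epsilon> \<Psi>" and cl: "\<forall>f\<in>U. \<forall>g\<in>U. dual_mult H \<Delta> \<Psi> f g \<in> U" and b: "bij_UU H \<Psi> U"
    and u: "\<And>e. u = Some e \<Longrightarrow> e = dual_unit H \<epsilon> \<and> e \<in> U"
  shows "braided_algebra DU (mult_U H \<Delta> \<Psi> U) u (Psi_UU H \<Psi> U)"
proof -
  let ?m = "mult_U H \<Delta> \<Psi> U" and ?P = "Psi_UU H \<Psi> U" and ?\<Phi> = "inv_arr \<Psi>"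
  note A = c[unfolded braided_coalgebra_iff]
  have \<Psi>: "crossing H H \<Psi>" and sL: "endo_slidesL H H \<Psi> \<Psi>" and d: "comult H \<Delta>" and \<epsilon>: "linear_form H \<epsilon>"
    and co: "assoc H H H \<cdot> (\<Delta> \<boxtimes> idm H) \<cdot> \<Delta> \<doteq> (idm H \<boxtimes> \<Delta>) \<cdot> \<Delta>"
    and dL: "comult_slidesL H H \<Psi> \<Delta>" and dR: "comult_slidesR H H \<Psi> \<Delta>"
    and cu: "\<And>a. a \<in> car H \<Longrightarrow> fn (lunit H) (fn (\<epsilon> \<boxtimes> idm H) (fn \<Delta> a)) = a" "\<And>a. a \<in> car H \<Longrightarrow> fn (runit H) (fn (idm H \<boxtimes> \<epsilon>) (fn \<Delta> a)) = a"
    and cx: "\<And>x. x \<in> car (H \<otimes> H) \<Longrightarrow> fn (runit H) (fn (idm H \<boxtimes> \<epsilon>) (fn \<Psi> x)) = fn (lunit H) (fn (\<epsilon> \<boxtimes> idm H) x)"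
      "\<And>x. x \<in> car (H \<otimes> H) \<Longrightarrow> fn (lunit H) (fn (\<epsilon> \<boxtimes> idm H) (fn \<Psi> x)) = fn (runit H) (fn (idm H \<boxtimes> \<epsilon>) x)"
    using A by blast+
  have sR: "endo_slidesR H H \<Psi> \<Psi>" using \<Psi> sL braiding_iffL braiding_right_braided by blast
  note C = crossingD[OF \<Psi>] comultD[OF d] linear_formD[OF \<epsilon>]
  have e: "endo H \<Psi>" by (simp add: endo_def C)
  note I = crossing_inv[OF \<Psi>]
  have \<Phi>: "endo_slidesL H H ?\<Phi> ?\<Phi>" "comult_slidesL H H ?\<Phi> \<Delta>" "comult_slidesR H H ?\<Phi> \<Delta>"
    using twisted_slidesL(1)[OF I e slidesR_slidesL(1)[OF \<Psi> e sR]] slidesR_slidesL(3)[OF \<Psi> d dR] slidesL_slidesR(3)[OF \<Psi> d dL]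
    by blast+
  note P = iso_Psi_UU[OF C(4,6,7) b] Psi_UU_src_tgt[OF C(4,6,7) b] adjoint_Psi_UU[OF C(4,6,7) b]
  note M = mult_mult_U[OF \<Psi> d cl] adjoint_mult_U[OF \<Psi> d cl]
  note ad = adjointD(9)[OF P(4), unfolded duality_sel evaluation_sel]
  note am = adjointD(9)[OF M(2), unfolded duality_sel evaluation_sel]
  have X: "crossing DU DU ?P" using P R by (simp add: crossing_def)
  have "?m \<cdot> (?m \<boxtimes> idm DU) \<doteq> ?m \<cdot> (idm DU \<boxtimes> ?m) \<cdot> assoc DU DU DU"
    using dual_assoc[OF E M(2)] twisted_comult_coassoc[OF I \<Phi>(1) d \<Phi>(2,3) co] by simp
  moreover have "endo_slidesL DU DU ?P ?P" using dual_endo_slidesL[OF E P(4)] sL by simp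
  moreover have "mult_slidesL DU DU ?P ?m" using dual_mult_slidesL[OF E P(4) M(2)] twisted_slidesL(3)[OF \<Psi> e sL d dL] by simp
  moreover have "mult_slidesR DU DU ?P ?m" using dual_mult_slidesR[OF E P(4) M(2)] twisted_slidesR(3)[OF \<Psi> e sR d dR] by simp
  moreover have "x \<in> car DU \<and> (\<forall>f\<in>car DU. fn ?m (pure DU DU x f) = f \<and> fn ?m (pure DU DU f x) = f \<and>
        fn ?P (pure DU DU x f) = pure DU DU f x \<and> fn ?P (pure DU DU f x) = pure DU DU x f)" if ux: "u = Some x" for x
  proof -
    have x: "x = dual_unit H \<epsilon>" and xU: "x \<in> U" using u[OF ux] by auto
    note F = form_dual_unit[OF \<epsilon> xU[unfolded x], folded x]
    have 1: "fn (lunit H) (fn (\<epsilon> \<boxtimes> idm H) (fn ?\<Phi> (fn \<Delta> a))) = a" "fn (runit H) (fn (idm H \<boxtimes> \<epsilon>) (fn ?\<Phi> (fn \<Delta> a))) = a" if "a \<in> car H" for a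
      using cx[of "fn ?\<Phi> (fn \<Delta> a)"] cu[OF that] that by (simp_all add: C arr_simps inv_arr_right)
    have "fn ?m (pure DU DU x f) = f \<and> fn ?m (pure DU DU f x) = f \<and>
        fn ?P (pure DU DU x f) = pure DU DU f x \<and> fn ?P (pure DU DU f x) = pure DU DU x f" if f: "f \<in> U" for f
    proof (intro conjI)
      have p: "pure DU DU x f \<in> car (DU \<otimes> DU)" "pure DU DU f x \<in> car (DU \<otimes> DU)" using f xU by (simp_all add: pure_in_tensor dual_sub_sel)
      have m: "fn ?m (pure DU DU x f) \<in> U" "fn ?m (pure DU DU f x) \<in> U"
        using p lin_fn_mem[OF multD(1)[OF M(1)], of DU] by (simp_all add: multD[OF M(1)] dual_sub_sel)
      have P': "fn ?P (pure DU DU x f) \<in> car (DU \<otimes> DU)" "fn ?P (pure DU DU f x) \<in> car (DU \<otimes> DU)"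
        using p by (simp_all add: P lin_fn_mem iso_lin)
      show "fn ?m (pure DU DU x f) = f" "fn ?m (pure DU DU f x) = f"
        by (rule DU_eqI; use p f m am in \<open>simp add: F C arr_simps 1\<close>)+
      show "fn ?P (pure DU DU x f) = pure DU DU f x" "fn ?P (pure DU DU f x) = pure DU DU x f"
        by (rule eq_by_form[OF E2]; use p P' f ad in \<open>simp add: F C arr_simps cx\<close>)+
    qed
    then show ?thesis using xU by (simp add: dual_sub_sel)
  qed
  ultimately show ?thesis using X M(1) by (simp add: braided_algebra_iff)
qed

lemma dual_braided_coalgebra:
  assumes c: "braided_algebra H m (Some e) \<Psi>" and ex: "\<forall>f\<in>U. \<exists>\<omega>. dual_coproduct H m \<Psi> U f \<omega>" and b: "bij_UU H \<Psi> U"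
  shows "braided_coalgebra DU (comult_U H m \<Psi> U) (counit_U H e U) (Psi_UU H \<Psi> U)"
proof -
  let ?d = "comult_U H m \<Psi> U" and ?P = "Psi_UU H \<Psi> U" and ?c = "counit_U H e U"
  note A = c[unfolded braided_algebra_iff]
  have \<Psi>: "crossing H H \<Psi>" and sL: "endo_slidesL H H \<Psi> \<Psi>" and m: "mult H m"
    and as: "m \<cdot> (m \<boxtimes> idm H) \<doteq> m \<cdot> (idm H \<boxtimes> m) \<cdot> assoc H H H"
    and mL: "mult_slidesL H H \<Psi> m" and mR: "mult_slidesR H H \<Psi> m" and e: "e \<in> car H"
    and un: "\<And>a. a \<in> car H \<Longrightarrow> fn m (pure H H e a) = a" "\<And>a. a \<in> car H \<Longrightarrow> fn m (pure H H a e) = a"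
      "\<And>a. a \<in> car H \<Longrightarrow> fn \<Psi> (pure H H e a) = pure H H a e" "\<And>a. a \<in> car H \<Longrightarrow> fn \<Psi> (pure H H a e) = pure H H e a"
    using A by blast+
  have sR: "endo_slidesR H H \<Psi> \<Psi>" using \<Psi> sL braiding_iffL braiding_right_braided by blast
  note C = crossingD[OF \<Psi>] multD[OF m]
  have en: "endo H \<Psi>" by (simp add: endo_def C)
  note P = iso_Psi_UU[OF C(4,6,7) b] Psi_UU_src_tgt[OF C(4,6,7) b] adjoint_Psi_UU[OF C(4,6,7) b]
  note M = comult_comult_U[OF \<Psi> m ex] adjoint_comult_U[OF \<Psi> m ex]
  note ad = adjointD(9)[OF P(4), unfolded duality_sel evaluation_sel]
  note am = adjointD(9)[OF M(2), unfolded duality_sel evaluation_sel]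
  note L = linear_form_counit_U[OF e]
  have X: "crossing DU DU ?P" using P R by (simp add: crossing_def)
  have "assoc DU DU DU \<cdot> (?d \<boxtimes> idm DU) \<cdot> ?d \<doteq> (idm DU \<boxtimes> ?d) \<cdot> ?d"
    using dual_coassoc[OF E M(2)] twisted_mult_assoc[OF \<Psi> sL m mL mR as] by simp
  moreover have "endo_slidesL DU DU ?P ?P" using dual_endo_slidesL[OF E P(4)] sL by simp
  moreover have "comult_slidesL DU DU ?P ?d" using dual_comult_slidesL[OF E P(4) M(2)] twisted_slidesL(2)[OF \<Psi> en sL m mL] by simp
  moreover have "comult_slidesR DU DU ?P ?d" using dual_comult_slidesR[OF E P(4) M(2)] twisted_slidesR(2)[OF \<Psi> en sR m mR] by simp
  moreover have "fn (lunit DU) (fn (?c \<boxtimes> idm DU) (fn ?d f)) = f" "fn (runit DU) (fn (idm DU \<boxtimes> ?c) (fn ?d f)) = f" if f: "f \<in> car DU" for f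
  proof -
    have F: "fn ?d f \<in> car (DU \<otimes> DU)" using f by (simp add: comultD[OF M(1)] lin_fn_mem)
    have "fn (lunit DU) (fn (?c \<boxtimes> idm DU) (fn ?d f)) \<in> car DU" "fn (runit DU) (fn (idm DU \<boxtimes> ?c) (fn ?d f)) \<in> car DU"
      using F linear_formD(1)[OF L] by (simp_all add: arr_simps R(1))
    then have m: "fn (lunit DU) (fn (?c \<boxtimes> idm DU) (fn ?d f)) \<in> U" "fn (runit DU) (fn (idm DU \<boxtimes> ?c) (fn ?d f)) \<in> U"
      by (simp_all add: dual_sub_sel)
    have fU: "f \<in> U" using f by (simp add: dual_sub_sel)
    show "fn (lunit DU) (fn (?c \<boxtimes> idm DU) (fn ?d f)) = f"
      by (rule DU_eqI[OF m(1) fU]) (use f e am[OF f] in \<open>simp add: form_counit(1)[OF e _ F, symmetric] pure_in_tensor un\<close>)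
    show "fn (runit DU) (fn (idm DU \<boxtimes> ?c) (fn ?d f)) = f"
      by (rule DU_eqI[OF m(2) fU]) (use f e am[OF f] in \<open>simp add: form_counit(2)[OF e _ F, symmetric] pure_in_tensor un\<close>)
  qed
  moreover have "fn (runit DU) (fn (idm DU \<boxtimes> ?c) (fn ?P x)) = fn (lunit DU) (fn (?c \<boxtimes> idm DU) x)"
    "fn (lunit DU) (fn (?c \<boxtimes> idm DU) (fn ?P x)) = fn (runit DU) (fn (idm DU \<boxtimes> ?c) x)" if x: "x \<in> car (DU \<otimes> DU)" for x
  proof -
    have F: "fn ?P x \<in> car (DU \<otimes> DU)" using x by (simp add: P lin_fn_mem iso_lin)
    have "fn (lunit DU) (fn (?c \<boxtimes> idm DU) y) \<in> car DU" "fn (runit DU) (fn (idm DU \<boxtimes> ?c) y) \<in> car DU" if "y \<in> car (DU \<otimes> DU)" for y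
      using that linear_formD(1)[OF L] by (simp_all add: arr_simps R(1))
    then have m: "fn (lunit DU) (fn (?c \<boxtimes> idm DU) y) \<in> U" "fn (runit DU) (fn (idm DU \<boxtimes> ?c) y) \<in> U" if "y \<in> car (DU \<otimes> DU)" for y
      using that by (simp_all add: dual_sub_sel)
    show "fn (runit DU) (fn (idm DU \<boxtimes> ?c) (fn ?P x)) = fn (lunit DU) (fn (?c \<boxtimes> idm DU) x)"
      by (rule DU_eqI[OF m(2)[OF F] m(1)[OF x]])
        (use e ad[OF x] in \<open>simp add: form_counit(2)[OF e _ F, symmetric] form_counit(1)[OF e _ x, symmetric] pure_in_tensor un\<close>)
    show "fn (lunit DU) (fn (?c \<boxtimes> idm DU) (fn ?P x)) = fn (runit DU) (fn (idm DU \<boxtimes> ?c) x)"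
      by (rule DU_eqI[OF m(1)[OF F] m(2)[OF x]])
        (use e ad[OF x] in \<open>simp add: form_counit(1)[OF e _ F, symmetric] form_counit(2)[OF e _ x, symmetric] pure_in_tensor un\<close>)
  qed
  ultimately show ?thesis using X M(1) L by (simp add: braided_coalgebra_iff)
qed

lemma dual_braided_bialgebra:
  assumes "standard_dual H m e \<Delta> \<epsilon> \<Psi> U"
  shows "braided_bialgebra DU (mult_U H \<Delta> \<Psi> U) (dual_unit H \<epsilon>) (comult_U H m \<Psi> U) (counit_U H e U) (Psi_UU H \<Psi> U)"
proof -
  let ?d = "comult_U H m \<Psi> U" and ?P = "Psi_UU H \<Psi> U" and ?m = "mult_U H \<Delta> \<Psi> U" and ?u = "dual_unit H \<epsilon>" and ?\<Phi> = "inv_arr \<Psi>"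
  have B: "braided_bialgebra H m e \<Delta> \<epsilon> \<Psi>" and u: "?u \<in> U" and cl: "\<forall>f\<in>U. \<forall>g\<in>U. dual_mult H \<Delta> \<Psi> f g \<in> U"
    and ex: "\<forall>f\<in>U. \<exists>\<omega>. dual_coproduct H m \<Psi> U f \<omega>" and b: "bij_UU H \<Psi> U"
    using assms by (auto simp: standard_dual_def)
  have al: "braided_algebra H m (Some e) \<Psi>" and ca: "braided_coalgebra H \<Delta> \<epsilon> \<Psi>"
    and bi: "\<Delta> \<cdot> m \<doteq> (m \<boxtimes> m) \<cdot> middle H H H H \<Psi> \<cdot> (\<Delta> \<boxtimes> \<Delta>)"
    and \<Delta>e: "fn \<Delta> e = pure H H e e" and \<epsilon>m: "\<And>a b. a \<in> car H \<Longrightarrow> b \<in> car H \<Longrightarrow> fn \<epsilon> (fn m (pure H H a b)) = fn \<epsilon> a * fn \<epsilon> b" and \<epsilon>e: "fn \<epsilon> e = 1"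
    using B by (auto simp: braided_bialgebra_def)
  have \<Psi>: "crossing H H \<Psi>" "endo_slidesL H H \<Psi> \<Psi>" and d: "comult H \<Delta>" "comult_slidesL H H \<Psi> \<Delta>" "comult_slidesR H H \<Psi> \<Delta>" and \<epsilon>: "linear_form H \<epsilon>"
    and cx: "\<And>x. x \<in> car (H \<otimes> H) \<Longrightarrow> fn (runit H) (fn (idm H \<boxtimes> \<epsilon>) (fn \<Psi> x)) = fn (lunit H) (fn (\<epsilon> \<boxtimes> idm H) x)"
    using ca[unfolded braided_coalgebra_iff] by blast+
  have sR: "endo_slidesR H H \<Psi> \<Psi>" using \<Psi> braiding_iffL braiding_right_braided by blast
  have m: "mult H m" "mult_slidesL H H \<Psi> m" "mult_slidesR H H \<Psi> m" and e: "e \<in> car H"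
    and \<Psi>e: "fn \<Psi> (pure H H e e) = pure H H e e"
    using al[unfolded braided_algebra_iff] by blast+
  note C = crossingD[OF \<Psi>(1)] multD[OF m(1)] comultD[OF d(1)] linear_formD[OF \<epsilon>]
  note P = adjoint_Psi_UU[OF C(4,6,7) b]
  note M = mult_mult_U[OF \<Psi>(1) d(1) cl] adjoint_mult_U[OF \<Psi>(1) d(1) cl]
  note N = comult_comult_U[OF \<Psi>(1) m(1) ex] adjoint_comult_U[OF \<Psi>(1) m(1) ex]
  have 1: "?d \<cdot> ?m \<doteq> (?m \<boxtimes> ?m) \<cdot> middle DU DU DU DU ?P \<cdot> (?d \<boxtimes> ?d)"
    by (rule adjoint_arr_eq[OF adjoint_comp[OF N(2) M(2)]
          adjoint_comp[OF adjoint_tmap[OF M(2) M(2)] adjoint_comp[OF adjoint_middle[OF E' P, unfolded evaluation_sel] adjoint_tmap[OF N(2) N(2)]]] E2])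
      (rule arr_eqI, use twisted_bialgebra[OF \<Psi> sR m d bi] in \<open>simp_all add: C\<close>)
  have 2: "fn ?d ?u = pure DU DU ?u ?u"
  proof (rule eq_by_form[OF E2])
    have f: "\<forall>t\<in>car (H \<otimes> H). ?u (fn m t) = form (D \<odot> D) (pure DU DU ?u ?u) t"
      by (rule tensor_ext_ball[OF linear_map_compose[OF dual_sub_linear(1)[OF u]]])
        (use u in \<open>simp_all add: R C arr_simps ev_pure dual_unit_eval \<epsilon>m\<close>)
    fix t assume "t \<in> car (rsp (D \<odot> D))"
    then have t: "t \<in> car (H \<otimes> H)" by simp
    have "form (D \<odot> D) (fn ?d ?u) t = ?u (fn m (fn \<Psi> t))"
      using adjointD(9)[OF N(2), of ?u t] u t by (simp add: dual_sub_sel)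
    also have "\<dots> = form (D \<odot> D) (pure DU DU ?u ?u) (fn \<Psi> t)" using f t by (simp add: C arr_simps)
    also have "\<dots> = ?u (fn (lunit H) (fn (\<epsilon> \<boxtimes> idm H) t))" using t by (simp add: form_dual_unit(2)[OF \<epsilon> u u] C arr_simps cx)
    also have "\<dots> = form (D \<odot> D) (pure DU DU ?u ?u) t" using t by (simp add: form_dual_unit(1)[OF \<epsilon> u u])
    finally show "form (D \<odot> D) (fn ?d ?u) t = form (D \<odot> D) (pure DU DU ?u ?u) t" .
  qed (use u in \<open>simp_all add: pure_in_tensor dual_sub_sel lin_fn_mem comultD[OF N(1)]\<close>)
  have i: "fn ?\<Phi> (pure H H e e) = pure H H e e"
    by (rule inv_arr_eqI) (use e \<Psi>e in \<open>simp_all add: C arr_simps\<close>)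
  have 3: "fn ?m (pure DU DU f g) e = f e * g e" if "f \<in> U" "g \<in> U" for f g
    using adjointD(9)[OF M(2), of "pure DU DU f g" e] that e
    by (simp add: pure_in_tensor dual_sub_sel \<Delta>e i ev_pure)
  show ?thesis
    unfolding braided_bialgebra_def
    using dual_braided_algebra[OF ca cl b, of "Some ?u"] dual_braided_coalgebra[OF al ex b] u 1 2 3 e \<epsilon>e
    by (simp add: dual_sub_sel dual_unit_eval)
qed

section \<open>Modules over the dual\<close>

lemma slice_dual_unit:
  assumes \<epsilon>: "linear_form H \<epsilon>" and V: "vspace V" and u: "dual_unit H \<epsilon> \<in> U"
  shows "t \<in> car (H \<otimes> V) \<Longrightarrow> fn (sliceL H V (dual_unit H \<epsilon>)) t = fn (lunit V) (fn (\<epsilon> \<boxtimes> idm V) t)"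
    and "s \<in> car (V \<otimes> H) \<Longrightarrow> fn (sliceR V H (dual_unit H \<epsilon>)) s = fn (runit V) (fn (idm V \<boxtimes> \<epsilon>) s)"
proof -
  note C = linear_formD[OF \<epsilon>] H V dual_sub_linear(1)[OF u]
  have "\<forall>t\<in>car (H \<otimes> V). fn (sliceL H V (dual_unit H \<epsilon>)) t = fn (lunit V) (fn (\<epsilon> \<boxtimes> idm V) t)"
    by (rule tensor_ext_ball[of _ _ V]) (simp_all add: C arr_simps slice_simps dual_unit_eval)
  then show "t \<in> car (H \<otimes> V) \<Longrightarrow> fn (sliceL H V (dual_unit H \<epsilon>)) t = fn (lunit V) (fn (\<epsilon> \<boxtimes> idm V) t)" by blast
  have "\<forall>t\<in>car (V \<otimes> H). fn (sliceR V H (dual_unit H \<epsilon>)) t = fn (runit V) (fn (idm V \<boxtimes> \<epsilon>) t)"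
    by (rule tensor_ext_ball[of _ _ V]) (simp_all add: C arr_simps slice_simps dual_unit_eval)
  then show "s \<in> car (V \<otimes> H) \<Longrightarrow> fn (sliceR V H (dual_unit H \<epsilon>)) s = fn (runit V) (fn (idm V \<boxtimes> \<epsilon>) s)" by blast
qed

text \<open>
  Each axiom is the transpose of a property of \<open>\<Omega>\<^sup>-\<^sup>1\<close> or of \<open>S = \<Omega>\<^sup>-\<^sup>1 \<rho>\<close>: the braiding axioms come from the
  sliding rules for \<open>\<Omega>\<^sup>-\<^sup>1\<close>, associativity from \<open>S\<close> being a coaction for the twisted coproduct, and the
  compatibility of the action with the braidings from that of \<open>S\<close> with \<open>\<Psi>\<close>.
\<close>

lemma dual_left_module:
  assumes cm: "braided_right_comodule H \<Delta> \<epsilon> \<Psi> V \<Omega> \<rho>" and cl: "\<forall>f\<in>U. \<forall>g\<in>U. dual_mult H \<Delta> \<Psi> f g \<in> U"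
    and b: "bij_UU H \<Psi> U" and bV: "bij_UV H V \<Omega> U" and u: "\<And>e. u = Some e \<Longrightarrow> e = dual_unit H \<epsilon> \<and> e \<in> U"
  shows "braided_left_module DU (mult_U H \<Delta> \<Psi> U) u (Psi_UU H \<Psi> U) V (Psi_UV H V \<Omega> U) (action_left H V \<Omega> \<rho> U)"
proof -
  let ?m = "mult_U H \<Delta> \<Psi> U" and ?P = "Psi_UU H \<Psi> U" and ?Q = "Psi_UV H V \<Omega> U" and ?\<nu> = "action_left H V \<Omega> \<rho> U"
    and ?\<Theta> = "inv_arr \<Omega>" and ?\<Phi> = "inv_arr \<Psi>"
  let ?S = "?\<Theta> \<cdot> \<rho>"
  have ca: "braided_coalgebra H \<Delta> \<epsilon> \<Psi>" and lb: "left_braided H \<Psi> V \<Omega>" and cc: "compat_comult_left H \<Delta> \<epsilon> V \<Omega>"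
    and \<rho>H: "\<rho> \<in> Hom V (V \<otimes> H)" and coassoc: "assoc V H H \<cdot> (\<rho> \<boxtimes> idm H) \<cdot> \<rho> \<doteq> (idm V \<boxtimes> \<Delta>) \<cdot> \<rho>"
    and counit: "runit V \<cdot> (idm V \<boxtimes> \<epsilon>) \<cdot> \<rho> \<doteq> idm V"
    and compat: "(\<rho> \<boxtimes> idm H) \<cdot> \<Omega> \<doteq> assoc' V H H \<cdot> (idm V \<boxtimes> \<Psi>) \<cdot> assoc V H H \<cdot> (\<Omega> \<boxtimes> idm H) \<cdot> assoc' H V H \<cdot> (idm H \<boxtimes> \<rho>)"
    using cm by (auto simp: braided_right_comodule_def)
  have \<Psi>: "crossing H H \<Psi>" "endo_slidesL H H \<Psi> \<Psi>" and d: "comult H \<Delta>" and \<epsilon>: "linear_form H \<epsilon>"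
    using ca[unfolded braided_coalgebra_iff] by blast+
  have \<Omega>: "crossing H V \<Omega>" "endo_slidesL H V \<Omega> \<Psi>" using lb by (auto simp: left_braided_iff)
  have dV: "comult_slidesL H V \<Omega> \<Delta>"
    and \<epsilon>V: "\<And>x. x \<in> car (H \<otimes> V) \<Longrightarrow> fn (runit V) (fn (idm V \<boxtimes> \<epsilon>) (fn \<Omega> x)) = fn (lunit V) (fn (\<epsilon> \<boxtimes> idm V) x)"
    using cc[unfolded compat_comult_left_iff[OF \<Omega>(1) d linear_formD(1-3)[OF \<epsilon>]]] by blast+
  note V = crossingD(2)[OF \<Omega>(1)]
  have \<rho>: "lin \<rho>" "src \<rho> = V" "tgt \<rho> = V \<otimes> H" using \<rho>H V by (simp_all add: Hom_iff vspace_tensor)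
  note C = crossingD[OF \<Psi>(1)] crossingD[OF \<Omega>(1)] comultD[OF d] linear_formD[OF \<epsilon>] \<rho>
  have e: "endo H \<Psi>" by (simp add: endo_def C)
  note I = crossing_inv[OF \<Omega>(1)]
  note P = adjoint_Psi_UU[OF C(4,6,7) b]
  note M = mult_mult_U[OF \<Psi>(1) d cl] adjoint_mult_U[OF \<Psi>(1) d cl]
  note Q = crossing_Psi_UV[OF \<Omega>(1) bV] mates_Psi_UV[OF \<Omega>(1) bV]
  note N = left_action_action_left[OF \<Omega>(1) \<rho>]
  note N' = left_actionD[OF N, unfolded evaluation_sel dual_sub_sel]
  have al: "braided_algebra DU ?m u ?P" by (rule dual_braided_algebra[OF ca cl b u])
  have br: "braiding DU ?P" using al by (simp add: braided_algebra_def)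
  have sR: "endo_slidesR V H ?\<Theta> \<Psi>" "comult_slidesR V H ?\<Theta> \<Delta>"
    using slidesL_slidesR[OF \<Omega>(1)] e \<Omega>(2) d dV by blast+
  have s1: "endo_slidesL DU V ?Q ?P" using mate_slidesL(1)[OF Q(2) E P] sR(1) by simp
  have s2: "mult_slidesL DU V ?Q ?m" using mate_slidesL(2)[OF Q(2) E M(2)] twisted_slidesR(3)[OF I e sR(1) d sR(2)] by simp
  note tw = twisted_right_coaction[OF \<Psi>(1) \<Omega> d dV \<rho> coassoc compat]
  have counit\<Theta>: "fn (lunit V) (fn (\<epsilon> \<boxtimes> idm V) (fn ?\<Theta> y)) = fn (runit V) (fn (idm V \<boxtimes> \<epsilon>) y)" if "y \<in> car (V \<otimes> H)" for y
    using \<epsilon>V[of "fn ?\<Theta> y"] that by (simp add: C arr_simps inv_arr_right)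
  have un: "fn ?Q (pure DU V x v) = pure V DU v x \<and> fn ?\<nu> (pure DU V x v) = v" if ux: "u = Some x" and v: "v \<in> car V" for x v
  proof
    have x: "x = dual_unit H \<epsilon>" and xU: "x \<in> U" using u[OF ux] by auto
    note sl = slice_dual_unit(1)[OF \<epsilon> V xU[unfolded x], folded x]
    have xl: "linear_map H ground x" by (rule dual_sub_linear(1)[OF xU])
    show "fn ?Q (pure DU V x v) = pure V DU v x"
    proof (rule eq_by_rslice[OF E V])
      fix a assume "a \<in> car (rsp D)"
      then have a: "a \<in> car H" by simp
      have "fn (rslice V D a) (fn ?Q (pure DU V x v)) = fn (sliceL H V x) (fn ?\<Theta> (pure V H v a))"
        using matesD(15)[OF Q(2), of x v a] xU v a by (simp add: dual_sub_sel)
      also have "\<dots> = scl V (x a) v"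
        using v a by (simp add: sl[unfolded x] C arr_simps counit\<Theta> x dual_unit_eval)
      also have "\<dots> = fn (rslice V D a) (pure V DU v x)"
        using rslice_pure[OF E' V, of a x v] v a xU by (simp add: dual_sub_sel)
      finally show "fn (rslice V D a) (fn ?Q (pure DU V x v)) = fn (rslice V D a) (pure V DU v x)" .
    qed (use v xU crossingD[OF Q(1)] in \<open>simp_all add: lin_fn_mem pure_in_tensor dual_sub_sel\<close>)
    have "fn ?\<nu> (pure DU V x v) = fn (runit V) (fn (idm V \<boxtimes> \<epsilon>) (fn \<rho> v))"
      using N'(11)[OF xU v] v by (simp add: sl C arr_simps counit\<Theta>)
    then show "fn ?\<nu> (pure DU V x v) = v" using arr_eqD[OF counit, of v] v by simp
  qed
  have as: "?\<nu> \<cdot> (idm DU \<boxtimes> ?\<nu>) \<cdot> assoc DU DU V \<doteq> ?\<nu> \<cdot> (?m \<boxtimes> idm V)"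
    using left_action_assoc[OF N M(2)] tw(1) by simp
  note K1 = mates_left_action_then_cross[OF N Q(2)]
  note K2 = mates_precompose[OF mates_cross_then_left_action[OF N Q(2)] P]
  note QD = crossingD[OF Q(1)]
  \<comment> \<open>both sides are rebracketed to start from \<open>(U \<otimes> U) \<otimes> V\<close>, where they have the mates compared in \<open>tw(2)\<close>\<close>
  have cp: "?Q \<cdot> (idm DU \<boxtimes> ?\<nu>) \<doteq> (?\<nu> \<boxtimes> idm DU) \<cdot> assoc' DU V DU \<cdot> (idm DU \<boxtimes> ?Q) \<cdot> assoc DU DU V \<cdot> (?P \<boxtimes> idm V) \<cdot> assoc' DU DU V"
  proof (rule arr_eqI)
    fix x assume "x \<in> car (src ((?\<nu> \<boxtimes> idm DU) \<cdot> assoc' DU V DU \<cdot> (idm DU \<boxtimes> ?Q) \<cdot> assoc DU DU V \<cdot> (?P \<boxtimes> idm V) \<cdot> assoc' DU DU V))"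
    then have x: "x \<in> car (DU \<otimes> (DU \<otimes> V))" by simp
    define z where "z = fn (assoc' DU DU V) x"
    have z: "z \<in> car ((DU \<otimes> DU) \<otimes> V)" and xz: "x = fn (assoc DU DU V) z"
      using x by (simp_all add: z_def arr_simps R(1) V inv_arr_right iso_assoc)
    have "fn (?Q \<cdot> (idm (lsp D) \<boxtimes> ?\<nu>) \<cdot> assoc (lsp D) (lsp D) V) z =
        fn (((?\<nu> \<boxtimes> idm (lsp D)) \<cdot> assoc' (lsp D) V (lsp D) \<cdot> (idm (lsp D) \<boxtimes> ?Q) \<cdot> assoc (lsp D) (lsp D) V) \<cdot> (?P \<boxtimes> idm V)) z"
      by (rule mates_unique_left[OF K1 K2 E]) (use z tw(2) in simp_all)
    then show "fn (?Q \<cdot> (idm DU \<boxtimes> ?\<nu>)) x = fn ((?\<nu> \<boxtimes> idm DU) \<cdot> assoc' DU V DU \<cdot> (idm DU \<boxtimes> ?Q) \<cdot> assoc DU DU V \<cdot> (?P \<boxtimes> idm V) \<cdot> assoc' DU DU V) x"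
      using z by (simp add: xz inv_arr_left iso_assoc R(1) V)
  qed (use QD N' in simp_all)
  show ?thesis
    unfolding braided_left_module_def
    using al br Q(1) s1 s2 un as cp N'(1-8) R(1) V
    by (simp add: left_braided_iff compat_mult_left_iff[OF Q(1) M(1)] Hom_iff vspace_tensor)
qed

text \<open>
  The mates are now \<open>\<Omega>\<^sup>-\<^sup>1\<close> and \<open>\<Psi>\<^sub>V\<^sub>U\<^sup>\<circ>\<close> in this order, so the statements about \<open>\<Psi>\<^sub>V\<^sub>U\<^sup>\<circ>\<close> concern the second
  mate, and uniqueness of mates is used from the other side.
\<close>

lemma dual_right_module:
  assumes cm: "braided_left_comodule H \<Delta> \<epsilon> \<Psi> V \<Omega> \<rho>" and cl: "\<forall>f\<in>U. \<forall>g\<in>U. dual_mult H \<Delta> \<Psi> f g \<in> U"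
    and b: "bij_UU H \<Psi> U" and bV: "bij_VU H V \<Omega> U" and u: "\<And>e. u = Some e \<Longrightarrow> e = dual_unit H \<epsilon> \<and> e \<in> U"
  shows "braided_right_module DU (mult_U H \<Delta> \<Psi> U) u (Psi_UU H \<Psi> U) V (Psi_VU H V \<Omega> U) (action_right H V \<Omega> \<rho> U)"
proof -
  let ?m = "mult_U H \<Delta> \<Psi> U" and ?P = "Psi_UU H \<Psi> U" and ?Q = "Psi_VU H V \<Omega> U" and ?\<nu> = "action_right H V \<Omega> \<rho> U"
    and ?\<Theta> = "inv_arr \<Omega>" and ?\<Phi> = "inv_arr \<Psi>" and ?F = "flip D"
  let ?S = "?\<Theta> \<cdot> \<rho>"
  have ca: "braided_coalgebra H \<Delta> \<epsilon> \<Psi>" and rb: "right_braided H \<Psi> V \<Omega>" and cc: "compat_comult_right V H \<Delta> \<epsilon> \<Omega>"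
    and \<rho>H: "\<rho> \<in> Hom V (H \<otimes> V)" and coassoc: "(idm H \<boxtimes> \<rho>) \<cdot> \<rho> \<doteq> assoc H H V \<cdot> (\<Delta> \<boxtimes> idm V) \<cdot> \<rho>"
    and counit: "lunit V \<cdot> (\<epsilon> \<boxtimes> idm V) \<cdot> \<rho> \<doteq> idm V"
    and compat: "(idm H \<boxtimes> \<rho>) \<cdot> \<Omega> \<doteq> assoc H H V \<cdot> (\<Psi> \<boxtimes> idm V) \<cdot> assoc' H H V \<cdot> (idm H \<boxtimes> \<Omega>) \<cdot> assoc H V H \<cdot> (\<rho> \<boxtimes> idm H)"
    using cm by (auto simp: braided_left_comodule_def)
  have \<Psi>: "crossing H H \<Psi>" "endo_slidesL H H \<Psi> \<Psi>" and d: "comult H \<Delta>" and \<epsilon>: "linear_form H \<epsilon>"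
    using ca[unfolded braided_coalgebra_iff] by blast+
  have \<Omega>: "crossing V H \<Omega>" "endo_slidesR V H \<Omega> \<Psi>" using rb by (auto simp: right_braided_iff)
  have dV: "comult_slidesR V H \<Omega> \<Delta>"
    and \<epsilon>V: "\<And>x. x \<in> car (V \<otimes> H) \<Longrightarrow> fn (lunit V) (fn (\<epsilon> \<boxtimes> idm V) (fn \<Omega> x)) = fn (runit V) (fn (idm V \<boxtimes> \<epsilon>) x)"
    using cc[unfolded compat_comult_right_iff[OF \<Omega>(1) d linear_formD(1-3)[OF \<epsilon>]]] by blast+
  note V = crossingD(1)[OF \<Omega>(1)]
  have \<rho>: "lin \<rho>" "src \<rho> = V" "tgt \<rho> = H \<otimes> V" using \<rho>H V by (simp_all add: Hom_iff vspace_tensor)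
  note C = crossingD[OF \<Psi>(1)] crossingD[OF \<Omega>(1)] comultD[OF d] linear_formD[OF \<epsilon>] \<rho>
  have e: "endo H \<Psi>" by (simp add: endo_def C)
  note I = crossing_inv[OF \<Omega>(1)]
  note P = adjoint_Psi_UU[OF C(4,6,7) b]
  note M = mult_mult_U[OF \<Psi>(1) d cl] adjoint_mult_U[OF \<Psi>(1) d cl]
  note Pf = adjoint_flip(1)[OF E' P] and Mf = adjoint_flip(2)[OF E' M(2)]
  note Q = crossing_Psi_VU[OF \<Omega>(1) bV] mates_Psi_VU[OF \<Omega>(1) bV]
  note N = right_action_action_right[OF \<Omega>(1) \<rho>]
  note N' = right_actionD[OF N, unfolded duality_sel evaluation_sel dual_sub_sel]
  have FE: "left_nondegenerate (flip ?F)" using E by simp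
  note FE2 = flip_nested_nondegenerate[OF FE]
  have al: "braided_algebra DU ?m u ?P" by (rule dual_braided_algebra[OF ca cl b u])
  have br: "braiding DU ?P" using al by (simp add: braided_algebra_def)
  have sL: "endo_slidesL H V ?\<Theta> \<Psi>" "comult_slidesL H V ?\<Theta> \<Delta>"
    using slidesR_slidesL[OF \<Omega>(1)] e \<Omega>(2) d dV by blast+
  have s1: "endo_slidesR V DU ?Q ?P" using mate_slidesR(1)[OF Q(2) FE FE2 Pf] sL(1) by simp
  have s2: "mult_slidesR V DU ?Q ?m" using mate_slidesR(2)[OF Q(2) FE FE2 Mf] twisted_slidesL(3)[OF I e sL(1) d sL(2)] by simp
  note tw = twisted_left_coaction[OF \<Psi>(1) \<Omega> d dV \<rho> coassoc compat]
  have counit\<Theta>: "fn (runit V) (fn (idm V \<boxtimes> \<epsilon>) (fn ?\<Theta> y)) = fn (lunit V) (fn (\<epsilon> \<boxtimes> idm V) y)" if "y \<in> car (H \<otimes> V)" for y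
    using \<epsilon>V[of "fn ?\<Theta> y"] that by (simp add: C arr_simps inv_arr_right)
  have un: "fn ?Q (pure V DU v x) = pure DU V x v \<and> fn ?\<nu> (pure V DU v x) = v" if ux: "u = Some x" and v: "v \<in> car V" for x v
  proof
    have x: "x = dual_unit H \<epsilon>" and xU: "x \<in> U" using u[OF ux] by auto
    note sl = slice_dual_unit(2)[OF \<epsilon> V xU[unfolded x], folded x]
    have xl: "linear_map H ground x" by (rule dual_sub_linear(1)[OF xU])
    show "fn ?Q (pure V DU v x) = pure DU V x v"
    proof (rule eq_by_lslice[OF FE V])
      fix a assume "a \<in> car (lsp ?F)"
      then have a: "a \<in> car H" by simp
      have "fn (lslice ?F V a) (fn ?Q (pure V DU v x)) = fn (sliceR V H x) (fn ?\<Theta> (pure H V a v))"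
        using matesD(15)[OF Q(2), of a v x] xU v a by (simp add: dual_sub_sel)
      also have "\<dots> = scl V (x a) v"
        using v a by (simp add: sl[unfolded x] C arr_simps counit\<Theta> x dual_unit_eval)
      also have "\<dots> = fn (lslice ?F V a) (pure DU V x v)"
        using lslice_pure[OF dual_pair_flip[OF E'] V, of a x v] v a xU by (simp add: dual_sub_sel)
      finally show "fn (lslice ?F V a) (fn ?Q (pure V DU v x)) = fn (lslice ?F V a) (pure DU V x v)" .
    qed (use v xU crossingD[OF Q(1)] in \<open>simp_all add: lin_fn_mem pure_in_tensor dual_sub_sel\<close>)
    have "fn ?\<nu> (pure V DU v x) = fn (lunit V) (fn (\<epsilon> \<boxtimes> idm V) (fn \<rho> v))"
      using N'(11)[OF xU v] v by (simp add: sl C arr_simps counit\<Theta>)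
    then show "fn ?\<nu> (pure V DU v x) = v" using arr_eqD[OF counit, of v] v by simp
  qed
  have as: "?\<nu> \<cdot> (?\<nu> \<boxtimes> idm DU) \<doteq> ?\<nu> \<cdot> (idm V \<boxtimes> ?m) \<cdot> assoc V DU DU"
    using right_action_assoc[OF N Mf] tw(1) by simp
  note K1 = mates_right_action_then_cross[OF N Q(2)]
  note K2 = mates_postcompose[OF mates_cross_then_right_action[OF N Q(2)] Pf]
  note QD = crossingD[OF Q(1)]
  \<comment> \<open>both sides are rebracketed to start from \<open>V \<otimes> (U \<otimes> U)\<close>, where they have the mates compared in \<open>tw(2)\<close>\<close>
  have cp: "?Q \<cdot> (?\<nu> \<boxtimes> idm DU) \<doteq> (idm DU \<boxtimes> ?\<nu>) \<cdot> assoc DU V DU \<cdot> (?Q \<boxtimes> idm DU) \<cdot> assoc' V DU DU \<cdot> (idm V \<boxtimes> ?P) \<cdot> assoc V DU DU"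
  proof (rule arr_eqI)
    fix x assume "x \<in> car (src ((idm DU \<boxtimes> ?\<nu>) \<cdot> assoc DU V DU \<cdot> (?Q \<boxtimes> idm DU) \<cdot> assoc' V DU DU \<cdot> (idm V \<boxtimes> ?P) \<cdot> assoc V DU DU))"
    then have x: "x \<in> car ((V \<otimes> DU) \<otimes> DU)" by simp
    define z where "z = fn (assoc V DU DU) x"
    have z: "z \<in> car (V \<otimes> (DU \<otimes> DU))" and xz: "x = fn (assoc' V DU DU) z"
      using x by (simp_all add: z_def arr_simps R(1) V inv_arr_left iso_assoc)
    have "fn (?Q \<cdot> (?\<nu> \<boxtimes> idm (rsp ?F)) \<cdot> assoc' V (rsp ?F) (rsp ?F)) z =
        fn (((idm (rsp ?F) \<boxtimes> ?\<nu>) \<cdot> assoc (rsp ?F) V (rsp ?F) \<cdot> (?Q \<boxtimes> idm (rsp ?F)) \<cdot> assoc' V (rsp ?F) (rsp ?F)) \<cdot> (idm V \<boxtimes> ?P)) z"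
      by (rule mates_unique_right[OF K1 K2 FE]) (use z tw(2) in simp_all)
    then show "fn (?Q \<cdot> (?\<nu> \<boxtimes> idm DU)) x = fn ((idm DU \<boxtimes> ?\<nu>) \<cdot> assoc DU V DU \<cdot> (?Q \<boxtimes> idm DU) \<cdot> assoc' V DU DU \<cdot> (idm V \<boxtimes> ?P) \<cdot> assoc V DU DU) x"
      using z by (simp add: xz inv_arr_right iso_assoc R(1) V)
  qed (use QD N' in simp_all)
  show ?thesis
    unfolding braided_right_module_def
    using al br Q(1) s1 s2 un as cp N'(1-8) R(1) V
    by (simp add: right_braided_iff compat_mult_right_iff[OF Q(1) M(1)] Hom_iff vspace_tensor)
qed

text \<open>
  Compatibility of \<open>\<Psi>\<^sub>U\<^sub>V\<^sup>\<circ>\<close> with the product of \<open>V\<close> is different from the other axioms, as the sliding map lives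
  on the strand \<open>V\<close> that is not bent; it is the mate of the same compatibility for \<open>\<Omega>\<^sup>-\<^sup>1\<close> by \<open>mates_crossR\<close>. The
  module algebra axiom is the transpose of the multiplicativity of \<open>S\<close>.
\<close>

lemma dual_left_module_algebra:
  assumes ca: "braided_right_comodule_algebra H m e \<Delta> \<epsilon> \<Psi> V mV uV \<Psi>VV \<Omega> \<rho>"
    and sd: "standard_dual H m e \<Delta> \<epsilon> \<Psi> U" and bV: "bij_UV H V \<Omega> U"
  shows "braided_left_module_algebra DU (mult_U H \<Delta> \<Psi> U) (dual_unit H \<epsilon>) (comult_U H m \<Psi> U) (counit_U H e U) (Psi_UU H \<Psi> U)
    V mV uV \<Psi>VV (Psi_UV H V \<Omega> U) (action_left H V \<Omega> \<rho> U)"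
proof -
  let ?d = "comult_U H m \<Psi> U" and ?c = "counit_U H e U" and ?P = "Psi_UU H \<Psi> U" and ?Q = "Psi_UV H V \<Omega> U"
    and ?\<nu> = "action_left H V \<Omega> \<rho> U" and ?\<Theta> = "inv_arr \<Omega>"
  let ?S = "?\<Theta> \<cdot> \<rho>"
  have B: "braided_bialgebra H m e \<Delta> \<epsilon> \<Psi>" and u: "dual_unit H \<epsilon> \<in> U" and cl: "\<forall>f\<in>U. \<forall>g\<in>U. dual_mult H \<Delta> \<Psi> f g \<in> U"
    and ex: "\<forall>f\<in>U. \<exists>\<omega>. dual_coproduct H m \<Psi> U f \<omega>" and b: "bij_UU H \<Psi> U"
    using sd by (auto simp: standard_dual_def)
  have alV: "braided_algebra V mV uV \<Psi>VV" and lb: "left_braided H \<Psi> V \<Omega>" and cml: "compat_mult_left H m (Some e) V \<Omega>"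
    and cmr: "compat_mult_right H V mV uV \<Omega>" and cc: "compat_comult_left H \<Delta> \<epsilon> V \<Omega>"
    and cm: "braided_right_comodule H \<Delta> \<epsilon> \<Psi> V \<Omega> \<rho>"
    and \<rho>m: "\<rho> \<cdot> mV \<doteq> (mV \<boxtimes> m) \<cdot> middle V H V H \<Omega> \<cdot> (\<rho> \<boxtimes> \<rho>)" and \<rho>1: "\<And>x. uV = Some x \<Longrightarrow> fn \<rho> x = pure V H x e"
    using ca by (auto simp: braided_right_comodule_algebra_def left_module_algebra_braiding_def)
  have mod: "braided_left_module DU (mult_U H \<Delta> \<Psi> U) (Some (dual_unit H \<epsilon>)) ?P V ?Q ?\<nu>"
    by (rule dual_left_module[OF cm cl b bV]) (use u in auto)
  have bi: "braided_bialgebra DU (mult_U H \<Delta> \<Psi> U) (dual_unit H \<epsilon>) ?d ?c ?P" by (rule dual_braided_bialgebra[OF sd])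
  have \<Psi>: "crossing H H \<Psi>" and d: "comult H \<Delta>" and \<epsilon>: "linear_form H \<epsilon>"
    using B unfolding braided_bialgebra_def braided_coalgebra_iff by blast+
  have m: "mult H m" and e: "e \<in> car H"
    using B unfolding braided_bialgebra_def braided_algebra_iff by blast+
  have \<Omega>: "crossing H V \<Omega>" "endo_slidesL H V \<Omega> \<Psi>" using lb by (auto simp: left_braided_iff)
  have mV: "mult V mV" and uV: "\<And>x. uV = Some x \<Longrightarrow> x \<in> car V"
    using alV unfolding braided_algebra_iff by blast+
  have dV: "comult_slidesL H V \<Omega> \<Delta>" using cc[unfolded compat_comult_left_iff[OF \<Omega>(1) d linear_formD(1-3)[OF \<epsilon>]]] by blast
  have ml: "mult_slidesL H V \<Omega> m" and \<Omega>e: "\<And>v. v \<in> car V \<Longrightarrow> fn \<Omega> (pure H V e v) = pure V H v e"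
    using cml[unfolded compat_mult_left_iff[OF \<Omega>(1) m]] by blast+
  have mr: "mult_slidesR H V \<Omega> mV" and \<Omega>1: "\<And>x a. uV = Some x \<Longrightarrow> a \<in> car H \<Longrightarrow> fn \<Omega> (pure H V a x) = pure V H x a"
    using cmr[unfolded compat_mult_right_iff[OF \<Omega>(1) mV]] by blast+
  have V: "vspace V" using crossingD(2)[OF \<Omega>(1)] .
  have \<rho>: "lin \<rho>" "src \<rho> = V" "tgt \<rho> = V \<otimes> H"
    and coassoc: "assoc V H H \<cdot> (\<rho> \<boxtimes> idm H) \<cdot> \<rho> \<doteq> (idm V \<boxtimes> \<Delta>) \<cdot> \<rho>"
    and compat: "(\<rho> \<boxtimes> idm H) \<cdot> \<Omega> \<doteq> assoc' V H H \<cdot> (idm V \<boxtimes> \<Psi>) \<cdot> assoc V H H \<cdot> (\<Omega> \<boxtimes> idm H) \<cdot> assoc' H V H \<cdot> (idm H \<boxtimes> \<rho>)"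
    using cm V by (auto simp: braided_right_comodule_def Hom_iff vspace_tensor)
  note C = crossingD[OF \<Psi>] crossingD[OF \<Omega>(1)] \<rho> multD[OF m] multD[OF mV]
  have en: "endo H \<Psi>" by (simp add: endo_def C)
  note I = crossing_inv[OF \<Omega>(1)]
  note P = adjoint_Psi_UU[OF C(4,6,7) b]
  note M = comult_comult_U[OF \<Psi> m ex] adjoint_comult_U[OF \<Psi> m ex]
  note Q = crossing_Psi_UV[OF \<Omega>(1) bV] mates_Psi_UV[OF \<Omega>(1) bV]
  note QD = crossingD[OF Q(1)]
  note N = left_action_action_left[OF \<Omega>(1) \<rho>]
  note N' = left_actionD(11)[OF N, unfolded evaluation_sel dual_sub_sel]
  note L = linear_formD[OF linear_form_counit_U[OF e]]
  have sR: "endo_slidesR V H ?\<Theta> \<Psi>" "mult_slidesR V H ?\<Theta> m"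
    using slidesL_slidesR[OF \<Omega>(1)] en \<Omega>(2) m ml by blast+
  have sL: "mult_slidesL V H ?\<Theta> mV" by (rule slidesR_slidesL(2)[OF \<Omega>(1) mV mr])
  have sl: "fn (rslice V D a) (fn ?Q (pure DU V f v)) = fn (lslice D V f) (fn ?\<Theta> (pure V H v a))"
    if "f \<in> U" "v \<in> car V" "a \<in> car H" for f v a
    using matesD(15)[OF Q(2), of f v a] that by (simp add: dual_sub_sel)
  have lp: "fn (lslice D V f) (pure H V a v) = scl V (f a) v" if "f \<in> U" "v \<in> car V" "a \<in> car H" for f v a
    using lslice_pure[OF E' V, of f a v] that by (simp add: dual_sub_sel)
  have \<Theta>e: "fn ?\<Theta> (pure V H v e) = pure H V e v" if "v \<in> car V" for v
    by (rule inv_arr_eqI) (use e that \<Omega>e in \<open>simp_all add: C arr_simps\<close>)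
  have \<Theta>1: "fn ?\<Theta> (pure V H x a) = pure H V a x" if "uV = Some x" "a \<in> car H" for x a
    by (rule inv_arr_eqI) (use that uV \<Omega>1 in \<open>simp_all add: C arr_simps\<close>)
  have 1: "mult_slidesR DU V ?Q mV"
    unfolding mult_slidesR_def slidesR_def
  proof
    fix x assume "x \<in> car (DU \<otimes> src mV)"
    then have x: "x \<in> car (lsp D \<otimes> (V \<otimes> V))" by (simp add: C)
    have "fn (?Q \<cdot> (idm (lsp D) \<boxtimes> mV)) x = fn ((mV \<boxtimes> idm (lsp D)) \<cdot> crossR (lsp D) V ?Q) x"
      by (rule mates_unique_left[OF mates_source[OF Q(2) multD(1)[OF mV] multD(2)[OF mV] multD(3)[OF mV]]
            mates_target[OF mates_crossR[OF Q(2)] multD(1)[OF mV] multD(2)[OF mV] multD(3)[OF mV]] E _ x])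
        (use sL in \<open>simp add: mult_slidesL_def slidesL_def C\<close>)
    then show "fn ?Q (fn (idm DU \<boxtimes> mV) x) = fn (mV \<boxtimes> idm DU) (fn (crossR DU V ?Q) x)" by simp
  qed
  have 2: "fn ?Q (pure DU V f x) = pure V DU x f" if x: "uV = Some x" and f: "f \<in> U" for x f
  proof (rule eq_by_rslice[OF E V])
    fix a assume "a \<in> car (rsp D)"
    then have a: "a \<in> car H" by simp
    show "fn (rslice V D a) (fn ?Q (pure DU V f x)) = fn (rslice V D a) (pure V DU x f)"
      using rslice_pure[OF E' V, of a f x] uV[OF x] f a sl[OF f uV[OF x] a] lp[OF f uV[OF x] a]
      by (simp add: \<Theta>1[OF x a] dual_sub_sel)
  qed (use uV[OF x] f QD in \<open>simp_all add: lin_fn_mem pure_in_tensor dual_sub_sel\<close>)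
  have 3: "comult_slidesL DU V ?Q ?d"
    using mate_slidesL(3)[OF Q(2) E M(2)] twisted_slidesR(2)[OF I en sR(1) m sR(2)] by simp
  \<comment> \<open>the counit of \<open>U\<close> evaluates at the unit \<open>e\<close>, so the claim is \<open>\<Theta>e\<close> in terms of slices\<close>
  have 4: "\<forall>x\<in>car (DU \<otimes> V). fn (runit V) (fn (idm V \<boxtimes> ?c) (fn ?Q x)) = fn (lunit V) (fn (?c \<boxtimes> idm V) x)"
  proof (rule tensor_ext_ball[of _ _ V])
    have r: "\<forall>t\<in>car (V \<otimes> DU). fn (runit V) (fn (idm V \<boxtimes> ?c) t) = fn (rslice V D e) t"
      by (rule tensor_ext_ball[of _ _ V])
        (use e lin_rslice[OF E' V, of e] rslice_pure[OF E' V, of e] L in \<open>simp_all add: arr_simps R(1) V\<close>)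
    fix f v assume f: "f \<in> car DU" and v: "v \<in> car V"
    have "fn ?Q (pure DU V f v) \<in> car (V \<otimes> DU)" using f v QD by (simp add: lin_fn_mem pure_in_tensor)
    then show "fn (runit V) (fn (idm V \<boxtimes> ?c) (fn ?Q (pure DU V f v))) = fn (lunit V) (fn (?c \<boxtimes> idm V) (pure DU V f v))"
      using r f v e sl[of f v e] lp[of f v e] L by (simp add: \<Theta>e dual_sub_sel tmap_pure lunit_pure V lin_idm)
  qed (use QD L in \<open>simp_all add: arr_simps R(1) V\<close>)
  \<comment> \<open>the transposed module algebra axiom, with \<open>m \<cdot> \<Psi>\<close> as the adjoint of the coproduct\<close>
  have K: "fn (idm H \<boxtimes> mV) (fn ((m \<cdot> \<Psi>) \<boxtimes> idm (V \<otimes> V)) (fn (assoc (H \<otimes> H) V V)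
        (fn ((assoc' H H V \<cdot> (idm H \<boxtimes> ?S) \<cdot> ?\<Theta>) \<boxtimes> idm V) (fn (assoc' V H V) (pure V (H \<otimes> V) v (fn ?S w))))))
      = fn ?S (fn mV (pure V V v w))" if "v \<in> car V" "w \<in> car V" for v w
    by (rule left_coaction_product[OF H V _ _ _ _ _ _ C(4,6,7) m mV twisted_right_coaction(2)[OF \<Psi> \<Omega> d dV \<rho> coassoc compat]
          coaction_multiplicative[OF \<Omega>(1) m ml mV mr \<rho> \<rho>m that] that])
      (simp_all add: C arr_simps)
  have 5: "?\<nu> \<cdot> (idm DU \<boxtimes> mV) \<doteq> mV \<cdot> (?\<nu> \<boxtimes> ?\<nu>) \<cdot> middle DU DU V V ?Q \<cdot> (?d \<boxtimes> idm (V \<otimes> V))"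
    using left_action_algebra[OF N Q(2) M(2) mV] K by simp
  have 6: "fn ?\<nu> (pure DU V f x) = scl V (fn ?c f) x" if x: "uV = Some x" and f: "f \<in> U" for x f
    using N'[OF f uV[OF x]] uV[OF x] e f by (simp add: \<rho>1[OF x] \<Theta>1[OF x e] lp[simplified])
  have lb': "left_braided DU ?P V ?Q" "compat_mult_left DU (mult_U H \<Delta> \<Psi> U) (Some (dual_unit H \<epsilon>)) V ?Q"
    using mod by (auto simp: braided_left_module_def)
  show ?thesis
    unfolding braided_left_module_algebra_def left_module_algebra_braiding_def
      compat_mult_right_iff[OF Q(1) mV] compat_comult_left_iff[OF Q(1) M(1) L(1-3)]
    using bi alV lb' 1 2 3 4 mod 5 6 by (auto simp: dual_sub_sel)
qed

lemma dual_right_module_algebra: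
  assumes ca: "braided_left_comodule_algebra H m e \<Delta> \<epsilon> \<Psi> V mV uV \<Psi>VV \<Omega> \<rho>"
    and sd: "standard_dual H m e \<Delta> \<epsilon> \<Psi> U" and bV: "bij_VU H V \<Omega> U"
  shows "braided_right_module_algebra DU (mult_U H \<Delta> \<Psi> U) (dual_unit H \<epsilon>) (comult_U H m \<Psi> U) (counit_U H e U) (Psi_UU H \<Psi> U)
    V mV uV \<Psi>VV (Psi_VU H V \<Omega> U) (action_right H V \<Omega> \<rho> U)"
proof -
  let ?d = "comult_U H m \<Psi> U" and ?c = "counit_U H e U" and ?P = "Psi_UU H \<Psi> U" and ?Q = "Psi_VU H V \<Omega> U"
    and ?\<nu> = "action_right H V \<Omega> \<rho> U" and ?\<Theta> = "inv_arr \<Omega>" and ?F = "flip D"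
  let ?S = "?\<Theta> \<cdot> \<rho>"
  have B: "braided_bialgebra H m e \<Delta> \<epsilon> \<Psi>" and u: "dual_unit H \<epsilon> \<in> U" and cl: "\<forall>f\<in>U. \<forall>g\<in>U. dual_mult H \<Delta> \<Psi> f g \<in> U"
    and ex: "\<forall>f\<in>U. \<exists>\<omega>. dual_coproduct H m \<Psi> U f \<omega>" and b: "bij_UU H \<Psi> U"
    using sd by (auto simp: standard_dual_def)
  have alV: "braided_algebra V mV uV \<Psi>VV" and rb: "right_braided H \<Psi> V \<Omega>" and cmr: "compat_mult_right V H m (Some e) \<Omega>"
    and cml: "compat_mult_left V mV uV H \<Omega>" and cc: "compat_comult_right V H \<Delta> \<epsilon> \<Omega>"
    and cm: "braided_left_comodule H \<Delta> \<epsilon> \<Psi> V \<Omega> \<rho>"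
    and \<rho>m: "\<rho> \<cdot> mV \<doteq> (m \<boxtimes> mV) \<cdot> middle H V H V \<Omega> \<cdot> (\<rho> \<boxtimes> \<rho>)" and \<rho>1: "\<And>x. uV = Some x \<Longrightarrow> fn \<rho> x = pure H V e x"
    using ca by (auto simp: braided_left_comodule_algebra_def right_module_algebra_braiding_def)
  have mod: "braided_right_module DU (mult_U H \<Delta> \<Psi> U) (Some (dual_unit H \<epsilon>)) ?P V ?Q ?\<nu>"
    by (rule dual_right_module[OF cm cl b bV]) (use u in auto)
  have bi: "braided_bialgebra DU (mult_U H \<Delta> \<Psi> U) (dual_unit H \<epsilon>) ?d ?c ?P" by (rule dual_braided_bialgebra[OF sd])
  have \<Psi>: "crossing H H \<Psi>" and d: "comult H \<Delta>" and \<epsilon>: "linear_form H \<epsilon>"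
    using B unfolding braided_bialgebra_def braided_coalgebra_iff by blast+
  have m: "mult H m" and e: "e \<in> car H"
    using B unfolding braided_bialgebra_def braided_algebra_iff by blast+
  have \<Omega>: "crossing V H \<Omega>" "endo_slidesR V H \<Omega> \<Psi>" using rb by (auto simp: right_braided_iff)
  have mV: "mult V mV" and uV: "\<And>x. uV = Some x \<Longrightarrow> x \<in> car V"
    using alV unfolding braided_algebra_iff by blast+
  have dV: "comult_slidesR V H \<Omega> \<Delta>" using cc[unfolded compat_comult_right_iff[OF \<Omega>(1) d linear_formD(1-3)[OF \<epsilon>]]] by blast
  have mr: "mult_slidesR V H \<Omega> m" and \<Omega>e: "\<And>v. v \<in> car V \<Longrightarrow> fn \<Omega> (pure V H v e) = pure H V e v"
    using cmr[unfolded compat_mult_right_iff[OF \<Omega>(1) m]] by blast+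
  have ml: "mult_slidesL V H \<Omega> mV" and \<Omega>1: "\<And>x a. uV = Some x \<Longrightarrow> a \<in> car H \<Longrightarrow> fn \<Omega> (pure V H x a) = pure H V a x"
    using cml[unfolded compat_mult_left_iff[OF \<Omega>(1) mV]] by blast+
  have V: "vspace V" using crossingD(1)[OF \<Omega>(1)] .
  have \<rho>: "lin \<rho>" "src \<rho> = V" "tgt \<rho> = H \<otimes> V"
    and coassoc: "(idm H \<boxtimes> \<rho>) \<cdot> \<rho> \<doteq> assoc H H V \<cdot> (\<Delta> \<boxtimes> idm V) \<cdot> \<rho>"
    and compat: "(idm H \<boxtimes> \<rho>) \<cdot> \<Omega> \<doteq> assoc H H V \<cdot> (\<Psi> \<boxtimes> idm V) \<cdot> assoc' H H V \<cdot> (idm H \<boxtimes> \<Omega>) \<cdot> assoc H V H \<cdot> (\<rho> \<boxtimes> idm H)"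
    using cm V by (auto simp: braided_left_comodule_def Hom_iff vspace_tensor)
  note C = crossingD[OF \<Psi>] crossingD[OF \<Omega>(1)] \<rho> multD[OF m] multD[OF mV]
  have en: "endo H \<Psi>" by (simp add: endo_def C)
  note I = crossing_inv[OF \<Omega>(1)]
  note P = adjoint_Psi_UU[OF C(4,6,7) b]
  note M = comult_comult_U[OF \<Psi> m ex] adjoint_comult_U[OF \<Psi> m ex]
  note Mf = adjoint_flip(3)[OF E' M(2)]
  note Q = crossing_Psi_VU[OF \<Omega>(1) bV] mates_Psi_VU[OF \<Omega>(1) bV]
  note QD = crossingD[OF Q(1)]
  note N = right_action_action_right[OF \<Omega>(1) \<rho>]
  note N' = right_actionD(11)[OF N, unfolded duality_sel evaluation_sel dual_sub_sel]
  note L = linear_formD[OF linear_form_counit_U[OF e]]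
  have FE: "left_nondegenerate (flip ?F)" using E by simp
  note FE2 = flip_nested_nondegenerate[OF FE]
  note Ef = dual_pair_flip[OF E']
  have sL: "endo_slidesL H V ?\<Theta> \<Psi>" "mult_slidesL H V ?\<Theta> m"
    using slidesR_slidesL[OF \<Omega>(1)] en \<Omega>(2) m mr by blast+
  have sR: "mult_slidesR H V ?\<Theta> mV" by (rule slidesL_slidesR(2)[OF \<Omega>(1) mV ml])
  have sl: "fn (lslice ?F V a) (fn ?Q (pure V DU v f)) = fn (rslice V ?F f) (fn ?\<Theta> (pure H V a v))"
    if "f \<in> U" "v \<in> car V" "a \<in> car H" for f v a
    using matesD(15)[OF Q(2), of a v f] that by (simp add: dual_sub_sel)
  have rp: "fn (rslice V ?F f) (pure V H v a) = scl V (f a) v" if "f \<in> U" "v \<in> car V" "a \<in> car H" for f v a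
    using rslice_pure[OF Ef V, of f a v] that by (simp add: dual_sub_sel)
  have \<Theta>e: "fn ?\<Theta> (pure H V e v) = pure V H v e" if "v \<in> car V" for v
    by (rule inv_arr_eqI) (use e that \<Omega>e in \<open>simp_all add: C arr_simps\<close>)
  have \<Theta>1: "fn ?\<Theta> (pure H V a x) = pure V H x a" if "uV = Some x" "a \<in> car H" for x a
    by (rule inv_arr_eqI) (use that uV \<Omega>1 in \<open>simp_all add: C arr_simps\<close>)
  have 1: "mult_slidesL V DU ?Q mV"
    unfolding mult_slidesL_def slidesL_def
  proof
    fix x assume "x \<in> car (src mV \<otimes> DU)"
    then have x: "x \<in> car ((V \<otimes> V) \<otimes> rsp ?F)" by (simp add: C)
    have "fn (?Q \<cdot> (mV \<boxtimes> idm (rsp ?F))) x = fn ((idm (rsp ?F) \<boxtimes> mV) \<cdot> crossL V (rsp ?F) ?Q) x"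
      by (rule mates_unique_right[OF mates_source[OF Q(2) multD(1)[OF mV] multD(2)[OF mV] multD(3)[OF mV]]
            mates_target[OF mates_crossR[OF Q(2)] multD(1)[OF mV] multD(2)[OF mV] multD(3)[OF mV]] FE _ x])
        (use sR in \<open>simp add: mult_slidesR_def slidesR_def C\<close>)
    then show "fn ?Q (fn (mV \<boxtimes> idm DU) x) = fn (idm DU \<boxtimes> mV) (fn (crossL V DU ?Q) x)" by simp
  qed
  have 2: "fn ?Q (pure V DU x f) = pure DU V f x" if x: "uV = Some x" and f: "f \<in> U" for x f
  proof (rule eq_by_lslice[OF FE V])
    fix a assume "a \<in> car (lsp ?F)"
    then have a: "a \<in> car H" by simp
    show "fn (lslice ?F V a) (fn ?Q (pure V DU x f)) = fn (lslice ?F V a) (pure DU V f x)"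
      using lslice_pure[OF Ef V, of a f x] uV[OF x] f a sl[OF f uV[OF x] a] rp[OF f uV[OF x] a]
      by (simp add: \<Theta>1[OF x a] dual_sub_sel)
  qed (use uV[OF x] f QD in \<open>simp_all add: lin_fn_mem pure_in_tensor dual_sub_sel\<close>)
  have 3: "comult_slidesR V DU ?Q ?d"
    using mate_slidesR(3)[OF Q(2) FE FE2 Mf] twisted_slidesL(2)[OF I en sL(1) m sL(2)] by simp
  \<comment> \<open>the counit of \<open>U\<close> evaluates at the unit \<open>e\<close>, so the claim is \<open>\<Theta>e\<close> in terms of slices\<close>
  have 4: "\<forall>x\<in>car (V \<otimes> DU). fn (lunit V) (fn (?c \<boxtimes> idm V) (fn ?Q x)) = fn (runit V) (fn (idm V \<boxtimes> ?c) x)"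
  proof (rule tensor_ext_ball[of _ _ V])
    have r: "\<forall>t\<in>car (DU \<otimes> V). fn (lunit V) (fn (?c \<boxtimes> idm V) t) = fn (lslice ?F V e) t"
      by (rule tensor_ext_ball[of _ _ V])
        (use e lin_lslice[OF Ef V, of e] lslice_pure[OF Ef V, of e] L in \<open>simp_all add: arr_simps R(1) V\<close>)
    fix v f assume f: "f \<in> car DU" and v: "v \<in> car V"
    have "fn ?Q (pure V DU v f) \<in> car (DU \<otimes> V)" using f v QD by (simp add: lin_fn_mem pure_in_tensor)
    then show "fn (lunit V) (fn (?c \<boxtimes> idm V) (fn ?Q (pure V DU v f))) = fn (runit V) (fn (idm V \<boxtimes> ?c) (pure V DU v f))"
      using r f v e sl[of f v e] rp[of f v e] L by (simp add: \<Theta>e dual_sub_sel tmap_pure runit_pure V lin_idm)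
  qed (use QD L in \<open>simp_all add: arr_simps R(1) V\<close>)
  \<comment> \<open>the transposed module algebra axiom, with \<open>m \<cdot> \<Psi>\<close> as the adjoint of the coproduct\<close>
  have K: "fn (mV \<boxtimes> idm H) (fn (idm (V \<otimes> V) \<boxtimes> (m \<cdot> \<Psi>)) (fn (assoc' V V (H \<otimes> H))
        (fn (idm V \<boxtimes> (assoc V H H \<cdot> (?S \<boxtimes> idm H) \<cdot> ?\<Theta>)) (fn (assoc V H V) (pure (V \<otimes> H) V (fn ?S v) w)))))
      = fn ?S (fn mV (pure V V v w))" if "v \<in> car V" "w \<in> car V" for v w
    by (rule right_coaction_product[OF H V _ _ _ _ _ _ C(4,6,7) m mV twisted_left_coaction(2)[OF \<Psi> \<Omega> d dV \<rho> coassoc compat]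
          left_coaction_multiplicative[OF \<Omega>(1) m mr mV ml \<rho> \<rho>m that] that])
      (simp_all add: C arr_simps)
  have 5: "?\<nu> \<cdot> (mV \<boxtimes> idm DU) \<doteq> mV \<cdot> (?\<nu> \<boxtimes> ?\<nu>) \<cdot> middle V V DU DU ?Q \<cdot> (idm (V \<otimes> V) \<boxtimes> ?d)"
    using right_action_algebra[OF N Q(2) Mf mV] K by simp
  have 6: "fn ?\<nu> (pure V DU x f) = scl V (fn ?c f) x" if x: "uV = Some x" and f: "f \<in> U" for x f
    using N'[OF f uV[OF x]] uV[OF x] e f rp[OF f uV[OF x] e] by (simp add: \<rho>1[OF x] \<Theta>1[OF x e])
  have rb': "right_braided DU ?P V ?Q" "compat_mult_right V DU (mult_U H \<Delta> \<Psi> U) (Some (dual_unit H \<epsilon>)) ?Q"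
    using mod by (auto simp: braided_right_module_def)
  show ?thesis
    unfolding braided_right_module_algebra_def right_module_algebra_braiding_def
      compat_mult_left_iff[OF Q(1) mV] compat_comult_right_iff[OF Q(1) M(1) L(1-3)]
    using bi alV rb' 1 2 3 4 mod 5 6 by (auto simp: dual_sub_sel)
qed

end

theorem theorem5p4:
  fixes H :: "('k::field, 'h::ab_group_add) vs"
    and V :: "('k, 'v::ab_group_add) vs"
    and U :: "('h \<Rightarrow> 'k) set"
  shows
    "(\<forall>\<Delta> \<epsilon> \<Psi>HH \<Psi>HV \<rho>.
       braided_coalgebra H \<Delta> \<epsilon> \<Psi>HH \<and>
       braided_right_comodule H \<Delta> \<epsilon> \<Psi>HH V \<Psi>HV \<rho> \<and>
       nondegenerate_subspace H U \<and>
       (\<forall>f\<in>U. \<forall>g\<in>U. dual_mult H \<Delta> \<Psi>HH f g \<in> U) \<and>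
       bij_UU H \<Psi>HH U \<and> bij_UV H V \<Psi>HV U
       \<longrightarrow>
       braided_left_module (dual_sub H U) (mult_U H \<Delta> \<Psi>HH U) (unit_U H \<epsilon> U) (Psi_UU H \<Psi>HH U)
         V (Psi_UV H V \<Psi>HV U) (action_left H V \<Psi>HV \<rho> U) \<and>
       (\<forall>mH eH mV uV \<Psi>VV.
          braided_bialgebra H mH eH \<Delta> \<epsilon> \<Psi>HH \<and>
          braided_right_comodule_algebra H mH eH \<Delta> \<epsilon> \<Psi>HH V mV uV \<Psi>VV \<Psi>HV \<rho> \<and>
          standard_left_dual H mH eH \<Delta> \<epsilon> \<Psi>HH U
          \<longrightarrow>
          braided_left_module_algebra (dual_sub H U) (mult_U H \<Delta> \<Psi>HH U) (dual_unit H \<epsilon>)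
            (comult_U H mH \<Psi>HH U) (counit_U H eH U) (Psi_UU H \<Psi>HH U)
            V mV uV \<Psi>VV (Psi_UV H V \<Psi>HV U) (action_left H V \<Psi>HV \<rho> U)))
     \<and>
     (\<forall>\<Delta> \<epsilon> \<Psi>HH \<Psi>VH \<rho>.
       braided_coalgebra H \<Delta> \<epsilon> \<Psi>HH \<and>
       braided_left_comodule H \<Delta> \<epsilon> \<Psi>HH V \<Psi>VH \<rho> \<and>
       nondegenerate_subspace H U \<and>
       (\<forall>f\<in>U. \<forall>g\<in>U. dual_mult H \<Delta> \<Psi>HH f g \<in> U) \<and>
       bij_UU H \<Psi>HH U \<and> bij_VU H V \<Psi>VH U
       \<longrightarrow>
       braided_right_module (dual_sub H U) (mult_U H \<Delta> \<Psi>HH U) (unit_U H \<epsilon> U) (Psi_UU H \<Psi>HH U)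
         V (Psi_VU H V \<Psi>VH U) (action_right H V \<Psi>VH \<rho> U) \<and>
       (\<forall>mH eH mV uV \<Psi>VV.
          braided_bialgebra H mH eH \<Delta> \<epsilon> \<Psi>HH \<and>
          braided_left_comodule_algebra H mH eH \<Delta> \<epsilon> \<Psi>HH V mV uV \<Psi>VV \<Psi>VH \<rho> \<and>
          standard_right_dual H mH eH \<Delta> \<epsilon> \<Psi>HH U
          \<longrightarrow>
          braided_right_module_algebra (dual_sub H U) (mult_U H \<Delta> \<Psi>HH U) (dual_unit H \<epsilon>)
            (comult_U H mH \<Psi>HH U) (counit_U H eH U) (Psi_UU H \<Psi>HH U)
            V mV uV \<Psi>VV (Psi_VU H V \<Psi>VH U) (action_right H V \<Psi>VH \<rho> U)))"
proof -
  have H: "vspace H" if "braided_coalgebra H \<Delta> \<epsilon> \<Psi>" for \<Delta> \<epsilon> \<Psi>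
    using that crossingD(1) braided_coalgebra_iff by blast
  have u: "unit_U H \<epsilon> U = Some e \<Longrightarrow> e = dual_unit H \<epsilon> \<and> e \<in> U" for \<epsilon> :: "('k, 'h, 'k) arrow" and e
    by (auto simp: unit_U_def split: if_splits)
  have L: "braided_left_module (dual_sub H U) (mult_U H \<Delta> \<Psi> U) (unit_U H \<epsilon> U) (Psi_UU H \<Psi> U)
      V (Psi_UV H V \<Omega> U) (action_left H V \<Omega> \<rho> U)"
    if "braided_coalgebra H \<Delta> \<epsilon> \<Psi>" "braided_right_comodule H \<Delta> \<epsilon> \<Psi> V \<Omega> \<rho>" "nondegenerate_subspace H U"
      "\<forall>f\<in>U. \<forall>g\<in>U. dual_mult H \<Delta> \<Psi> f g \<in> U" "bij_UU H \<Psi> U" "bij_UV H V \<Omega> U" for \<Delta> \<epsilon> \<Psi> \<Omega> \<rho>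
    by (rule dual_subspace.dual_left_module[OF dual_subspace.intro[OF H[OF that(1)] that(3)] that(2,4-6) u])
  have R: "braided_right_module (dual_sub H U) (mult_U H \<Delta> \<Psi> U) (unit_U H \<epsilon> U) (Psi_UU H \<Psi> U)
      V (Psi_VU H V \<Omega> U) (action_right H V \<Omega> \<rho> U)"
    if "braided_coalgebra H \<Delta> \<epsilon> \<Psi>" "braided_left_comodule H \<Delta> \<epsilon> \<Psi> V \<Omega> \<rho>" "nondegenerate_subspace H U"
      "\<forall>f\<in>U. \<forall>g\<in>U. dual_mult H \<Delta> \<Psi> f g \<in> U" "bij_UU H \<Psi> U" "bij_VU H V \<Omega> U" for \<Delta> \<epsilon> \<Psi> \<Omega> \<rho>
    by (rule dual_subspace.dual_right_module[OF dual_subspace.intro[OF H[OF that(1)] that(3)] that(2,4-6) u])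
  show ?thesis
    unfolding standard_left_dual_def standard_right_dual_def
    by (intro conjI allI impI; elim conjE)
      (rule L R dual_subspace.dual_left_module_algebra[OF dual_subspace.intro[OF H]]
        dual_subspace.dual_right_module_algebra[OF dual_subspace.intro[OF H]]; assumption)+
qed

end
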